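(* Let $\psi:S^2\to \mathrm{U}(3)$ be a minimal immersion with constant curvature and uniton number $2$, with normalized extended solution $W=X\oplus\lambda^2\mathcal{H}_+$, where $X\subset S^2\times(\mathbb{C}^3\oplus\lambda\mathbb{C}^3)$. Let $X_0\subset X_1$ be the associated holomorphic subbundles of $S^2\times\mathbb{C}^3$ (of ranks $1$ and $2$ respectively), given away from a finite subset of $S^2$ by $X_0=p_0(X)$ and $X_1=p_1(X\cap\lambda\mathbb{C}^3)$ and extended holomorphically over that finite set, where $p_0(a+\lambda b)=a$ and $p_1(a+\lambda b)=b$ for $a,b\in\mathbb{C}^3$. If the holomorphic map $X_0:S^2\to\mathbb{C}P^2$ is totally unramified, then $\psi$ is $S^1$-invariant. Consequently, $\psi$ is unitarily congruent to $\pi_{V_1^2}-\pi_{V_1^2}^\perp$.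
   Context: Metrics: $\mathrm{U}(n)$ carries the bi-invariant metric $h_n(\xi,\eta)=\frac18\mathrm{tr}(\xi\eta^* )$, $\xi,\eta\in\mathfrak{u}(n)$. "Constant curvature" means that the induced metric on $S^2$ has constant Gaussian curvature. $S^2$ is the Riemann sphere with local complex coordinate $z$; every nonconstant harmonic map $S^2\to \mathrm{U}(n)$ is a branched minimal immersion. Extended solutions: for smooth $\psi:S^2\to \mathrm{U}(n)$ write $\frac12\psi^{-1}d\psi=A^\psi_z dz+A^\psi_{\bar z}d\bar z$. If $\psi$ is harmonic, an extended solution of $\psi$ is a smooth map $\Psi:S^2\to\Omega \mathrm{U}(n)=\{\gamma:S^1\to \mathrm{U}(n)\text{ smooth}:\gamma(1)=I_n\}$ with $\Psi^{-1}d\Psi=(1-\lambda^{-1})A^\psi_zdz+(1-\lambda)A^\psi_{\bar z}d\bar z$ for all $\lambda\in S^1$; it is unique up to left multiplication by a constant loop, and $\psi=\Psi_{-1}$ up to left multiplication by a constant element of $\mathrm{U}(n)$ (here $\Psi_\lambda(z)=\Psi(z)(\lambda)$). Let $\mathcal{H}_+\subset L^2(S^1,\mathbb{C}^n)$ be the closed subspace of Fourier series with vanishing negative coefficients. $\Psi$ is identified with the subbundle $W=\Psi\mathcal{H}_+$ of $S^2\times L^2(S^1,\mathbb{C}^n)$, with fibers $W(z)=\Psi(z)\mathcal{H}_+$. The uniton number of $\psi$ is the smallest $r$ for which $\psi$ has a polynomial extended solution $\Psi=\sum_{i=0}^r\lambda^iA_i$. If $\psi$ has uniton number $r$, a normalized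 extended solution of $\psi$ is one with $\lambda^r\mathcal{H}_+\subset W\subset\mathcal{H}_+$ such that $\bigcup_{z\in S^2}W(z)$ spans $\mathcal{H}_+$; then $W=X\oplus\lambda^r\mathcal{H}_+$ with $X=W\cap\bigoplus_{j=0}^{r-1}\lambda^j\mathbb{C}^n$ (zeros filled out), a holomorphic subbundle. $S^1$-invariance: an extended solution is $S^1$-invariant if it takes values in the $\mathrm{U}(n)$-conjugacy class of some homomorphism $\gamma:S^1\to \mathrm{U}(n)$; equivalently $W=X_0\oplus\lambda X_1\oplus\dots\oplus\lambda^{r-1}X_{r-1}\oplus\lambda^r\mathcal{H}_+$ with each $X_j$ a holomorphic subbundle of $S^2\times\mathbb{C}^n$. $\psi$ is $S^1$-invariant if it admits an $S^1$-invariant extended solution. Totally unramified: a smooth map $Y:S^2\to G_k(\mathbb{C}^N)$ is identified with a rank-$k$ subbundle of $S^2\times\mathbb{C}^N$; its $\partial_z$-second fundamental form $A'_Y\in\mathrm{Hom}(Y,Y^\perp)$ is $A'_Y(s)=\pi_Y^\perp\partial_zs$ for $s\in\Gamma(Y)$. For $Y$ holomorphic, $G^{(0)}(Y)=Y$ and $G^{(i+1)}(Y)$ is the subbundle generated by the image of $A'_{G^{(i)}(Y)}$ (zeros filled out). With $r$ the smallest integer such that $G^{(r+1)}(Y)=\{0\}$, $Y$ is totally unramified if $\det A'_{G^{(i)}(Y)}(A'_{G^{(i)}(Y)})^*\neq0$ everywhere on $S^2$ for all $i\in\{0,\dots,r-1\}$, where $A'_{G^{(i)}(Y)}$ is regarded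 as a map $G^{(i)}(Y)\to G^{(i+1)}(Y)$. Veronese sequence: $V_0^n:S^2\to\mathbb{C}P^n$ is spanned by $f(z)=\big(\sqrt{\tbinom{n}{k}}\,z^k\big)_{k=0}^n$, and $V_i^n$ is the orthogonal complement of $\mathrm{span}\{f,\dots,\partial_z^{i-1}f\}$ in $\mathrm{span}\{f,\dots,\partial_z^if\}$ (extended to all of $S^2$), $0\le i\le n$. For a subbundle $Y$, $\pi_Y$ and $\pi_Y^\perp$ are the orthogonal projections onto $Y$ and $Y^\perp$. Unitary congruence: $\psi,\tilde\psi:S^2\to \mathrm{U}(n)$ are unitarily congruent if $\tilde\psi=A\,(\psi\circ g)\,B$ for some constants $A,B\in \mathrm{U}(n)$ and some biholomorphism $g$ of $S^2$ (choice of complex coordinate). *)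

theory Defs
  imports "HOL-Analysis.Analysis"
begin

subsection \<open>Smooth maps\<close>

primrec Ck :: "nat \<Rightarrow> ('a::euclidean_space \<Rightarrow> 'b::real_normed_vector) \<Rightarrow> bool" where
  "Ck 0 f \<longleftrightarrow> continuous_on UNIV f"
| "Ck (Suc k) f \<longleftrightarrow> (\<forall>x. f differentiable (at x)) \<and>
     (\<forall>b\<in>Basis. Ck k (\<lambda>x. frechet_derivative f (at x) b))"

definition smooth :: "('a::euclidean_space \<Rightarrow> 'b::real_normed_vector) \<Rightarrow> bool" where
  "smooth f \<longleftrightarrow> (\<forall>k. Ck k f)"

subsection \<open>The Riemann sphere\<close>

datatype rsphere = Fin complex | Infty

definition coord_inf :: "complex \<Rightarrow> rsphere" where
  "coord_inf w = (if w = 0 then Infty else Fin (1 / w))"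

text \<open>The two standard local coordinates \<open>z\<close> and \<open>w = 1/z\<close>, given by their inverses, which are
  parametrisations by the whole plane.\<close>

definition coords :: "(complex \<Rightarrow> rsphere) set" where
  "coords = {Fin, coord_inf}"

definition smooth_map :: "(rsphere \<Rightarrow> 'b::real_normed_vector) \<Rightarrow> bool" where
  "smooth_map F \<longleftrightarrow> (\<forall>c\<in>coords. smooth (\<lambda>z. F (c z)))"

definition holomorphic_self_map :: "(rsphere \<Rightarrow> rsphere) \<Rightarrow> bool" where
  "holomorphic_self_map g \<longleftrightarrow> (\<forall>c\<in>coords. \<forall>d\<in>coords.
     open {z. g (c z) \<in> range d} \<and>
     (\<lambda>z. inv d (g (c z))) holomorphic_on {z. g (c z) \<in> range d})"

definition biholomorphism :: "(rsphere \<Rightarrow> rsphere) \<Rightarrow> bool" where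
  "biholomorphism g \<longleftrightarrow> bij g \<and> holomorphic_self_map g \<and> holomorphic_self_map (inv g)"

subsection \<open>Complex linear algebra\<close>

definition hinner :: "complex ^ 'n \<Rightarrow> complex ^ 'n \<Rightarrow> complex" where
  "hinner u v = (\<Sum>i\<in>UNIV. u $ i * cnj (v $ i))"

definition adj :: "complex ^ 'n ^ 'm \<Rightarrow> complex ^ 'm ^ 'n" where
  "adj A = (\<chi> i j. cnj (A $ j $ i))"

definition unitary :: "complex ^ 'n ^ 'n \<Rightarrow> bool" where
  "unitary A \<longleftrightarrow> adj A ** A = mat 1 \<and> A ** adj A = mat 1"

definition csmult :: "complex \<Rightarrow> complex ^ 'n ^ 'm \<Rightarrow> complex ^ 'n ^ 'm" where
  "csmult c A = (\<chi> i j. c * A $ i $ j)"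

text \<open>Complex subspaces are handled with the library's \<open>vec.subspace\<close>, \<open>vec.span\<close>, \<open>vec.dim\<close>,
  which refer to the complex scalar multiplication \<open>*s\<close>.\<close>

definition proj :: "(complex ^ 'n) set \<Rightarrow> complex ^ 'n ^ 'n" where
  "proj Y = (THE P. \<forall>v. P *v v \<in> Y \<and> (\<forall>u\<in>Y. hinner (v - P *v v) u = 0))"

definition proj_perp :: "(complex ^ 'n) set \<Rightarrow> complex ^ 'n ^ 'n" where
  "proj_perp Y = mat 1 - proj Y"

text \<open>The determinant of \<open>T\<close> as an endomorphism of the subspace \<open>V\<close>: the block on \<open>V\<close> is
  completed by the identity on the orthogonal complement.\<close>

definition det_on :: "(complex ^ 'n) set \<Rightarrow> complex ^ 'n ^ 'n \<Rightarrow> complex" where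
  "det_on V T = det (proj V ** T ** proj V + proj_perp V)"

subsection \<open>Derivatives in a local coordinate\<close>

definition pd :: "complex \<Rightarrow> (complex \<Rightarrow> 'b::real_normed_vector) \<Rightarrow> complex \<Rightarrow> 'b" where
  "pd v f z = frechet_derivative f (at z) v"

definition dz :: "(complex \<Rightarrow> complex ^ 'n ^ 'm) \<Rightarrow> complex \<Rightarrow> complex ^ 'n ^ 'm" where
  "dz f z = csmult (1/2) (pd 1 f z - csmult \<i> (pd \<i> f z))"

definition dzbar :: "(complex \<Rightarrow> complex ^ 'n ^ 'm) \<Rightarrow> complex \<Rightarrow> complex ^ 'n ^ 'm" where
  "dzbar f z = csmult (1/2) (pd 1 f z + csmult \<i> (pd \<i> f z))"

definition laplacian :: "(complex \<Rightarrow> real) \<Rightarrow> complex \<Rightarrow> real" where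
  "laplacian f z = pd 1 (pd 1 f) z + pd \<i> (pd \<i> f) z"

subsection \<open>Minimal immersions of the sphere into the unitary group\<close>

text \<open>In this and the following definitions a map into the unitary group is first written in a
  local coordinate, as a matrix-valued function \<open>\<phi>\<close> on the plane.\<close>

definition Az :: "(complex \<Rightarrow> complex ^ 'n ^ 'n) \<Rightarrow> complex \<Rightarrow> complex ^ 'n ^ 'n" where
  "Az \<phi> z = csmult (1/2) (matrix_inv (\<phi> z) ** dz \<phi> z)"

definition Azbar :: "(complex \<Rightarrow> complex ^ 'n ^ 'n) \<Rightarrow> complex \<Rightarrow> complex ^ 'n ^ 'n" where
  "Azbar \<phi> z = csmult (1/2) (matrix_inv (\<phi> z) ** dzbar \<phi> z)"

text \<open>The harmonic map equation \<open>d\<^sup>*(\<psi>\<^sup>-\<^sup>1 d\<psi>) = 0\<close> for the bi-invariant metric.\<close>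

definition harmonic :: "(rsphere \<Rightarrow> complex ^ 'n ^ 'n) \<Rightarrow> bool" where
  "harmonic \<psi> \<longleftrightarrow> (\<forall>p. unitary (\<psi> p)) \<and> smooth_map \<psi> \<and>
     (\<forall>c\<in>coords. \<forall>z. dzbar (Az (\<lambda>w. \<psi> (c w))) z + dz (Azbar (\<lambda>w. \<psi> (c w))) z = 0)"

text \<open>On skew-Hermitian matrices the trace below is already real.\<close>

definition h_metric :: "complex ^ 'n ^ 'n \<Rightarrow> complex ^ 'n ^ 'n \<Rightarrow> real" where
  "h_metric \<xi> \<eta> = Re (trace (\<xi> ** adj \<eta>)) / 8"

definition induced_metric ::
    "(complex \<Rightarrow> complex ^ 'n ^ 'n) \<Rightarrow> complex \<Rightarrow> complex \<Rightarrow> complex \<Rightarrow> real" where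
  "induced_metric \<phi> z u v =
     h_metric (matrix_inv (\<phi> z) ** pd u \<phi> z) (matrix_inv (\<phi> z) ** pd v \<phi> z)"

definition immersion :: "(rsphere \<Rightarrow> complex ^ 'n ^ 'n) \<Rightarrow> bool" where
  "immersion \<psi> \<longleftrightarrow> smooth_map \<psi> \<and>
     (\<forall>c\<in>coords. \<forall>z. inj (frechet_derivative (\<lambda>w. \<psi> (c w)) (at z)))"

definition conformal :: "(rsphere \<Rightarrow> complex ^ 'n ^ 'n) \<Rightarrow> bool" where
  "conformal \<psi> \<longleftrightarrow> (\<forall>c\<in>coords. \<forall>z.
     induced_metric (\<lambda>w. \<psi> (c w)) z 1 \<i> = 0 \<and>
     induced_metric (\<lambda>w. \<psi> (c w)) z 1 1 = induced_metric (\<lambda>w. \<psi> (c w)) z \<i> \<i>)"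

text \<open>A minimal immersion of a Riemann surface is a conformal harmonic immersion. (On the sphere
  conformality follows from harmonicity.)\<close>

definition minimal_immersion :: "(rsphere \<Rightarrow> complex ^ 'n ^ 'n) \<Rightarrow> bool" where
  "minimal_immersion \<psi> \<longleftrightarrow> immersion \<psi> \<and> conformal \<psi> \<and> harmonic \<psi>"

text \<open>For a conformal immersion the induced metric is \<open>\<rho> (dx\<^sup>2 + dy\<^sup>2)\<close> with the
  \<open>\<rho>\<close> below, and its Gaussian curvature is \<open>- (\<Delta> ln \<rho>) / (2 \<rho>)\<close>.\<close>

definition gauss_curvature :: "(complex \<Rightarrow> complex ^ 'n ^ 'n) \<Rightarrow> complex \<Rightarrow> real" where
  "gauss_curvature \<phi> z =
     (let \<rho> = (\<lambda>w. induced_metric \<phi> w 1 1) in - laplacian (\<lambda>w. ln (\<rho> w)) z / (2 * \<rho> z))"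

definition constant_curvature :: "(rsphere \<Rightarrow> complex ^ 'n ^ 'n) \<Rightarrow> bool" where
  "constant_curvature \<psi> \<longleftrightarrow>
     (\<exists>K. \<forall>c\<in>coords. \<forall>z. gauss_curvature (\<lambda>w. \<psi> (c w)) z = K)"

subsection \<open>Extended solutions\<close>

text \<open>A loop is a function on the complex plane of which only the values on the unit circle matter.
  Smoothness of a map from the sphere into the loop group is joint smoothness in the point of the
  sphere and the loop parameter.\<close>

abbreviation S1 :: "complex set" where "S1 \<equiv> sphere 0 1"

definition extended_solution ::
    "(rsphere \<Rightarrow> complex ^ 'n ^ 'n) \<Rightarrow> (rsphere \<Rightarrow> complex \<Rightarrow> complex ^ 'n ^ 'n) \<Rightarrow> bool" where
  "extended_solution \<psi> \<Psi> \<longleftrightarrow>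
     (\<forall>p. \<forall>l\<in>S1. unitary (\<Psi> p l)) \<and> (\<forall>p. \<Psi> p 1 = mat 1) \<and>
     (\<forall>c\<in>coords. smooth (\<lambda>(z, t::real). \<Psi> (c z) (cis t))) \<and>
     (\<forall>c\<in>coords. \<forall>z. \<forall>l\<in>S1.
        matrix_inv (\<Psi> (c z) l) ** dz (\<lambda>w. \<Psi> (c w) l) z
          = csmult (1 - inverse l) (Az (\<lambda>w. \<psi> (c w)) z) \<and>
        matrix_inv (\<Psi> (c z) l) ** dzbar (\<lambda>w. \<Psi> (c w) l) z
          = csmult (1 - l) (Azbar (\<lambda>w. \<psi> (c w)) z))"

definition has_polynomial_extended_solution ::
    "(rsphere \<Rightarrow> complex ^ 'n ^ 'n) \<Rightarrow> nat \<Rightarrow> bool" where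
  "has_polynomial_extended_solution \<psi> r \<longleftrightarrow>
     (\<exists>\<Psi> A. extended_solution \<psi> \<Psi> \<and> (\<forall>p. \<forall>l\<in>S1. \<Psi> p l = (\<Sum>i\<le>r. csmult (l ^ i) (A i p))))"

definition has_uniton_number :: "(rsphere \<Rightarrow> complex ^ 'n ^ 'n) \<Rightarrow> nat \<Rightarrow> bool" where
  "has_uniton_number \<psi> r \<longleftrightarrow> has_polynomial_extended_solution \<psi> r \<and>
     (\<forall>s<r. \<not> has_polynomial_extended_solution \<psi> s)"

text \<open>Elements of \<open>L\<^sup>2\<close> of the circle are represented by functions rather than by classes modulo
  null sets; the subspaces below are closed under changes on null sets and off the circle.\<close>

definition L2_circle :: "(complex \<Rightarrow> complex ^ 'n) set" where
  "L2_circle = {f. (\<lambda>t. f (cis t)) \<in> borel_measurable (lebesgue_on {0..2*pi}) \<and>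
     integrable (lebesgue_on {0..2*pi}) (\<lambda>t. (norm (f (cis t)))\<^sup>2)}"

definition fourier_coeff :: "(complex \<Rightarrow> complex ^ 'n) \<Rightarrow> int \<Rightarrow> complex ^ 'n" where
  "fourier_coeff f k =
     (1 / (2*pi)) *\<^sub>R (LINT t|lebesgue_on {0..2*pi}. cis (- of_int k * t) *s f (cis t))"

definition H_plus :: "(complex \<Rightarrow> complex ^ 'n) set" where
  "H_plus = {f \<in> L2_circle. \<forall>k<0. fourier_coeff f k = 0}"

definition loop_image ::
    "(complex \<Rightarrow> complex ^ 'n ^ 'n) \<Rightarrow> (complex \<Rightarrow> complex ^ 'n) set \<Rightarrow> (complex \<Rightarrow> complex ^ 'n) set" where
  "loop_image \<gamma> F = {g. \<exists>f\<in>F. \<forall>l\<in>S1. g l = \<gamma> l *v f l}"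

definition W_bundle ::
    "(rsphere \<Rightarrow> complex \<Rightarrow> complex ^ 'n ^ 'n) \<Rightarrow> rsphere \<Rightarrow> (complex \<Rightarrow> complex ^ 'n) set" where
  "W_bundle \<Psi> p = loop_image (\<Psi> p) H_plus"

text \<open>Since every \<open>W_bundle \<Psi> p\<close> is a subspace of finite codimension, the algebraic
  span used here is the same as the closed one.\<close>

definition normalized_extended_solution ::
    "(rsphere \<Rightarrow> complex ^ 'n ^ 'n) \<Rightarrow> nat \<Rightarrow> (rsphere \<Rightarrow> complex \<Rightarrow> complex ^ 'n ^ 'n) \<Rightarrow> bool" where
  "normalized_extended_solution \<psi> r \<Psi> \<longleftrightarrow> extended_solution \<psi> \<Psi> \<and>
     (\<forall>p. loop_image (\<lambda>l. mat (l ^ r)) H_plus \<subseteq> W_bundle \<Psi> p \<and> W_bundle \<Psi> p \<subseteq> H_plus) \<and>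
     (\<forall>f\<in>H_plus. \<exists>(N::nat) q g. (\<forall>i<N. g i \<in> W_bundle \<Psi> (q i)) \<and>
        (\<forall>l\<in>S1. f l = (\<Sum>i<N. g i l)))"

text \<open>For uniton number two: the fibre of \<open>X\<close>, with \<open>(a, b)\<close> standing for the loop
  \<open>a + \<lambda> b\<close>.\<close>

definition X_bundle ::
    "(rsphere \<Rightarrow> complex \<Rightarrow> complex ^ 'n ^ 'n) \<Rightarrow> rsphere \<Rightarrow> ((complex ^ 'n) \<times> (complex ^ 'n)) set" where
  "X_bundle \<Psi> p = {(a, b). (\<lambda>l. a + l *s b) \<in> W_bundle \<Psi> p}"

definition S1_homomorphism :: "(complex \<Rightarrow> complex ^ 'n ^ 'n) \<Rightarrow> bool" where
  "S1_homomorphism \<gamma> \<longleftrightarrow> continuous_on S1 \<gamma> \<and> (\<forall>l\<in>S1. unitary (\<gamma> l)) \<and>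
     (\<forall>l\<in>S1. \<forall>m\<in>S1. \<gamma> (l * m) = \<gamma> l ** \<gamma> m)"

definition S1_invariant_solution :: "(rsphere \<Rightarrow> complex \<Rightarrow> complex ^ 'n ^ 'n) \<Rightarrow> bool" where
  "S1_invariant_solution \<Psi> \<longleftrightarrow> (\<exists>\<gamma>. S1_homomorphism \<gamma> \<and>
     (\<forall>p. \<exists>A. unitary A \<and> (\<forall>l\<in>S1. \<Psi> p l = A ** \<gamma> l ** matrix_inv A)))"

definition S1_invariant :: "(rsphere \<Rightarrow> complex ^ 'n ^ 'n) \<Rightarrow> bool" where
  "S1_invariant \<psi> \<longleftrightarrow> (\<exists>\<Psi>. extended_solution \<psi> \<Psi> \<and> S1_invariant_solution \<Psi>)"

subsection \<open>Subbundles\<close>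

text \<open>A smooth map into a Grassmannian, the latter being embedded by orthogonal projections.\<close>

definition smooth_subbundle :: "nat \<Rightarrow> (rsphere \<Rightarrow> (complex ^ 'n) set) \<Rightarrow> bool" where
  "smooth_subbundle k Y \<longleftrightarrow> (\<forall>p. vec.subspace (Y p) \<and> vec.dim (Y p) = k) \<and>
     smooth_map (\<lambda>p. proj (Y p))"

definition holomorphic_subbundle :: "nat \<Rightarrow> (rsphere \<Rightarrow> (complex ^ 'n) set) \<Rightarrow> bool" where
  "holomorphic_subbundle k Y \<longleftrightarrow> (\<forall>c\<in>coords. \<forall>z0. \<exists>U (s :: nat \<Rightarrow> complex \<Rightarrow> complex ^ 'n).
     open U \<and> z0 \<in> U \<and> (\<forall>i<k. \<forall>j. (\<lambda>z. s i z $ j) holomorphic_on U) \<and>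
     (\<forall>z\<in>U. Y (c z) = vec.span ((\<lambda>i. s i z) ` {..<k}) \<and> vec.dim (Y (c z)) = k))"

text \<open>The second fundamental form \<open>A'\<^sub>Y\<close> in the coordinate \<open>c\<close> at the point with coordinate
  \<open>z\<close>, extended by zero to the complement of the fibre. It is tensorial, so its value on \<open>v\<close> in
  the fibre can be computed from the section \<open>w \<mapsto> proj (Y (c w)) *v v\<close>.\<close>

definition second_ff ::
    "(rsphere \<Rightarrow> (complex ^ 'n) set) \<Rightarrow> (complex \<Rightarrow> rsphere) \<Rightarrow> complex \<Rightarrow> complex ^ 'n ^ 'n" where
  "second_ff Y c z =
     proj_perp (Y (c z)) ** dz (\<lambda>w. proj (Y (c w))) z ** proj (Y (c z))"

text \<open>The subbundle generated by the image of \<open>A'\<^sub>Y\<close>: the image itself has constant rank away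
  from finitely many points, over which it extends uniquely.\<close>

definition next_bundle ::
    "(rsphere \<Rightarrow> (complex ^ 'n) set) \<Rightarrow> rsphere \<Rightarrow> (complex ^ 'n) set" where
  "next_bundle Y = (THE Z. (\<exists>k. smooth_subbundle k Z) \<and>
     (\<exists>S. finite S \<and> (\<forall>c\<in>coords. \<forall>z. c z \<notin> S \<longrightarrow> Z (c z) = (*v) (second_ff Y c z) ` Y (c z))))"

definition gauss_bundle ::
    "nat \<Rightarrow> (rsphere \<Rightarrow> (complex ^ 'n) set) \<Rightarrow> rsphere \<Rightarrow> (complex ^ 'n) set" where
  "gauss_bundle i Y = (next_bundle ^^ i) Y"

definition totally_unramified :: "(rsphere \<Rightarrow> (complex ^ 'n) set) \<Rightarrow> bool" where
  "totally_unramified Y \<longleftrightarrow> (\<exists>r.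
     (\<forall>p. gauss_bundle (Suc r) Y p = {0}) \<and>
     (\<forall>s<r. \<not> (\<forall>p. gauss_bundle (Suc s) Y p = {0})) \<and>
     (\<forall>i<r. \<forall>c\<in>coords. \<forall>z.
        det_on (gauss_bundle (Suc i) Y (c z))
          (second_ff (gauss_bundle i Y) c z ** adj (second_ff (gauss_bundle i Y) c z)) \<noteq> 0))"

subsection \<open>Veronese sequence and unitary congruence\<close>

text \<open>The index type is meant to be the numeral type with \<open>n + 1\<close> elements; note that
  \<open>vector\<close> numbers the coordinates \<open>1, \<dots>, n + 1\<close>.\<close>

definition veronese_curve :: "nat \<Rightarrow> complex \<Rightarrow> complex ^ 'N::{finite,one,plus}" where
  "veronese_curve n z =
     vector (map (\<lambda>k. complex_of_real (sqrt (real (n choose k))) * z ^ k) [0..<Suc n])"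

definition osculating :: "nat \<Rightarrow> nat \<Rightarrow> complex \<Rightarrow> (complex ^ 'N::{finite,one,plus}) set" where
  "osculating n i z = vec.span ((\<lambda>j. \<chi> m. (deriv ^^ j) (\<lambda>w. veronese_curve n w $ m) z) ` {..<i})"

definition veronese :: "nat \<Rightarrow> nat \<Rightarrow> rsphere \<Rightarrow> (complex ^ 'N::{finite,one,plus}) set" where
  "veronese n i = (THE Y. smooth_subbundle 1 Y \<and>
     (\<forall>z. Y (Fin z) = {v \<in> osculating n (Suc i) z. \<forall>u\<in>osculating n i z. hinner v u = 0}))"

definition unitarily_congruent ::
    "(rsphere \<Rightarrow> complex ^ 'n ^ 'n) \<Rightarrow> (rsphere \<Rightarrow> complex ^ 'n ^ 'n) \<Rightarrow> bool" where
  "unitarily_congruent \<psi> \<psi>' \<longleftrightarrow> (\<exists>A B g. unitary A \<and> unitary B \<and> biholomorphism g \<and>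
     (\<forall>p. \<psi>' p = A ** \<psi> (g p) ** B))"

end

theory Submission
  imports Defs "HOL-Complex_Analysis.Complex_Analysis" "HOL-Computational_Algebra.Fundamental_Theorem_Algebra"
begin

text \<open>On a normalised solution of uniton number two the loop is \<open>A0 + l A1 + l\<^sup>2 A2\<close>, and
  \<open>Q = A2 - A0\<close> is Hermitian with \<open>\<partial>Q = A\<^sub>z\<close>, so the induced metric is \<open>\<bar>\<partial>Q\<bar>\<^sup>2\<close>. Total unramifiedness
  forces the curve \<open>f\<close> spanning \<open>X0\<close> and its dual curve to have degree two, so \<open>f\<close> is a conic. Away
  from finitely many points \<open>A0\<close> has range \<open>f\<close> and \<open>A2\<close> has range \<open>\<nu>\<close>, the conjugate of
  \<open>f \<times> f'\<close>, and the loop is determined by \<open>f\<close> and one holomorphic function \<open>h\<close>; this \<open>h\<close> turns out to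
  be rational, \<open>h = p / q\<close>. The metric is then \<open>\<partial>\<partial>' ln N\<close> with \<open>N = \<bar>q f\<bar>\<^sup>2 \<bar>\<nu>\<bar>\<^sup>2 + \<bar>p\<bar>\<^sup>2\<close>, and \<open>h = 0\<close>
  is exactly the circle-invariant case. Constant curvature and Liouville's theorem give \<open>N = v\<^sup>n\<close> for a
  positive definite Hermitian form \<open>v\<close>, which a Moebius transformation takes to \<open>1 + \<bar>z\<bar>\<^sup>2\<close>. Polarising
  the identity and comparing coefficients yields \<open>p = 0\<close> and identifies \<open>f\<close> with the Veronese conic up
  to a unitary matrix.\<close>

no_notation fps_nth (infixl "$" 75)

subsection \<open>Wirtinger derivatives\<close>

definition wd :: "(complex \<Rightarrow> complex) \<Rightarrow> complex \<Rightarrow> complex \<Rightarrow> complex \<Rightarrow> bool" where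
  "wd F a b z \<longleftrightarrow> (F has_derivative (\<lambda>h. a * h + b * cnj h)) (at z)"

lemma wd_unique:
  assumes "wd F a b z" "wd F c d z" shows "a = c" "b = d"
proof -
  have "(\<lambda>h. a * h + b * cnj h) = (\<lambda>h. c * h + d * cnj h)"
    using assms has_derivative_unique unfolding wd_def by blast
  then have e: "a * h + b * cnj h = c * h + d * cnj h" for h by meson
  have 1: "a + b = c + d" using e[of 1] by simp
  have "\<i> * (a - b) = \<i> * (c - d)" using e[of \<i>] by (simp add: algebra_simps)
  then have 2: "a - b = c - d" by simp
  have "(a + b) + (a - b) = (c + d) + (c - d)" "(a + b) - (a - b) = (c + d) - (c - d)"
    using 1 2 by simp_all
  then show "a = c" "b = d" by simp_all
qed

lemma wd_const: "wd (\<lambda>w. c) 0 0 z"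
  by (simp add: wd_def)

lemma wd_add: "wd F a b z \<Longrightarrow> wd G c d z \<Longrightarrow> wd (\<lambda>w. F w + G w) (a + c) (b + d) z"
  unfolding wd_def by (auto dest: has_derivative_add simp: algebra_simps)

lemma wd_diff: "wd F a b z \<Longrightarrow> wd G c d z \<Longrightarrow> wd (\<lambda>w. F w - G w) (a - c) (b - d) z"
  unfolding wd_def by (auto dest: has_derivative_diff simp: algebra_simps)

lemma wd_mult: "wd F a b z \<Longrightarrow> wd G c d z \<Longrightarrow> wd (\<lambda>w. F w * G w) (a * G z + F z * c) (b * G z + F z * d) z"
  unfolding wd_def by (drule (1) has_derivative_mult) (simp add: algebra_simps)

lemma wd_cnj: "wd F a b z \<Longrightarrow> wd (\<lambda>w. cnj (F w)) (cnj b) (cnj a) z"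
  unfolding wd_def by (drule has_derivative_cnj) (simp add: algebra_simps)

lemma wd_sum:
  "(\<And>i. i \<in> I \<Longrightarrow> wd (F i) (a i) (b i) z) \<Longrightarrow> wd (\<lambda>w. \<Sum>i\<in>I. F i w) (\<Sum>i\<in>I. a i) (\<Sum>i\<in>I. b i) z"
  by (induction I rule: infinite_finite_induct) (auto simp: wd_const wd_add)

lemma wd_inverse:
  assumes "wd F a b z" "F z \<noteq> 0"
  shows "wd (\<lambda>w. inverse (F w)) (- a / (F z)\<^sup>2) (- b / (F z)\<^sup>2) z"
proof -
  have "((\<lambda>w. inverse (F w)) has_derivative
      (\<lambda>h. - (inverse (F z) * (a * h + b * cnj h) * inverse (F z)))) (at z)"
    using Deriv.has_derivative_inverse[OF assms(2) assms(1)[unfolded wd_def]] .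
  moreover have "- (inverse (F z) * (a * h + b * cnj h) * inverse (F z)) =
      - a / (F z)\<^sup>2 * h + - b / (F z)\<^sup>2 * cnj h" for h
    using assms(2) by (simp add: divide_simps power2_eq_square)
  ultimately show ?thesis unfolding wd_def by (simp only:)
qed

lemma wd_divide:
  assumes "wd F a b z" "wd G c d z" "G z \<noteq> 0"
  shows "wd (\<lambda>w. F w / G w) (a / G z - F z * c / (G z)\<^sup>2) (b / G z - F z * d / (G z)\<^sup>2) z"
  using wd_mult[OF assms(1) wd_inverse[OF assms(2,3)]] assms(3)
  by (simp add: field_simps power2_eq_square)

lemma wd_holo: "(F has_field_derivative a) (at z) \<Longrightarrow> wd F a 0 z"
  by (simp add: wd_def has_field_derivative_def)

lemma holo_wd: "wd F a 0 z \<Longrightarrow> (F has_field_derivative a) (at z)"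
  by (simp add: wd_def has_field_derivative_def)

lemma wd_poly: "wd (poly p) (poly (pderiv p) z) 0 z"
  by (rule wd_holo) (rule poly_DERIV)

lemma wd_cong_ev:
  assumes "wd F a b z" "\<forall>\<^sub>F w in nhds z. F w = G w" shows "wd G a b z"
proof -
  have "\<forall>\<^sub>F w in at z. F w = G w"
    using assms(2) by (auto simp: eventually_at_filter elim: eventually_mono)
  moreover have "F z = G z" using eventually_nhds_x_imp_x[OF assms(2)] .
  ultimately show ?thesis using assms(1) unfolding wd_def
    by (simp add: has_derivative_transform_eventually[of F _ z UNIV G])
qed

lemma wd_cong: "wd F a b z \<Longrightarrow> (\<And>w. F w = G w) \<Longrightarrow> wd G a b z"
  by (metis ext)

lemma wd_eqI: "wd F a b z \<Longrightarrow> a = c \<Longrightarrow> b = d \<Longrightarrow> wd F c d z"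
  by simp

lemma wd_isCont: "wd F a b z \<Longrightarrow> isCont F z"
  unfolding wd_def using has_derivative_continuous isCont_def continuous_at by blast

lemma wd_differentiable:
  fixes F :: "complex \<Rightarrow> complex"
  assumes "F differentiable (at z)"
  shows "wd F ((pd 1 F z - \<i> * pd \<i> F z) / 2) ((pd 1 F z + \<i> * pd \<i> F z) / 2) z"
proof -
  let ?D = "frechet_derivative F (at z)"
  have D: "(F has_derivative ?D) (at z)" using assms frechet_derivative_works by blast
  then have L: "linear ?D" using has_derivative_linear by blast
  have "?D h = ((pd 1 F z - \<i> * pd \<i> F z) / 2) * h + ((pd 1 F z + \<i> * pd \<i> F z) / 2) * cnj h" for h
  proof -
    have "?D (Re h *\<^sub>R 1 + Im h *\<^sub>R \<i>) = Re h *\<^sub>R ?D 1 + Im h *\<^sub>R ?D \<i>"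
      by (simp only: linear_add[OF L] linear_scale[OF L])
    moreover have "Re h *\<^sub>R 1 + Im h *\<^sub>R \<i> = h" by (simp add: complex_eq_iff)
    ultimately have "?D h = Re h *\<^sub>R ?D 1 + Im h *\<^sub>R ?D \<i>" by simp
    moreover have "((X - \<i> * Y) / 2) * h + ((X + \<i> * Y) / 2) * cnj h = Re h *\<^sub>R X + Im h *\<^sub>R Y" for X Y
    proof -
      have "((X - \<i> * Y) / 2) * h + ((X + \<i> * Y) / 2) * cnj h
          = X * (h + cnj h) / 2 - \<i> * Y * (h - cnj h) / 2"
        by (simp add: algebra_simps diff_divide_distrib add_divide_distrib)
      also have "\<dots> = Re h *\<^sub>R X + Im h *\<^sub>R Y"
        by (simp add: complex_add_cnj complex_diff_cnj scaleR_conv_of_real mult.commute mult.left_commute)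
      finally show ?thesis .
    qed
    ultimately show ?thesis
      unfolding pd_def by simp
  qed
  then have "?D = (\<lambda>h. ((pd 1 F z - \<i> * pd \<i> F z) / 2) * h + ((pd 1 F z + \<i> * pd \<i> F z) / 2) * cnj h)"
    by blast
  then show ?thesis using D unfolding wd_def by (simp only:)
qed

subsection \<open>Fourier coefficients\<close>

abbreviation circ :: "real measure" where "circ \<equiv> lebesgue_on {0..2*pi}"

definition fcoef :: "(complex \<Rightarrow> complex) \<Rightarrow> int \<Rightarrow> complex" where
  "fcoef f k = (1 / (2*pi)) *\<^sub>R (LINT t|circ. cis (- of_int k * t) * f (cis t))"

lemma circ_integrable_continuous:
  fixes f :: "real \<Rightarrow> 'b::euclidean_space"
  assumes "continuous_on {0..2*pi} f"
  shows "integrable circ f"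
  using continuous_imp_integrable_real[OF assms] by simp

lemma continuous_on_cis_comp:
  fixes f :: "complex \<Rightarrow> 'b::topological_space"
  assumes "continuous_on S1 f"
  shows "continuous_on {0..2*pi} (\<lambda>t. f (cis t))"
  by (rule continuous_on_compose2[OF assms]) (auto intro!: continuous_intros)

lemma circ_LINT_eq_integral:
  fixes f :: "real \<Rightarrow> complex"
  assumes "continuous_on {0..2*pi} f"
  shows "(LINT t|circ. f t) = integral {0..2*pi} f"
  using circ_integrable_continuous[OF assms] by (intro lebesgue_integral_eq_integral) auto

lemma vanishing_moments_polynomial_function:
  fixes g :: "complex \<Rightarrow> real"
  assumes "real_polynomial_function g"
    and "continuous_on {0..2*pi} u"
    and "\<And>k::int. integral {0..2*pi} (\<lambda>t. cis (of_int k * t) * u t) = 0"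
  shows "integral {0..2*pi} (\<lambda>t. cis (of_int k * t) * (complex_of_real (g (cis t)) * u t)) = 0"
  using assms
proof (induction g arbitrary: u k rule: real_polynomial_function.induct)
  case (linear f)
  note [continuous_intros] = linear(2)
  have f: "complex_of_real (f (cis t)) =
      (f 1 - \<i> * f \<i>) / 2 * cis t + (f 1 + \<i> * f \<i>) / 2 * cis (- t)" for t
  proof -
    have "cis t = cos t *\<^sub>R 1 + sin t *\<^sub>R \<i>" by (simp add: complex_eq_iff)
    then have "f (cis t) = cos t * f 1 + sin t * f \<i>"
      using linear(1) by (simp add: bounded_linear.linear linear_add linear_scale)
    then show ?thesis by (simp add: complex_eq_iff field_simps)
  qed
  have "cis (of_int k * t) * (complex_of_real (f (cis t)) * u t)
      = (f 1 - \<i> * f \<i>) / 2 * (cis (of_int (k + 1) * t) * u t)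
        + (f 1 + \<i> * f \<i>) / 2 * (cis (of_int (k - 1) * t) * u t)" for t
  proof -
    have "cis (of_int (k + 1) * t) = cis (of_int k * t) * cis t"
      "cis (of_int (k - 1) * t) = cis (of_int k * t) * cis (- t)"
      by (simp_all add: cis_mult algebra_simps)
    then show ?thesis unfolding f by (simp only: algebra_simps)
  qed
  moreover have "(\<lambda>t. cis (of_int m * t) * u t) integrable_on {0..2*pi}" for m :: int
    by (intro integrable_continuous_real continuous_intros)
  ultimately show ?case
    by (simp add: integral_add integrable_on_mult_right integral_mult_right linear(3) del: of_int_add of_int_diff)
next
  case (const c)
  have "cis (of_int k * t) * (complex_of_real c * u t) = complex_of_real c * (cis (of_int k * t) * u t)" for t
    by simp
  then show ?case using const(2)[of k] by (simp only: integral_mult_right mult_zero_right)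
next
  case (add f g)
  note [continuous_intros] = add(5)
  have cf: "continuous_on {0..2*pi} (\<lambda>t. h (cis t))" if "real_polynomial_function h" for h :: "complex \<Rightarrow> real"
    using that by (intro continuous_on_cis_comp continuous_on_polymonial_function)
      (simp add: real_polynomial_function_eq)
  have *: "(\<lambda>t. cis (of_int k * t) * (complex_of_real (h (cis t)) * u t)) integrable_on {0..2*pi}"
    if "real_polynomial_function h" for h
    by (intro integrable_continuous_real continuous_intros cf that)
  have "integral {0..2*pi} (\<lambda>t. cis (of_int k * t) * (complex_of_real (f (cis t)) * u t)
     + cis (of_int k * t) * (complex_of_real (g (cis t)) * u t)) = 0"
    using add by (subst integral_add) (auto intro!: *)
  then show ?case by (simp add: algebra_simps)
next
  case (mult f g)
  have "continuous_on {0..2*pi} (\<lambda>t. g (cis t))"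
    using mult(2) by (intro continuous_on_cis_comp continuous_on_polymonial_function)
      (simp add: real_polynomial_function_eq)
  then have "continuous_on {0..2*pi} (\<lambda>t. complex_of_real (g (cis t)) * u t)"
    by (intro continuous_intros mult(5))
  from mult(3)[OF this] mult(4)[OF mult(5,6)]
  show ?case by (simp add: mult.assoc)
qed

lemma fourier_unique:
  fixes f :: "complex \<Rightarrow> complex"
  assumes f: "continuous_on S1 f" and 0: "\<And>k. fcoef f k = 0" and l: "l \<in> S1"
  shows "f l = 0"
proof -
  define u where "u t = f (cis t)" for t
  have u: "continuous_on {0..2*pi} u"
    unfolding u_def by (rule continuous_on_cis_comp[OF f])
  note [continuous_intros] = u
  have mom: "integral {0..2*pi} (\<lambda>t. cis (of_int k * t) * u t) = 0" for k
  proof -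
    have "(LINT t|circ. cis (of_int k * t) * u t) = 0"
      using 0[of "- k"] by (simp add: fcoef_def u_def)
    then show ?thesis by (subst (asm) circ_LINT_eq_integral) (auto intro!: continuous_intros)
  qed
  define C where "C = integral {0..2*pi} (\<lambda>t. norm (u t))"
  have C0: "C \<ge> 0" unfolding C_def
    by (intro Henstock_Kurzweil_Integration.integral_nonneg integrable_continuous_real continuous_intros) auto
  have bound: "norm (integral {0..2*pi} (\<lambda>t. u t * cnj (u t))) \<le> e * C" if e0: "e > 0" for e
  proof -
    obtain g where g: "polynomial_function g" "\<And>x. x \<in> S1 \<Longrightarrow> norm (cnj (f x) - g x) < e"
      using Stone_Weierstrass_polynomial_function[of S1 "\<lambda>x. cnj (f x)" e, OF compact_sphere _ e0]
        continuous_on_cnj[OF f] by blast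
    have Re: "real_polynomial_function (\<lambda>x. Re (g x))" and Im: "real_polynomial_function (\<lambda>x. Im (g x))"
      using g(1) bounded_linear_Re bounded_linear_Im by (auto simp: polynomial_function_def o_def)
    have cg: "continuous_on {0..2*pi} (\<lambda>t. g (cis t))"
      using g(1) by (intro continuous_on_cis_comp continuous_on_polymonial_function)
    note [continuous_intros] = cg
    have "integral {0..2*pi} (\<lambda>t. complex_of_real (Re (g (cis t))) * u t) = 0"
      "integral {0..2*pi} (\<lambda>t. complex_of_real (Im (g (cis t))) * u t) = 0"
      using vanishing_moments_polynomial_function[OF Re u mom, of 0]
        vanishing_moments_polynomial_function[OF Im u mom, of 0] by simp_all
    then have "integral {0..2*pi} (\<lambda>t. complex_of_real (Re (g (cis t))) * u t +
        \<i> * (complex_of_real (Im (g (cis t))) * u t)) = 0"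
      by (subst integral_add) (auto intro!: integrable_continuous_real continuous_intros)
    moreover have "complex_of_real (Re (g (cis t))) * u t + \<i> * (complex_of_real (Im (g (cis t))) * u t)
        = u t * g (cis t)" for t
      by (simp add: complex_eq_iff algebra_simps)
    ultimately have "integral {0..2*pi} (\<lambda>t. u t * g (cis t)) = 0" by simp
    then have "integral {0..2*pi} (\<lambda>t. u t * cnj (u t))
        = integral {0..2*pi} (\<lambda>t. u t * cnj (u t)) - integral {0..2*pi} (\<lambda>t. u t * g (cis t))"
      by simp
    also have "\<dots> = integral {0..2*pi} (\<lambda>t. u t * cnj (u t) - u t * g (cis t))"
      by (rule integral_diff[symmetric]) (auto intro!: integrable_continuous_real continuous_intros)
    also have "norm \<dots> \<le> integral {0..2*pi} (\<lambda>t. e * norm (u t))"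
    proof (rule integral_norm_bound_integral)
      fix t
      have "norm (cnj (u t) - g (cis t)) \<le> e" using g(2)[of "cis t"] by (simp add: u_def)
      then have "norm (u t) * norm (cnj (u t) - g (cis t)) \<le> norm (u t) * e"
        by (intro mult_left_mono) auto
      then show "norm (u t * cnj (u t) - u t * g (cis t)) \<le> e * norm (u t)"
        by (simp only: right_diff_distrib[symmetric] norm_mult mult.commute)
    qed (auto intro!: integrable_continuous_real continuous_intros)
    also have "\<dots> = e * C" by (simp add: C_def)
    finally show ?thesis .
  qed
  have "norm (integral {0..2*pi} (\<lambda>t. u t * cnj (u t))) \<le> 0"
  proof (rule field_le_epsilon)
    fix e :: real assume "e > 0"
    then have "norm (integral {0..2*pi} (\<lambda>t. u t * cnj (u t))) \<le> e / (C + 1) * C"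
      using C0 by (intro bound) auto
    also have "\<dots> \<le> e" using C0 \<open>e > 0\<close> by (simp add: field_simps)
    finally show "norm (integral {0..2*pi} (\<lambda>t. u t * cnj (u t))) \<le> 0 + e" by simp
  qed
  then have z: "integral {0..2*pi} (\<lambda>t. u t * cnj (u t)) = 0" by simp
  have "integral {0..2*pi} (\<lambda>t. (norm (u t))\<^sup>2) = 0"
  proof -
    have "complex_of_real (integral {0..2*pi} (\<lambda>t. (norm (u t))\<^sup>2))
        = integral {0..2*pi} (complex_of_real \<circ> (\<lambda>t. (norm (u t))\<^sup>2))"
      by (rule integral_linear[symmetric])
        (auto intro!: integrable_continuous_real continuous_intros bounded_linear_of_real)
    also have "\<dots> = integral {0..2*pi} (\<lambda>t. complex_of_real ((norm (u t))\<^sup>2))"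
      by (simp add: o_def)
    also have "\<dots> = 0" using z by (simp only: complex_norm_square)
    finally show ?thesis by simp
  qed
  then have hi: "((\<lambda>t. (norm (u t))\<^sup>2) has_integral 0) (cbox 0 (2*pi))"
    using integrable_integral[OF integrable_continuous_real[of 0 "2*pi" "\<lambda>t. (norm (u t))\<^sup>2"]]
    by (simp add: continuous_intros)
  have "(norm (u t))\<^sup>2 = 0" if "t \<in> {0..2*pi}" for t
    by (rule has_integral_0_cbox_imp_0[OF _ _ hi]) (use that pi_gt_zero in \<open>auto intro!: continuous_intros simp del: pi_gt_zero\<close>)
  then have "u t = 0" if "t \<in> {0..2*pi}" for t using that by simp
  moreover obtain t where "t \<in> {0..2*pi}" "l = cis t"
  proof -
    have "l = cis (Arg2pi l)" using Arg2pi_eq[of l, symmetric] l by (simp add: cis_conv_exp)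
    moreover have "Arg2pi l \<in> {0..2*pi}" using Arg2pi_ge_0[of l] Arg2pi_lt_2pi[of l] by auto
    ultimately show ?thesis using that by blast
  qed
  ultimately show ?thesis by (simp add: u_def)
qed

lemma fcoef_cong: "(\<And>l. l \<in> S1 \<Longrightarrow> f l = g l) \<Longrightarrow> fcoef f k = fcoef g k"
  by (simp add: fcoef_def)

lemma fcoef_shift: "fcoef (\<lambda>l. l ^ m * f l) k = fcoef f (k - int m)"
proof -
  have "cis (- of_int k * t) * (cis t ^ m * f (cis t)) = cis (- of_int (k - int m) * t) * f (cis t)" for t
    by (simp only: Complex.DeMoivre cis_mult mult.assoc[symmetric]) (simp add: algebra_simps)
  then show ?thesis unfolding fcoef_def by (simp only:)
qed

lemma fcoef_cmult: "fcoef (\<lambda>l. c * f l) k = c * fcoef f k"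
proof -
  have "cis (- of_int k * t) * (c * f (cis t)) = c * (cis (- of_int k * t) * f (cis t))" for t
    by simp
  then have "(LINT t|circ. cis (- of_int k * t) * (c * f (cis t)))
      = c * (LINT t|circ. cis (- of_int k * t) * f (cis t))"
    by (simp only: integral_mult_right_zero)
  then show ?thesis by (simp add: fcoef_def)
qed

lemma fcoef_cnj_shift: "fcoef (\<lambda>l. l ^ m * cnj (f l)) k = cnj (fcoef f (int m - k))"
proof -
  have "cis (- of_int k * t) * (cis t ^ m * cnj (f (cis t))) = cnj (cis (- of_int (int m - k) * t) * f (cis t))" for t
    by (simp only: Complex.DeMoivre cis_mult mult.assoc[symmetric] cis_cnj complex_cnj_mult) (simp add: algebra_simps)
  then have "(LINT t|circ. cis (- of_int k * t) * (cis t ^ m * cnj (f (cis t))))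
      = cnj (LINT t|circ. cis (- of_int (int m - k) * t) * f (cis t))"
    by (simp only: Bochner_Integration.integral_cnj)
  then show ?thesis by (simp add: fcoef_def)
qed

lemma circ_cis_mult_integrable:
  fixes u :: "real \<Rightarrow> complex"
  assumes "integrable circ u"
  shows "integrable circ (\<lambda>t. cis (c * t) * u t)"
proof (rule Bochner_Integration.integrable_bound[OF assms])
  have "(\<lambda>t. cis (c * t)) \<in> borel_measurable circ"
    by (intro borel_measurable_integrable circ_integrable_continuous continuous_intros)
  then show "(\<lambda>t. cis (c * t) * u t) \<in> borel_measurable circ"
    using assms by (intro borel_measurable_times) auto
qed (simp add: norm_mult)

lemma fcoef_sum:
  assumes "\<And>i. i \<in> I \<Longrightarrow> integrable circ (\<lambda>t. f i (cis t))"
  shows "fcoef (\<lambda>l. \<Sum>i\<in>I. f i l) k = (\<Sum>i\<in>I. fcoef (f i) k)"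
proof -
  have "(LINT t|circ. (\<Sum>i\<in>I. cis (- of_int k * t) * f i (cis t)))
      = (\<Sum>i\<in>I. LINT t|circ. cis (- of_int k * t) * f i (cis t))"
    by (intro Bochner_Integration.integral_sum circ_cis_mult_integrable assms)
  then show ?thesis unfolding fcoef_def sum_distrib_left by (simp only: scaleR_sum_right)
qed

lemma fcoef_one: "fcoef (\<lambda>l. 1) k = (if k = 0 then 1 else 0)"
proof (cases "k = 0")
  case True
  have "(LINT t|circ. 1 :: complex) = of_real (2 * pi)"
    by (subst circ_LINT_eq_integral) (auto simp: scaleR_conv_of_real)
  then show ?thesis using True by (simp add: fcoef_def scaleR_conv_of_real)
next
  case False
  define c where "c = - \<i> * of_int k"
  have c: "c \<noteq> 0" using False by (simp add: c_def)
  have cis: "exp (c * of_real t) = cis (- of_int k * t)" for t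
    by (simp add: cis_conv_exp c_def mult.assoc)
  let ?F = "\<lambda>t. cis (- of_int k * t) / c"
  have "((\<lambda>t. cis (- of_int k * t)) has_integral (?F (2*pi) - ?F 0)) {0..2*pi}"
  proof (rule fundamental_theorem_of_calculus)
    fix t
    have "((\<lambda>z. exp (c * z) / c) has_field_derivative exp (c * of_real t)) (at (of_real t))"
      using c by (auto intro!: derivative_eq_intros)
    then have "((\<lambda>t. exp (c * of_real t) / c) has_vector_derivative exp (c * of_real t)) (at t within {0..2*pi})"
      by (rule has_vector_derivative_at_within[OF has_vector_derivative_real_field])
    then show "(?F has_vector_derivative cis (- of_int k * t)) (at t within {0..2*pi})"
      by (simp only: cis)
  qed simp
  moreover have "cis (- of_int k * (2*pi)) = 1"
  proof -
    have "cis (2 * pi * of_int (- k)) = 1" by (rule cis_multiple_2pi) auto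
    moreover have "2 * pi * of_int (- k) = - of_int k * (2*pi)" by simp
    ultimately show ?thesis by (simp only:)
  qed
  ultimately have "integral {0..2*pi} (\<lambda>t. cis (- of_int k * t)) = 0"
    by (simp add: integral_unique)
  then have "(LINT t|circ. cis (- of_int k * t)) = 0"
    by (subst circ_LINT_eq_integral) (auto intro!: continuous_intros)
  then show ?thesis using False by (simp add: fcoef_def)
qed

lemma fcoef_polynomial:
  "fcoef (\<lambda>l. \<Sum>k\<le>n. l ^ k * c k) m = (if 0 \<le> m \<and> m \<le> int n then c (nat m) else 0)"
proof -
  have "fcoef (\<lambda>l. \<Sum>k\<le>n. l ^ k * c k) m = (\<Sum>k\<le>n. fcoef (\<lambda>l. l ^ k * c k) m)"
    by (intro fcoef_sum circ_integrable_continuous continuous_intros)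
  also have "\<dots> = (\<Sum>k\<le>n. if int k = m then c k else 0)"
  proof (rule sum.cong)
    fix k
    have "fcoef (\<lambda>l. l ^ k * c k) m = c k * fcoef (\<lambda>l. l ^ k * 1) m"
      by (subst fcoef_cmult[symmetric]) (simp add: mult.commute)
    also have "fcoef (\<lambda>l. l ^ k * 1) m = (if m - int k = 0 then 1 else 0)"
      by (simp only: fcoef_shift fcoef_one)
    finally show "fcoef (\<lambda>l. l ^ k * c k) m = (if int k = m then c k else 0)" by auto
  qed simp
  also have "\<dots> = (if 0 \<le> m \<and> m \<le> int n then c (nat m) else 0)"
  proof (cases "0 \<le> m")
    case True
    then have "int k = m \<longleftrightarrow> k = nat m" for k by auto
    then show ?thesis using True by (auto simp: sum.delta)
  qed (auto intro!: sum.neutral)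
  finally show ?thesis .
qed

lemma polynomial_loop:
  assumes f: "continuous_on S1 f" and 0: "\<And>k. k < 0 \<Longrightarrow> fcoef f k = 0" "\<And>k. k > int n \<Longrightarrow> fcoef f k = 0"
    and l: "l \<in> S1"
  shows "f l = (\<Sum>k\<le>n. l ^ k * fcoef f (int k))"
proof -
  define P where "P l = (\<Sum>k\<le>n. l ^ k * fcoef f (int k))" for l
  have P: "continuous_on S1 P" unfolding P_def by (intro continuous_intros)
  have "f l - P l = 0"
  proof (rule fourier_unique[OF _ _ l])
    show "continuous_on S1 (\<lambda>l. f l - P l)" by (intro continuous_intros f P)
    fix k
    have "fcoef (\<lambda>l. f l - P l) k = fcoef (\<lambda>l. \<Sum>b\<in>UNIV. (if b then f l else - 1 * P l)) k"
      by (simp add: UNIV_bool)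
    also have "\<dots> = fcoef f k + fcoef (\<lambda>l. - 1 * P l) k"
    proof (subst fcoef_sum)
      fix b
      show "integrable circ (\<lambda>t. if b then f (cis t) else - 1 * P (cis t))"
        using circ_integrable_continuous[OF continuous_on_cis_comp[OF f]]
          circ_integrable_continuous[OF continuous_on_cis_comp[OF P]]
        by (cases b) auto
    qed (simp only: UNIV_bool, simp)
    also have "\<dots> = fcoef f k - fcoef P k" by (simp only: fcoef_cmult) simp
    also have "fcoef P k = (if 0 \<le> k \<and> k \<le> int n then fcoef f (int (nat k)) else 0)"
      unfolding P_def by (rule fcoef_polynomial)
    also have "fcoef f k - \<dots> = 0" using 0[of k] by auto
    finally show "fcoef (\<lambda>l. f l - P l) k = 0" .
  qed
  then show ?thesis by (simp add: P_def)
qed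

lemma L2_circle_integrable:
  assumes "f \<in> L2_circle" shows "integrable circ (\<lambda>t. f (cis t))"
proof (rule Bochner_Integration.integrable_bound)
  show "integrable circ (\<lambda>t. 1 + (norm (f (cis t)))\<^sup>2)"
    using assms circ_integrable_continuous[of "\<lambda>_. 1 :: real"] unfolding L2_circle_def
    by (intro Bochner_Integration.integrable_add) auto
  show "(\<lambda>t. f (cis t)) \<in> borel_measurable circ" using assms by (simp add: L2_circle_def)
  have "x \<le> 1 + x\<^sup>2" for x :: real
  proof -
    have "0 \<le> (x - 1 / 2)\<^sup>2 + 3 / 4" by simp
    then show ?thesis by (simp add: power2_eq_square field_simps)
  qed
  then show "AE t in circ. norm (f (cis t)) \<le> norm (1 + (norm (f (cis t)))\<^sup>2)" by simp
qed

lemma L2_circle_component_integrable: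
  assumes "f \<in> L2_circle" shows "integrable circ (\<lambda>t. f (cis t) $ i)"
  by (rule integrable_bounded_linear[OF bounded_linear_vec_nth L2_circle_integrable[OF assms]])

lemma fourier_coeff_component:
  fixes f :: "complex \<Rightarrow> complex ^ 'n"
  assumes "f \<in> L2_circle" shows "fourier_coeff f k $ i = fcoef (\<lambda>l. f l $ i) k"
proof -
  have int: "integrable circ (\<lambda>t. cis (- of_int k * t) *s f (cis t))"
  proof (rule Bochner_Integration.integrable_bound[OF L2_circle_integrable[OF assms]])
    show "(\<lambda>t. cis (- of_int k * t) *s f (cis t)) \<in> borel_measurable circ"
    proof (rule borel_measurable_continuous_Pair[where H = "\<lambda>c v. c *s v"])
      show "(\<lambda>t. cis (- of_int k * t)) \<in> borel_measurable circ"
        by (intro borel_measurable_integrable circ_integrable_continuous continuous_intros)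
      show "(\<lambda>t. f (cis t)) \<in> borel_measurable circ" using assms by (simp add: L2_circle_def)
      show "continuous_on UNIV (\<lambda>x. fst x *s (snd x :: complex ^ 'n))"
        unfolding vector_scalar_mult_def by (intro continuous_intros)
    qed
    have "norm (c *s v) = norm c * norm v" for c :: complex and v :: "complex ^ 'n"
      by (simp add: norm_vec_def norm_mult L2_set_right_distrib)
    then show "AE t in circ. norm (cis (- of_int k * t) *s f (cis t)) \<le> norm (f (cis t))" by simp
  qed
  show ?thesis
    using integral_bounded_linear[OF bounded_linear_vec_nth int, of i]
    by (simp add: fourier_coeff_def fcoef_def)
qed

lemma H_plus_fcoef: "f \<in> H_plus \<Longrightarrow> k < 0 \<Longrightarrow> fcoef (\<lambda>l. f l $ i) k = 0"
  using fourier_coeff_component[of f k i] by (simp add: H_plus_def)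

lemma H_plus_continuousI:
  assumes f: "continuous_on S1 f" and "\<And>k i. k < 0 \<Longrightarrow> fcoef (\<lambda>l. f l $ i) k = 0"
  shows "f \<in> H_plus"
proof -
  have c: "continuous_on {0..2*pi} (\<lambda>t. f (cis t))" by (rule continuous_on_cis_comp[OF f])
  then have "integrable circ (\<lambda>t. (norm (f (cis t)))\<^sup>2)" "integrable circ (\<lambda>t. f (cis t))"
    by (auto intro!: circ_integrable_continuous continuous_intros)
  then have "f \<in> L2_circle" by (auto simp: L2_circle_def)
  then show ?thesis using assms(2) by (simp add: H_plus_def vec_eq_iff fourier_coeff_component)
qed

lemma H_plus_polynomial: "(\<lambda>l. \<chi> i. \<Sum>k\<le>n. l ^ k * c k i) \<in> H_plus"
proof (rule H_plus_continuousI)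
  show "continuous_on S1 (\<lambda>l. \<chi> i. \<Sum>k\<le>n. l ^ k * c k i)" by (intro continuous_intros)
qed (simp add: fcoef_polynomial)

subsection \<open>Rational functions on the sphere\<close>

lemma not_essential_power_tendsto:
  assumes "isolated_singularity_at f a" "not_essential f a"
  shows "\<exists>k c. (\<lambda>z. (z - a) ^ k * f z) \<midarrow>a\<rightarrow> c"
proof (cases "is_pole f a")
  case False
  then obtain c where "f \<midarrow>a\<rightarrow> c" using assms(2) unfolding not_essential_def by blast
  then have "(\<lambda>z. (z - a) ^ 0 * f z) \<midarrow>a\<rightarrow> c" by simp
  then show ?thesis by blast
next
  case True
  obtain A where A: "open A" "a \<in> A" "f holomorphic_on (A - {a})"
    using assms(1) analytic_imp_holomorphic isolated_singularity_at_iff_analytic_nhd by auto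
  let ?n = "nat (- zorder f a)" and ?g = "zor_poly f a"
  obtain r where r: "r > 0" "?g holomorphic_on cball a r"
    "\<forall>w\<in>cball a r - {a}. f w = ?g w / (w - a) ^ ?n \<and> ?g w \<noteq> 0"
    using zorder_exist_pole[OF A(3,1,2) True] by blast
  have "continuous_on (ball a r) ?g"
    by (meson ball_subset_cball holomorphic_on_imp_continuous_on holomorphic_on_subset r(2))
  then have "isCont ?g a" using r(1) by (simp add: continuous_on_eq_continuous_at)
  then have "?g \<midarrow>a\<rightarrow> ?g a" by (simp add: isCont_def)
  moreover have "\<forall>\<^sub>F w in at a. ?g w = (w - a) ^ ?n * f w"
  proof -
    have "\<forall>\<^sub>F w in at a. w \<in> ball a r - {a}"
      using r(1) by (intro eventually_at_in_open) auto
    then show ?thesis by eventually_elim (use r(3) in auto)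
  qed
  ultimately have "(\<lambda>z. (z - a) ^ ?n * f z) \<midarrow>a\<rightarrow> ?g a"
    using tendsto_cong by fast
  then show ?thesis by blast
qed

lemma isolated_singularity_finite:
  assumes "F holomorphic_on (UNIV - S)" "finite S"
  shows "isolated_singularity_at F a"
proof (rule isolated_singularity_at_holomorphic)
  have "finite (S - {a})" using assms(2) by simp
  then show "open (- (S - {a}))" using \<open>finite (S - {a})\<close> by (intro open_Compl finite_imp_closed)
  show "a \<in> - (S - {a})" by simp
  show "F holomorphic_on (- (S - {a})) - {a}"
    by (rule holomorphic_on_subset[OF assms(1)]) auto
qed

lemma rational_if_not_essential:
  assumes F: "F holomorphic_on (UNIV - S)" "finite S"
    and ne: "\<And>a. a \<in> S \<Longrightarrow> not_essential F a"
    and inf: "not_essential (\<lambda>w. F (1 / w)) 0"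
  shows "\<exists>p q :: complex poly. q \<noteq> 0 \<and> (\<forall>z. z \<notin> S \<longrightarrow> poly q z \<noteq> 0 \<and> F z = poly p z / poly q z)"
proof -
  have "\<forall>a\<in>S. \<exists>k c. (\<lambda>z. (z - a) ^ k * F z) \<midarrow>a\<rightarrow> c"
    using not_essential_power_tendsto isolated_singularity_finite[OF F] ne by blast
  then obtain k c where kc: "\<And>a. a \<in> S \<Longrightarrow> (\<lambda>z. (z - a) ^ k a * F z) \<midarrow>a\<rightarrow> c a"
    by metis
  define q :: "complex poly" where "q = (\<Prod>a\<in>S. [:- a, 1:] ^ k a)"
  have q: "poly q z = (\<Prod>a\<in>S. (z - a) ^ k a)" for z
    by (simp add: q_def poly_prod)
  have q0: "poly q z \<noteq> 0" if "z \<notin> S" for z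
    using that F(2) by (auto simp: q)
  have "q \<noteq> 0" by (simp add: q_def F(2))
  define E where "E = remove_sings (\<lambda>z. poly q z * F z)"
  have hol: "(\<lambda>z. poly q z * F z) holomorphic_on (UNIV - S)"
    by (intro holomorphic_intros F)
  have op: "open (UNIV - S)" using F(2) by (simp add: finite_imp_closed open_Diff)
  have Eeq: "E z = poly q z * F z" and Ean: "E analytic_on {z}" if "z \<notin> S" for z
  proof -
    have "(\<lambda>z. poly q z * F z) analytic_on {z}"
      using hol op that analytic_on_open analytic_on_subset[of _ "UNIV - S"] by blast
    then show "E z = poly q z * F z" "E analytic_on {z}"
      by (auto simp: E_def intro!: remove_sings_analytic_on)
  qed
  have Ean': "E analytic_on {a}" if "a \<in> S" for a
    unfolding E_def
  proof (rule remove_sings_analytic_at)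
    show "isolated_singularity_at (\<lambda>z. poly q z * F z) a"
      by (rule isolated_singularity_finite[OF hol F(2)])
    have "(\<lambda>z. (\<Prod>b\<in>S - {a}. (z - b) ^ k b) * ((z - a) ^ k a * F z))
        \<midarrow>a\<rightarrow> (\<Prod>b\<in>S - {a}. (a - b) ^ k b) * c a"
      by (intro tendsto_intros kc that)
    moreover have "(\<Prod>b\<in>S - {a}. (z - b) ^ k b) * ((z - a) ^ k a * F z) = poly q z * F z" for z
      unfolding q using prod.remove[OF F(2) that, of "\<lambda>b. (z - b) ^ k b"] by simp
    ultimately show "(\<lambda>z. poly q z * F z) \<midarrow>a\<rightarrow> (\<Prod>b\<in>S - {a}. (a - b) ^ k b) * c a"
      by simp
  qed
  have "E analytic_on UNIV" using Ean Ean' by (metis analytic_on_analytic_at)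
  then have Eh: "E holomorphic_on UNIV" by (rule analytic_imp_holomorphic)
  have "isolated_singularity_at (\<lambda>w. F (1 / w)) 0"
  proof (rule isolated_singularity_at_holomorphic)
    let ?B = "- ((\<lambda>a. 1 / a) ` (S - {0}))"
    show "open ?B" using F(2) by (simp add: finite_imp_closed open_Compl)
    show "0 \<in> ?B" by auto
    show "(\<lambda>w. F (1 / w)) holomorphic_on ?B - {0}"
    proof (rule holomorphic_on_compose_gen[OF _ F(1), unfolded o_def])
      show "(\<lambda>w. 1 / w) holomorphic_on ?B - {0}" by (intro holomorphic_intros) auto
      have "w = 1 / (1 / w)" for w :: complex by simp
      then show "(\<lambda>w. 1 / w) ` (?B - {0}) \<subseteq> UNIV - S" by fastforce
    qed
  qed
  then obtain n L where L: "(\<lambda>w. (w - 0) ^ n * F (1 / w)) \<midarrow>0\<rightarrow> L"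
    using not_essential_power_tendsto inf by blast
  obtain B where B: "\<forall>\<^sub>F w in at 0. norm ((w - 0) ^ n * F (1 / w)) \<le> B"
  proof
    have "\<forall>\<^sub>F w in at 0. dist ((w - 0) ^ n * F (1 / w)) L < 1"
      using tendstoD[OF L, of 1] by simp
    then show "\<forall>\<^sub>F w in at 0. norm ((w - 0) ^ n * F (1 / w)) \<le> norm L + 1"
    proof eventually_elim
      case (elim w)
      then show ?case
        using norm_triangle_ineq2[of "(w - 0) ^ n * F (1 / w)" L] by (simp only: dist_norm)
    qed
  qed
  then obtain d where d: "d > 0" "\<And>w. w \<noteq> 0 \<Longrightarrow> norm w < d \<Longrightarrow> norm (w ^ n * F (1 / w)) \<le> B"
    unfolding eventually_at by (auto simp: dist_norm)
  obtain M where M: "\<And>a. a \<in> S \<Longrightarrow> norm a \<le> M" using F(2)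
    by (metis bounded_iff finite_imp_bounded)
  define A where "A = max (max (M + 1) 1) (2 / d)"
  obtain Cq where Cq: "\<And>z. norm z \<ge> 1 \<Longrightarrow> norm (poly q z) \<le> Cq * norm z ^ degree q"
  proof
    fix z :: complex assume z: "norm z \<ge> 1"
    have "norm (poly q z) \<le> (\<Sum>i\<le>degree q. norm (coeff q i) * norm z ^ i)"
      unfolding poly_altdef by (rule order_trans[OF norm_sum]) (simp add: norm_mult norm_power)
    also have "\<dots> \<le> (\<Sum>i\<le>degree q. norm (coeff q i) * norm z ^ degree q)"
      using z by (intro sum_mono mult_left_mono power_increasing) auto
    finally show "norm (poly q z) \<le> (\<Sum>i\<le>degree q. norm (coeff q i)) * norm z ^ degree q"
      by (simp add: sum_distrib_right)
  qed
  have bnd: "norm (E z) \<le> (Cq * B) * norm z ^ (degree q + n)" if z: "A \<le> norm z" for z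
  proof -
    have z1: "norm z \<ge> 1" "norm z > M" "z \<noteq> 0" "norm z \<ge> 2 / d"
      using z unfolding A_def by auto
    then have "z \<notin> S" using M by force
    have "norm (1 / z) < d" using z1 d(1) by (simp add: norm_divide field_simps) 
    then have "norm ((1 / z) ^ n * F z) \<le> B" using d(2)[of "1 / z"] z1 by simp
    then have Fz: "norm (F z) \<le> B * norm z ^ n" using z1
      by (simp add: norm_mult norm_power norm_divide field_simps)
    have "norm (E z) = norm (poly q z) * norm (F z)" using Eeq[OF \<open>z \<notin> S\<close>] by (simp add: norm_mult)
    also have "\<dots> \<le> (Cq * norm z ^ degree q) * (B * norm z ^ n)"
      using order_trans[OF norm_ge_zero Cq[OF z1(1)]]
      by (intro mult_mono Cq z1 Fz) auto
    finally show ?thesis by (simp add: power_add mult_ac)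
  qed
  define p :: "complex poly" where
    "p = (\<Sum>i\<le>degree q + n. monom ((deriv ^^ i) E 0 / fact i) i)"
  have "E z = poly p z" for z
    using Liouville_polynomial[OF Eh bnd] by (simp add: p_def poly_sum poly_monom)
  then have "F z = poly p z / poly q z" if "z \<notin> S" for z
    using Eeq[OF that] q0[OF that] by simp
  then show ?thesis using \<open>q \<noteq> 0\<close> q0 by blast
qed

subsection \<open>Complex matrices\<close>

definition outer :: "complex ^ 'm \<Rightarrow> complex ^ 'n \<Rightarrow> complex ^ 'n ^ 'm" where
  "outer u v = (\<chi> i j. u $ i * cnj (v $ j))"

lemma hinner_add_left: "hinner (u + v) w = hinner u w + hinner v w"
  by (simp add: hinner_def algebra_simps sum.distrib)
lemma hinner_add_right: "hinner u (v + w) = hinner u v + hinner u w"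
  by (simp add: hinner_def algebra_simps sum.distrib)
lemma hinner_diff_left: "hinner (u - v) w = hinner u w - hinner v w"
  by (simp add: hinner_def algebra_simps sum_subtractf)
lemma hinner_diff_right: "hinner u (v - w) = hinner u v - hinner u w"
  by (simp add: hinner_def algebra_simps sum_subtractf)
lemma hinner_uminus_left: "hinner (- u) w = - hinner u w"
  by (simp add: hinner_def sum_negf)
lemma hinner_uminus_right: "hinner u (- w) = - hinner u w"
  by (simp add: hinner_def sum_negf)
lemma hinner_scale_left: "hinner (c *s u) w = c * hinner u w"
  by (simp add: hinner_def sum_distrib_left mult.assoc)
lemma hinner_scale_right: "hinner u (c *s w) = cnj c * hinner u w"
  by (simp add: hinner_def sum_distrib_left mult_ac)
lemma hinner_zero_left [simp]: "hinner 0 w = 0" by (simp add: hinner_def)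
lemma hinner_zero_right [simp]: "hinner u 0 = 0" by (simp add: hinner_def)
lemma cnj_hinner [simp]: "cnj (hinner u v) = hinner v u"
  by (simp add: hinner_def mult.commute)
lemmas hinner_simps = hinner_add_left hinner_add_right hinner_diff_left hinner_diff_right
  hinner_uminus_left hinner_uminus_right hinner_scale_left hinner_scale_right

lemma hinner_self: "hinner u u = complex_of_real ((norm u)\<^sup>2)"
proof -
  have "(norm u)\<^sup>2 = (\<Sum>i\<in>UNIV. (norm (u $ i))\<^sup>2)"
    by (simp add: norm_vec_def L2_set_def sum_nonneg)
  then show ?thesis by (simp add: hinner_def complex_norm_square[symmetric])
qed

lemma hinner_self_eq_0 [simp]: "hinner u u = 0 \<longleftrightarrow> u = 0"
  by (simp add: hinner_self)

lemma hinner_eq_0_commute: "hinner u v = 0 \<longleftrightarrow> hinner v u = 0"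
  by (metis cnj_hinner complex_cnj_zero)

lemma adj_adj [simp]: "adj (adj A) = A" by (simp add: adj_def vec_eq_iff)
lemma adj_add: "adj (A + B) = adj A + adj B" by (simp add: adj_def vec_eq_iff)
lemma adj_diff: "adj (A - B) = adj A - adj B" by (simp add: adj_def vec_eq_iff)
lemma adj_uminus: "adj (- A) = - adj A" by (simp add: adj_def vec_eq_iff)
lemma adj_csmult: "adj (csmult c A) = csmult (cnj c) (adj A)" by (simp add: adj_def csmult_def vec_eq_iff)
lemma adj_mult: "adj (A ** B) = adj B ** adj A"
  by (simp add: adj_def matrix_matrix_mult_def vec_eq_iff mult.commute)
lemma adj_mat_1 [simp]: "adj (mat 1) = mat 1" by (simp add: adj_def mat_def vec_eq_iff)
lemma adj_zero [simp]: "adj 0 = 0" by (simp add: adj_def vec_eq_iff)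
lemma adj_outer: "adj (outer u v) = outer v u" by (simp add: adj_def outer_def vec_eq_iff)

lemma csmult_mult_left: "csmult c A ** B = csmult c (A ** B)"
  by (simp add: csmult_def matrix_matrix_mult_def vec_eq_iff sum_distrib_left mult.assoc)
lemma csmult_mult_right: "A ** csmult c B = csmult c (A ** B)"
  by (simp add: csmult_def matrix_matrix_mult_def vec_eq_iff sum_distrib_left mult_ac)
lemma csmult_csmult: "csmult c (csmult d A) = csmult (c * d) A"
  by (simp add: csmult_def vec_eq_iff mult.assoc)
lemma csmult_add_right: "csmult c (A + B) = csmult c A + csmult c B"
  by (simp add: csmult_def vec_eq_iff algebra_simps)
lemma csmult_diff_right: "csmult c (A - B) = csmult c A - csmult c B"
  by (simp add: csmult_def vec_eq_iff algebra_simps)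
lemma csmult_uminus_right: "csmult c (- A) = - csmult c A"
  by (simp add: csmult_def vec_eq_iff)
lemma csmult_diff_left: "csmult (c - d) A = csmult c A - csmult d A"
  by (simp add: csmult_def vec_eq_iff algebra_simps)
lemma csmult_one [simp]: "csmult 1 A = A" by (simp add: csmult_def vec_eq_iff)
lemma csmult_zero [simp]: "csmult 0 A = 0" "csmult c 0 = 0" by (simp_all add: csmult_def vec_eq_iff)
lemma csmult_nth [simp]: "csmult c A $ i $ j = c * A $ i $ j" by (simp add: csmult_def)
lemma csmult_mv: "csmult c A *v v = c *s (A *v v)"
  by (simp add: csmult_def matrix_vector_mult_def vec_eq_iff sum_distrib_left mult.assoc)

lemma matrix_add_mv: "(A + B) *v v = A *v v + B *v (v :: complex ^ 'n)"
  by (simp add: matrix_vector_mult_def vec_eq_iff algebra_simps sum.distrib)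
lemma matrix_diff_mv: "(A - B) *v v = A *v v - B *v (v :: complex ^ 'n)"
  by (simp add: matrix_vector_mult_def vec_eq_iff algebra_simps sum_subtractf)
lemma matrix_uminus_mv: "(- A) *v v = - (A *v (v :: complex ^ 'n))"
  by (simp add: matrix_vector_mult_def vec_eq_iff sum_negf)
lemma mv_scale: "A *v (c *s v) = c *s (A *v (v :: complex ^ 'n))"
  by (simp add: matrix_vector_mult_def vec_eq_iff sum_distrib_left mult_ac)
lemma mv_add: "A *v (u + v) = A *v u + A *v (v :: complex ^ 'n)"
  by (simp add: matrix_vector_mult_def vec_eq_iff algebra_simps sum.distrib)
lemma mv_diff: "A *v (u - v) = A *v u - A *v (v :: complex ^ 'n)"
  by (simp add: matrix_vector_mult_def vec_eq_iff algebra_simps sum_subtractf)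
lemma mv_uminus: "A *v (- v) = - (A *v (v :: complex ^ 'n))"
  by (simp add: matrix_vector_mult_def vec_eq_iff sum_negf)
lemma mm_add_left: "(A + B) ** C = A ** C + B ** (C :: complex ^ 'n ^ 'm)"
  by (simp add: matrix_matrix_mult_def vec_eq_iff algebra_simps sum.distrib)
lemma mm_add_right: "A ** (B + C) = A ** B + A ** (C :: complex ^ 'n ^ 'm)"
  by (simp add: matrix_matrix_mult_def vec_eq_iff algebra_simps sum.distrib)
lemma mm_diff_left: "(A - B) ** C = A ** C - B ** (C :: complex ^ 'n ^ 'm)"
  by (simp add: matrix_matrix_mult_def vec_eq_iff algebra_simps sum_subtractf)
lemma mm_diff_right: "A ** (B - C) = A ** B - A ** (C :: complex ^ 'n ^ 'm)"
  by (simp add: matrix_matrix_mult_def vec_eq_iff algebra_simps sum_subtractf)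
lemma mm_uminus_left: "(- A) ** C = - (A ** (C :: complex ^ 'n ^ 'm))"
  by (simp add: matrix_matrix_mult_def vec_eq_iff sum_negf)
lemma mm_uminus_right: "A ** (- C) = - (A ** (C :: complex ^ 'n ^ 'm))"
  by (simp add: matrix_matrix_mult_def vec_eq_iff sum_negf)
lemma mm_zero [simp]: "0 ** (C :: complex ^ 'n ^ 'm) = 0" "C ** (0 :: complex ^ 'k ^ 'n) = 0"
  by (simp_all add: matrix_matrix_mult_def vec_eq_iff)
lemmas mm_simps = mm_add_left mm_add_right mm_diff_left mm_diff_right mm_uminus_left mm_uminus_right
  csmult_mult_left csmult_mult_right csmult_csmult csmult_add_right csmult_diff_right csmult_uminus_right
lemmas mv_simps = matrix_add_mv matrix_diff_mv matrix_uminus_mv mv_scale mv_add mv_diff mv_uminus csmult_mv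

lemma hinner_adj: "hinner (A *v u) w = hinner u (adj A *v w)"
proof -
  have "hinner (A *v u) w = (\<Sum>i\<in>UNIV. \<Sum>j\<in>UNIV. A $ i $ j * u $ j * cnj (w $ i))"
    by (simp add: hinner_def matrix_vector_mult_def sum_distrib_right)
  also have "\<dots> = (\<Sum>j\<in>UNIV. \<Sum>i\<in>UNIV. A $ i $ j * u $ j * cnj (w $ i))"
    by (rule sum.swap)
  also have "\<dots> = hinner u (adj A *v w)"
    by (simp add: hinner_def matrix_vector_mult_def adj_def sum_distrib_left mult_ac)
  finally show ?thesis .
qed

lemma outer_mv: "outer u v *v w = hinner w v *s u"
  by (simp add: outer_def matrix_vector_mult_def hinner_def vec_eq_iff sum_distrib_left mult_ac)
lemma mm_outer: "A ** outer u v = outer (A *v u) v"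
  by (simp add: outer_def matrix_matrix_mult_def matrix_vector_mult_def vec_eq_iff sum_distrib_left mult_ac)
lemma outer_mm: "outer u v ** A = outer u (adj A *v v)"
  by (simp add: outer_def matrix_matrix_mult_def matrix_vector_mult_def adj_def vec_eq_iff sum_distrib_left mult_ac)
lemma outer_scale_left: "outer (c *s u) w = csmult c (outer u w)"
  by (simp add: outer_def vec_eq_iff)
lemma outer_scale_right: "outer u (c *s w) = csmult (cnj c) (outer u w)"
  by (simp add: outer_def vec_eq_iff)
lemma outer_zero [simp]: "outer 0 w = 0" "outer u 0 = 0"
  by (simp_all add: outer_def vec_eq_iff)
lemma outer_mult_outer: "outer a b ** outer c d = csmult (hinner c b) (outer a d)"
  by (simp add: mm_outer outer_mv outer_scale_left)

lemma mv_axis: "(A *v axis j 1) $ i = (A :: complex ^ 'n ^ 'm) $ i $ j"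
  by (simp add: matrix_vector_mult_def axis_def if_distrib[of "\<lambda>x. _ * x"] cong: if_cong)

lemma matrix_eqI_mv: "(\<And>v. A *v v = B *v v) \<Longrightarrow> A = (B :: complex ^ 'n ^ 'm)"
  by (simp add: matrix_eq)

lemma unitary_inv: "unitary A \<Longrightarrow> matrix_inv A = adj A"
proof -
  assume "unitary A"
  then have 1: "A ** adj A = mat 1" "adj A ** A = mat 1" by (auto simp: unitary_def)
  then have "A ** matrix_inv A = mat 1 \<and> matrix_inv A ** A = mat 1"
    unfolding matrix_inv_def by (intro someI[of "\<lambda>B. A ** B = mat 1 \<and> B ** A = mat 1"]) auto
  then have 2: "A ** matrix_inv A = mat 1" by blast
  have "matrix_inv A = (adj A ** A) ** matrix_inv A" using 1 by simp
  also have "\<dots> = adj A" by (simp only: matrix_mul_assoc[symmetric] 2 matrix_mul_rid)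
  finally show ?thesis .
qed

subsection \<open>Loops with three Fourier modes\<close>

lemma infinite_S1: "infinite S1"
proof
  assume "finite S1"
  moreover have "cis ` {0..1} \<subseteq> S1" by auto
  ultimately have "finite (cis ` {0..1})" by (rule rev_finite_subset)
  moreover have "inj_on cis {0..1}"
  proof (rule inj_onI)
    fix x y :: real assume xy: "x \<in> {0..1}" "y \<in> {0..1}" "cis x = cis y"
    have "cos x = cos y" using arg_cong[OF xy(3), of Re] by simp
    moreover have "pi > 1" using pi_gt3 by simp
    ultimately show "x = y" using xy(1,2) cos_inj_pi[of x y] by simp
  qed
  ultimately have "finite {0..1 :: real}" by (rule finite_imageD)
  then show False using infinite_Icc[of 0 "1 :: real"] by simp
qed

lemma poly_zero_on_S1:
  assumes "\<And>l. l \<in> S1 \<Longrightarrow> poly p l = 0" shows "p = 0"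
  using assms infinite_S1 poly_roots_finite[of p] finite_subset[of S1 "{x. poly p x = 0}"] by blast

lemma matrix_poly_zero_on_S1:
  fixes C0 :: "complex ^ 'n ^ 'm"
  assumes "\<And>l. l \<in> S1 \<Longrightarrow> C0 + csmult l C1 + csmult (l\<^sup>2) C2 + csmult (l^3) C3 + csmult (l^4) C4 = 0"
  shows "C0 = 0 \<and> C1 = 0 \<and> C2 = 0 \<and> C3 = 0 \<and> C4 = 0"
proof -
  have "C0 $ i $ j = 0 \<and> C1 $ i $ j = 0 \<and> C2 $ i $ j = 0 \<and> C3 $ i $ j = 0 \<and> C4 $ i $ j = 0" for i j
  proof -
    have "[:C0 $ i $ j, C1 $ i $ j, C2 $ i $ j, C3 $ i $ j, C4 $ i $ j:] = 0"
    proof (rule poly_zero_on_S1)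
      fix l assume "l \<in> S1"
      then have "(C0 + csmult l C1 + csmult (l\<^sup>2) C2 + csmult (l^3) C3 + csmult (l^4) C4) $ i $ j = 0"
        using assms by simp
      then show "poly [:C0 $ i $ j, C1 $ i $ j, C2 $ i $ j, C3 $ i $ j, C4 $ i $ j:] l = 0"
        by (simp add: algebra_simps power2_eq_square power3_eq_cube power4_eq_xxxx)
    qed
    then show ?thesis by simp
  qed
  then show ?thesis by (simp add: vec_eq_iff)
qed

lemma unitary_loop_relations:
  fixes \<gamma> :: "complex \<Rightarrow> complex ^ 'n ^ 'n"
  assumes u: "\<And>l. l \<in> S1 \<Longrightarrow> unitary (\<gamma> l)"
    and g: "\<And>l. l \<in> S1 \<Longrightarrow> \<gamma> l = A0 + csmult l A1 + csmult (l\<^sup>2) A2"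
  shows "A0 ** adj A2 = 0" "A0 ** adj A1 + A1 ** adj A2 = 0"
    "A0 ** adj A0 + A1 ** adj A1 + A2 ** adj A2 = mat 1"
    "adj A2 ** A0 = 0" "adj A1 ** A0 + adj A2 ** A1 = 0"
proof -
  have lc: "l * cnj l = 1" if "l \<in> S1" for l
    using that by (simp flip: complex_norm_square)
  have ad: "csmult (l\<^sup>2) (adj (\<gamma> l)) = adj A2 + csmult l (adj A1) + csmult (l\<^sup>2) (adj A0)" if "l \<in> S1" for l
  proof -
    have "l\<^sup>2 * cnj l = l" "l\<^sup>2 * (cnj l)\<^sup>2 = 1"
      using lc[OF that] by (simp_all add: power2_eq_square mult.assoc power_mult_distrib[symmetric])
        (metis mult.left_commute mult.right_neutral)
    then show ?thesis by (simp add: g[OF that] adj_add adj_csmult csmult_add_right csmult_csmult)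
  qed
  have 1: "(A0 ** adj A2) + csmult l (A0 ** adj A1 + A1 ** adj A2)
      + csmult (l\<^sup>2) (A0 ** adj A0 + A1 ** adj A1 + A2 ** adj A2 - mat 1)
      + csmult (l^3) (A1 ** adj A0 + A2 ** adj A1) + csmult (l^4) (A2 ** adj A0) = 0" if "l \<in> S1" for l
  proof -
    have "\<gamma> l ** csmult (l\<^sup>2) (adj (\<gamma> l)) = csmult (l\<^sup>2) (mat 1)"
      using u[OF that] by (simp add: csmult_mult_right unitary_def)
    then show ?thesis unfolding ad[OF that] unfolding g[OF that]
      by (simp add: mm_simps algebra_simps power2_eq_square power3_eq_cube power4_eq_xxxx)
  qed
  have 2: "(adj A2 ** A0) + csmult l (adj A1 ** A0 + adj A2 ** A1)
      + csmult (l\<^sup>2) (adj A0 ** A0 + adj A1 ** A1 + adj A2 ** A2 - mat 1)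
      + csmult (l^3) (adj A0 ** A1 + adj A1 ** A2) + csmult (l^4) (adj A0 ** A2) = 0" if "l \<in> S1" for l
  proof -
    have "csmult (l\<^sup>2) (adj (\<gamma> l)) ** \<gamma> l = csmult (l\<^sup>2) (mat 1)"
      using u[OF that] by (simp add: csmult_mult_left unitary_def)
    then show ?thesis unfolding ad[OF that] unfolding g[OF that]
      by (simp add: mm_simps algebra_simps power2_eq_square power3_eq_cube power4_eq_xxxx)
  qed
  from matrix_poly_zero_on_S1[OF 1] matrix_poly_zero_on_S1[OF 2]
  show "A0 ** adj A2 = 0" "A0 ** adj A1 + A1 ** adj A2 = 0"
    "A0 ** adj A0 + A1 ** adj A1 + A2 ** adj A2 = mat 1"
    "adj A2 ** A0 = 0" "adj A1 ** A0 + adj A2 ** A1 = 0"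
    by simp_all
qed

lemma loop_fcoef:
  assumes f: "f \<in> H_plus"
    and g: "\<And>l. l \<in> S1 \<Longrightarrow> g l = A0 *v f l + l *s (A1 *v f l) + l\<^sup>2 *s (A2 *v f l)"
  shows "fcoef (\<lambda>l. g l $ i) m = (\<Sum>j\<in>UNIV. A0 $ i $ j * fcoef (\<lambda>l. f l $ j) m
    + A1 $ i $ j * fcoef (\<lambda>l. f l $ j) (m - 1) + A2 $ i $ j * fcoef (\<lambda>l. f l $ j) (m - 2))"
proof -
  have f2: "f \<in> L2_circle" using f by (simp add: H_plus_def)
  define B where "B k = (if k = 0 then A0 else if k = 1 then A1 else A2)" for k :: nat
  have int: "integrable circ (\<lambda>t. cis t ^ k * (c * f (cis t) $ j))" for k j c
    using circ_cis_mult_integrable[OF L2_circle_component_integrable[OF f2], of "real k" j]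
    by (simp add: Complex.DeMoivre mult.left_commute[of _ c])
  have "fcoef (\<lambda>l. g l $ i) m = fcoef (\<lambda>l. \<Sum>j\<in>UNIV. \<Sum>k\<in>{0,1,2}. l ^ k * (B k $ i $ j * f l $ j)) m"
    by (rule fcoef_cong) (simp add: g matrix_vector_mult_def B_def sum.distrib sum_distrib_left algebra_simps)
  also have "\<dots> = (\<Sum>j\<in>UNIV. \<Sum>k\<in>{0,1,2}. fcoef (\<lambda>l. l ^ k * (B k $ i $ j * f l $ j)) m)"
    by (subst fcoef_sum) (intro Bochner_Integration.integrable_sum int sum.cong fcoef_sum refl)+
  also have "\<dots> = (\<Sum>j\<in>UNIV. A0 $ i $ j * fcoef (\<lambda>l. f l $ j) m
    + A1 $ i $ j * fcoef (\<lambda>l. f l $ j) (m - 1) + A2 $ i $ j * fcoef (\<lambda>l. f l $ j) (m - 2))"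
    by (simp only: fcoef_shift fcoef_cmult) (simp add: B_def add.assoc)
  finally show ?thesis .
qed

lemma H_plus_quadratic: "(\<lambda>l. a + l *s b + l\<^sup>2 *s c) \<in> H_plus"
proof -
  have "(\<lambda>l. \<chi> i. \<Sum>k\<le>2. l ^ k * (if k = 0 then a $ i else if k = 1 then b $ i else c $ i)) \<in> H_plus"
    by (rule H_plus_polynomial)
  moreover have "(\<lambda>l. \<chi> i. \<Sum>k\<le>2. l ^ k * (if k = 0 then a $ i else if k = 1 then b $ i else c $ i))
      = (\<lambda>l. a + l *s b + l\<^sup>2 *s c)"
    by (simp add: fun_eq_iff vec_eq_iff numeral_2_eq_2)
  ultimately show ?thesis by simp
qed

lemma normalized_loop:
  fixes \<gamma> :: "complex \<Rightarrow> complex ^ 'n ^ 'n"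
  assumes cont: "\<And>i j. continuous_on S1 (\<lambda>l. \<gamma> l $ i $ j)"
    and u: "\<And>l. l \<in> S1 \<Longrightarrow> unitary (\<gamma> l)"
    and sub1: "loop_image (\<lambda>l. mat (l\<^sup>2)) H_plus \<subseteq> loop_image \<gamma> H_plus"
    and sub2: "loop_image \<gamma> H_plus \<subseteq> H_plus"
  obtains A0 A1 A2 where
    "\<And>l. l \<in> S1 \<Longrightarrow> \<gamma> l = A0 + csmult l A1 + csmult (l\<^sup>2) A2"
    "fst ` {(a, b). (\<lambda>l. a + l *s b) \<in> loop_image \<gamma> H_plus} = range ((*v) A0)"
    "snd ` ({(a, b). (\<lambda>l. a + l *s b) \<in> loop_image \<gamma> H_plus} \<inter> ({0} \<times> UNIV)) = {b. adj A2 *v b = 0}"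
    "\<And>g. g \<in> loop_image \<gamma> H_plus \<Longrightarrow> \<exists>v. (\<chi> i. fcoef (\<lambda>l. g l $ i) 0) = A0 *v v"
proof -
  define c where "c i j k = fcoef (\<lambda>l. \<gamma> l $ i $ j) k" for i j k
  have const: "(\<lambda>l. a) \<in> H_plus" for a :: "complex ^ 'n"
    using H_plus_quadratic[of a 0 0] by simp
  have neg: "c i j k = 0" if "k < 0" for i j k
  proof -
    have "(\<lambda>l. \<gamma> l *v axis j 1) \<in> loop_image \<gamma> H_plus"
      unfolding loop_image_def using const[of "axis j 1"] by (intro CollectI bexI[where x = "\<lambda>l. axis j 1"]) auto
    then have "fcoef (\<lambda>l. (\<gamma> l *v axis j 1) $ i) k = 0"
      using sub2 H_plus_fcoef that by blast
    then show ?thesis by (simp add: c_def mv_axis)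
  qed
  have pos: "c i j k = 0" if "k > 2" for i j k
  proof -
    have "(\<lambda>l. mat (l\<^sup>2) *v axis i 1) \<in> loop_image (\<lambda>l. mat (l\<^sup>2)) H_plus"
      unfolding loop_image_def using const[of "axis i 1"] by (intro CollectI bexI[where x = "\<lambda>l. axis i 1"]) auto
    from subsetD[OF sub1 this]
    obtain h where h: "h \<in> H_plus" "\<And>l. l \<in> S1 \<Longrightarrow> mat (l\<^sup>2) *v axis i 1 = \<gamma> l *v h l"
      unfolding loop_image_def by auto
    have "h l $ j = l ^ 2 * cnj (\<gamma> l $ i $ j)" if "l \<in> S1" for l
    proof -
      have "h l = (adj (\<gamma> l) ** \<gamma> l) *v h l" using u[OF that] by (simp add: unitary_def)
      also have "\<dots> = adj (\<gamma> l) *v (mat (l\<^sup>2) *v axis i 1)"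
        using h(2)[OF that] by (simp add: matrix_vector_mul_assoc)
      also have "mat (l\<^sup>2) *v axis i 1 = l\<^sup>2 *s axis i (1 :: complex)"
        by (simp add: vec_eq_iff matrix_vector_mult_def mat_def axis_def if_distrib[of "\<lambda>x. x * _"] cong: if_cong)
      finally show ?thesis
        by (simp add: mv_scale mv_axis adj_def)
    qed
    then have "fcoef (\<lambda>l. h l $ j) (2 - k) = fcoef (\<lambda>l. l ^ 2 * cnj (\<gamma> l $ i $ j)) (2 - k)"
      by (rule fcoef_cong)
    also have "\<dots> = cnj (c i j k)" unfolding fcoef_cnj_shift c_def by simp
    finally show ?thesis using H_plus_fcoef[OF h(1), of "2 - k" j] that by simp
  qed
  define A where "A k = (\<chi> i j. c i j k)" for k
  have eq: "\<gamma> l = A 0 + csmult l (A 1) + csmult (l\<^sup>2) (A 2)" if "l \<in> S1" for l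
  proof -
    have "\<gamma> l $ i $ j = (\<Sum>k\<le>2. l ^ k * c i j (int k))" for i j
      unfolding c_def using neg pos unfolding c_def
      by (intro polynomial_loop[OF cont _ _ that]) auto
    then show ?thesis by (simp add: vec_eq_iff A_def numeral_2_eq_2)
  qed
  have lc: "l * cnj l = 1" if "l \<in> S1" for l
    using that by (simp flip: complex_norm_square)
  have adj_eq: "adj (\<gamma> l) = adj (A 0) + csmult (cnj l) (adj (A 1)) + csmult ((cnj l)\<^sup>2) (adj (A 2))" if "l \<in> S1" for l
    by (simp add: eq[OF that] adj_add adj_csmult)
  have W: "x = A 0 *v y + l *s (A 1 *v y) + l\<^sup>2 *s (A 2 *v y)"
    if "l \<in> S1" "x = \<gamma> l *v y" for x y l
    using that by (simp add: eq mv_simps)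
  have W0: "\<exists>h\<in>H_plus. (\<forall>l\<in>S1. g l = \<gamma> l *v h l) \<and> (\<chi> i. fcoef (\<lambda>l. g l $ i) 0) = A 0 *v (\<chi> i. fcoef (\<lambda>l. h l $ i) 0)"
    if "g \<in> loop_image \<gamma> H_plus" for g
  proof -
    obtain h where h: "h \<in> H_plus" "\<And>l. l \<in> S1 \<Longrightarrow> g l = \<gamma> l *v h l"
      using \<open>g \<in> loop_image \<gamma> H_plus\<close> unfolding loop_image_def by blast
    have "(\<chi> i. fcoef (\<lambda>l. g l $ i) 0) = A 0 *v (\<chi> i. fcoef (\<lambda>l. h l $ i) 0)"
    proof -
      have "g l = A 0 *v h l + l *s (A 1 *v h l) + l\<^sup>2 *s (A 2 *v h l)" if "l \<in> S1" for l
        using W[OF that h(2)[OF that]] .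
      from loop_fcoef[OF h(1) this] show ?thesis
        by (simp add: vec_eq_iff matrix_vector_mult_def H_plus_fcoef[OF h(1)])
    qed
    then show ?thesis using h by blast
  qed
  have fc_lin: "(\<chi> i. fcoef (\<lambda>l. (a + l *s b) $ i) 0) = a" for a b :: "complex ^ 'n"
  proof -
    have "fcoef (\<lambda>l. (a + l *s b) $ i) 0 = a $ i" for i
      using fcoef_polynomial[where n = 1 and c = "\<lambda>k. if k = 0 then a $ i else b $ i" and m = 0] by simp
    then show ?thesis by (simp add: vec_eq_iff)
  qed
  note ad2 = matrix_vector_mul_assoc
  show thesis
  proof (rule that[of "A 0" "A 1" "A 2"])
    show "\<exists>v. (\<chi> i. fcoef (\<lambda>l. g l $ i) 0) = A 0 *v v" if "g \<in> loop_image \<gamma> H_plus" for g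
      using W0[OF that] by blast
    show "fst ` {(a, b). (\<lambda>l. a + l *s b) \<in> loop_image \<gamma> H_plus} = range ((*v) (A 0))"
    proof (intro equalityI subsetI)
      fix a assume "a \<in> fst ` {(a, b). (\<lambda>l. a + l *s b) \<in> loop_image \<gamma> H_plus}"
      then obtain b where "(\<lambda>l. a + l *s b) \<in> loop_image \<gamma> H_plus" by auto
      from W0[OF this] show "a \<in> range ((*v) (A 0))" unfolding fc_lin by blast
    next
      fix a assume "a \<in> range ((*v) (A 0))"
      then obtain v where v: "a = A 0 *v v" by blast
      let ?w = "A 2 *v v"
      let ?h = "\<lambda>l. (v - adj (A 2) *v ?w) + l *s (- (adj (A 1) *v ?w)) + l\<^sup>2 *s (- (adj (A 0) *v ?w))"
      have "a + l *s (A 1 *v v) = \<gamma> l *v ?h l" if l: "l \<in> S1" for l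
      proof -
        have e: "l\<^sup>2 * cnj l = l" "l\<^sup>2 * (cnj l)\<^sup>2 = 1"
          using lc[OF l] by (simp_all add: power2_eq_square mult.assoc power_mult_distrib[symmetric])
            (metis mult.left_commute mult.right_neutral)
        have "?h l = v - l\<^sup>2 *s (adj (\<gamma> l) *v ?w)"
          unfolding adj_eq[OF l] by (simp add: mv_simps vec.scale_right_distrib vec.scale_right_diff_distrib e e[unfolded mult.commute[of "l\<^sup>2"]] algebra_simps vector_smult_assoc)
        then have "\<gamma> l *v ?h l = \<gamma> l *v v - l\<^sup>2 *s ((\<gamma> l ** adj (\<gamma> l)) *v ?w)"
          by (simp only: mv_simps matrix_vector_mul_assoc matrix_mul_assoc)
        also have "\<gamma> l ** adj (\<gamma> l) = mat 1" using u[OF l] by (simp add: unitary_def)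
        also have "\<gamma> l *v v - l\<^sup>2 *s (mat 1 *v ?w) = a + l *s (A 1 *v v)"
          by (simp add: eq[OF l] v mv_simps)
        finally show ?thesis by simp
      qed
      then have "(\<lambda>l. a + l *s (A 1 *v v)) \<in> loop_image \<gamma> H_plus"
        unfolding loop_image_def by (intro CollectI bexI[where x = ?h] ballI H_plus_quadratic)
      then show "a \<in> fst ` {(a, b). (\<lambda>l. a + l *s b) \<in> loop_image \<gamma> H_plus}" by force
    qed
    show "snd ` ({(a, b). (\<lambda>l. a + l *s b) \<in> loop_image \<gamma> H_plus} \<inter> ({0} \<times> UNIV)) = {b. adj (A 2) *v b = 0}"
    proof (intro equalityI subsetI)
      fix b assume "b \<in> snd ` ({(a, b). (\<lambda>l. a + l *s b) \<in> loop_image \<gamma> H_plus} \<inter> ({0} \<times> UNIV))"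
      then have "(\<lambda>l. 0 + l *s b) \<in> loop_image \<gamma> H_plus" by auto
      then obtain h where h: "h \<in> H_plus" "\<And>l. l \<in> S1 \<Longrightarrow> l *s b = \<gamma> l *v h l"
        unfolding loop_image_def by auto
      have hl: "l *s h l = adj (A 2) *v b + l *s (adj (A 1) *v b) + l\<^sup>2 *s (adj (A 0) *v b)" if l: "l \<in> S1" for l
      proof -
        have e: "l\<^sup>2 * cnj l = l" "l\<^sup>2 * (cnj l)\<^sup>2 = 1"
          using lc[OF l] by (simp_all add: power2_eq_square mult.assoc power_mult_distrib[symmetric])
            (metis mult.left_commute mult.right_neutral)
        have "h l = (adj (\<gamma> l) ** \<gamma> l) *v h l" using u[OF l] by (simp add: unitary_def)
        also have "\<dots> = l *s (adj (\<gamma> l) *v b)" using h(2)[OF l, symmetric]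
          by (simp add: matrix_vector_mul_assoc[symmetric] mv_scale)
        finally have "l *s h l = l\<^sup>2 *s (adj (\<gamma> l) *v b)"
          by (simp add: vector_smult_assoc power2_eq_square)
        also have "\<dots> = adj (A 2) *v b + l *s (adj (A 1) *v b) + l\<^sup>2 *s (adj (A 0) *v b)"
          unfolding adj_eq[OF l] by (simp add: mv_simps vec.scale_right_distrib e vector_smult_assoc)
        finally show ?thesis .
      qed
      have "(adj (A 2) *v b) $ i = 0" for i
      proof -
        have "fcoef (\<lambda>l. l ^ 1 * h l $ i) 0 = fcoef (\<lambda>l. \<Sum>k\<le>2. l ^ k *
            (if k = 0 then adj (A 2) *v b else if k = 1 then adj (A 1) *v b else adj (A 0) *v b) $ i) 0"
        proof (rule fcoef_cong)
          fix l assume "l \<in> S1"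
          from arg_cong[OF hl[OF this], of "\<lambda>v. v $ i"]
          show "l ^ 1 * h l $ i = (\<Sum>k\<le>2. l ^ k *
            (if k = 0 then adj (A 2) *v b else if k = 1 then adj (A 1) *v b else adj (A 0) *v b) $ i)"
            by (simp add: numeral_2_eq_2)
        qed
        also have "\<dots> = (adj (A 2) *v b) $ i" by (simp only: fcoef_polynomial) simp
        finally show ?thesis unfolding fcoef_shift using H_plus_fcoef[OF h(1), of "- 1" i] by simp
      qed
      then show "b \<in> {b. adj (A 2) *v b = 0}" by (simp add: vec_eq_iff)
    next
      fix b assume b: "b \<in> {b. adj (A 2) *v b = 0}"
      let ?h = "\<lambda>l. adj (A 1) *v b + l *s (adj (A 0) *v b) + l\<^sup>2 *s 0"
      have "l *s b = \<gamma> l *v ?h l" if l: "l \<in> S1" for l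
      proof -
        have "?h l = l *s (adj (\<gamma> l) *v b)"
          unfolding adj_eq[OF l] using b
          by (simp add: mv_simps vec.scale_right_distrib lc[OF l] vector_smult_assoc)
        then have "\<gamma> l *v ?h l = l *s ((\<gamma> l ** adj (\<gamma> l)) *v b)"
          by (simp only: mv_simps matrix_vector_mul_assoc matrix_mul_assoc)
        then show ?thesis using u[OF l] by (simp add: unitary_def)
      qed
      then have "\<And>l. l \<in> S1 \<Longrightarrow> 0 + l *s b = \<gamma> l *v ?h l" by simp
      then have "(\<lambda>l. 0 + l *s b) \<in> loop_image \<gamma> H_plus"
        unfolding loop_image_def by (intro CollectI bexI[where x = ?h] ballI H_plus_quadratic)
      then show "b \<in> snd ` ({(a, b). (\<lambda>l. a + l *s b) \<in> loop_image \<gamma> H_plus} \<inter> ({0} \<times> UNIV))" by force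
    qed
  qed (use eq in auto)
qed

subsection \<open>The bilinear cross product\<close>

definition crs :: "complex ^ 3 \<Rightarrow> complex ^ 3 \<Rightarrow> complex ^ 3" where
  "crs u v = vector [u $ 2 * v $ 3 - u $ 3 * v $ 2, u $ 3 * v $ 1 - u $ 1 * v $ 3, u $ 1 * v $ 2 - u $ 2 * v $ 1]"

definition vcnj :: "complex ^ 'n \<Rightarrow> complex ^ 'n" where
  "vcnj v = (\<chi> i. cnj (v $ i))"

lemma vcnj_nth [simp]: "vcnj v $ i = cnj (v $ i)" by (simp add: vcnj_def)
lemma vcnj_vcnj [simp]: "vcnj (vcnj v) = v" by (simp add: vec_eq_iff)
lemma vcnj_eq_0 [simp]: "vcnj v = 0 \<longleftrightarrow> v = 0" by (simp add: vec_eq_iff)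
lemma vcnj_scale: "vcnj (c *s v) = cnj c *s vcnj v" by (simp add: vec_eq_iff)
lemma hinner_vcnj: "hinner (vcnj u) (vcnj v) = cnj (hinner u v)"
  by (simp add: hinner_def)

lemma crs_nth [simp]:
  "crs u v $ 1 = u $ 2 * v $ 3 - u $ 3 * v $ 2"
  "crs u v $ 2 = u $ 3 * v $ 1 - u $ 1 * v $ 3"
  "crs u v $ 3 = u $ 1 * v $ 2 - u $ 2 * v $ 1"
  by (simp_all add: crs_def)

lemma hinner_3: "hinner u v = u $ 1 * cnj (v $ 1) + u $ 2 * cnj (v $ 2) + u $ 3 * cnj (v $ (3 :: 3))"
  by (simp add: hinner_def sum_3)

lemma hinner_crs_left: "hinner u (vcnj (crs u v)) = 0" and hinner_crs_right: "hinner v (vcnj (crs u v)) = 0"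
  by (simp_all add: hinner_3 algebra_simps)

lemma crs_scale: "crs (a *s u) (b *s v) = (a * b) *s crs u v"
  by (simp add: vec_eq_iff forall_3 algebra_simps)

lemma crs_zero [simp]: "crs 0 v = 0" "crs u 0 = 0" "crs u u = 0"
  by (simp_all add: vec_eq_iff forall_3)

lemma cramer_3:
  "hinner (crs f g) w *s v = hinner (crs v g) w *s f + hinner (crs f v) w *s g
    + hinner v (vcnj (crs f g)) *s vcnj w"
proof -
  have "hinner (crs f g) w * v $ i = hinner (crs v g) w * f $ i + hinner (crs f v) w * g $ i
    + hinner v (vcnj (crs f g)) * vcnj w $ i" for i
    using exhaust_3[of i] by (elim disjE) (simp_all add: hinner_3 algebra_simps)
  then show ?thesis by (simp add: vec_eq_iff)
qed

lemma crs_eq_0_iff: "crs u v = 0 \<Longrightarrow> u \<noteq> 0 \<Longrightarrow> \<exists>c. v = c *s u"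
proof -
  assume c: "crs u v = 0" and u: "u \<noteq> 0"
  have uv: "u $ i * v $ j = u $ j * v $ i" for i j
    using c exhaust_3[of i] exhaust_3[of j] by (auto simp: vec_eq_iff forall_3 mult.commute)
  obtain k where k: "u $ k \<noteq> 0" using u by (auto simp: vec_eq_iff)
  have "v $ j = (v $ k / u $ k) * u $ j" for j
    using uv[of k j] k by (simp add: field_simps)
  then have "v = (v $ k / u $ k) *s u" unfolding vec_eq_iff vector_smult_component by blast
  then show ?thesis by blast
qed

text \<open>A vector orthogonal to \<open>u\<close> and \<open>v\<close> for the Hermitian product is proportional to the
  conjugate of their cross product.\<close>

lemma crs_adj_rank_one:
  fixes A :: "complex ^ 3 ^ 3"
  assumes "A *v f = 0" "A *v g = 0" "crs f g \<noteq> 0"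
  shows "\<exists>e. A = outer e (vcnj (crs f g))"
proof -
  let ?\<nu> = "vcnj (crs f g)" and ?c = "hinner (crs f g) (crs f g)"
  have c: "?c \<noteq> 0" using assms(3) by simp
  have "?c *s (A *v v) = hinner v ?\<nu> *s (A *v ?\<nu>)" for v
  proof -
    have "?c *s (A *v v) = A *v (?c *s v)" by (simp add: mv_scale)
    also have "\<dots> = hinner v ?\<nu> *s (A *v ?\<nu>)"
      unfolding cramer_3[of f g _ v] by (simp add: mv_add mv_scale assms)
    finally show ?thesis .
  qed
  then have 1: "(1 / ?c) *s (?c *s (A *v v)) = (1 / ?c) *s (hinner v ?\<nu> *s (A *v ?\<nu>))" for v
    by (simp only:)
  have 2: "(1 / ?c) *s (?c *s x) = x" for x :: "complex ^ 3"
    using c by (simp add: vector_smult_assoc)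
  have Av: "A *v v = hinner v ?\<nu> *s ((1 / ?c) *s (A *v ?\<nu>))" for v
    using 1[of v] unfolding 2 by (simp only: vector_smult_assoc mult.commute)
  have "A = outer ((1 / ?c) *s (A *v ?\<nu>)) ?\<nu>"
  proof (rule matrix_eqI_mv)
    show "A *v v = outer ((1 / ?c) *s (A *v ?\<nu>)) ?\<nu> *v v" for v
      unfolding outer_mv by (rule Av)
  qed
  then show ?thesis by blast
qed

subsection \<open>Wirtinger derivatives of vectors and matrices\<close>

definition wdV :: "(complex \<Rightarrow> complex ^ 'n) \<Rightarrow> complex ^ 'n \<Rightarrow> complex ^ 'n \<Rightarrow> complex \<Rightarrow> bool" where
  "wdV F a b z \<longleftrightarrow> (\<forall>i. wd (\<lambda>w. F w $ i) (a $ i) (b $ i) z)"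

definition wdM :: "(complex \<Rightarrow> complex ^ 'n ^ 'm) \<Rightarrow> complex ^ 'n ^ 'm \<Rightarrow> complex ^ 'n ^ 'm \<Rightarrow> complex \<Rightarrow> bool" where
  "wdM F a b z \<longleftrightarrow> (\<forall>i j. wd (\<lambda>w. F w $ i $ j) (a $ i $ j) (b $ i $ j) z)"

lemma wdV_unique: "wdV F a b z \<Longrightarrow> wdV F c d z \<Longrightarrow> a = c \<and> b = d"
  unfolding wdV_def vec_eq_iff using wd_unique by blast
lemma wdM_unique: "wdM F a b z \<Longrightarrow> wdM F c d z \<Longrightarrow> a = c \<and> b = d"
  unfolding wdM_def vec_eq_iff using wd_unique by blast
lemma wdV_const: "wdV (\<lambda>w. c) 0 0 z" by (simp add: wdV_def wd_const)
lemma wdM_const: "wdM (\<lambda>w. c) 0 0 z" by (simp add: wdM_def wd_const)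
lemma wdV_add: "wdV F a b z \<Longrightarrow> wdV G c d z \<Longrightarrow> wdV (\<lambda>w. F w + G w) (a + c) (b + d) z"
  by (simp add: wdV_def wd_add)
lemma wdM_add: "wdM F a b z \<Longrightarrow> wdM G c d z \<Longrightarrow> wdM (\<lambda>w. F w + G w) (a + c) (b + d) z"
  by (simp add: wdM_def wd_add)
lemma wdM_diff: "wdM F a b z \<Longrightarrow> wdM G c d z \<Longrightarrow> wdM (\<lambda>w. F w - G w) (a - c) (b - d) z"
  by (simp add: wdM_def wd_diff)
lemma wdM_csmult: "wd h a b z \<Longrightarrow> wdM F c d z \<Longrightarrow>
    wdM (\<lambda>w. csmult (h w) (F w)) (csmult a (F z) + csmult (h z) c) (csmult b (F z) + csmult (h z) d) z"
  unfolding wdM_def by (auto intro!: wd_mult)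
lemma wdV_scale: "wd h a b z \<Longrightarrow> wdV F c d z \<Longrightarrow>
    wdV (\<lambda>w. h w *s F w) (a *s F z + h z *s c) (b *s F z + h z *s d) z"
  unfolding wdV_def by (auto intro!: wd_mult)
lemma wdM_adj: "wdM F a b z \<Longrightarrow> wdM (\<lambda>w. adj (F w)) (adj b) (adj a) z"
  by (simp add: wdM_def adj_def wd_cnj)
lemma wdV_vcnj: "wdV F a b z \<Longrightarrow> wdV (\<lambda>w. vcnj (F w)) (vcnj b) (vcnj a) z"
  by (simp add: wdV_def wd_cnj)
lemma wdV_mv: "wdM F a b z \<Longrightarrow> wdV u c d z \<Longrightarrow>
    wdV (\<lambda>w. F w *v u w) (a *v u z + F z *v c) (b *v u z + F z *v d) z"
  unfolding wdM_def wdV_def matrix_vector_mult_def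
  by (auto simp: sum.distrib[symmetric] intro!: wd_sum wd_mult)
lemma wdM_mm: "wdM F a b z \<Longrightarrow> wdM G c d z \<Longrightarrow>
    wdM (\<lambda>w. F w ** G w) (a ** G z + F z ** c) (b ** G z + F z ** d) z"
  unfolding wdM_def matrix_matrix_mult_def
  by (auto simp: sum.distrib[symmetric] intro!: wd_sum wd_mult)
lemma wd_hinner: "wdV u a b z \<Longrightarrow> wdV v c d z \<Longrightarrow>
    wd (\<lambda>w. hinner (u w) (v w)) (hinner a (v z) + hinner (u z) d) (hinner b (v z) + hinner (u z) c) z"
  unfolding wdV_def hinner_def
  by (auto simp: sum.distrib[symmetric] intro!: wd_sum wd_mult wd_cnj)
lemma wdM_outer: "wdV u a b z \<Longrightarrow> wdV v c d z \<Longrightarrow>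
    wdM (\<lambda>w. outer (u w) (v w)) (outer a (v z) + outer (u z) d) (outer b (v z) + outer (u z) c) z"
  unfolding wdV_def wdM_def outer_def
  by (auto intro!: wd_mult wd_cnj)
lemma wdM_cong_ev: "wdM F a b z \<Longrightarrow> \<forall>\<^sub>F w in nhds z. F w = G w \<Longrightarrow> wdM G a b z"
  unfolding wdM_def by (intro allI, rule wd_cong_ev, blast, erule eventually_mono, simp)
lemma wdV_cong_ev: "wdV F a b z \<Longrightarrow> \<forall>\<^sub>F w in nhds z. F w = G w \<Longrightarrow> wdV G a b z"
  unfolding wdV_def by (intro allI, rule wd_cong_ev, blast, erule eventually_mono, simp)

lemma wdM_differentiable:
  fixes f :: "complex \<Rightarrow> complex ^ 'n ^ 'm"
  assumes "f differentiable (at z)" shows "wdM f (dz f z) (dzbar f z) z"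
proof -
  have D: "(f has_derivative frechet_derivative f (at z)) (at z)"
    using assms frechet_derivative_works by blast
  have "wd (\<lambda>w. f w $ i $ j) (dz f z $ i $ j) (dzbar f z $ i $ j) z" for i j
  proof -
    have c: "((\<lambda>w. f w $ i $ j) has_derivative (\<lambda>h. frechet_derivative f (at z) h $ i $ j)) (at z)"
      by (intro bounded_linear.has_derivative[OF bounded_linear_vec_nth] D)
    then have "(\<lambda>w. f w $ i $ j) differentiable (at z)" by (auto simp: differentiable_def)
    moreover have "pd v (\<lambda>w. f w $ i $ j) z = pd v f z $ i $ j" for v
      unfolding pd_def frechet_derivative_at[OF c, symmetric] ..
    ultimately show ?thesis
      using wd_differentiable[of "\<lambda>w. f w $ i $ j" z] by (simp add: dz_def dzbar_def)
  qed
  then show ?thesis by (simp add: wdM_def)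
qed

lemma wdM_dz: "wdM f a b z \<Longrightarrow> dz f z = a \<and> dzbar f z = b"
proof -
  assume w: "wdM f a b z"
  have "((\<lambda>w. f w) has_derivative (\<lambda>h. \<chi> i. \<chi> j. a $ i $ j * h + b $ i $ j * cnj h)) (at z)"
  proof -
    have 1: "((\<lambda>w. f w $ i $ j) has_derivative (\<lambda>h. a $ i $ j * h + b $ i $ j * cnj h)) (at z)" for i j
      using w by (simp add: wdM_def wd_def)
    have vec: "((\<lambda>w. g w) has_derivative (\<lambda>h. \<chi> i. D i h)) (at z)"
      if "\<And>i. ((\<lambda>w. g w $ i) has_derivative D i) (at z)"
      for g :: "complex \<Rightarrow> 'x::euclidean_space ^ 'y" and D
      by (subst has_derivative_componentwise_within[where S = UNIV])
        (auto simp: Basis_vec_def inner_axis intro!: has_derivative_inner_left that)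
    show ?thesis by (intro vec 1)
  qed
  then have "f differentiable (at z)" by (auto simp: differentiable_def)
  from wdM_unique[OF wdM_differentiable[OF this] w] show ?thesis .
qed

subsection \<open>Hermitian squares of polynomial vectors\<close>

definition hs :: "('i::finite \<Rightarrow> complex poly) \<Rightarrow> ('i \<Rightarrow> complex poly) \<Rightarrow> complex \<Rightarrow> complex" where
  "hs P R z = (\<Sum>i\<in>UNIV. poly (P i) z * cnj (poly (R i) z))"

definition dv :: "('i \<Rightarrow> complex poly) \<Rightarrow> 'i \<Rightarrow> complex poly" where
  "dv P i = pderiv (P i)"

definition wedge :: "('i \<Rightarrow> complex poly) \<Rightarrow> 'i \<times> 'i \<Rightarrow> complex poly" where
  "wedge P = (\<lambda>(i, j). P i * pderiv (P j) - P j * pderiv (P i))"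

lemma wd_hs: "wd (hs P R) (hs (dv P) R z) (hs P (dv R) z) z"
proof -
  have "wd (\<lambda>z. \<Sum>i\<in>UNIV. poly (P i) z * cnj (poly (R i) z))
      (\<Sum>i\<in>UNIV. poly (pderiv (P i)) z * cnj (poly (R i) z) + poly (P i) z * cnj 0)
      (\<Sum>i\<in>UNIV. 0 * cnj (poly (R i) z) + poly (P i) z * cnj (poly (pderiv (R i)) z)) z"
    by (intro wd_sum wd_mult wd_cnj wd_poly)
  then show ?thesis by (simp add: hs_def[abs_def] dv_def)
qed

lemma cnj_hs: "cnj (hs P R z) = hs R P z"
  by (simp add: hs_def mult.commute)

lemma hs_self: "hs P P z = complex_of_real (\<Sum>i\<in>UNIV. (norm (poly (P i) z))\<^sup>2)"
  by (simp add: hs_def complex_norm_square[symmetric])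

lemma hs_self_Re: "hs P P z = complex_of_real (Re (hs P P z))"
  by (simp add: hs_self)

lemma hs_self_nonneg: "Re (hs P P z) \<ge> 0"
  by (simp add: hs_self sum_nonneg)

lemma hs_self_pos: "hs P P z \<noteq> 0 \<Longrightarrow> Re (hs P P z) > 0"
  using hs_self_nonneg[of P z] hs_self_Re[of P z] by (metis less_eq_real_def of_real_0)

lemma hs_wedge:
  "hs (wedge P) (wedge P) z = 2 * (hs P P z * hs (dv P) (dv P) z - hs (dv P) P z * hs P (dv P) z)"
proof -
  define p where "p i = poly (P i) z" for i
  define d where "d i = poly (pderiv (P i)) z" for i
  have "hs (wedge P) (wedge P) z = (\<Sum>i\<in>UNIV. \<Sum>j\<in>UNIV. (p i * d j - p j * d i) * cnj (p i * d j - p j * d i))"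
    by (simp add: hs_def wedge_def p_def d_def sum.cartesian_product split_def)
  also have "\<dots> = (\<Sum>i\<in>UNIV. \<Sum>j\<in>UNIV. (p i * cnj (p i)) * (d j * cnj (d j)))
     + (\<Sum>i\<in>UNIV. \<Sum>j\<in>UNIV. (d i * cnj (d i)) * (p j * cnj (p j)))
     - (\<Sum>i\<in>UNIV. \<Sum>j\<in>UNIV. (p i * cnj (d i)) * (d j * cnj (p j)))
     - (\<Sum>i\<in>UNIV. \<Sum>j\<in>UNIV. (d i * cnj (p i)) * (p j * cnj (d j)))"
    by (simp add: sum.distrib[symmetric] sum_subtractf[symmetric] algebra_simps)
  also have "\<dots> = 2 * (hs P P z * hs (dv P) (dv P) z - hs (dv P) P z * hs P (dv P) z)"
    by (simp add: sum_product[symmetric] hs_def dv_def p_def d_def)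
  finally show ?thesis .
qed

lemma poly_over_power_tendsto:
  fixes p :: "complex poly"
  assumes "degree p \<le> n"
  shows "((\<lambda>z. poly p z / z ^ n) \<longlongrightarrow> coeff p n) at_infinity"
proof -
  have "((\<lambda>z. \<Sum>i\<le>n. coeff p i * inverse z ^ (n - i)) \<longlongrightarrow> (\<Sum>i\<le>n. coeff p i * 0 ^ (n - i))) at_infinity"
    by (intro tendsto_intros tendsto_inverse_0)
  moreover have "(\<Sum>i\<le>n. coeff p i * 0 ^ (n - i)) = coeff p n"
  proof -
    have "(\<Sum>i\<le>n. coeff p i * 0 ^ (n - i)) = (\<Sum>i\<le>n. if i = n then coeff p i else 0)"
      by (rule sum.cong) (auto simp: power_0_left)
    then show ?thesis by simp
  qed
  moreover have "\<forall>\<^sub>F z in at_infinity. (\<Sum>i\<le>n. coeff p i * inverse z ^ (n - i)) = poly p z / z ^ n"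
  proof -
    have "\<forall>\<^sub>F z :: complex in at_infinity. z \<noteq> 0"
      by (auto simp: eventually_at_infinity intro: exI[of _ 1])
    then show ?thesis
    proof eventually_elim
      case (elim z)
      have "poly p z = (\<Sum>i\<le>n. coeff p i * z ^ i)"
        unfolding poly_altdef using assms by (intro sum.mono_neutral_left) (auto simp: coeff_eq_0)
      moreover have "z ^ i / z ^ n = inverse z ^ (n - i)" if "i \<le> n" for i
        using elim that by (simp add: power_diff field_simps power_inverse)
      ultimately show ?case by (simp add: sum_divide_distrib times_divide_eq_right[symmetric] del: times_divide_eq_right)
    qed
  qed
  ultimately show ?thesis by - (drule (1) Lim_transform_eventually, simp)
qed

lemma pderiv_over_power_tendsto:
  fixes p :: "complex poly"
  assumes "degree p \<le> n"
  shows "((\<lambda>z. z * poly (pderiv p) z / z ^ n) \<longlongrightarrow> of_nat n * coeff p n) at_infinity"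
proof -
  have "degree ([:0, 1:] * pderiv p) \<le> n"
  proof (cases "degree p = 0")
    case True
    then have "pderiv p = 0" by (simp add: pderiv_eq_0_iff)
    then show ?thesis by simp
  next
    case False
    then show ?thesis
      using assms degree_mult_le[of "[:0, 1:]" "pderiv p"] by (simp add: degree_pderiv)
  qed
  moreover have "coeff ([:0, 1:] * pderiv p) n = of_nat n * coeff p n"
    by (cases n) (simp_all add: coeff_pderiv coeff_pCons)
  ultimately show ?thesis using poly_over_power_tendsto[of "[:0, 1:] * pderiv p" n] by simp
qed

lemma hs_log_derivative_tendsto:
  assumes deg: "\<And>i. degree (P i) \<le> n" and lead: "coeff (P i0) n \<noteq> 0"
  shows "((\<lambda>z. z * (hs (dv P) P z / hs P P z)) \<longlongrightarrow> of_nat n) at_infinity"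
    and "((\<lambda>z. hs P P z / (z ^ n * cnj z ^ n)) \<longlongrightarrow> (\<Sum>i\<in>UNIV. coeff (P i) n * cnj (coeff (P i) n))) at_infinity"
    and "(\<Sum>i\<in>UNIV. coeff (P i) n * cnj (coeff (P i) n)) \<noteq> 0"
proof -
  let ?c = "\<Sum>i\<in>UNIV. coeff (P i) n * cnj (coeff (P i) n)"
  have c: "?c = complex_of_real (\<Sum>i\<in>UNIV. (norm (coeff (P i) n))\<^sup>2)"
    by (simp add: complex_norm_square[symmetric])
  have "(\<Sum>i\<in>UNIV. (norm (coeff (P i) n))\<^sup>2) > 0"
    using lead by (intro sum_pos2[of _ i0]) auto
  then show c0: "?c \<noteq> 0" unfolding c of_real_eq_0_iff by (metis less_irrefl)
  have "((\<lambda>z. \<Sum>i\<in>UNIV. poly (P i) z / z ^ n * cnj (poly (P i) z / z ^ n)) \<longlongrightarrow> ?c) at_infinity"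
    by (intro tendsto_intros poly_over_power_tendsto deg)
  then show 1: "((\<lambda>z. hs P P z / (z ^ n * cnj z ^ n)) \<longlongrightarrow> ?c) at_infinity"
    by (simp add: hs_def sum_divide_distrib)
  have "((\<lambda>z. \<Sum>i\<in>UNIV. z * poly (pderiv (P i)) z / z ^ n * cnj (poly (P i) z / z ^ n))
      \<longlongrightarrow> (\<Sum>i\<in>UNIV. of_nat n * coeff (P i) n * cnj (coeff (P i) n))) at_infinity"
    by (intro tendsto_intros poly_over_power_tendsto pderiv_over_power_tendsto deg)
  then have 2: "((\<lambda>z. z * hs (dv P) P z / (z ^ n * cnj z ^ n)) \<longlongrightarrow> of_nat n * ?c) at_infinity"
    by (simp add: hs_def dv_def sum_divide_distrib sum_distrib_left mult.assoc)
  have "((\<lambda>z. (z * hs (dv P) P z / (z ^ n * cnj z ^ n)) / (hs P P z / (z ^ n * cnj z ^ n))) \<longlongrightarrow> of_nat n * ?c / ?c) at_infinity"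
    by (intro tendsto_divide 1 2 c0)
  moreover have "\<forall>\<^sub>F z in at_infinity. (z * hs (dv P) P z / (z ^ n * cnj z ^ n)) / (hs P P z / (z ^ n * cnj z ^ n))
      = z * (hs (dv P) P z / hs P P z)"
  proof -
    have "\<forall>\<^sub>F z :: complex in at_infinity. z \<noteq> 0"
      by (auto simp: eventually_at_infinity intro: exI[of _ 1])
    then show ?thesis by eventually_elim simp
  qed
  ultimately show "((\<lambda>z. z * (hs (dv P) P z / hs P P z)) \<longlongrightarrow> of_nat n) at_infinity"
    using c0 by - (drule (1) Lim_transform_eventually, simp)
qed

lemma wd_log_derivative:
  assumes "hs P P z \<noteq> 0"
  shows "wd (\<lambda>z. hs (dv P) P z / hs P P z)
    (hs (dv (dv P)) P z / hs P P z - (hs (dv P) P z / hs P P z)\<^sup>2)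
    (hs (wedge P) (wedge P) z / (2 * (hs P P z)\<^sup>2)) z"
proof (rule wd_eqI[OF wd_divide[OF wd_hs wd_hs assms]])
  let ?N = "hs P P z" and ?X = "hs (dv P) (dv P) z" and ?Y = "hs (dv P) P z * hs P (dv P) z"
  show "hs (dv (dv P)) P z / ?N - hs (dv P) P z * hs (dv P) P z / ?N\<^sup>2
      = hs (dv (dv P)) P z / ?N - (hs (dv P) P z / ?N)\<^sup>2"
    by (simp add: power2_eq_square)
  have "?N * ?X / ?N\<^sup>2 = ?X / ?N" using assms by (simp add: power2_eq_square)
  then show "?X / ?N - ?Y / ?N\<^sup>2 = hs (wedge P) (wedge P) z / (2 * ?N\<^sup>2)"
    unfolding hs_wedge by (simp add: diff_divide_distrib)
qed

lemma real_derivative_ln_hs: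
  assumes "hs P P z \<noteq> 0"
  shows "((\<lambda>w. ln (Re (hs P P w))) has_derivative (\<lambda>h. Re (2 * (hs (dv P) P z / hs P P z) * h))) (at z)"
proof -
  have "(hs P P has_derivative (\<lambda>h. hs (dv P) P z * h + hs P (dv P) z * cnj h)) (at z)"
    using wd_hs[of P P z] by (simp add: wd_def)
  then have "((\<lambda>w. Re (hs P P w)) has_derivative (\<lambda>h. Re (hs (dv P) P z * h + hs P (dv P) z * cnj h))) (at z)"
    by (rule has_derivative_Re)
  then have "((\<lambda>w. ln (Re (hs P P w))) has_derivative
     (\<lambda>h. Re (hs (dv P) P z * h + hs P (dv P) z * cnj h) * inverse (Re (hs P P z)))) (at z)"
    using has_derivative_ln[of "\<lambda>w. Re (hs P P w)"] hs_self_pos[OF assms]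
    by (auto simp: field_simps)
  moreover have "Re (hs (dv P) P z * h + hs P (dv P) z * cnj h) * inverse (Re (hs P P z))
      = Re (2 * (hs (dv P) P z / hs P P z) * h)" for h
  proof -
    have "hs P (dv P) z * cnj h = cnj (hs (dv P) P z * h)" by (simp add: cnj_hs)
    moreover have "Re (X + cnj X) = 2 * Re X" for X by simp
    ultimately have "Re (hs (dv P) P z * h + hs P (dv P) z * cnj h) = 2 * Re (hs (dv P) P z * h)" by metis
    moreover have "Re (2 * (hs (dv P) P z / hs P P z) * h) = 2 * (Re (hs (dv P) P z * h) / Re (hs P P z))"
    proof -
      have "2 * (hs (dv P) P z / hs P P z) * h = 2 * (hs (dv P) P z * h / complex_of_real (Re (hs P P z)))"
        using hs_self_Re[of P z] by simp
      moreover have "Re (2 * w) = 2 * Re w" for w by simp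
      ultimately show ?thesis by (simp only: Re_divide_of_real)
    qed
    moreover have "2 * x * inverse y = 2 * (x / y)" for x y :: real by (simp add: field_simps)
    ultimately show ?thesis by metis
  qed
  ultimately show ?thesis by simp
qed

lemma laplacian_eq:
  assumes f: "\<And>w. (f has_derivative (\<lambda>h. Re (2 * a w * h))) (at w)" and a: "wd a a1 a2 z"
  shows "laplacian f z = 4 * Re a2"
proof -
  have pd: "pd v f = (\<lambda>w. Re (2 * a w * v))" for v
    unfolding pd_def by (simp only: frechet_derivative_at[OF f, symmetric])
  have "(a has_derivative (\<lambda>h. a1 * h + a2 * cnj h)) (at z)" using a by (simp add: wd_def)
  then have "((\<lambda>w. Re (2 * a w * v)) has_derivative (\<lambda>h. Re (2 * (a1 * h + a2 * cnj h) * v))) (at z)" for v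
    by (intro has_derivative_Re has_derivative_mult_left has_derivative_mult_right)
  from frechet_derivative_at[OF this, symmetric]
  have pd2: "pd v (pd v f) z = Re (2 * (a1 * v + a2 * cnj v) * v)" for v
    unfolding pd by (simp only: pd_def)
  show ?thesis unfolding laplacian_def pd2 by simp
qed

lemma coeff_mult_degree_le:
  assumes "degree p \<le> a" "degree q \<le> b"
  shows "coeff (p * q) (a + b) = coeff p a * coeff q b"
proof -
  have "coeff (p * q) (a + b) = (\<Sum>i\<le>a + b. coeff p i * coeff q (a + b - i))"
    by (rule coeff_mult)
  also have "\<dots> = (\<Sum>i\<le>a + b. if i = a then coeff p a * coeff q b else 0)"
  proof (rule sum.cong)
    fix i assume "i \<in> {..a + b}"
    show "coeff p i * coeff q (a + b - i) = (if i = a then coeff p a * coeff q b else 0)"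
    proof (cases i a rule: linorder_cases)
      case less
      then have "degree q < a + b - i" using assms(2) by simp
      then show ?thesis using less by (simp add: coeff_eq_0)
    next
      case greater
      then have "degree p < i" using assms(1) by simp
      then show ?thesis using greater by (simp add: coeff_eq_0)
    qed simp
  qed simp
  finally show ?thesis by simp
qed

subsection \<open>Metrics of constant curvature\<close>

theorem constant_curvature_hermitian_square:
  fixes P :: "'i::finite \<Rightarrow> complex poly"
  assumes N0: "\<And>z. hs P P z \<noteq> 0" and M0: "\<And>z. hs (wedge P) (wedge P) z \<noteq> 0"
    and deg: "\<And>i. degree (P i) \<le> n" and lead: "coeff (P i0) n \<noteq> 0"
    and growth: "\<epsilon> > 0" "\<And>z. norm z \<ge> R \<Longrightarrow>
        \<epsilon> * (Re (hs P P z))\<^sup>2 \<le> Re (hs (wedge P) (wedge P) z) * norm z ^ 4"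
    and curv: "\<And>z. laplacian (\<lambda>w. ln (Re (hs (wedge P) (wedge P) w) / (2 * (Re (hs P P w))\<^sup>2))) z
        = - 2 * K * (Re (hs (wedge P) (wedge P) z) / (2 * (Re (hs P P z))\<^sup>2))"
  shows "\<exists>v0 \<beta> c. n \<ge> 1 \<and> c > 0 \<and> (norm \<beta>)\<^sup>2 < v0 * c \<and>
    (\<forall>z. Re (hs P P z) = (v0 + 2 * Re (\<beta> * z) + c * (norm z)\<^sup>2) ^ n)"
proof -
  define N where "N = hs P P"
  define M where "M = hs (wedge P) (wedge P)"
  define G where "G z = hs (dv P) P z / hs P P z" for z
  define H where "H z = hs (dv (wedge P)) (wedge P) z / hs (wedge P) (wedge P) z" for z
  define \<rho> where "\<rho> z = M z / (2 * (N z)\<^sup>2)" for z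
  define \<sigma> where "\<sigma> z = hs (wedge (wedge P)) (wedge (wedge P)) z / (2 * (M z)\<^sup>2)" for z
  define G1 where "G1 z = hs (dv (dv P)) P z / hs P P z - (G z)\<^sup>2" for z
  have wdG: "wd G (G1 z) (\<rho> z) z" for z
    using wd_log_derivative[OF N0, of z] unfolding G_def[abs_def] G1_def \<rho>_def N_def M_def .
  have wdH: "wd H (hs (dv (dv (wedge P))) (wedge P) z / M z - (H z)\<^sup>2) (\<sigma> z) z" for z
    using wd_log_derivative[OF M0, of z] unfolding H_def[abs_def] \<sigma>_def M_def .
  have \<rho>r: "\<rho> z = complex_of_real (Re (M z) / (2 * (Re (N z))\<^sup>2))" for z
    unfolding \<rho>_def M_def N_def by (subst (1) hs_self_Re, subst (2) hs_self_Re) simp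
  have \<rho>pos: "Re (\<rho> z) > 0" and \<rho>real: "\<rho> z = complex_of_real (Re (\<rho> z))" for z
    using hs_self_pos[OF N0[of z]] hs_self_pos[OF M0[of z]]
    by (simp_all add: \<rho>r M_def N_def)
  have \<sigma>real: "\<sigma> z = complex_of_real (Re (\<sigma> z))" for z
  proof -
    have "\<sigma> z = complex_of_real (Re (hs (wedge (wedge P)) (wedge (wedge P)) z) / (2 * (Re (M z))\<^sup>2))"
      unfolding \<sigma>_def M_def by (subst (1) hs_self_Re, subst (2) hs_self_Re) simp
    then show ?thesis by simp
  qed
  define b where "b = 2 - K / 2"
  have \<sigma>\<rho>: "\<sigma> z = of_real b * \<rho> z" for z
  proof -
    define f where "f w = ln (Re (M w) / (2 * (Re (N w))\<^sup>2))" for w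
    have f: "f w = ln (Re (hs (wedge P) (wedge P) w)) - 2 * ln (Re (hs P P w)) - ln 2" for w
      using hs_self_pos[OF N0[of w]] hs_self_pos[OF M0[of w]]
      by (simp add: f_def M_def N_def ln_div ln_mult ln_realpow)
    have "(f has_derivative (\<lambda>h. Re (2 * (H w - 2 * G w) * h))) (at w)" for w
    proof -
      have "((\<lambda>w. ln (Re (hs (wedge P) (wedge P) w)) - 2 * ln (Re (hs P P w)) - ln 2) has_derivative
        (\<lambda>h. Re (2 * H w * h) - 2 * Re (2 * G w * h) - 0)) (at w)"
        unfolding H_def G_def
        by (intro has_derivative_diff has_derivative_mult_right has_derivative_const real_derivative_ln_hs N0 M0)
      moreover have "(\<lambda>h. Re (2 * H w * h) - 2 * Re (2 * G w * h) - 0) = (\<lambda>h. Re (2 * (H w - 2 * G w) * h))"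
        by (auto simp: algebra_simps)
      ultimately show ?thesis unfolding f[abs_def] by simp
    qed
    moreover have "wd (\<lambda>w. H w - 2 * G w) (hs (dv (dv (wedge P))) (wedge P) z / M z - (H z)\<^sup>2 - (0 * G z + 2 * G1 z))
        (\<sigma> z - (0 * G z + 2 * \<rho> z)) z"
      by (intro wd_diff wd_mult wd_const wdG wdH)
    ultimately have "laplacian f z = 4 * Re (\<sigma> z - (0 * G z + 2 * \<rho> z))" by (rule laplacian_eq)
    moreover have "laplacian f z = - 2 * K * Re (\<rho> z)"
      using curv[of z] \<rho>r[of z] unfolding f_def[abs_def] M_def N_def by simp
    ultimately have "Re (\<sigma> z) = b * Re (\<rho> z)" by (simp add: b_def algebra_simps)
    then show ?thesis using \<rho>real[of z] \<sigma>real[of z] by (metis of_real_mult)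
  qed
  have n1: "n \<ge> 1"
  proof (rule ccontr)
    assume "\<not> n \<ge> 1"
    then have "pderiv (P i) = 0" for i using deg[of i] by (simp add: pderiv_eq_0_iff)
    then have "hs (wedge P) (wedge P) 0 = 0" by (simp add: hs_def wedge_def)
    then show False using M0 by blast
  qed
  define m where "m = 2 * n - 2"
  have wdeg: "degree (wedge P x) \<le> m" for x
  proof -
    obtain i j where x: "x = (i, j)" by (cases x)
    have d: "degree (P i) \<le> n" "degree (P j) \<le> n" "degree (pderiv (P i)) \<le> n - 1" "degree (pderiv (P j)) \<le> n - 1"
      using deg[of i] deg[of j] by (auto simp: degree_pderiv)
    have "degree (P i * pderiv (P j)) \<le> 2 * n - 1" "degree (P j * pderiv (P i)) \<le> 2 * n - 1"
      using degree_mult_le[of "P i" "pderiv (P j)"] degree_mult_le[of "P j" "pderiv (P i)"] d n1 by linarith+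
    then have le: "degree (wedge P x) \<le> 2 * n - 1" by (simp add: x wedge_def degree_diff_le)
    have cm: "coeff (p * q) (n + (n - 1)) = coeff p n * coeff q (n - 1)" if "degree p \<le> n" "degree q \<le> n - 1"
      for p q :: "complex poly"
      using that by (rule coeff_mult_degree_le)
    have "coeff (wedge P x) (n + (n - 1))
        = coeff (P i) n * coeff (pderiv (P j)) (n - 1) - coeff (P j) n * coeff (pderiv (P i)) (n - 1)"
      by (simp only: x wedge_def split coeff_diff cm[OF d(1,4)] cm[OF d(2,3)])
    also have "\<dots> = 0" using n1 by (simp add: coeff_pderiv)
    finally have "coeff (wedge P x) (n + (n - 1)) = 0" .
    moreover have "n + (n - 1) = 2 * n - 1" using n1 by simp
    ultimately have top: "coeff (wedge P x) (2 * n - 1) = 0" by simp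
    show ?thesis
    proof (rule degree_le, intro allI impI)
      fix i assume "m < i"
      then have "i = 2 * n - 1 \<or> i > degree (wedge P x)" using le n1 unfolding m_def by linarith
      then show "coeff (wedge P x) i = 0" using top coeff_eq_0 by blast
    qed
  qed
  obtain x0 where x0: "coeff (wedge P x0) m \<noteq> 0"
  proof (rule ccontr)
    assume "\<not> thesis"
    then have c0: "coeff (wedge P x) m = 0" for x using that by blast
    have "((\<lambda>z. \<Sum>x\<in>UNIV. poly (wedge P x) z / z ^ m * cnj (poly (wedge P x) z / z ^ m)) \<longlongrightarrow>
        (\<Sum>x\<in>UNIV. coeff (wedge P x) m * cnj (coeff (wedge P x) m))) at_infinity"
      by (intro tendsto_intros poly_over_power_tendsto wdeg)
    then have 1: "((\<lambda>z. M z / (z ^ m * cnj z ^ m)) \<longlongrightarrow> 0) at_infinity"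
      by (simp add: M_def hs_def sum_divide_distrib c0)
    have 2: "((\<lambda>z. N z / (z ^ n * cnj z ^ n)) \<longlongrightarrow> (\<Sum>i\<in>UNIV. coeff (P i) n * cnj (coeff (P i) n))) at_infinity"
      unfolding N_def by (rule hs_log_derivative_tendsto(2)[of P n i0, OF deg lead])
    let ?c = "\<Sum>i\<in>UNIV. coeff (P i) n * cnj (coeff (P i) n)"
    have c: "?c \<noteq> 0" by (rule hs_log_derivative_tendsto(3)[of P n i0, OF deg lead])
    have "((\<lambda>z. (M z / (z ^ m * cnj z ^ m)) / (N z / (z ^ n * cnj z ^ n))\<^sup>2) \<longlongrightarrow> 0 / ?c\<^sup>2) at_infinity"
      using c by (intro tendsto_intros 1 2) auto
    then have "((\<lambda>z. norm ((M z / (z ^ m * cnj z ^ m)) / (N z / (z ^ n * cnj z ^ n))\<^sup>2)) \<longlongrightarrow> 0) at_infinity"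
      using tendsto_norm_zero by fastforce
    then have "\<forall>\<^sub>F z in at_infinity. norm ((M z / (z ^ m * cnj z ^ m)) / (N z / (z ^ n * cnj z ^ n))\<^sup>2) < \<epsilon>"
      using growth(1) by (rule order_tendstoD)
    moreover have "\<forall>\<^sub>F z :: complex in at_infinity. norm z \<ge> max R 1"
      unfolding eventually_at_infinity by blast
    ultimately have "\<forall>\<^sub>F z :: complex in at_infinity. False"
    proof eventually_elim
      case (elim z)
      then have z: "z \<noteq> 0" "norm z \<ge> R" by auto
      have nn: "norm (N z) = Re (N z)" "norm (M z) = Re (M z)" "Re (N z) > 0"
        using hs_self_pos[OF N0[of z]] hs_self_pos[OF M0[of z]] hs_self_Re[of P z] hs_self_Re[of "wedge P" z]
        unfolding N_def M_def by (metis abs_of_pos norm_of_real)+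
      have mn: "m + 2 = 2 * n" using n1 by (simp add: m_def)
      have zz: "norm z ^ m * norm z ^ m * norm z ^ 4 = (norm z ^ n * norm z ^ n)\<^sup>2"
      proof -
        have "norm z ^ m * norm z ^ m * norm z ^ 4 = (norm z ^ (m + 2))\<^sup>2"
          by (simp add: power_add power2_eq_square power4_eq_xxxx)
        also have "\<dots> = (norm z ^ n * norm z ^ n)\<^sup>2" unfolding mn by (simp add: mult_2 power_add)
        finally show ?thesis .
      qed
      have "Re (M z) * norm z ^ 4 < \<epsilon> * (Re (N z))\<^sup>2"
      proof -
        have "norm ((M z / (z ^ m * cnj z ^ m)) / (N z / (z ^ n * cnj z ^ n))\<^sup>2)
            = Re (M z) * (norm z ^ n * norm z ^ n)\<^sup>2 / (norm z ^ m * norm z ^ m * (Re (N z))\<^sup>2)"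
          by (simp add: norm_divide norm_mult norm_power nn field_simps)
        also have "\<dots> = Re (M z) * norm z ^ 4 / (Re (N z))\<^sup>2"
          unfolding zz[symmetric] using z by simp
        finally have q: "norm ((M z / (z ^ m * cnj z ^ m)) / (N z / (z ^ n * cnj z ^ n))\<^sup>2)
            = Re (M z) * norm z ^ 4 / (Re (N z))\<^sup>2" .
        have "Re (M z) * norm z ^ 4 / (Re (N z))\<^sup>2 < \<epsilon>" using elim(1) unfolding q .
        then show ?thesis using nn(3) by (simp add: pos_divide_less_eq)
      qed
      then show ?case using growth(2)[OF z(2)] unfolding M_def N_def by simp
    qed
    then show False using eventually_False trivial_limit_at_infinity by blast
  qed
  have limG: "((\<lambda>z. z * G z) \<longlongrightarrow> of_nat n) at_infinity"
    unfolding G_def by (rule hs_log_derivative_tendsto(1)[of P n i0, OF deg lead])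
  have limH: "((\<lambda>z. z * H z) \<longlongrightarrow> of_nat m) at_infinity"
    unfolding H_def by (rule hs_log_derivative_tendsto(1)[of "wedge P" m x0, OF wdeg x0])
  have zinf: "\<forall>\<^sub>F z :: complex in at_infinity. z \<noteq> 0"
    by (auto simp: eventually_at_infinity intro: exI[of _ 1])
  have dec: "(f \<longlongrightarrow> 0) at_infinity" if "((\<lambda>z. z * f z) \<longlongrightarrow> l) at_infinity" for f :: "complex \<Rightarrow> complex" and l
  proof -
    have "((\<lambda>z. inverse z * (z * f z)) \<longlongrightarrow> 0 * l) at_infinity"
      by (intro tendsto_mult tendsto_inverse_0 that)
    moreover have "\<forall>\<^sub>F z in at_infinity. inverse z * (z * f z) = f z"
      using zinf by eventually_elim simp
    ultimately show ?thesis by - (drule (1) Lim_transform_eventually, simp)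
  qed
  define E where "E z = H z - of_real b * G z" for z
  have limE: "((\<lambda>z. z * E z) \<longlongrightarrow> of_nat m - of_real b * of_nat n) at_infinity"
  proof -
    have "((\<lambda>z. z * H z - of_real b * (z * G z)) \<longlongrightarrow> of_nat m - of_real b * of_nat n) at_infinity"
      by (intro tendsto_intros limG limH)
    then show ?thesis by (simp add: E_def algebra_simps)
  qed
  have E0: "E z = 0" for z
  proof -
    have "E holomorphic_on UNIV"
    proof -
      have "wd E (hs (dv (dv (wedge P))) (wedge P) z / M z - (H z)\<^sup>2 - (0 * G z + of_real b * G1 z))
          (\<sigma> z - (0 * G z + of_real b * \<rho> z)) z" for z
        unfolding E_def[abs_def] by (intro wd_diff wd_mult wd_const wdG wdH)
      then have "wd E (hs (dv (dv (wedge P))) (wedge P) z / M z - (H z)\<^sup>2 - (0 * G z + of_real b * G1 z)) 0 z" for z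
        by (simp add: \<sigma>\<rho>)
      then show ?thesis by (meson holo_wd holomorphic_on_open open_UNIV)
    qed
    then show ?thesis using dec[OF limE] by (rule Liouville_weak_0)
  qed
  have bn: "b * real n = real m"
  proof -
    have z: "((\<lambda>z :: complex. 0 :: complex) \<longlongrightarrow> of_nat m - of_real b * of_nat n) at_infinity" using limE by (simp add: E0)
    then have "of_nat m - complex_of_real b * of_nat n = 0"
      using tendsto_unique[OF trivial_limit_at_infinity z tendsto_const] by simp
    then have "complex_of_real (b * real n) = complex_of_real (real m)" by simp
    then show ?thesis by (simp only: of_real_eq_iff)
  qed
  have bn': "of_nat n * (complex_of_real b - 2) = - 2"
  proof -
    have "real n * (b - 2) = - 2" using bn n1 by (simp add: m_def of_nat_diff algebra_simps)
    then have "complex_of_real (real n * (b - 2)) = complex_of_real (- 2)" by (simp only:)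
    then show ?thesis by simp
  qed
  define D where "D z = hs (dv (dv P)) (dv P) z / N z - hs (dv (dv P)) P z * hs P (dv P) z / (N z)\<^sup>2 - 2 * G z * \<rho> z" for z
  have wdG1: "\<exists>a. wd G1 a (D z) z" for z
  proof -
    have "wd (\<lambda>z. hs (dv (dv P)) P z / hs P P z - G z * G z)
        (hs (dv (dv (dv P))) P z / hs P P z - hs (dv (dv P)) P z * hs (dv P) P z / (hs P P z)\<^sup>2 - (G1 z * G z + G z * G1 z))
        (hs (dv (dv P)) (dv P) z / hs P P z - hs (dv (dv P)) P z * hs P (dv P) z / (hs P P z)\<^sup>2 - (\<rho> z * G z + G z * \<rho> z)) z"
      by (intro wd_diff wd_mult wd_divide wd_hs wdG N0)
    then show ?thesis unfolding G1_def[abs_def] D_def N_def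
      by (intro exI) (erule wd_eqI[OF wd_cong], simp_all add: power2_eq_square)
  qed
  have D: "D z = \<rho> z * (of_real b - 2) * G z" for z
  proof -
    have "wd \<rho> (hs (dv (wedge P)) (wedge P) z / (2 * (N z)\<^sup>2) - M z * (2 * (hs (dv P) P z * N z + N z * hs (dv P) P z)) / (2 * (N z)\<^sup>2)\<^sup>2)
        (hs (wedge P) (dv (wedge P)) z / (2 * (N z)\<^sup>2) - M z * (2 * (hs P (dv P) z * N z + N z * hs P (dv P) z)) / (2 * (N z)\<^sup>2)\<^sup>2) z"
    proof -
      have "wd (\<lambda>z. M z / (2 * (N z * N z)))
        (hs (dv (wedge P)) (wedge P) z / (2 * (N z * N z)) - M z * (0 * (N z * N z) + 2 * (hs (dv P) P z * N z + N z * hs (dv P) P z)) / (2 * (N z * N z))\<^sup>2)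
        (hs (wedge P) (dv (wedge P)) z / (2 * (N z * N z)) - M z * (0 * (N z * N z) + 2 * (hs P (dv P) z * N z + N z * hs P (dv P) z)) / (2 * (N z * N z))\<^sup>2) z"
        unfolding M_def N_def by (intro wd_divide wd_mult wd_const wd_hs) (simp add: N0)
      then show ?thesis unfolding \<rho>_def[abs_def] by (simp add: power2_eq_square)
    qed
    moreover have "hs (dv (wedge P)) (wedge P) z / (2 * (N z)\<^sup>2) - M z * (2 * (hs (dv P) P z * N z + N z * hs (dv P) P z)) / (2 * (N z)\<^sup>2)\<^sup>2
        = \<rho> z * (H z - 2 * G z)"
      using N0[of z] M0[of z] unfolding \<rho>_def H_def G_def M_def N_def
      by (simp add: field_simps power2_eq_square)
    ultimately have 1: "\<exists>b. wd \<rho> (\<rho> z * (H z - 2 * G z)) b z" by auto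
    have \<rho>2: "\<rho> z = hs (dv P) (dv P) z / N z - hs (dv P) P z * hs P (dv P) z / (N z * N z)" for z
      using N0[of z] unfolding \<rho>_def M_def N_def hs_wedge by (simp add: field_simps power2_eq_square)
    have "wd (\<lambda>z. hs (dv P) (dv P) z / N z - hs (dv P) P z * hs P (dv P) z / (N z * N z))
       (hs (dv (dv P)) (dv P) z / N z - hs (dv P) (dv P) z * hs (dv P) P z / (N z)\<^sup>2 -
        ((hs (dv (dv P)) P z * hs P (dv P) z + hs (dv P) P z * hs (dv P) (dv P) z) / (N z * N z)
         - hs (dv P) P z * hs P (dv P) z * (hs (dv P) P z * N z + N z * hs (dv P) P z) / (N z * N z)\<^sup>2))
       (hs (dv P) (dv (dv P)) z / N z - hs (dv P) (dv P) z * hs P (dv P) z / (N z)\<^sup>2 -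
        ((hs (dv P) (dv P) z * hs P (dv P) z + hs (dv P) P z * hs P (dv (dv P)) z) / (N z * N z)
         - hs (dv P) P z * hs P (dv P) z * (hs P (dv P) z * N z + N z * hs P (dv P) z) / (N z * N z)\<^sup>2)) z"
      unfolding N_def by (intro wd_diff wd_divide wd_mult wd_hs) (simp_all add: N0)
    then have 2: "\<exists>b. wd \<rho> (hs (dv (dv P)) (dv P) z / N z - hs (dv P) (dv P) z * hs (dv P) P z / (N z)\<^sup>2 -
        ((hs (dv (dv P)) P z * hs P (dv P) z + hs (dv P) P z * hs (dv P) (dv P) z) / (N z * N z)
         - hs (dv P) P z * hs P (dv P) z * (hs (dv P) P z * N z + N z * hs (dv P) P z) / (N z * N z)\<^sup>2)) b z"
      unfolding \<rho>2[abs_def, symmetric] by blast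
    have "D z = hs (dv (dv P)) (dv P) z / N z - hs (dv P) (dv P) z * hs (dv P) P z / (N z)\<^sup>2 -
        ((hs (dv (dv P)) P z * hs P (dv P) z + hs (dv P) P z * hs (dv P) (dv P) z) / (N z * N z)
         - hs (dv P) P z * hs P (dv P) z * (hs (dv P) P z * N z + N z * hs (dv P) P z) / (N z * N z)\<^sup>2)"
      using N0[of z] unfolding D_def \<rho>2 G_def N_def by (simp add: field_simps power2_eq_square)
    then have "D z = \<rho> z * (H z - 2 * G z)" using wd_unique(1) 1 2 by metis
    also have "H z = of_real b * G z" using E0[of z] by (simp add: E_def)
    finally show ?thesis by (simp add: algebra_simps)
  qed
  define e where "e z = of_nat n * G1 z + (G z)\<^sup>2" for z
  have e0: "e z = 0" for z
  proof -
    have "e holomorphic_on UNIV"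
    proof -
      have "\<exists>a. wd e a 0 z" for z
      proof -
        obtain a where a: "wd G1 a (D z) z" using wdG1 by blast
        have "wd (\<lambda>z. of_nat n * G1 z + G z * G z) (0 * G1 z + of_nat n * a + (G1 z * G z + G z * G1 z))
            (0 * G1 z + of_nat n * D z + (\<rho> z * G z + G z * \<rho> z)) z"
          by (intro wd_add wd_mult wd_const wdG a)
        moreover have "0 * G1 z + of_nat n * D z + (\<rho> z * G z + G z * \<rho> z) = 0"
        proof -
          have "of_nat n * D z = (of_nat n * (complex_of_real b - 2)) * (\<rho> z * G z)"
            by (simp add: D)
          then show ?thesis unfolding bn' by simp
        qed
        ultimately show ?thesis unfolding e_def[abs_def] power2_eq_square by metis
      qed
      then show ?thesis by (meson holo_wd holomorphic_on_open open_UNIV)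
    qed
    moreover have "(e \<longlongrightarrow> 0) at_infinity"
    proof -
      have G0: "(G \<longlongrightarrow> 0) at_infinity" by (rule dec[OF limG])
      have "((\<lambda>z. z * (hs (dv (dv P)) P z / hs P P z)) \<longlongrightarrow> 0) at_infinity"
      proof (rule dec)
        let ?c = "\<Sum>i\<in>UNIV. coeff (P i) n * cnj (coeff (P i) n)"
        have c: "?c \<noteq> 0" by (rule hs_log_derivative_tendsto(3)[of P n i0, OF deg lead])
        let ?X2 = "[:0, 0, 1:] :: complex poly"
        have d2: "degree (?X2 * pderiv (pderiv (P i))) \<le> n" for i
        proof (cases "degree (P i) \<le> 1")
          case True
          then have "pderiv (pderiv (P i)) = 0" by (simp add: pderiv_eq_0_iff degree_pderiv)
          then show ?thesis by simp
        next
          case False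
          then show ?thesis using deg[of i] degree_mult_le[of ?X2 "pderiv (pderiv (P i))"]
            by (simp add: degree_pderiv)
        qed
        have "((\<lambda>z. \<Sum>i\<in>UNIV. poly (?X2 * pderiv (pderiv (P i))) z / z ^ n * cnj (poly (P i) z / z ^ n))
            \<longlongrightarrow> (\<Sum>i\<in>UNIV. coeff (?X2 * pderiv (pderiv (P i))) n * cnj (coeff (P i) n))) at_infinity"
          by (intro tendsto_intros poly_over_power_tendsto deg d2)
        then have "((\<lambda>z. (\<Sum>i\<in>UNIV. poly (?X2 * pderiv (pderiv (P i))) z / z ^ n * cnj (poly (P i) z / z ^ n))
            / (hs P P z / (z ^ n * cnj z ^ n)))
            \<longlongrightarrow> (\<Sum>i\<in>UNIV. coeff (?X2 * pderiv (pderiv (P i))) n * cnj (coeff (P i) n)) / ?c) at_infinity"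
          by (intro tendsto_divide hs_log_derivative_tendsto(2)[of P n i0, OF deg lead] c)
        moreover have "\<forall>\<^sub>F z in at_infinity. (\<Sum>i\<in>UNIV. poly (?X2 * pderiv (pderiv (P i))) z / z ^ n * cnj (poly (P i) z / z ^ n))
            / (hs P P z / (z ^ n * cnj z ^ n)) = z * (z * (hs (dv (dv P)) P z / hs P P z))"
          using zinf
        proof eventually_elim
          case (elim z)
          have "(\<Sum>i\<in>UNIV. poly (?X2 * pderiv (pderiv (P i))) z / z ^ n * cnj (poly (P i) z / z ^ n))
              = z * z * hs (dv (dv P)) P z / (z ^ n * cnj z ^ n)"
            by (simp add: hs_def dv_def sum_distrib_left sum_divide_distrib mult.assoc)
          then show ?case using elim by simp
        qed
        ultimately show "((\<lambda>z. z * (z * (hs (dv (dv P)) P z / hs P P z))) \<longlongrightarrow>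
            (\<Sum>i\<in>UNIV. coeff (?X2 * pderiv (pderiv (P i))) n * cnj (coeff (P i) n)) / ?c) at_infinity"
          by - (drule (1) Lim_transform_eventually, simp)
      qed
      then have "((\<lambda>z. hs (dv (dv P)) P z / hs P P z) \<longlongrightarrow> 0) at_infinity" by (rule dec)
      then have "((\<lambda>z. of_nat n * (hs (dv (dv P)) P z / hs P P z - (G z)\<^sup>2) + (G z)\<^sup>2)
          \<longlongrightarrow> of_nat n * (0 - 0\<^sup>2) + 0\<^sup>2) at_infinity"
        by (intro tendsto_intros G0)
      then show ?thesis by (simp add: e_def[abs_def] G1_def)
    qed
    ultimately show ?thesis by (rule Liouville_weak_0)
  qed
  define v where "v z = exp (ln (Re (N z)) / real n)" for z
  have vpos: "v z > 0" for z by (simp add: v_def)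
  have vN: "Re (N z) = v z ^ n" for z
  proof -
    have "v z ^ n = exp (ln (Re (N z)))" unfolding v_def using n1
      by (simp add: exp_of_nat_mult[symmetric])
    then show ?thesis using hs_self_pos[OF N0[of z]] by (simp add: N_def)
  qed
  have vder: "(v has_derivative (\<lambda>h. Re (2 * (of_real (v w) * G w / of_nat n) * h))) (at w)" for w
  proof -
    have "((\<lambda>w. (1 / real n) * ln (Re (N w))) has_derivative (\<lambda>h. (1 / real n) * Re (2 * G w * h))) (at w)"
      unfolding N_def G_def by (intro has_derivative_mult_right real_derivative_ln_hs N0)
    then have "((\<lambda>w. ln (Re (N w)) / real n) has_derivative (\<lambda>h. Re (2 * G w * h) / real n)) (at w)"
      by simp
    from has_derivative_exp[OF this]
    have "(v has_derivative (\<lambda>h. exp (ln (Re (N w)) / real n) * (Re (2 * G w * h) / real n))) (at w)"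
      by (simp add: v_def[abs_def] mult.commute)
    moreover have "exp (ln (Re (N w)) / real n) * (Re (2 * G w * h) / real n)
        = Re (2 * (of_real (v w) * G w / of_nat n) * h)" for h
    proof -
      have "2 * (of_real (v w) * G w / of_nat n) * h = complex_of_real (v w / real n) * (2 * G w * h)"
        by simp
      then have "Re (2 * (of_real (v w) * G w / of_nat n) * h) = (v w / real n) * Re (2 * G w * h)"
        by (simp only: Re_complex_of_real Im_complex_of_real times_complex.sel)
      then show ?thesis by (simp add: v_def algebra_simps)
    qed
    ultimately show ?thesis by (simp only:)
  qed
  define a where "a z = complex_of_real (v z) * G z / of_nat n" for z
  have wdv: "wd (\<lambda>w. complex_of_real (v w)) (a z) (cnj (a z)) z" for z
  proof -
    have "((\<lambda>w. complex_of_real (v w)) has_derivative (\<lambda>h. complex_of_real (Re (2 * a z * h)))) (at z)"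
      unfolding a_def by (rule has_derivative_of_real[OF vder])
    moreover have "complex_of_real (Re (2 * a z * h)) = a z * h + cnj (a z) * cnj h" for h
      using complex_add_cnj[of "a z * h"] by simp
    ultimately show ?thesis by (simp add: wd_def)
  qed
  define \<kappa> where "\<kappa> z = v z * (norm (G z))\<^sup>2 / (real n)\<^sup>2 + v z * Re (\<rho> z) / real n" for z
  have \<kappa>pos: "\<kappa> z > 0" for z
    using vpos[of z] \<rho>pos[of z] n1 unfolding \<kappa>_def by (intro add_nonneg_pos) auto
  have wda: "wd a 0 (complex_of_real (\<kappa> z)) z" for z
  proof -
    have w1: "wd (\<lambda>w. complex_of_real (v w) * G w * (1 / of_nat n))
        ((a z * G z + complex_of_real (v z) * G1 z) * (1 / of_nat n) + complex_of_real (v z) * G z * 0)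
        ((cnj (a z) * G z + complex_of_real (v z) * \<rho> z) * (1 / of_nat n) + complex_of_real (v z) * G z * 0) z"
      by (intro wd_mult wdv wdG wd_const)
    have e1: "(a z * G z + complex_of_real (v z) * G1 z) * (1 / of_nat n) + complex_of_real (v z) * G z * 0 = 0"
    proof -
      have "(a z * G z + complex_of_real (v z) * G1 z) * (1 / of_nat n)
          = complex_of_real (v z) * e z / (of_nat n)\<^sup>2"
        using n1 by (simp add: a_def e_def field_simps power2_eq_square)
      then show ?thesis by (simp add: e0)
    qed
    have e2: "(cnj (a z) * G z + complex_of_real (v z) * \<rho> z) * (1 / of_nat n) + complex_of_real (v z) * G z * 0
        = complex_of_real (\<kappa> z)"
    proof -
      have "cnj (G z) * G z = complex_of_real ((norm (G z))\<^sup>2)"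
        by (simp add: complex_norm_square mult.commute del: of_real_power)
      then show ?thesis using \<rho>real[of z] n1
        by (simp add: a_def \<kappa>_def add_divide_distrib power2_eq_square mult.assoc)
    qed
    show ?thesis using wd_eqI[OF w1 e1 e2] unfolding a_def[abs_def] by (simp only: times_divide_eq_right mult_1_right)
  qed
  define k where "k z = cnj (a z)" for z
  have kd: "(k has_field_derivative complex_of_real (\<kappa> z)) (at z)" for z
    using wd_cnj[OF wda[of z]] by (intro holo_wd) (simp add: k_def[abs_def])
  have kh: "k holomorphic_on UNIV" using kd by (meson holomorphic_on_open open_UNIV)
  have dk: "deriv k z = complex_of_real (\<kappa> z)" for z using kd by (rule DERIV_imp_deriv)
  have "deriv (deriv k) z = 0" for z
  proof -
    have "(deriv k has_field_derivative deriv (deriv k) z) (at z)"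
      using holomorphic_deriv[OF kh open_UNIV] by (meson UNIV_I holomorphic_derivI open_UNIV)
    then have 1: "wd (deriv k) (deriv (deriv k) z) 0 z" by (rule wd_holo)
    have "wd (\<lambda>w. cnj (deriv k w)) (cnj 0) (cnj (deriv (deriv k) z)) z" by (rule wd_cnj[OF 1])
    moreover have "(\<lambda>w. cnj (deriv k w)) = deriv k" by (simp add: fun_eq_iff dk)
    ultimately show ?thesis using wd_unique(1)[OF 1] by simp
  qed
  then have "(deriv k has_field_derivative 0) (at z)" for z
    using holomorphic_deriv[OF kh open_UNIV] by (metis UNIV_I holomorphic_derivI open_UNIV)
  then obtain c' where c': "\<And>z. deriv k z = c'"
    using has_field_derivative_zero_constant[of UNIV "deriv k"] by auto
  define c where "c = \<kappa> 0"
  have \<kappa>c: "\<kappa> z = c" for z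
  proof -
    have "complex_of_real (\<kappa> z) = complex_of_real (\<kappa> 0)" using c' dk by metis
    then show ?thesis by (simp add: c_def)
  qed
  have "((\<lambda>z. k z - of_real c * z) has_field_derivative 0) (at z)" for z
    using kd[of z] unfolding \<kappa>c by (auto intro!: derivative_eq_intros)
  then obtain k0 where k0: "\<And>z. k z - of_real c * z = k0"
    using has_field_derivative_zero_constant[of UNIV "\<lambda>z. k z - of_real c * z"] by auto
  define \<beta> where "\<beta> = cnj k0"
  have a_eq: "a z = \<beta> + of_real c * cnj z" for z
  proof -
    have "k z = k0 + of_real c * z" using k0[of z] by (simp add: algebra_simps)
    then have "cnj (k z) = cnj (k0 + of_real c * z)" by simp
    then show ?thesis by (simp add: k_def \<beta>_def)
  qed
  have "((\<lambda>z. v z - 2 * Re (\<beta> * z) - c * Re (z * cnj z)) has_derivative (\<lambda>h. 0)) (at z)" for z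
  proof -
    have "((\<lambda>z. v z - 2 * Re (\<beta> * z) - c * Re (z * cnj z)) has_derivative
        (\<lambda>h. Re (2 * a z * h) - 2 * Re (\<beta> * h) - c * Re (z * cnj h + h * cnj z))) (at z)"
      unfolding a_def
      by (intro has_derivative_diff vder has_derivative_mult_right has_derivative_Re has_derivative_mult
          has_derivative_cnj has_derivative_ident)
    moreover have "Re (2 * a z * h) - 2 * Re (\<beta> * h) - c * Re (z * cnj h + h * cnj z) = 0" for h
      by (simp add: a_eq algebra_simps)
    ultimately show ?thesis by simp
  qed
  then obtain v0 where v0: "\<And>z. v z - 2 * Re (\<beta> * z) - c * Re (z * cnj z) = v0"
    using has_derivative_zero_constant[of UNIV "\<lambda>z. v z - 2 * Re (\<beta> * z) - c * Re (z * cnj z)"] by auto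
  have v: "v z = v0 + 2 * Re (\<beta> * z) + c * (norm z)\<^sup>2" for z
  proof -
    have "z * cnj z = complex_of_real ((norm z)\<^sup>2)" by (rule complex_norm_square[symmetric])
    then have "Re (z * cnj z) = (norm z)\<^sup>2" by (simp only: Re_complex_of_real)
    then show ?thesis using v0[of z] by simp
  qed
  have cpos: "c > 0" using \<kappa>pos[of 0] by (simp add: c_def)
  have "(norm \<beta>)\<^sup>2 < v0 * c"
  proof -
    have "\<beta> * (- cnj \<beta> / of_real c) = complex_of_real (- (norm \<beta>)\<^sup>2 / c)"
      by (simp add: complex_norm_square[symmetric])
    then have "2 * Re (\<beta> * (- cnj \<beta> / of_real c)) = 2 * (- (norm \<beta>)\<^sup>2 / c)" by (simp only: Re_complex_of_real)
    moreover have "c * (norm (- cnj \<beta> / of_real c))\<^sup>2 = (norm \<beta>)\<^sup>2 / c"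
      using cpos by (simp add: norm_divide power_divide power2_eq_square)
    ultimately have "v (- cnj \<beta> / of_real c) = v0 + 2 * (- (norm \<beta>)\<^sup>2 / c) + (norm \<beta>)\<^sup>2 / c"
      by (simp only: v)
    then have "(norm \<beta>)\<^sup>2 / c < v0" using vpos[of "- cnj \<beta> / of_real c"] by linarith
    then show ?thesis using cpos by (simp add: field_simps)
  qed
  then show ?thesis using n1 cpos vN unfolding N_def v by blast
qed

subsection \<open>Extended solutions with three modes\<close>

lemma trace_outer_adj:
  fixes a c :: "complex ^ 'm" and b d :: "complex ^ 'n"
  shows "trace (outer a b ** adj (outer c d)) = hinner a c * hinner d b"
proof -
  have "trace (csmult x (outer u v)) = x * hinner u v" for x :: complex and u v :: "complex ^ 'm"
    by (simp add: trace_def outer_def hinner_def sum_distrib_left mult.assoc)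
  then show ?thesis by (simp add: adj_outer outer_mult_outer mult.commute)
qed

lemma trace_add: "trace (A + B) = trace A + trace (B :: complex ^ 'n ^ 'n)"
  by (simp add: trace_def sum.distrib)
lemma trace_diff: "trace (A - B) = trace A - trace (B :: complex ^ 'n ^ 'n)"
  by (simp add: trace_def sum_subtractf)
lemma trace_csmult: "trace (csmult c A) = c * trace A"
  by (simp add: trace_def sum_distrib_left)
text \<open>The loop relations for \<open>A0 + l A1 + l\<^sup>2 A2\<close> and the coefficients of the extended solution
  equation, \<open>S\<close> and \<open>T\<close> standing for \<open>A\<^sub>z\<close> and \<open>A\<^bsub>\<bar>z\<^esub>\<close>.\<close>

lemma extended_solution_coefficients:
  fixes A0 A1 A2 S :: "complex ^ 'n ^ 'n"
  assumes "\<And>l. l \<in> S1 \<Longrightarrow> B0 + csmult l B1 + csmult (l\<^sup>2) B2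
      = (A0 + csmult l A1 + csmult (l\<^sup>2) A2) ** csmult (1 - inverse l) S"
  shows "A0 ** S = 0" "B0 = - (A1 ** S)" "B1 = A1 ** S - A2 ** S" "B2 = A2 ** S"
proof -
  have e: "A0 ** S + csmult l (B0 - A0 ** S + A1 ** S) + csmult (l\<^sup>2) (B1 - A1 ** S + A2 ** S)
      + csmult (l ^ 3) (B2 - A2 ** S) + csmult (l ^ 4) 0 = 0" if l: "l \<in> S1" for l
  proof -
    have l0: "l \<noteq> 0" using l by auto
    have "csmult l (B0 + csmult l B1 + csmult (l\<^sup>2) B2)
        = csmult (l * (1 - inverse l)) ((A0 + csmult l A1 + csmult (l\<^sup>2) A2) ** S)"
      unfolding assms[OF l] by (simp add: mm_simps mult_ac)
    moreover have "l * (1 - inverse l) = l - 1" using l0 by (simp add: right_diff_distrib)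
    ultimately show ?thesis
      by (simp add: mm_simps csmult_diff_left algebra_simps power2_eq_square power3_eq_cube)
  qed
  from matrix_poly_zero_on_S1[OF e]
  show A0S: "A0 ** S = 0" and "B2 = A2 ** S"
    and "B0 = - (A1 ** S)" "B1 = A1 ** S - A2 ** S"
    by (auto simp: algebra_simps eq_neg_iff_add_eq_0)
qed

lemma extended_solution_coefficients_bar:
  fixes A0 A1 A2 S :: "complex ^ 'n ^ 'n"
  assumes "\<And>l. l \<in> S1 \<Longrightarrow> B0 + csmult l B1 + csmult (l\<^sup>2) B2
      = (A0 + csmult l A1 + csmult (l\<^sup>2) A2) ** csmult (1 - l) S"
  shows "B0 = A0 ** S" "B1 = A1 ** S - A0 ** S" "B2 = - (A1 ** S)" "A2 ** S = 0"
proof -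
  have e: "(B0 - A0 ** S) + csmult l (B1 - A1 ** S + A0 ** S) + csmult (l\<^sup>2) (B2 - A2 ** S + A1 ** S)
      + csmult (l ^ 3) (A2 ** S) + csmult (l ^ 4) 0 = 0" if l: "l \<in> S1" for l
    using assms[OF l]
    by (simp add: mm_simps csmult_diff_left algebra_simps power2_eq_square power3_eq_cube)
  from matrix_poly_zero_on_S1[OF e]
  show "A2 ** S = 0" "B0 = A0 ** S" "B1 = A1 ** S - A0 ** S" "B2 = - (A1 ** S)"
    by (auto simp: algebra_simps eq_neg_iff_add_eq_0)
qed

lemma hermitian_difference:
  fixes A0 A1 A2 :: "complex ^ 'n ^ 'n"
  assumes sum: "A0 + A1 + A2 = mat 1" and r1: "A0 ** adj A2 = 0"
    and r2: "A0 ** adj A1 + A1 ** adj A2 = 0"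
  shows "adj (A2 - A0) = A2 - A0"
proof -
  have s: "adj A0 + adj A1 + adj A2 = mat 1" using arg_cong[OF sum, of adj] by (simp add: adj_add)
  have r1': "A2 ** adj A0 = 0" using arg_cong[OF r1, of adj] by (simp add: adj_mult)
  have r2': "A1 ** adj A0 + A2 ** adj A1 = 0" using arg_cong[OF r2, of adj] by (simp add: adj_mult adj_add)
  have a0: "A0 = A0 ** adj A0 + A0 ** adj A1"
  proof -
    have "A0 = A0 ** (adj A0 + adj A1 + adj A2)" by (simp add: s)
    then show ?thesis by (simp add: mm_add_right r1)
  qed
  have a2: "A2 = A2 ** adj A1 + A2 ** adj A2"
  proof -
    have "A2 = A2 ** (adj A0 + adj A1 + adj A2)" by (simp add: s)
    then show ?thesis by (simp add: mm_add_right r1')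
  qed
  have a0': "adj A0 = A0 ** adj A0 + A1 ** adj A0"
    using arg_cong[OF a0, of adj] by (simp add: adj_add adj_mult)
  have a2': "adj A2 = A1 ** adj A2 + A2 ** adj A2"
    using arg_cong[OF a2, of adj] by (simp add: adj_add adj_mult)
  have "adj A2 - adj A0 - (A2 - A0) = (A1 ** adj A2 + A2 ** adj A2) - (A0 ** adj A0 + A1 ** adj A0)
      - ((A2 ** adj A1 + A2 ** adj A2) - (A0 ** adj A0 + A0 ** adj A1))"
    by (simp only: a0[symmetric] a0'[symmetric] a2[symmetric] a2'[symmetric])
  also have "\<dots> = (A0 ** adj A1 + A1 ** adj A2) - (A1 ** adj A0 + A2 ** adj A1)"
    by simp
  also have "\<dots> = 0" by (simp only: r2 r2' diff_self)
  finally show ?thesis by (simp add: adj_diff)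
qed

subsection \<open>The normal form of the loop over a generic point\<close>

lemma rank_one_loop:
  fixes A0 A1 A2 :: "complex ^ 'n ^ 'n"
  assumes sum: "A0 + A1 + A2 = mat 1"
    and r1: "A0 ** adj A2 = 0" and r2: "A0 ** adj A1 + A1 ** adj A2 = 0"
    and r4: "adj A1 ** A0 + adj A2 ** A1 = 0"
    and A0: "A0 = outer f g" and A2: "A2 = outer \<nu> e"
    and f0: "f \<noteq> 0" and g0: "g \<noteq> 0" and n0: "\<nu> \<noteq> 0" and e0: "e \<noteq> 0"
    and fn: "hinner f \<nu> = 0"
  defines "h \<equiv> hinner (A1 *v g) \<nu> / hinner g g"
    and "F \<equiv> hinner f f" and "n \<equiv> hinner \<nu> \<nu>"
  shows "F * n + h * cnj h \<noteq> 0"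
    "A2 - A0 = csmult (1 / (F * n + h * cnj h)) (csmult F (outer \<nu> \<nu>) - csmult n (outer f f)
       - csmult h (outer \<nu> f) - csmult (cnj h) (outer f \<nu>))"
    "A2 = csmult (1 / (F * n + h * cnj h)) (csmult F (outer \<nu> \<nu>) - csmult h (outer \<nu> f))"
    "A0 = csmult (1 / (F * n + h * cnj h)) (csmult n (outer f f) + csmult (cnj h) (outer f \<nu>))"
proof -
  have F: "F \<noteq> 0" and n: "n \<noteq> 0" using f0 n0 by (simp_all add: F_def n_def)
  have nf: "hinner \<nu> f = 0" using fn hinner_eq_0_commute by blast
  have s: "adj A1 = mat 1 - adj A0 - adj A2"
    using arg_cong[OF sum, of adj] by (simp add: adj_add algebra_simps)
  have "hinner g g *s (adj A1 *v f) = - (hinner (A1 *v g) \<nu> *s e)"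
  proof -
    have "(adj A1 ** A0 + adj A2 ** A1) *v g = 0" by (simp add: r4)
    then have "hinner g g *s (adj A1 *v f) + hinner (A1 *v g) \<nu> *s e = 0"
      by (simp add: A0 A2 adj_outer matrix_add_mv matrix_vector_mul_assoc[symmetric] outer_mv mv_scale)
    then show ?thesis by (simp add: eq_neg_iff_add_eq_0)
  qed
  then have "(1 / hinner g g) *s (hinner g g *s (adj A1 *v f)) = (1 / hinner g g) *s (- (hinner (A1 *v g) \<nu> *s e))"
    by (simp only:)
  then have A1f: "adj A1 *v f = - (h *s e)"
    using g0 by (simp add: h_def vector_smult_assoc vec.scale_minus_right)
  have "adj A1 *v f = f - F *s g"
    by (simp add: s A0 A2 adj_outer matrix_diff_mv outer_mv fn F_def)
  then have Fg: "F *s g = f + h *s e" using A1f by (simp add: algebra_simps)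
  have eg: "hinner e g = 0"
  proof -
    have "outer f g ** outer e \<nu> = 0" using r1 by (simp add: A0 A2 adj_outer)
    then have "csmult (hinner e g) (outer f \<nu>) *v \<nu> = 0" by (simp add: outer_mult_outer)
    then have "(hinner e g * n) *s f = 0" by (simp add: csmult_mv outer_mv n_def vector_smult_assoc)
    then show ?thesis using n f0 by simp
  qed
  define E where "E = hinner e e"
  have E: "E \<noteq> 0" using e0 by (simp add: E_def)
  have "A0 - A0 ** adj A0 + adj A2 - A2 ** adj A2 = 0"
  proof -
    have e1: "A0 ** adj A1 = A0 - A0 ** adj A0"
      by (simp add: s mm_diff_right r1)
    have "A1 = mat 1 - A0 - A2" using sum by (simp add: algebra_simps)
    then have e2: "A1 ** adj A2 = adj A2 - A2 ** adj A2"
      by (simp add: mm_diff_left r1)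
    show ?thesis using r2 unfolding e1 e2 by (simp only: add_diff_eq)
  qed
  then have "(A0 - A0 ** adj A0 + adj A2 - A2 ** adj A2) *v \<nu> = 0" by simp
  then have en: "n *s e = (E * n) *s \<nu> - hinner \<nu> g *s f"
    by (simp add: A0 A2 adj_outer matrix_add_mv matrix_diff_mv outer_mult_outer csmult_mv outer_mv nf n_def E_def
       vector_smult_assoc algebra_simps)
  have ne: "hinner \<nu> e = E * n"
  proof -
    have "hinner (n *s e) \<nu> = E * n * n"
      unfolding en by (simp add: hinner_simps fn n_def)
    then have "hinner e \<nu> = E * n" using n by (simp add: hinner_simps n_def)
    then have "cnj (hinner e \<nu>) = cnj (E * n)" by simp
    then show ?thesis by (simp add: E_def n_def)
  qed
  have ng: "F * hinner \<nu> g = cnj h * E * n"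
  proof -
    have "hinner \<nu> (F *s g) = hinner \<nu> (f + h *s e)" by (simp only: Fg)
    then show ?thesis by (simp add: hinner_simps nf ne) (simp add: F_def)
  qed
  have Fe: "F *s e = E *s (F *s \<nu> - cnj h *s f)"
  proof -
    have "n *s (F *s e) = F *s (n *s e)" by (simp add: vector_smult_assoc mult.commute)
    also have "\<dots> = n *s (E *s (F *s \<nu> - cnj h *s f))"
      unfolding en by (simp add: vec.scale_right_diff_distrib vector_smult_assoc ng mult_ac)
    finally show ?thesis using n vec.scale_cancel_left[of n] by blast
  qed
  let ?N = "F * n + h * cnj h"
  have EN: "F = E * ?N"
  proof -
    have "hinner (F *s e) (F *s e) = hinner (E *s (F *s \<nu> - cnj h *s f)) (E *s (F *s \<nu> - cnj h *s f))"
      by (simp only: Fe)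
    moreover have cF: "cnj F = F" and cE: "cnj E = E" by (simp_all add: F_def E_def)
    moreover have "hinner (F *s e) (F *s e) = F * cnj F * E"
      by (simp add: hinner_simps E_def mult.assoc)
    moreover have "hinner (E *s (F *s \<nu> - cnj h *s f)) (E *s (F *s \<nu> - cnj h *s f))
        = E * cnj E * (F * cnj F * n + cnj h * h * F)"
    proof -
      have "hinner (F *s \<nu> - cnj h *s f) (F *s \<nu> - cnj h *s f) = F * cnj F * n + cnj h * h * F"
        by (simp add: hinner_simps fn nf flip: F_def n_def)
      then show ?thesis by (simp only: hinner_scale_left hinner_scale_right mult_ac)
    qed
    ultimately have "F * F * E = E * E * (F * F * n + h * cnj h * F)"
      by (simp only: mult.commute)
    then have "(F * E) * F = (F * E) * (E * ?N)" by (simp add: algebra_simps)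
    then show ?thesis using F E by simp
  qed
  then show N: "?N \<noteq> 0" using F by auto
  have cN: "cnj ?N = ?N" by (simp add: F_def n_def mult.commute)
  have E': "E = F / ?N" using EN N by (simp add: field_simps)
  have e: "e = (1 / ?N) *s (F *s \<nu> - cnj h *s f)"
  proof -
    have "(1 / F) *s (F *s e) = (1 / F) *s (E *s (F *s \<nu> - cnj h *s f))" by (simp only: Fe)
    then show ?thesis using F unfolding E' by (simp add: vector_smult_assoc)
  qed
  have g: "g = (1 / ?N) *s (n *s f + h *s \<nu>)"
  proof -
    have "F *s (?N *s g) = ?N *s (F *s g)" by (simp only: vector_smult_assoc mult.commute)
    also have "\<dots> = ?N *s f + h *s (?N *s e)"
      unfolding Fg by (simp only: vec.scale_right_distrib vector_smult_assoc mult.commute)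
    also have "?N *s e = F *s \<nu> - cnj h *s f" unfolding e using N by (simp add: vector_smult_assoc)
    also have "?N *s f + h *s (F *s \<nu> - cnj h *s f) = F *s (n *s f + h *s \<nu>)"
      by (simp add: vec_eq_iff algebra_simps)
    finally have "?N *s g = n *s f + h *s \<nu>" using F vec.scale_cancel_left[of F] by blast
    moreover have "(1 / ?N) *s (?N *s g) = (1 / ?N * ?N) *s g" by (simp only: vector_smult_assoc)
    moreover have "1 / ?N * ?N = 1" using N by simp
    ultimately show ?thesis by (simp only: vector_smult_lid)
  qed
  have cr: "cnj (1 / ?N) = 1 / ?N" unfolding complex_cnj_divide cN by simp
  have cF: "cnj F = F" "cnj n = n" by (simp_all add: F_def n_def)
  show A2': "A2 = csmult (1 / ?N) (csmult F (outer \<nu> \<nu>) - csmult h (outer \<nu> f))"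
    unfolding A2 by (subst e, simp only: outer_scale_right cr)
      (simp add: vec_eq_iff outer_def algebra_simps cF)
  show A0': "A0 = csmult (1 / ?N) (csmult n (outer f f) + csmult (cnj h) (outer f \<nu>))"
    unfolding A0 by (subst g, simp only: outer_scale_right cr)
      (simp add: vec_eq_iff outer_def algebra_simps cF)
  show "A2 - A0 = csmult (1 / ?N) (csmult F (outer \<nu> \<nu>) - csmult n (outer f f)
       - csmult h (outer \<nu> f) - csmult (cnj h) (outer f \<nu>))"
    by (subst A2', subst A0') (simp add: csmult_diff_right csmult_add_right algebra_simps)
qed

subsection \<open>The energy density\<close>

lemma energy_identity:
  fixes f f' \<nu> \<nu>' :: "complex ^ 'n" and h k :: complex
  assumes o: "hinner f \<nu> = 0" "hinner f' \<nu> = 0" "hinner f \<nu>' = 0"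
  defines "F \<equiv> hinner f f" and "n \<equiv> hinner \<nu> \<nu>" and "F' \<equiv> hinner f' f" and "n' \<equiv> hinner \<nu> \<nu>'"
  defines "R \<equiv> csmult F (outer \<nu> \<nu>) - csmult n (outer f f) - csmult h (outer \<nu> f) - csmult (cnj h) (outer f \<nu>)"
    and "R' \<equiv> csmult F' (outer \<nu> \<nu>) + csmult F (outer \<nu> \<nu>') - csmult n' (outer f f) - csmult n (outer f' f)
      - csmult k (outer \<nu> f) - csmult (cnj h) (outer f' \<nu> + outer f \<nu>')"
    and "N \<equiv> F * n + h * cnj h" and "N' \<equiv> F' * n + F * n' + k * cnj h"
    and "N2 \<equiv> hinner f' f' * n + F' * cnj n' + cnj F' * n' + F * hinner \<nu>' \<nu>' + k * cnj k"
  assumes N: "N \<noteq> 0"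
  defines "S \<equiv> csmult (1 / N) R' - csmult (N' / N\<^sup>2) R"
  shows "trace (S ** adj S) = (N * N2 - N' * cnj N') / N\<^sup>2"
proof -
  have o': "hinner \<nu> f = 0" "hinner \<nu> f' = 0" "hinner \<nu>' f = 0"
    using o hinner_eq_0_commute by blast+
  have cr: "cnj F = F" "cnj n = n" "cnj N = N" by (simp_all add: F_def n_def N_def mult.commute)
  define s where "s = F * n"
  define s' where "s' = F' * n + F * n'"
  have RR: "trace (R ** adj R) = 2 * s * N"
    unfolding R_def
    by (simp add: adj_diff adj_csmult mm_simps trace_diff trace_csmult trace_outer_adj cr o o'
        flip: F_def n_def) (simp add: N_def s_def algebra_simps)
  have R'R: "trace (R' ** adj R) = s' * N + s * N'"
    unfolding R_def R'_def
    by (simp add: adj_diff adj_add adj_csmult mm_simps trace_diff trace_add trace_csmult trace_outer_adj cr o o'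
        flip: F_def n_def F'_def n'_def) (simp add: N_def N'_def s_def s'_def algebra_simps)
  have R'R': "trace (R' ** adj R') = N * (N2 - k * cnj k) + s * (k * cnj k) + s' * cnj s'"
    unfolding R'_def
    by (simp add: adj_diff adj_add adj_csmult mm_simps trace_diff trace_add trace_csmult trace_outer_adj cr o o'
        flip: F_def n_def F'_def n'_def) (simp add: N_def N2_def s_def s'_def F_def n_def F'_def n'_def algebra_simps)
  have RR': "trace (R ** adj R') = cnj (s' * N + s * N')"
  proof -
    have "trace (R ** adj R') = cnj (trace (R' ** adj R))"
      by (simp add: trace_def adj_def matrix_matrix_mult_def mult.commute)
    then show ?thesis by (simp add: R'R)
  qed
  have cs: "cnj s = s" by (simp add: s_def cr)
  have "trace (S ** adj S) = trace (R' ** adj R') / N\<^sup>2 - N' * trace (R ** adj R') / N ^ 3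
     - cnj N' * trace (R' ** adj R) / N ^ 3 + N' * cnj N' * trace (R ** adj R) / N ^ 4"
    unfolding S_def
    by (simp add: adj_diff adj_csmult mm_simps trace_diff trace_add trace_csmult cr power2_eq_square power3_eq_cube
        power4_eq_xxxx algebra_simps)
  also have "\<dots> = (N * N2 - N' * cnj N') / N\<^sup>2"
  proof -
    have N's: "N' = s' + k * cnj h" by (simp add: N'_def s'_def)
    have "(trace (R' ** adj R') * N\<^sup>2 - N' * trace (R ** adj R') * N - cnj N' * trace (R' ** adj R) * N
        + N' * cnj N' * trace (R ** adj R)) = N\<^sup>2 * (N * N2 - N' * cnj N')"
    proof -
      have Ns: "N = s + h * cnj h" by (simp add: N_def s_def)
      have t: "trace (R' ** adj R') = N * N2 - N' * cnj N' + N' * cnj s' + cnj N' * s'"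
        unfolding R'R' N's by (simp add: Ns algebra_simps)
      show ?thesis
        unfolding t RR R'R RR' by (simp add: cs cr power2_eq_square algebra_simps)
    qed
    moreover have "X1 / N\<^sup>2 - a * X2 / N ^ 3 - b * X3 / N ^ 3 + a * b * X4 / N ^ 4
        = (X1 * N\<^sup>2 - a * X2 * N - b * X3 * N + a * b * X4) / N ^ 4" for X1 X2 X3 X4 a b
      using N by (simp add: add_divide_distrib diff_divide_distrib power2_eq_square power3_eq_cube power4_eq_xxxx)
    moreover have "N\<^sup>2 * Y / N ^ 4 = Y / N\<^sup>2" for Y
      using N by (simp add: power2_eq_square power4_eq_xxxx)
    ultimately show ?thesis by (simp only:)
  qed
  finally show ?thesis .
qed

subsection \<open>Polarisation\<close>

lemma entire_zero_on_reals:
  assumes "g holomorphic_on UNIV" "\<And>x :: real. g (of_real x) = 0"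
  shows "g z = 0"
proof (rule analytic_continuation[where f = g and w = z and S = UNIV and U = "range complex_of_real" and \<xi> = 0])
  show "(0 :: complex) islimpt range of_real"
    unfolding islimpt_approachable
  proof (intro allI impI)
    fix e :: real assume "e > 0"
    then show "\<exists>x'\<in>range complex_of_real. x' \<noteq> 0 \<and> dist x' 0 < e"
      by (intro bexI[OF _ rangeI[of of_real "e / 2"]]) (simp add: dist_norm)
  qed
qed (use assms in auto)

lemma polarise:
  fixes K :: "complex \<Rightarrow> complex \<Rightarrow> complex"
  assumes 1: "\<And>y. (\<lambda>x. K (x + \<i> * y) (x - \<i> * y)) holomorphic_on UNIV"
    and 2: "\<And>x. (\<lambda>y. K (x + \<i> * y) (x - \<i> * y)) holomorphic_on UNIV"
    and 3: "\<And>z. K z (cnj z) = 0"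
  shows "K z w = 0"
proof -
  have "K (of_real x + \<i> * of_real y) (of_real x - \<i> * of_real y) = 0" for x y :: real
    using 3[of "of_real x + \<i> * of_real y"] by simp
  then have "K (x + \<i> * of_real y) (x - \<i> * of_real y) = 0" for x :: complex and y :: real
    using entire_zero_on_reals[OF 1[of "of_real y"]] by blast
  then have K: "K (x + \<i> * y) (x - \<i> * y) = 0" for x y :: complex
    using entire_zero_on_reals[OF 2[of x]] by blast
  have "(z + w) / 2 + \<i> * ((z - w) / (2 * \<i>)) = z" "(z + w) / 2 - \<i> * ((z - w) / (2 * \<i>)) = w"
    by (simp_all add: field_simps)
  then show ?thesis using K[of "(z + w) / 2" "(z - w) / (2 * \<i>)"] by simp
qed

lemma poly_hermitian_identity_polarise:
  fixes Q P :: "complex poly" and F M :: "3 \<Rightarrow> complex poly"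
  assumes "\<And>z. poly Q z * cnj (poly Q z) * (\<Sum>i\<in>UNIV. poly (F i) z * cnj (poly (F i) z))
      * (\<Sum>i\<in>UNIV. poly (M i) z * cnj (poly (M i) z)) + poly P z * cnj (poly P z) = (1 + z * cnj z) ^ n"
  shows "poly Q z * cnj (poly Q w) * (\<Sum>i\<in>UNIV. poly (F i) z * cnj (poly (F i) w))
      * (\<Sum>i\<in>UNIV. poly (M i) z * cnj (poly (M i) w)) + poly P z * cnj (poly P w) = (1 + z * cnj w) ^ n"
proof -
  let ?c = "map_poly cnj"
  define K where "K z w = poly Q z * poly (?c Q) w * (\<Sum>i\<in>UNIV. poly (F i) z * poly (?c (F i)) w)
      * (\<Sum>i\<in>UNIV. poly (M i) z * poly (?c (M i)) w) + poly P z * poly (?c P) w - (1 + z * w) ^ n" for z w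
  have "K z (cnj w) = 0"
  proof (rule polarise[where K = K and z = z and w = "cnj w"])
    show "(\<lambda>x. K (x + \<i> * y) (x - \<i> * y)) holomorphic_on UNIV" for y
      unfolding K_def by (intro holomorphic_intros)
    show "(\<lambda>y. K (x + \<i> * y) (x - \<i> * y)) holomorphic_on UNIV" for x
      unfolding K_def by (intro holomorphic_intros)
    show "K z (cnj z) = 0" for z
      unfolding K_def by (simp add: assms poly_cnj[symmetric])
  qed
  then show ?thesis by (simp add: K_def poly_cnj[symmetric])
qed

lemma poly_product_radial:
  fixes P \<Psi> :: "complex poly"
  assumes "\<And>z w. poly P z * cnj (poly P w) = poly \<Psi> (z * cnj w)"
  shows "coeff P i * cnj (coeff P j) = (if i = j then coeff \<Psi> i else 0)"
proof -
  have 1: "coeff P i * cnj (poly P w) = coeff \<Psi> i * cnj w ^ i" for i w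
  proof -
    have "smult (cnj (poly P w)) P = pcompose \<Psi> [:0, cnj w:]"
      using assms[of _ w] by (intro poly_ext) (simp add: poly_pcompose mult.commute)
    then have "coeff (smult (cnj (poly P w)) P) i = coeff (pcompose \<Psi> [:0, cnj w:]) i" by simp
    then show ?thesis by (simp add: coeff_pcompose_linear mult.commute)
  qed
  have "smult (cnj (coeff P i)) P = monom (cnj (coeff \<Psi> i)) i"
  proof (rule poly_ext)
    fix w
    from arg_cong[OF 1[of i w], of cnj]
    show "poly (smult (cnj (coeff P i)) P) w = poly (monom (cnj (coeff \<Psi> i)) i) w"
      by (simp add: poly_monom)
  qed
  then have "coeff (smult (cnj (coeff P i)) P) j = coeff (monom (cnj (coeff \<Psi> i)) i) j" by simp
  then have "cnj (cnj (coeff P i) * coeff P j) = cnj (if i = j then cnj (coeff \<Psi> i) else 0)"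
    by (auto simp: coeff_monom split: if_splits)
  then show ?thesis by (simp split: if_splits)
qed

subsection \<open>Rigidity of the quadratic curve\<close>

lemma poly_root_exists:
  fixes p :: "complex poly"
  assumes "degree p \<noteq> 0" shows "\<exists>z. poly p z = 0"
  using alg_closed_imp_poly_has_root[of p] assms by simp

lemma product_constant_quadratic:
  fixes a b :: "complex poly"
  assumes "a * b = [:c:]" "c \<noteq> 0"
  shows "degree a = 0 \<and> degree b = 0"
proof -
  have "a \<noteq> 0" "b \<noteq> 0" using assms by auto
  then have "degree a + degree b = degree (a * b)" by (simp add: degree_mult_eq)
  then show ?thesis using assms by simp
qed

lemma hinner_crs:
  "hinner (crs a b) (crs c d) = hinner a c * hinner b d - hinner a d * hinner b c"
  by (simp add: hinner_3 algebra_simps)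

text \<open>If the product of the two Hermitian forms is constant in \<open>z\<close> for \<open>w = 0\<close>, then the
  coefficient vectors are orthogonal.\<close>

lemma orthogonal_coefficients:
  fixes F0 F1 F2 :: "complex ^ 3"
  assumes const: "\<And>z. (hinner F0 F0 + z * hinner F1 F0 + z\<^sup>2 * hinner F2 F0)
      * (hinner (crs F0 F1) (crs F0 F1) + z * hinner (2 *s crs F0 F2) (crs F0 F1)
          + z\<^sup>2 * hinner (crs F1 F2) (crs F0 F1)) = c" and c: "c \<noteq> 0"
  shows "hinner F1 F0 = 0" "hinner F2 F0 = 0" "hinner F2 F1 = 0"
proof -
  let ?a = "[:hinner F0 F0, hinner F1 F0, hinner F2 F0:]"
  let ?b = "[:hinner (crs F0 F1) (crs F0 F1), hinner (2 *s crs F0 F2) (crs F0 F1), hinner (crs F1 F2) (crs F0 F1):]"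
  have "?a * ?b = [:c:]"
  proof (rule poly_ext)
    fix z
    have "poly ?a z = hinner F0 F0 + z * hinner F1 F0 + z\<^sup>2 * hinner F2 F0"
      by (simp add: algebra_simps power2_eq_square)
    moreover have "poly ?b z = hinner (crs F0 F1) (crs F0 F1) + z * hinner (2 *s crs F0 F2) (crs F0 F1)
          + z\<^sup>2 * hinner (crs F1 F2) (crs F0 F1)"
      by (simp add: algebra_simps power2_eq_square)
    moreover have "poly [:c:] z = c" by simp
    ultimately show "poly (?a * ?b) z = poly [:c:] z" using const[of z] by (simp only: poly_mult)
  qed
  from product_constant_quadratic[OF this c]
  have d: "degree ?a = 0" "degree ?b = 0" by auto
  then show 10: "hinner F1 F0 = 0" and 20: "hinner F2 F0 = 0"
    by (simp_all split: if_splits)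
  have F0: "F0 \<noteq> 0" using const[of 0] c by auto
  have "hinner (2 *s crs F0 F2) (crs F0 F1) = 0" using d(2) by (simp split: if_splits)
  then have "hinner (crs F0 F2) (crs F0 F1) = 0" by (simp add: hinner_scale_left)
  then have "hinner F0 F0 * hinner F2 F1 = 0" by (simp add: hinner_crs 20)
  then show "hinner F2 F1 = 0" using F0 by simp
qed

lemma orthogonal_forms:
  fixes F0 F1 F2 :: "complex ^ 3" and z w :: complex
  assumes o: "hinner F1 F0 = 0" "hinner F2 F0 = 0" "hinner F2 F1 = 0"
  defines "x \<equiv> hinner F0 F0" and "y \<equiv> hinner F1 F1" and "u \<equiv> hinner F2 F2"
  shows "hinner (F0 + z *s F1 + z\<^sup>2 *s F2) (F0 + w *s F1 + w\<^sup>2 *s F2)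
      * hinner (crs F0 F1 + z *s (2 *s crs F0 F2) + z\<^sup>2 *s crs F1 F2)
          (crs F0 F1 + w *s (2 *s crs F0 F2) + w\<^sup>2 *s crs F1 F2)
    = poly [:x\<^sup>2 * y, 4 * x\<^sup>2 * u + x * y\<^sup>2, 6 * x * y * u, 4 * x * u\<^sup>2 + y\<^sup>2 * u, y * u\<^sup>2:] (z * cnj w)"
proof -
  have o': "hinner F0 F1 = 0" "hinner F0 F2 = 0" "hinner F1 F2 = 0"
    using o hinner_eq_0_commute by blast+
  have "hinner (F0 + z *s F1 + z\<^sup>2 *s F2) (F0 + w *s F1 + w\<^sup>2 *s F2)
      = x + (z * cnj w) * y + (z * cnj w)\<^sup>2 * u"
    by (simp add: hinner_simps o o' x_def y_def u_def algebra_simps power2_eq_square)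
  moreover have "hinner (crs F0 F1 + z *s (2 *s crs F0 F2) + z\<^sup>2 *s crs F1 F2)
          (crs F0 F1 + w *s (2 *s crs F0 F2) + w\<^sup>2 *s crs F1 F2)
      = x * y + (z * cnj w) * (4 * x * u) + (z * cnj w)\<^sup>2 * (y * u)"
    by (simp add: hinner_simps hinner_crs o o' x_def y_def u_def algebra_simps power2_eq_square)
  ultimately show ?thesis by (simp add: algebra_simps power2_eq_square)
qed

lemma veronese_norms:
  fixes x y u k :: real and P :: "complex poly"
  assumes pos: "x > 0" "y > 0" "u > 0" "k > 0" and P0: "coeff P 0 = 0" and dP: "degree P \<le> 4"
    and rad: "\<And>z w. of_real k * poly [:of_real (x\<^sup>2 * y), of_real (4 * x\<^sup>2 * u + x * y\<^sup>2), of_real (6 * x * y * u),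
         of_real (4 * x * u\<^sup>2 + y\<^sup>2 * u), of_real (y * u\<^sup>2):] (z * cnj w) + poly P z * cnj (poly P w)
         = (1 + z * cnj w) ^ 4"
  shows "P = 0 \<and> y = 2 * x \<and> u = x"
proof -
  let ?A = "[:complex_of_real (x\<^sup>2 * y), of_real (4 * x\<^sup>2 * u + x * y\<^sup>2), of_real (6 * x * y * u),
         of_real (4 * x * u\<^sup>2 + y\<^sup>2 * u), of_real (y * u\<^sup>2):]"
  let ?B = "[:1, 4, 6, 4, 1:] :: complex poly"
  have B: "poly ?B t = (1 + t) ^ 4" for t :: complex
    by (simp add: algebra_simps power4_eq_xxxx)
  have "poly P z * cnj (poly P w) = poly (?B - smult (of_real k) ?A) (z * cnj w)" for z w
    using rad[of z w] unfolding poly_diff poly_smult B by (simp add: algebra_simps)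
  from poly_product_radial[OF this]
  have PP: "coeff P i * cnj (coeff P j) = (if i = j then coeff (?B - smult (of_real k) ?A) i else 0)" for i j .
  have sq: "coeff P i * cnj (coeff P i) = complex_of_real ((norm (coeff P i))\<^sup>2)" for i
    by (simp add: complex_norm_square del: of_real_power)
  have e0: "k * (x\<^sup>2 * y) = 1"
  proof -
    have "complex_of_real (1 - k * (x\<^sup>2 * y)) = 0" using PP[of 0 0] P0 by simp
    then show ?thesis by (simp only: of_real_eq_0_iff)
  qed
  have e1: "(norm (coeff P 1))\<^sup>2 = 4 - k * (4 * x\<^sup>2 * u + x * y\<^sup>2)"
  proof -
    have "complex_of_real ((norm (coeff P 1))\<^sup>2) = of_real (4 - k * (4 * x\<^sup>2 * u + x * y\<^sup>2))"
      using PP[of 1 1] unfolding sq by simp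
    then show ?thesis by (simp only: of_real_eq_iff)
  qed
  have e2: "(norm (coeff P 2))\<^sup>2 = 6 - k * (6 * x * y * u)"
  proof -
    have "complex_of_real ((norm (coeff P 2))\<^sup>2) = of_real (6 - k * (6 * x * y * u))"
      using PP[of 2 2] unfolding sq by (simp add: numeral_2_eq_2)
    then show ?thesis by (simp only: of_real_eq_iff)
  qed
  have e3: "(norm (coeff P 3))\<^sup>2 = 4 - k * (4 * x * u\<^sup>2 + y\<^sup>2 * u)"
  proof -
    have "complex_of_real ((norm (coeff P 3))\<^sup>2) = of_real (4 - k * (4 * x * u\<^sup>2 + y\<^sup>2 * u))"
      using PP[of 3 3] unfolding sq by (simp add: numeral_3_eq_3)
    then show ?thesis by (simp only: of_real_eq_iff)
  qed
  have e4: "(norm (coeff P 4))\<^sup>2 = 1 - k * (y * u\<^sup>2)"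
  proof -
    have "complex_of_real ((norm (coeff P 4))\<^sup>2) = of_real (1 - k * (y * u\<^sup>2))"
      using PP[of 4 4] unfolding sq by (simp add: numeral_eq_Suc)
    then show ?thesis by (simp only: of_real_eq_iff)
  qed
  have ux: "u = x" if "k * (y * u\<^sup>2) = 1"
  proof -
    have "(k * y) * u\<^sup>2 = (k * y) * x\<^sup>2" using that e0 by (simp add: algebra_simps)
    then have "u\<^sup>2 = x\<^sup>2" using pos by simp
    then show ?thesis using pos by simp
  qed
  have P4: "coeff P 4 = 0"
  proof (rule ccontr)
    assume n4: "coeff P 4 \<noteq> 0"
    have "coeff P 2 * cnj (coeff P 4) = 0" using PP[of 2 4] by simp
    then have "coeff P 2 = 0" using n4 by simp
    then have "k * (6 * x * y * u) = 6 * (k * (x\<^sup>2 * y))" using e2 e0 by simp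
    then have "(6 * k * x * y) * u = (6 * k * x * y) * x" by (simp add: algebra_simps power2_eq_square)
    then have "u = x" using pos by simp
    then show False using e4 e0 n4 by (simp add: mult_ac)
  qed
  then have ux: "u = x" using ux e4 by simp
  have "(norm (coeff P 1))\<^sup>2 = (norm (coeff P 3))\<^sup>2"
    unfolding e1 e3 ux by (simp add: algebra_simps power2_eq_square)
  then have n13: "norm (coeff P 1) = norm (coeff P 3)" by simp
  have "coeff P 1 * cnj (coeff P 3) = 0" using PP[of 1 3] by simp
  then have P13: "coeff P 1 = 0" "coeff P 3 = 0" using n13 by auto
  have "k * (4 * x\<^sup>2 * u + x * y\<^sup>2) = 4 * (k * (x\<^sup>2 * y))" using e1 P13 e0 by simp
  then have "(k * x) * (y - 2 * x)\<^sup>2 = 0" unfolding ux by (simp add: algebra_simps power2_eq_square)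
  then have yx: "y = 2 * x" using pos by simp
  have "k * (6 * x * y * u) = 6 * (k * (x\<^sup>2 * y))" unfolding ux by (simp add: power2_eq_square)
  then have "(norm (coeff P 2))\<^sup>2 = 0" unfolding e2 e0 by simp
  then have P2: "coeff P 2 = 0" by simp
  have "coeff P i = 0" for i
  proof (cases "i \<le> 4")
    case True
    then have "i = 0 \<or> i = 1 \<or> i = 2 \<or> i = 3 \<or> i = 4" by linarith
    then show ?thesis using P0 P13 P2 P4 by auto
  next
    case False
    then show ?thesis using dP by (simp add: coeff_eq_0)
  qed
  then have "P = 0" by (simp add: poly_eq_iff)
  then show ?thesis using yx ux by simp
qed

lemma quadratic_curve_rigidity:
  fixes F0 F1 F2 :: "complex ^ 3" and P Q :: "complex poly"
  assumes det: "hinner F0 (vcnj (crs F1 F2)) \<noteq> 0"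
    and id: "\<And>z. poly Q z * cnj (poly Q z)
      * hinner (F0 + z *s F1 + z\<^sup>2 *s F2) (F0 + z *s F1 + z\<^sup>2 *s F2)
      * hinner (crs F0 F1 + z *s (2 *s crs F0 F2) + z\<^sup>2 *s crs F1 F2)
          (crs F0 F1 + z *s (2 *s crs F0 F2) + z\<^sup>2 *s crs F1 F2)
      + poly P z * cnj (poly P z) = (1 + z * cnj z) ^ (m + 4)"
    and Q0: "Q \<noteq> 0" and dQ: "degree Q \<le> m" and dP: "degree P \<le> m + 4"
    and root: "if m = 0 then poly P 0 = 0 else poly Q 0 = 0"
  shows "P = 0 \<and> hinner F1 F0 = 0 \<and> hinner F2 F0 = 0 \<and> hinner F2 F1 = 0
     \<and> hinner F1 F1 = 2 * hinner F0 F0 \<and> hinner F2 F2 = hinner F0 F0"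
proof -
  define G where "G z w = hinner (F0 + z *s F1 + z\<^sup>2 *s F2) (F0 + w *s F1 + w\<^sup>2 *s F2)" for z w
  define H where "H z w = hinner (crs F0 F1 + z *s (2 *s crs F0 F2) + z\<^sup>2 *s crs F1 F2)
          (crs F0 F1 + w *s (2 *s crs F0 F2) + w\<^sup>2 *s crs F1 F2)" for z w
  define Fp where "Fp i = [:F0 $ i, F1 $ i, F2 $ i:]" for i
  define Mp where "Mp i = [:crs F0 F1 $ i, 2 * crs F0 F2 $ i, crs F1 F2 $ i:]" for i
  have GF: "G z w = (\<Sum>i\<in>UNIV. poly (Fp i) z * cnj (poly (Fp i) w))" for z w
    unfolding G_def hinner_def Fp_def by (rule sum.cong) (simp_all add: algebra_simps power2_eq_square)
  have HM: "H z w = (\<Sum>i\<in>UNIV. poly (Mp i) z * cnj (poly (Mp i) w))" for z w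
    unfolding H_def hinner_def Mp_def
    by (rule sum.cong) (simp_all add: algebra_simps power2_eq_square del: crs_nth)
  have pol: "poly Q z * cnj (poly Q w) * G z w * H z w + poly P z * cnj (poly P w) = (1 + z * cnj w) ^ (m + 4)" for z w
    unfolding GF HM
    by (rule poly_hermitian_identity_polarise) (use id in \<open>simp add: GF[symmetric] HM[symmetric] G_def H_def\<close>)
  have F12: "crs F1 F2 \<noteq> 0" using det by (intro notI) (simp add: hinner_def)
  have nz: "F0 \<noteq> 0" "F1 \<noteq> 0" "F2 \<noteq> 0" using det F12 by auto
  define x where "x = (norm F0)\<^sup>2"
  define y where "y = (norm F1)\<^sup>2"
  define u where "u = (norm F2)\<^sup>2"
  have xyu: "x > 0" "y > 0" "u > 0" using nz by (simp_all add: x_def y_def u_def)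
  have hx: "hinner F0 F0 = of_real x" "hinner F1 F1 = of_real y" "hinner F2 F2 = of_real u"
    by (simp_all add: x_def y_def u_def hinner_self)
  have GH0: "G z 0 * H z 0 = (hinner F0 F0 + z * hinner F1 F0 + z\<^sup>2 * hinner F2 F0)
      * (hinner (crs F0 F1) (crs F0 F1) + z * hinner (2 *s crs F0 F2) (crs F0 F1)
          + z\<^sup>2 * hinner (crs F1 F2) (crs F0 F1))" for z
    by (simp add: G_def H_def hinner_simps)
  have radial: "G z w * H z w = poly [:of_real (x\<^sup>2 * y), of_real (4 * x\<^sup>2 * u + x * y\<^sup>2), of_real (6 * x * y * u),
         of_real (4 * x * u\<^sup>2 + y\<^sup>2 * u), of_real (y * u\<^sup>2):] (z * cnj w)"
    if "hinner F1 F0 = 0" "hinner F2 F0 = 0" "hinner F2 F1 = 0" for z w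
    using orthogonal_forms[OF that, of z w] by (simp add: G_def H_def hx)
  show ?thesis
  proof (cases "m = 0")
    case True
    then obtain q where q: "Q = [:q:]" using dQ by (metis degree_eq_zeroE le_zero_eq)
    define k where "k = (norm q)\<^sup>2"
    have k: "k > 0" "q * cnj q = of_real k" using Q0 q
      by (simp_all add: k_def complex_norm_square del: of_real_power)
    have pk: "of_real k * (G z w * H z w) + poly P z * cnj (poly P w) = (1 + z * cnj w) ^ 4" for z w
      using pol[of z w] True by (simp add: q k(2)[symmetric] mult.assoc)
    have P0: "poly P 0 = 0" using root True by simp
    have const: "G z 0 * H z 0 = 1 / of_real k" for z
      using pk[of z 0] P0 k by (simp add: field_simps)
    have o: "hinner F1 F0 = 0" "hinner F2 F0 = 0" "hinner F2 F1 = 0"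
      using orthogonal_coefficients[of F0 F1 F2 "1 / of_real k"] const k unfolding GH0 by simp_all
    have "P = 0 \<and> y = 2 * x \<and> u = x"
    proof (rule veronese_norms[OF xyu k(1)])
      show "coeff P 0 = 0" using P0 by (simp add: poly_0_coeff_0)
      show "degree P \<le> 4" using dP True by simp
    qed (use pk radial[OF o] in simp)
    then show ?thesis using o hx by simp
  next
    case False
    then have rQ: "poly Q 0 = 0" using root by simp
    have P1: "poly P z * cnj (poly P 0) = 1" for z
      using pol[of z 0] rQ by simp
    then have PP: "poly P z * cnj (poly P w) = 1" for z w
    proof -
      have p0: "poly P 0 \<noteq> 0" using P1[of 0] by auto
      have "poly P z * cnj (poly P 0) = poly P 0 * cnj (poly P 0)" for z using P1[of z] P1[of 0] by simp
      then have "poly P z = poly P 0" for z using p0 by simp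
      then show ?thesis using P1 by metis
    qed
    have QGH: "poly Q z * cnj (poly Q w) * (G z w * H z w) = (1 + z * cnj w) ^ (m + 4) - 1" for z w
      using pol[of z w] PP[of z w] by (simp add: algebra_simps)
    have onlyz: "poly Q z \<noteq> 0" if "z \<noteq> 0" for z
    proof
      assume "poly Q z = 0"
      then have "(1 + z * cnj z) ^ (m + 4) = 1" using QGH[of z z] by simp
      moreover have "complex_of_real ((1 + (norm z)\<^sup>2) ^ (m + 4)) = (1 + z * cnj z) ^ (m + 4)"
        by (simp only: complex_norm_square[symmetric]) simp
      ultimately have "complex_of_real ((1 + (norm z)\<^sup>2) ^ (m + 4)) = of_real 1" by simp
      then have "(1 + (norm z)\<^sup>2) ^ (m + 4) = 1" by (simp only: of_real_eq_iff)
      moreover have "1 + (norm z)\<^sup>2 > 1" using that by simp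
      ultimately show False using one_less_power[of "1 + (norm z)\<^sup>2" "m + 4"] by simp
    qed
    obtain Q1 where Q1: "Q = [:0, 1:] ^ order 0 Q * Q1" "\<not> [:0, 1:] dvd Q1"
      using order_decomp[OF Q0, of 0] by auto
    have "poly Q1 z \<noteq> 0" for z
    proof (cases "z = 0")
      case True
      then show ?thesis using Q1(2) poly_eq_0_iff_dvd[of Q1 0] by auto
    next
      case False
      then show ?thesis using onlyz[OF False] Q1(1) by (metis mult_zero_right poly_mult)
    qed
    then have "degree Q1 = 0" using poly_root_exists[of Q1] by blast
    then obtain q where q: "Q1 = [:q:]" by (metis degree_eq_zeroE)
    have q0: "q \<noteq> 0" using Q1 Q0 q by auto
    define j where "j = order 0 Q"
    have Qz: "poly Q z = q * z ^ j" for z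
      unfolding Q1(1)[folded j_def] by (simp add: q poly_power mult.commute)
    have j0: "j \<noteq> 0" using rQ Qz[of 0] q0 by (intro notI) simp
    have exp: "(1 + t) ^ (m + 4) - 1 = t * poly (\<Sum>i<m + 4. monom (of_nat ((m + 4) choose Suc i)) i) t" for t :: complex
    proof -
      have "(1 + t) ^ (m + 4) = (\<Sum>i\<le>m + 4. of_nat ((m + 4) choose i) * t ^ i)"
        using binomial_ring[of t 1 "m + 4"] by (simp add: add.commute)
      also have "\<dots> = 1 + (\<Sum>i<m + 4. of_nat ((m + 4) choose Suc i) * t ^ Suc i)"
        by (subst sum.atMost_shift) simp
      finally show ?thesis by (simp add: poly_sum poly_monom sum_distrib_left mult_ac)
    qed
    define \<Phi> where "\<Phi> = (\<Sum>i<m + 4. monom (of_nat ((m + 4) choose Suc i)) i :: complex poly)"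
    have \<Phi>c: "coeff \<Phi> i = (if i < m + 4 then of_nat ((m + 4) choose Suc i) else 0)" for i
      by (simp add: \<Phi>_def coeff_sum sum.delta')
    define k where "k = (norm q)\<^sup>2"
    have k: "k > 0" "q * cnj q = of_real k" using q0
      by (simp_all add: k_def complex_norm_square del: of_real_power)
    have red: "of_real k * ((z * cnj w) ^ (j - 1) * (G z w * H z w)) = poly \<Phi> (z * cnj w)" if "z * cnj w \<noteq> 0" for z w
    proof -
      have "poly Q z * cnj (poly Q w) = of_real k * (z * cnj w) ^ j"
        by (simp add: Qz k(2)[symmetric] power_mult_distrib)
      also have "(z * cnj w) ^ j = (z * cnj w) * (z * cnj w) ^ (j - 1)"
        using j0 by (metis power_eq_if)
      finally have e: "poly Q z * cnj (poly Q w) = of_real k * ((z * cnj w) * (z * cnj w) ^ (j - 1))" .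
      have "(z * cnj w) * (of_real k * ((z * cnj w) ^ (j - 1) * (G z w * H z w))) = (z * cnj w) * poly \<Phi> (z * cnj w)"
        using QGH[of z w] unfolding e exp \<Phi>_def[symmetric] by (simp only: mult_ac)
      then show ?thesis using that by simp
    qed
    have GHpoly: "\<exists>A. degree A \<le> 4 \<and> (\<forall>z. poly A z = G z w * H z w)" for w
    proof -
      let ?a = "[:hinner F0 (F0 + w *s F1 + w\<^sup>2 *s F2), hinner F1 (F0 + w *s F1 + w\<^sup>2 *s F2), hinner F2 (F0 + w *s F1 + w\<^sup>2 *s F2):]"
      let ?v = "crs F0 F1 + w *s (2 *s crs F0 F2) + w\<^sup>2 *s crs F1 F2"
      let ?b = "[:hinner (crs F0 F1) ?v, hinner (2 *s crs F0 F2) ?v, hinner (crs F1 F2) ?v:]"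
      have "degree (?a * ?b) \<le> 2 + 2"
        by (rule order_trans[OF degree_mult_le add_mono]) (auto intro!: degree_le simp: coeff_pCons split: nat.splits)
      moreover have "poly (?a * ?b) z = G z w * H z w" for z
      proof -
        have "poly ?a z = G z w" by (simp add: G_def hinner_add_left hinner_scale_left algebra_simps power2_eq_square)
        moreover have "poly ?b z = H z w" by (simp add: H_def hinner_add_left hinner_scale_left algebra_simps power2_eq_square)
        ultimately show ?thesis by (simp only: poly_mult)
      qed
      ultimately show ?thesis by (intro exI[of _ "?a * ?b"]) simp
    qed
    obtain A where A: "degree A \<le> 4" "\<And>z. poly A z = G z 1 * H z 1" using GHpoly[of 1] by blast
    have "smult (of_real k) (monom 1 (j - 1) * A) = \<Phi>"
    proof (rule ccontr)
      assume "smult (of_real k) (monom 1 (j - 1) * A) \<noteq> \<Phi>"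
      then have "smult (of_real k) (monom 1 (j - 1) * A) - \<Phi> \<noteq> 0" by simp
      then have "finite {z. poly (smult (of_real k) (monom 1 (j - 1) * A) - \<Phi>) z = 0}" by (rule poly_roots_finite)
      moreover have "UNIV - {0} \<subseteq> {z. poly (smult (of_real k) (monom 1 (j - 1) * A) - \<Phi>) z = 0}"
        using red[of _ 1] by (auto simp: poly_monom A(2))
      ultimately have "finite (UNIV - {0 :: complex})" by (rule rev_finite_subset)
      then show False by (simp add: infinite_UNIV_char_0)
    qed
    then have A\<Phi>: "of_real k * coeff (monom 1 (j - 1) * A) i = coeff \<Phi> i" for i by (metis coeff_smult)
    have j1: "j = 1"
    proof (rule ccontr)
      assume "j \<noteq> 1"
      then have "coeff (monom 1 (j - 1) * A) 0 = 0" using j0 by (simp add: coeff_mult)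
      moreover have "coeff \<Phi> 0 \<noteq> 0"
      proof -
        have "(m + 4) choose Suc 0 \<noteq> 0" by simp
        then have "complex_of_nat ((m + 4) choose Suc 0) \<noteq> 0" by (simp only: of_nat_eq_0_iff not_False_eq_True)
        then show ?thesis by (simp only: \<Phi>c) simp
      qed
      ultimately show False using A\<Phi>[of 0] by simp
    qed
    have "m + 3 \<le> 4"
    proof (rule ccontr)
      assume "\<not> m + 3 \<le> 4"
      then have "coeff A (m + 3) = 0" using A(1) by (intro coeff_eq_0) simp
      then show False using A\<Phi>[of "m + 3"] j1 by (simp add: \<Phi>c)
    qed
    then have m1: "m = 1" using False by simp
    have red': "of_real k * (G z w * H z w) = poly \<Phi> (z * cnj w)" for z w
    proof -
      have nz: "of_real k * (G z w * H z w) = poly \<Phi> (z * cnj w)" if "w \<noteq> 0" for z w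
      proof -
        obtain A where A: "\<And>z. poly A z = G z w * H z w" using GHpoly[of w] by blast
        have "smult (of_real k) A = pcompose \<Phi> [:0, cnj w:]"
        proof (rule ccontr)
          assume "smult (of_real k) A \<noteq> pcompose \<Phi> [:0, cnj w:]"
          then have "smult (of_real k) A - pcompose \<Phi> [:0, cnj w:] \<noteq> 0" by simp
          then have "finite {z. poly (smult (of_real k) A - pcompose \<Phi> [:0, cnj w:]) z = 0}" by (rule poly_roots_finite)
          moreover have "UNIV - {0} \<subseteq> {z. poly (smult (of_real k) A - pcompose \<Phi> [:0, cnj w:]) z = 0}"
            using red[of _ w] that by (auto simp: j1 A poly_pcompose)
          ultimately have "finite (UNIV - {0 :: complex})" by (rule rev_finite_subset)
          then show False by (simp add: infinite_UNIV_char_0)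
        qed
        then have "poly (smult (of_real k) A) z = poly (pcompose \<Phi> [:0, cnj w:]) z" by simp
        then show ?thesis by (simp add: A poly_pcompose)
      qed
      have sym: "cnj (G z w * H z w) = G w z * H w z" for z w by (simp add: G_def H_def)
      show ?thesis
      proof (cases "w = 0 \<and> z = 0")
        case True
        have "((\<lambda>w. of_real k * (G 0 w * H 0 w)) \<longlongrightarrow> of_real k * (G 0 0 * H 0 0)) (at 0)"
          unfolding G_def H_def hinner_def by (auto intro!: tendsto_eq_intros sum.cong)
        moreover have "\<forall>\<^sub>F w in at 0. of_real k * (G 0 w * H 0 w) = poly \<Phi> 0"
          using nz[of _ 0] by (simp add: eventually_at_filter)
        ultimately have lim: "((\<lambda>w. poly \<Phi> 0) \<longlongrightarrow> of_real k * (G 0 0 * H 0 0)) (at (0 :: complex))"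
          by (rule Lim_transform_eventually)
        have "of_real k * (G 0 0 * H 0 0) = poly \<Phi> 0"
          by (rule tendsto_unique[OF at_neq_bot lim tendsto_const])
        then show ?thesis using True by simp
      next
        case F: False
        show ?thesis
        proof (cases "w = 0")
          case True
          then have "z \<noteq> 0" using F by simp
          from arg_cong[OF nz[OF this, of w], of cnj]
          have "of_real k * (G z w * H z w) = cnj (poly \<Phi> (w * cnj z))" unfolding complex_cnj_mult[of "of_real k"] sym by simp
          also have "\<dots> = poly \<Phi> (z * cnj w)" using True
            by (simp add: poly_0_coeff_0 \<Phi>c)
          finally show ?thesis .
        qed (rule nz)
      qed
    qed
    have \<Phi>5: "coeff \<Phi> 0 = 5" "coeff \<Phi> 1 = 10" "coeff \<Phi> 2 = 10" "coeff \<Phi> 3 = 5" "coeff \<Phi> 4 = 1"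
      unfolding \<Phi>c m1 by (simp_all add: numeral_eq_Suc)
    have const: "G z 0 * H z 0 = 5 / of_real k" for z
      using red'[of z 0] \<Phi>5(1) k by (simp add: poly_0_coeff_0 field_simps)
    have o: "hinner F1 F0 = 0" "hinner F2 F0 = 0" "hinner F2 F1 = 0"
      using orthogonal_coefficients[of F0 F1 F2 "5 / of_real k"] const k unfolding GH0 by simp_all
    have "\<Phi> = smult (of_real k) [:of_real (x\<^sup>2 * y), of_real (4 * x\<^sup>2 * u + x * y\<^sup>2), of_real (6 * x * y * u),
         of_real (4 * x * u\<^sup>2 + y\<^sup>2 * u), of_real (y * u\<^sup>2):]"
      (is "\<Phi> = smult _ ?A")
    proof (rule poly_ext)
      show "poly \<Phi> z = poly (smult (of_real k) ?A) z" for z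
        using red'[of z 1] unfolding radial[OF o, of z 1] by (simp only: poly_smult complex_cnj_one mult_1_right)
    qed
    then have c: "of_real (k * (x\<^sup>2 * y)) = coeff \<Phi> 0" "of_real (k * (4 * x\<^sup>2 * u + x * y\<^sup>2)) = coeff \<Phi> 1"
       "of_real (k * (4 * x * u\<^sup>2 + y\<^sup>2 * u)) = coeff \<Phi> 3" "of_real (k * (y * u\<^sup>2)) = coeff \<Phi> 4"
      by (simp_all add: numeral_eq_Suc)
    have "of_real (k * (x\<^sup>2 * y)) = complex_of_real 5" "of_real (k * (4 * x\<^sup>2 * u + x * y\<^sup>2)) = complex_of_real 10"
       "of_real (k * (4 * x * u\<^sup>2 + y\<^sup>2 * u)) = complex_of_real 5" "of_real (k * (y * u\<^sup>2)) = complex_of_real 1"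
      using c \<Phi>5 by simp_all
    then have r: "k * (x\<^sup>2 * y) = 5" "k * (4 * x\<^sup>2 * u + x * y\<^sup>2) = 10"
       "k * (4 * x * u\<^sup>2 + y\<^sup>2 * u) = 5" "k * (y * u\<^sup>2) = 1"
      by (simp_all only: of_real_eq_iff)
    define s where "s = k * (4 * x * u + y\<^sup>2)"
    have "x * s = 10" "u * s = 5" using r(2,3) by (simp_all add: s_def algebra_simps power2_eq_square)
    then have "s * (x - 2 * u) = 0" and "s \<noteq> 0" by (auto simp: algebra_simps)
    then have "x = 2 * u" by simp
    then have "k * (x\<^sup>2 * y) = 4 * (k * (y * u\<^sup>2))" by (simp add: power2_eq_square)
    then show ?thesis using r by simp
  qed
qed

subsection \<open>Homogeneous forms and linear substitutions\<close>

definition hom :: "nat \<Rightarrow> complex poly \<Rightarrow> complex \<Rightarrow> complex \<Rightarrow> complex" where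
  "hom k r x y = (\<Sum>i\<le>k. coeff r i * x ^ i * y ^ (k - i))"

definition pull :: "complex \<Rightarrow> complex \<Rightarrow> complex \<Rightarrow> complex \<Rightarrow> nat \<Rightarrow> complex poly \<Rightarrow> complex poly" where
  "pull a b c d k r = (\<Sum>i\<le>k. smult (coeff r i) ([:b, a:] ^ i * [:d, c:] ^ (k - i)))"

lemma poly_pull: "poly (pull a b c d k r) z = hom k r (a * z + b) (c * z + d)"
  by (simp add: pull_def hom_def poly_sum poly_power algebra_simps)

lemma degree_linear_power: "degree ([:b, a :: complex:] ^ i) \<le> i"
proof -
  have "degree ([:b, a:] ^ i) \<le> degree [:b, a:] * i" by (rule degree_power_le)
  also have "\<dots> \<le> 1 * i" by (intro mult_right_mono) simp_all
  finally show ?thesis by simp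
qed

lemma degree_pull: "degree (pull a b c d k r) \<le> k"
  unfolding pull_def
proof (rule degree_sum_le)
  fix i assume i: "i \<in> {..k}"
  have "degree ([:b, a:] ^ i * [:d, c:] ^ (k - i)) \<le> i + (k - i)"
    by (rule order_trans[OF degree_mult_le add_mono[OF degree_linear_power degree_linear_power]])
  then show "degree (smult (coeff r i) ([:b, a:] ^ i * [:d, c:] ^ (k - i))) \<le> k"
    using i degree_smult_le[of "coeff r i" "[:b, a:] ^ i * [:d, c:] ^ (k - i)"] by simp
qed simp

lemma hom_eq_poly:
  assumes "degree r \<le> k" "y \<noteq> 0"
  shows "hom k r x y = y ^ k * poly r (x / y)"
proof -
  have "poly r (x / y) = (\<Sum>i\<le>k. coeff r i * (x / y) ^ i)"
    unfolding poly_altdef using assms(1) by (intro sum.mono_neutral_left) (auto simp: coeff_eq_0)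
  then have "y ^ k * poly r (x / y) = (\<Sum>i\<le>k. y ^ k * (coeff r i * (x / y) ^ i))"
    by (simp add: sum_distrib_left)
  also have "\<dots> = hom k r x y"
    unfolding hom_def
  proof (rule sum.cong)
    fix i assume "i \<in> {..k}"
    then have "y ^ k = y ^ i * y ^ (k - i)" by (simp add: power_add[symmetric])
    then show "y ^ k * (coeff r i * (x / y) ^ i) = coeff r i * x ^ i * y ^ (k - i)"
      using assms(2) by (simp add: power_divide)
  qed simp
  finally show ?thesis by simp
qed

lemma pull_eq_0:
  assumes "degree r \<le> k" "a * d - b * c \<noteq> 0" "pull a b c d k r = 0"
  shows "r = 0"
proof (rule ccontr)
  assume "r \<noteq> 0"
  then have "finite {z. poly r z = 0}" by (rule poly_roots_finite)
  moreover have "UNIV - {z. c * z = a} \<subseteq> {z. poly r z = 0}"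
  proof
    fix w assume "w \<in> UNIV - {z. c * z = a}"
    then have ne: "a - c * w \<noteq> 0" by auto
    define z where "z = (d * w - b) / (a - c * w)"
    have x: "a * z + b = (a * d - b * c) * w / (a - c * w)" and y: "c * z + d = (a * d - b * c) / (a - c * w)"
      using ne by (simp_all add: z_def field_simps)
    have "hom k r (a * z + b) (c * z + d) = 0" using assms(3) poly_pull[of a b c d k r z] by simp
    moreover have "c * z + d \<noteq> 0" using y assms(2) ne by simp
    moreover have "(a * z + b) / (c * z + d) = w" unfolding x y using assms(2) ne by simp
    ultimately have "poly r w = 0" using hom_eq_poly[OF assms(1), of "c * z + d" "a * z + b"] by simp
    then show "w \<in> {z. poly r z = 0}" by simp
  qed
  ultimately have "finite (UNIV - {z. c * z = a})" by (rule rev_finite_subset)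
  moreover have "finite {z. c * z = a}"
  proof (cases "c = 0")
    case True
    then have "a \<noteq> 0" using assms(2) by auto
    then show ?thesis using True by simp
  next
    case False
    then have "{z. c * z = a} \<subseteq> {a / c}" by (auto simp: field_simps)
    then show ?thesis by (rule finite_subset) simp
  qed
  ultimately have "finite (UNIV :: complex set)" by (metis finite_Diff2)
  then show False by (simp add: infinite_UNIV_char_0)
qed

lemma hom_root:
  assumes "degree r \<le> k" "k \<noteq> 0"
  shows "\<exists>x y. (x \<noteq> 0 \<or> y \<noteq> 0) \<and> hom k r x y = 0"
proof (cases "degree r = k")
  case True
  then obtain z where "poly r z = 0" using poly_root_exists[of r] assms(2) by auto
  then have "hom k r z 1 = 0" using hom_eq_poly[OF assms(1), of 1 z] by simp
  then show ?thesis by (intro exI[of _ z] exI[of _ 1]) simp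
next
  case False
  then have "coeff r k = 0" using assms(1) by (intro coeff_eq_0) simp
  then have "hom k r 1 0 = 0" unfolding hom_def by (intro sum.neutral) (auto simp: power_0_left)
  then show ?thesis by (intro exI[of _ 1] exI[of _ 0]) simp
qed

lemma vcnj_add: "vcnj (u + v) = vcnj u + vcnj v" by (simp add: vec_eq_iff)

lemma quadratic_substitution:
  fixes fa fb fc :: "complex ^ 3" and a b c d x y z :: complex
  defines "fh \<equiv> \<lambda>x y. y\<^sup>2 *s fa + (x * y) *s fb + x\<^sup>2 *s fc"
    and "\<mu>h \<equiv> \<lambda>x y. y\<^sup>2 *s crs fa fb + (2 * x * y) *s crs fa fc + x\<^sup>2 *s crs fb fc"
  defines "F0 \<equiv> fh b d" and "F2 \<equiv> fh a c"
    and "F1 \<equiv> (2 * c * d) *s fa + (a * d + b * c) *s fb + (2 * a * b) *s fc"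
  shows "fh (a * x + b * y) (c * x + d * y) = y\<^sup>2 *s F0 + (x * y) *s F1 + x\<^sup>2 *s F2"
    "crs F0 F1 + z *s (2 *s crs F0 F2) + z\<^sup>2 *s crs F1 F2 = (a * d - b * c) *s \<mu>h (a * z + b) (c * z + d)"
    "hinner F0 (vcnj (crs F1 F2)) = (a * d - b * c) ^ 3 * hinner fa (vcnj (crs fb fc))"
proof -
  show "fh (a * x + b * y) (c * x + d * y) = y\<^sup>2 *s F0 + (x * y) *s F1 + x\<^sup>2 *s F2"
    by (simp add: fh_def F0_def F1_def F2_def vec_eq_iff algebra_simps power2_eq_square)
  have c01: "crs F0 F1 = (a * d - b * c) *s \<mu>h b d"
    unfolding F0_def F1_def fh_def \<mu>h_def vec_eq_iff forall_3
    by (simp add: algebra_simps power2_eq_square)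
  have c12: "crs F1 F2 = (a * d - b * c) *s \<mu>h a c"
    unfolding F2_def F1_def fh_def \<mu>h_def vec_eq_iff forall_3
    by (simp add: algebra_simps power2_eq_square)
  have c02: "crs F0 F2 = (a * d - b * c) *s ((c * d) *s crs fa fb + (a * d + b * c) *s crs fa fc + (a * b) *s crs fb fc)"
    unfolding F2_def F0_def fh_def vec_eq_iff forall_3
    by (simp add: algebra_simps power2_eq_square)
  show "crs F0 F1 + z *s (2 *s crs F0 F2) + z\<^sup>2 *s crs F1 F2 = (a * d - b * c) *s \<mu>h (a * z + b) (c * z + d)"
  proof -
    have "\<mu>h (a * z + b) (c * z + d) = \<mu>h b d + z *s (2 *s ((c * d) *s crs fa fb + (a * d + b * c) *s crs fa fc + (a * b) *s crs fb fc)) + z\<^sup>2 *s \<mu>h a c"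
      by (simp add: \<mu>h_def vec_eq_iff algebra_simps power2_eq_square del: crs_nth)
    then show ?thesis
      unfolding c01 c12 c02 by (simp add: vec_eq_iff algebra_simps del: crs_nth)
  qed
  have "hinner F0 (vcnj (crs F1 F2)) = (a * d - b * c) * hinner (fh b d) (vcnj (\<mu>h a c))"
    unfolding c12 vcnj_scale hinner_scale_right complex_cnj_cnj F0_def ..
  also have "hinner (fh b d) (vcnj (\<mu>h a c)) = (a * d - b * c)\<^sup>2 * hinner fa (vcnj (crs fb fc))"
  proof -
    define T where "T = hinner fa (vcnj (crs fb fc))"
    have t: "hinner fa (vcnj (crs fa fb)) = 0" "hinner fa (vcnj (crs fa fc)) = 0" "hinner fa (vcnj (crs fb fc)) = T"
      "hinner fb (vcnj (crs fa fb)) = 0" "hinner fb (vcnj (crs fa fc)) = - T" "hinner fb (vcnj (crs fb fc)) = 0"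
      "hinner fc (vcnj (crs fa fb)) = T" "hinner fc (vcnj (crs fa fc)) = 0" "hinner fc (vcnj (crs fb fc)) = 0"
      by (simp_all add: T_def hinner_3 algebra_simps)
    show ?thesis
      unfolding fh_def \<mu>h_def vcnj_add vcnj_scale hinner_add_left hinner_add_right hinner_scale_left hinner_scale_right
        complex_cnj_cnj t
      by (simp add: algebra_simps power2_eq_square)
  qed
  finally show "hinner F0 (vcnj (crs F1 F2)) = (a * d - b * c) ^ 3 * hinner fa (vcnj (crs fb fc))"
    by (simp add: power2_eq_square power3_eq_cube)
qed

lemma hermitian_form_basis:
  fixes v0 c :: real and \<beta> x0 y0 :: complex
  assumes pos: "c > 0" "(norm \<beta>)\<^sup>2 < v0 * c" and nz: "x0 \<noteq> 0 \<or> y0 \<noteq> 0"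
  defines "vh \<equiv> \<lambda>x y. v0 * (norm y)\<^sup>2 + 2 * Re (\<beta> * x * cnj y) + c * (norm x)\<^sup>2"
  shows "\<exists>a b a' d t. t \<noteq> 0 \<and> b = t * x0 \<and> d = t * y0 \<and> a * d - b * a' \<noteq> 0
    \<and> (\<forall>z. vh (a * z + b) (a' * z + d) = 1 + (norm z)\<^sup>2)"
proof -
  have vpos: "vh x y > 0" if "x \<noteq> 0 \<or> y \<noteq> 0" for x y
  proof -
    have "c * vh x y = (norm (of_real c * x + cnj \<beta> * y))\<^sup>2 + (v0 * c - (norm \<beta>)\<^sup>2) * (norm y)\<^sup>2"
      unfolding vh_def cmod_power2 by (simp add: power2_eq_square algebra_simps)
    also have "\<dots> > 0"
    proof (cases "y = 0")
      case True
      then show ?thesis using that pos by simp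
    next
      case False
      then show ?thesis using pos by (intro add_nonneg_pos mult_pos_pos) auto
    qed
    finally show ?thesis using pos(1) by (simp add: zero_less_mult_iff)
  qed
  have vscale: "vh (t * x) (t * y) = (norm t)\<^sup>2 * vh x y" for t x y
  proof -
    have "\<beta> * (t * x) * cnj (t * y) = complex_of_real ((norm t)\<^sup>2) * (\<beta> * x * cnj y)"
      by (simp only: complex_norm_square) (simp add: mult_ac)
    then have "Re (\<beta> * (t * x) * cnj (t * y)) = (norm t)\<^sup>2 * Re (\<beta> * x * cnj y)"
      by (simp only: Re_complex_of_real Im_complex_of_real times_complex.sel) 
    then show ?thesis by (simp add: vh_def norm_mult power_mult_distrib algebra_simps)
  qed
  define B where "B x y x' y' = of_real v0 * y * cnj y' + \<beta> * x * cnj y' + cnj \<beta> * y * cnj x' + of_real c * x * cnj x'" for x y x' y'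
  have vadd: "vh (a * z + b) (a' * z + d) = (norm z)\<^sup>2 * vh a a' + 2 * Re (z * B a a' b d) + vh b d" for a b a' d z
    unfolding vh_def B_def cmod_power2 by (simp add: power2_eq_square algebra_simps)
  define t where "t = complex_of_real (1 / sqrt (vh x0 y0))"
  have t: "t \<noteq> 0" "(norm t)\<^sup>2 * vh x0 y0 = 1" using vpos[OF nz]
    by (simp_all add: t_def norm_divide power_divide)
  define b where "b = t * x0"
  define d where "d = t * y0"
  have vbd: "vh b d = 1" using t(2) by (simp add: b_def d_def vscale)
  define p where "p = of_real v0 * cnj d + cnj \<beta> * cnj b"
  define p' where "p' = - (\<beta> * cnj d + of_real c * cnj b)"
  have Bp: "B p p' b d = 0" by (simp add: B_def p_def p'_def algebra_simps)
  have dp: "p * d - b * p' = 1"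
  proof -
    have "p * d - b * p' = of_real v0 * (d * cnj d) + (\<beta> * b * cnj d + cnj (\<beta> * b * cnj d)) + of_real c * (b * cnj b)"
      by (simp add: p_def p'_def algebra_simps)
    also have "\<dots> = of_real (vh b d)"
      unfolding complex_add_cnj complex_norm_square[symmetric] vh_def by simp
    finally show ?thesis by (simp add: vbd)
  qed
  then have "p \<noteq> 0 \<or> p' \<noteq> 0" by auto
  then have vp: "vh p p' > 0" by (rule vpos)
  define s where "s = complex_of_real (1 / sqrt (vh p p'))"
  have s: "s \<noteq> 0" "(norm s)\<^sup>2 * vh p p' = 1" using vp by (simp_all add: s_def norm_divide power_divide)
  have "vh (s * p * z + b) (s * p' * z + d) = 1 + (norm z)\<^sup>2" for z
  proof -
    have "B (s * p) (s * p') b d = s * B p p' b d" by (simp add: B_def algebra_simps)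
    then show ?thesis using s(2) by (simp add: vadd vscale vbd Bp)
  qed
  moreover have "(s * p) * d - b * (s * p') \<noteq> 0"
  proof -
    have "(s * p) * d - b * (s * p') = s * (p * d - b * p')" by (simp add: algebra_simps)
    then show ?thesis using dp s by simp
  qed
  ultimately show ?thesis using t(1) b_def d_def by blast
qed

definition vero :: "complex \<Rightarrow> complex \<Rightarrow> complex ^ 3" where
  "vero x y = vector [y\<^sup>2, of_real (sqrt 2) * x * y, x\<^sup>2]"

lemma orthogonal_frame_unitary:
  fixes F0 F1 F2 :: "complex ^ 3"
  assumes o: "hinner F1 F0 = 0" "hinner F2 F0 = 0" "hinner F2 F1 = 0"
    and n: "hinner F1 F1 = 2 * hinner F0 F0" "hinner F2 F2 = hinner F0 F0" and F0: "F0 \<noteq> 0"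
  shows "\<exists>U s. unitary U \<and> s \<noteq> 0 \<and> (\<forall>x y. y\<^sup>2 *s F0 + (x * y) *s F1 + x\<^sup>2 *s F2 = s *s (U *v vero x y))"
proof -
  define r where "r = norm F0"
  have r: "r > 0" using F0 by (simp add: r_def)
  have h0: "hinner F0 F0 = of_real (r\<^sup>2)" by (simp add: hinner_self r_def)
  define e0 where "e0 = complex_of_real (1 / r) *s F0"
  define e1 where "e1 = complex_of_real (1 / (sqrt 2 * r)) *s F1"
  define e2 where "e2 = complex_of_real (1 / r) *s F2"
  have o': "hinner F0 F1 = 0" "hinner F0 F2 = 0" "hinner F1 F2 = 0"
    using o hinner_eq_0_commute by blast+
  have e: "hinner e0 e0 = 1" "hinner e1 e1 = 1" "hinner e2 e2 = 1"
    "hinner e0 e1 = 0" "hinner e0 e2 = 0" "hinner e1 e2 = 0" "hinner e1 e0 = 0" "hinner e2 e0 = 0" "hinner e2 e1 = 0"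
  proof -
    have "complex_of_real (sqrt 2) * complex_of_real (sqrt 2) = 2"
      by (simp only: of_real_mult[symmetric]) simp
    then show "hinner e0 e0 = 1" "hinner e1 e1 = 1" "hinner e2 e2 = 1"
    "hinner e0 e1 = 0" "hinner e0 e2 = 0" "hinner e1 e2 = 0" "hinner e1 e0 = 0" "hinner e2 e0 = 0" "hinner e2 e1 = 0"
      using r by (simp_all add: e0_def e1_def e2_def hinner_scale_left hinner_scale_right o o' n h0 power2_eq_square field_simps)
  qed
  define U :: "complex ^ 3 ^ 3" where "U = (\<chi> i j. (if j = 1 then e0 else if j = 2 then e1 else e2) $ i)"
  have "adj U ** U = mat 1"
  proof -
    have "(adj U ** U) $ i $ j = hinner (if j = 1 then e0 else if j = 2 then e1 else e2) (if i = 1 then e0 else if i = 2 then e1 else e2)" for i j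
      by (simp add: matrix_matrix_mult_def adj_def U_def hinner_def mult.commute)
    then have "(adj U ** U) $ i $ j = mat 1 $ i $ j" for i j
      using exhaust_3[of i] exhaust_3[of j] e by (elim disjE) (simp_all add: mat_def)
    then show ?thesis by (simp add: vec_eq_iff)
  qed
  then have "unitary U" using matrix_left_right_inverse[of "adj U" U] by (simp add: unitary_def)
  moreover have "y\<^sup>2 *s F0 + (x * y) *s F1 + x\<^sup>2 *s F2 = complex_of_real r *s (U *v vero x y)" for x y
  proof -
    have "U *v vero x y = y\<^sup>2 *s e0 + (of_real (sqrt 2) * x * y) *s e1 + x\<^sup>2 *s e2"
      by (simp add: vec_eq_iff matrix_vector_mult_def sum_3 U_def vero_def mult.commute)
    then show ?thesis using r
      by (simp add: e0_def e1_def e2_def vec.scale_right_distrib vector_smult_assoc field_simps)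
  qed
  ultimately show ?thesis using r by (intro exI[of _ U] exI[of _ "complex_of_real r"]) auto
qed

theorem curve_normal_form:
  fixes f0 f1 f2 :: "complex ^ 3" and p q :: "complex poly" and v0 c :: real
  assumes det: "hinner f0 (vcnj (crs f1 f2)) \<noteq> 0"
    and id: "\<And>z. poly q z * cnj (poly q z) * hinner (f0 + z *s f1 + z\<^sup>2 *s f2) (f0 + z *s f1 + z\<^sup>2 *s f2)
        * hinner (crs f0 f1 + (2 * z) *s crs f0 f2 + z\<^sup>2 *s crs f1 f2) (crs f0 f1 + (2 * z) *s crs f0 f2 + z\<^sup>2 *s crs f1 f2)
        + poly p z * cnj (poly p z) = of_real ((v0 + 2 * Re (\<beta> * z) + c * (norm z)\<^sup>2) ^ (m + 4))"
    and q0: "q \<noteq> 0" and dq: "degree q \<le> m" and dp: "degree p \<le> m + 4"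
    and pos: "c > 0" "(norm \<beta>)\<^sup>2 < v0 * c"
  shows "p = 0 \<and> (\<exists>a b a' d U s. a * d - b * a' \<noteq> 0 \<and> unitary U \<and> s \<noteq> 0 \<and>
    (\<forall>x y. (a' * x + d * y)\<^sup>2 *s f0 + ((a * x + b * y) * (a' * x + d * y)) *s f1 + (a * x + b * y)\<^sup>2 *s f2
       = s *s (U *v vero x y)))"
proof -
  define fh where "fh x y = y\<^sup>2 *s f0 + (x * y) *s f1 + x\<^sup>2 *s f2" for x y
  define \<mu>h where "\<mu>h x y = y\<^sup>2 *s crs f0 f1 + (2 * x * y) *s crs f0 f2 + x\<^sup>2 *s crs f1 f2" for x y
  define vh where "vh x y = v0 * (norm y)\<^sup>2 + 2 * Re (\<beta> * x * cnj y) + c * (norm x)\<^sup>2" for x y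
  have hom_id: "hom m q x y * cnj (hom m q x y) * hinner (fh x y) (fh x y) * hinner (\<mu>h x y) (\<mu>h x y)
      + hom (m + 4) p x y * cnj (hom (m + 4) p x y) = of_real (vh x y ^ (m + 4))" (is "?L x y = ?R x y") for x y
  proof -
    have 1: "?L x y = ?R x y" if y: "y \<noteq> 0" for y
    proof -
      define z where "z = x / y"
      have x: "x = z * y" using y by (simp add: z_def)
      have h: "hom m q x y = y ^ m * poly q z" "hom (m + 4) p x y = y ^ (m + 4) * poly p z"
        using hom_eq_poly[OF dq y] hom_eq_poly[OF dp y] by (simp_all add: z_def)
      have f: "fh x y = y\<^sup>2 *s (f0 + z *s f1 + z\<^sup>2 *s f2)"
        by (simp add: fh_def x vec_eq_iff algebra_simps power2_eq_square)
      have \<mu>: "\<mu>h x y = y\<^sup>2 *s (crs f0 f1 + (2 * z) *s crs f0 f2 + z\<^sup>2 *s crs f1 f2)"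
        by (simp add: \<mu>h_def x vec_eq_iff algebra_simps power2_eq_square del: crs_nth)
      have v: "vh x y = (norm y)\<^sup>2 * (v0 + 2 * Re (\<beta> * z) + c * (norm z)\<^sup>2)"
      proof -
        have "\<beta> * x * cnj y = complex_of_real ((norm y)\<^sup>2) * (\<beta> * z)"
          unfolding complex_norm_square x by (simp add: mult_ac)
        then have "Re (\<beta> * x * cnj y) = (norm y)\<^sup>2 * Re (\<beta> * z)"
          by (simp only: Re_complex_of_real Im_complex_of_real times_complex.sel)
        then show ?thesis by (simp add: vh_def x norm_mult power_mult_distrib algebra_simps)
      qed
      have "?R x y = (y * cnj y) ^ (m + 4) * of_real ((v0 + 2 * Re (\<beta> * z) + c * (norm z)\<^sup>2) ^ (m + 4))"
        unfolding v power_mult_distrib of_real_mult of_real_power[of "(norm y)\<^sup>2"] complex_norm_square ..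
      also have "\<dots> = ?L x y"
        unfolding id[of z, symmetric] h f \<mu> hinner_scale_left hinner_scale_right
        by (simp add: power_mult_distrib power_add algebra_simps power2_eq_square power4_eq_xxxx)
      finally show ?thesis by simp
    qed
    show ?thesis
    proof (cases "y = 0")
      case True
      have l1: "((\<lambda>y. ?L x y) \<longlongrightarrow> ?L x 0) (at 0)"
        unfolding hom_def fh_def \<mu>h_def hinner_def by (auto intro!: tendsto_eq_intros sum.cong)
      have l2: "((\<lambda>y. ?R x y) \<longlongrightarrow> ?R x 0) (at 0)"
        unfolding vh_def by (auto intro!: tendsto_eq_intros)
      have ev: "\<forall>\<^sub>F y in at 0. ?R x y = ?L x y"
        using 1 by (simp add: eventually_at_filter)
      have "?L x 0 = ?R x 0"
        by (rule tendsto_unique[OF at_neq_bot l1 Lim_transform_eventually[OF l2 ev]])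
      then show ?thesis using True by simp
    qed (rule 1)
  qed
  obtain x0 y0 where xy: "x0 \<noteq> 0 \<or> y0 \<noteq> 0" "if m = 0 then hom (m + 4) p x0 y0 = 0 else hom m q x0 y0 = 0"
    using hom_root[OF dp] hom_root[OF dq] by (cases "m = 0") auto
  from hermitian_form_basis[OF pos xy(1)]
  obtain a b a' d t where T: "t \<noteq> 0" "b = t * x0" "d = t * y0" "a * d - b * a' \<noteq> 0"
     "\<And>z. vh (a * z + b) (a' * z + d) = 1 + (norm z)\<^sup>2" unfolding vh_def by blast
  define \<Delta> where "\<Delta> = a * d - b * a'"
  define F0 where "F0 = fh b d"
  define F2 where "F2 = fh a a'"
  define F1 where "F1 = (2 * a' * d) *s f0 + (a * d + b * a') *s f1 + (2 * a * b) *s f2"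
  define Q where "Q = smult (1 / \<Delta>) (pull a b a' d m q)"
  define P where "P = pull a b a' d (m + 4) p"
  have sub: "fh (a * x + b * y) (a' * x + d * y) = y\<^sup>2 *s F0 + (x * y) *s F1 + x\<^sup>2 *s F2" for x y
    using quadratic_substitution(1)[where a = a and b = b and c = a' and d = d and fa = f0 and fb = f1 and fc = f2 and x = x and y = y] unfolding F0_def F1_def F2_def fh_def .
  have subm: "crs F0 F1 + z *s (2 *s crs F0 F2) + z\<^sup>2 *s crs F1 F2 = \<Delta> *s \<mu>h (a * z + b) (a' * z + d)" for z
    using quadratic_substitution(2)[where a = a and b = b and c = a' and d = d and fa = f0 and fb = f1 and fc = f2 and z = z] unfolding F0_def F1_def F2_def fh_def \<mu>h_def \<Delta>_def .
  have hz: "hom k r (t * x) (t * y) = t ^ k * hom k r x y" for k r x y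
  proof -
    have "hom k r (t * x) (t * y) = (\<Sum>i\<le>k. t ^ k * (coeff r i * x ^ i * y ^ (k - i)))"
      unfolding hom_def
    proof (rule sum.cong)
      fix i assume "i \<in> {..k}"
      then have "t ^ k = t ^ i * t ^ (k - i)" by (simp add: power_add[symmetric])
      then show "coeff r i * (t * x) ^ i * (t * y) ^ (k - i) = t ^ k * (coeff r i * x ^ i * y ^ (k - i))"
        by (simp add: power_mult_distrib mult_ac)
    qed simp
    then show ?thesis by (simp add: hom_def sum_distrib_left)
  qed
  have rig: "P = 0 \<and> hinner F1 F0 = 0 \<and> hinner F2 F0 = 0 \<and> hinner F2 F1 = 0
     \<and> hinner F1 F1 = 2 * hinner F0 F0 \<and> hinner F2 F2 = hinner F0 F0"
  proof (rule quadratic_curve_rigidity[where Q = Q and m = m])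
    show "hinner F0 (vcnj (crs F1 F2)) \<noteq> 0"
      using quadratic_substitution(3)[where a = a and b = b and c = a' and d = d and fa = f0 and fb = f1 and fc = f2] T(4) det unfolding F0_def F1_def F2_def fh_def by simp
    show "Q \<noteq> 0"
      using pull_eq_0[OF dq T(4)] q0 T(4) by (auto simp: Q_def \<Delta>_def)
    show "degree Q \<le> m" unfolding Q_def by (rule order_trans[OF degree_smult_le degree_pull])
    show "degree P \<le> m + 4" unfolding P_def by (rule degree_pull)
    show "if m = 0 then poly P 0 = 0 else poly Q 0 = 0"
      using xy(2) by (auto simp: P_def Q_def poly_pull T(2,3) hz)
    fix z
    let ?x = "a * z + b" and ?y = "a' * z + d"
    have e: "poly Q z * cnj (poly Q z) * hinner (\<Delta> *s \<mu>h ?x ?y) (\<Delta> *s \<mu>h ?x ?y)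
       = hom m q ?x ?y * cnj (hom m q ?x ?y) * hinner (\<mu>h ?x ?y) (\<mu>h ?x ?y)"
      using T(4) by (simp add: Q_def poly_pull hinner_scale_left hinner_scale_right \<Delta>_def[symmetric])
    have f: "F0 + z *s F1 + z\<^sup>2 *s F2 = fh ?x ?y" using sub[of z 1] by simp
    have r: "of_real (vh ?x ?y ^ (m + 4)) = (1 + z * cnj z) ^ (m + 4)"
      unfolding T(5) by (simp add: complex_norm_square[symmetric])
    have ac: "A * A' * C * B + D = X * X' * C * Y + D" if "A * A' * B = X * X' * Y" for A A' B C D X X' Y :: complex
    proof -
      have "A * A' * C * B = (A * A' * B) * C" by (simp only: mult_ac)
      also have "\<dots> = X * X' * C * Y" unfolding that by (simp only: mult_ac)
      finally show ?thesis by simp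
    qed
    show "poly Q z * cnj (poly Q z)
      * hinner (F0 + z *s F1 + z\<^sup>2 *s F2) (F0 + z *s F1 + z\<^sup>2 *s F2)
      * hinner (crs F0 F1 + z *s (2 *s crs F0 F2) + z\<^sup>2 *s crs F1 F2)
          (crs F0 F1 + z *s (2 *s crs F0 F2) + z\<^sup>2 *s crs F1 F2)
      + poly P z * cnj (poly P z) = (1 + z * cnj z) ^ (m + 4)"
      unfolding subm f r[symmetric] hom_id[symmetric] P_def poly_pull by (rule ac[OF e])
  qed
  have p0: "p = 0" using rig pull_eq_0[OF dp T(4)] by (simp add: P_def)
  have "F0 \<noteq> 0"
  proof
    assume "F0 = 0"
    then have "hinner F0 (vcnj (crs F1 F2)) = 0" by simp
    then show False
      using quadratic_substitution(3)[where a = a and b = b and c = a' and d = d and fa = f0 and fb = f1 and fc = f2] T(4) det unfolding F0_def F1_def F2_def fh_def by simp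
  qed
  then obtain U s where "unitary U" "s \<noteq> 0" "\<And>x y. y\<^sup>2 *s F0 + (x * y) *s F1 + x\<^sup>2 *s F2 = s *s (U *v vero x y)"
    using orthogonal_frame_unitary rig by blast
  then show ?thesis using p0 T(4) sub unfolding fh_def by metis
qed

subsection \<open>Calculus of smooth functions\<close>

lemma Ck_SucD: "Ck (Suc k) f \<Longrightarrow> Ck k f"
proof (induction k arbitrary: f)
  case 0
  have "isCont f x" for x
  proof -
    have "f differentiable (at x)" using 0 by simp
    then show ?thesis by (rule differentiable_imp_continuous_within)
  qed
  then show ?case by (simp add: continuous_at_imp_continuous_on)
next
  case (Suc k)
  then show ?case unfolding Ck.simps(2)[of "Suc k"] Ck.simps(2)[of k] by blast
qed

lemma frechet_derivative_eqI: "(f has_derivative f') (at x) \<Longrightarrow> frechet_derivative f (at x) = f'"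
  by (rule frechet_derivative_at[symmetric])

lemma Ck_SucI:
  assumes "\<And>x. (f has_derivative D x) (at x)" "\<And>b. b \<in> Basis \<Longrightarrow> Ck k (\<lambda>x. D x b)"
  shows "Ck (Suc k) f"
proof -
  have "f differentiable (at x)" for x using assms(1)[of x] unfolding differentiable_def by blast
  moreover have "Ck k (\<lambda>x. frechet_derivative f (at x) b)" if "b \<in> Basis" for b
    unfolding frechet_derivative_eqI[OF assms(1)] by (rule assms(2)[OF that])
  ultimately show ?thesis by simp
qed

lemma Ck_SucE:
  assumes "Ck (Suc k) f"
  obtains D where "\<And>x. (f has_derivative D x) (at x)" "\<And>b. b \<in> Basis \<Longrightarrow> Ck k (\<lambda>x. D x b)"
proof (rule that[of "\<lambda>x. frechet_derivative f (at x)"])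
  show "(f has_derivative frechet_derivative f (at x)) (at x)" for x
  proof -
    have "f differentiable (at x)" using assms by simp
    then show ?thesis by (simp add: frechet_derivative_works)
  qed
  show "Ck k (\<lambda>x. frechet_derivative f (at x) b)" if "b \<in> Basis" for b
    using assms that by simp
qed

lemma Ck_const: "Ck k (\<lambda>x. c)"
proof (induction k arbitrary: c)
  case (Suc k)
  show ?case by (rule Ck_SucI[where D = "\<lambda>x h. 0"]) (use Suc in auto)
qed simp

lemma Ck_add: "Ck k f \<Longrightarrow> Ck k g \<Longrightarrow> Ck k (\<lambda>x. f x + g x)"
proof (induction k arbitrary: f g)
  case 0 then show ?case by (simp add: continuous_on_add)
next
  case (Suc k)
  obtain D E where D: "\<And>x. (f has_derivative D x) (at x)" "\<And>b. b \<in> Basis \<Longrightarrow> Ck k (\<lambda>x. D x b)"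
    and E: "\<And>x. (g has_derivative E x) (at x)" "\<And>b. b \<in> Basis \<Longrightarrow> Ck k (\<lambda>x. E x b)"
    using Ck_SucE[OF Suc.prems(1)] Ck_SucE[OF Suc.prems(2)] by metis
  show ?case
    by (rule Ck_SucI[where D = "\<lambda>x h. D x h + E x h"]) (intro has_derivative_add D E Suc.IH; assumption)+
qed

lemma Ck_linear:
  assumes "bounded_linear L" shows "Ck k f \<Longrightarrow> Ck k (\<lambda>x. L (f x))"
proof (induction k arbitrary: f)
  case 0 then show ?case using assms by (auto intro: bounded_linear.continuous_on)
next
  case (Suc k)
  obtain D where D: "\<And>x. (f has_derivative D x) (at x)" "\<And>b. b \<in> Basis \<Longrightarrow> Ck k (\<lambda>x. D x b)"
    using Ck_SucE[OF Suc.prems(1)] by metis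
  show ?case
    by (rule Ck_SucI[where D = "\<lambda>x h. L (D x h)"])
      (intro bounded_linear.has_derivative[OF assms] D Suc.IH; assumption)+
qed

lemma Ck_mult:
  fixes f g :: "'a::euclidean_space \<Rightarrow> complex"
  shows "Ck k f \<Longrightarrow> Ck k g \<Longrightarrow> Ck k (\<lambda>x. f x * g x)"
proof (induction k arbitrary: f g)
  case 0 then show ?case by (simp add: continuous_on_mult)
next
  case (Suc k)
  obtain D E where D: "\<And>x. (f has_derivative D x) (at x)" "\<And>b. b \<in> Basis \<Longrightarrow> Ck k (\<lambda>x. D x b)"
    and E: "\<And>x. (g has_derivative E x) (at x)" "\<And>b. b \<in> Basis \<Longrightarrow> Ck k (\<lambda>x. E x b)"
    using Ck_SucE[OF Suc.prems(1)] Ck_SucE[OF Suc.prems(2)] by metis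
  have fk: "Ck k f" "Ck k g" using Suc.prems Ck_SucD by blast+
  show ?case
  proof (rule Ck_SucI[where D = "\<lambda>x h. f x * E x h + D x h * g x"])
    show "((\<lambda>x. f x * g x) has_derivative (\<lambda>h. f x * E x h + D x h * g x)) (at x)" for x
      by (intro has_derivative_mult D E)
    show "Ck k (\<lambda>x. f x * E x b + D x b * g x)" if "b \<in> Basis" for b
      by (intro Ck_add Suc.IH D(2) E(2) fk that)
  qed
qed

lemma Ck_inverse:
  fixes f :: "'a::euclidean_space \<Rightarrow> complex"
  shows "Ck k f \<Longrightarrow> (\<And>x. f x \<noteq> 0) \<Longrightarrow> Ck k (\<lambda>x. inverse (f x))"
proof (induction k arbitrary: f)
  case 0 then show ?case by (simp add: continuous_on_inverse)
next
  case (Suc k)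
  obtain D where D: "\<And>x. (f has_derivative D x) (at x)" "\<And>b. b \<in> Basis \<Longrightarrow> Ck k (\<lambda>x. D x b)"
    using Ck_SucE[OF Suc.prems(1)] by metis
  have fk: "Ck k (\<lambda>x. inverse (f x))" using Suc.prems Ck_SucD Suc.IH by blast
  show ?case
  proof (rule Ck_SucI[where D = "\<lambda>x h. (- 1) * (inverse (f x) * D x h * inverse (f x))"])
    show "((\<lambda>x. inverse (f x)) has_derivative (\<lambda>h. (- 1) * (inverse (f x) * D x h * inverse (f x)))) (at x)" for x
      using Deriv.has_derivative_inverse[OF Suc.prems(2) D(1), of x] by simp
    show "Ck k (\<lambda>x. (- 1) * (inverse (f x) * D x b * inverse (f x)))" if "b \<in> Basis" for b
      by (intro Ck_mult Ck_const D(2) fk that)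
  qed
qed

lemma Ck_vec:
  fixes f :: "'a::euclidean_space \<Rightarrow> 'b::euclidean_space ^ 'n"
  shows "(\<And>i. Ck k (\<lambda>x. f x $ i)) \<Longrightarrow> Ck k f"
proof (induction k arbitrary: f)
  case 0
  then have "continuous_on UNIV (\<lambda>x. \<chi> i. f x $ i)" by (intro continuous_on_vec_lambda) simp
  then show ?case by simp
next
  case (Suc k)
  have "\<forall>i. \<exists>D. (\<forall>x. ((\<lambda>x. f x $ i) has_derivative D x) (at x)) \<and> (\<forall>b\<in>Basis. Ck k (\<lambda>x. D x b))"
    using Ck_SucE[OF Suc.prems] by metis
  then obtain D where D: "\<And>i x. ((\<lambda>x. f x $ i) has_derivative D i x) (at x)" "\<And>i b. b \<in> Basis \<Longrightarrow> Ck k (\<lambda>x. D i x b)"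
    by metis
  show ?case
  proof (rule Ck_SucI[where D = "\<lambda>x h. \<chi> i. D i x h"])
    show "(f has_derivative (\<lambda>h. \<chi> i. D i x h)) (at x)" for x
      by (subst has_derivative_componentwise_within[where S = UNIV])
        (auto simp: Basis_vec_def inner_axis intro!: has_derivative_inner_left D)
    show "Ck k (\<lambda>x. \<chi> i. D i x b)" if "b \<in> Basis" for b
      by (rule Suc.IH) (simp add: D(2)[OF that])
  qed
qed

lemma Ck_component: "Ck k f \<Longrightarrow> Ck k (\<lambda>x. f x $ i)"
  by (rule Ck_linear[OF bounded_linear_vec_nth])

lemma Ck_ident: "Ck k (\<lambda>x :: 'a::euclidean_space. x)"
proof (cases k)
  case (Suc j)
  show ?thesis unfolding Suc by (rule Ck_SucI[where D = "\<lambda>x h. h"]) (auto intro: Ck_const has_derivative_ident)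
qed simp

lemma Ck_poly: "Ck k (poly (p :: complex poly))"
proof (induction p)
  case 0
  have "poly 0 = (\<lambda>z :: complex. 0)" by auto
  then show ?case by (simp only: Ck_const)
next
  case (pCons a p)
  have "Ck k (\<lambda>z. a + z * poly p z)" by (intro Ck_add Ck_const Ck_mult Ck_ident pCons)
  moreover have "poly (pCons a p) = (\<lambda>z. a + z * poly p z)" by auto
  ultimately show ?case by (simp only:)
qed

lemma Ck_sum:
  assumes "\<And>i. i \<in> I \<Longrightarrow> Ck k (f i)" shows "Ck k (\<lambda>x. \<Sum>i\<in>I. f i x)"
  using assms
proof (induction I rule: infinite_finite_induct)
  case (insert i I)
  then have "Ck k (\<lambda>x. f i x + (\<Sum>i\<in>I. f i x))" by (intro Ck_add) simp_all
  then show ?case using insert by simp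
qed (simp_all add: Ck_const)

lemma Ck_hinner:
  assumes "Ck k u" "Ck k v" shows "Ck k (\<lambda>x. hinner (u x) (v x))"
proof -
  have "Ck k (\<lambda>x. u x $ i * cnj (v x $ i))" for i
    by (rule Ck_mult[OF Ck_component[OF assms(1)] Ck_linear[OF bounded_linear_cnj Ck_component[OF assms(2)]]])
  then show ?thesis unfolding hinner_def by (intro Ck_sum)
qed

lemma Ck_line_projection:
  fixes u :: "complex \<Rightarrow> complex ^ 'n"
  assumes "Ck k u" "\<And>x. u x \<noteq> 0"
  shows "Ck k (\<lambda>x. csmult (1 / hinner (u x) (u x)) (outer (u x) (u x)))"
proof (intro Ck_vec)
  fix i j
  have "Ck k (\<lambda>x. inverse (hinner (u x) (u x)) * (u x $ i * cnj (u x $ j)))"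
  proof (rule Ck_mult)
    show "Ck k (\<lambda>x. inverse (hinner (u x) (u x)))"
      by (rule Ck_inverse[OF Ck_hinner[OF assms(1,1)]]) (use assms(2) in simp)
    show "Ck k (\<lambda>x. u x $ i * cnj (u x $ j))"
      by (rule Ck_mult[OF Ck_component[OF assms(1)] Ck_linear[OF bounded_linear_cnj Ck_component[OF assms(1)]]])
  qed
  then show "Ck k (\<lambda>x. csmult (1 / hinner (u x) (u x)) (outer (u x) (u x)) $ i $ j)"
    by (simp add: outer_def divide_inverse)
qed

subsection \<open>Orthogonal projections onto lines\<close>

lemma span_single: "vec.span {u} = range (\<lambda>k. k *s (u :: complex ^ 'n))"
  by (rule vec.span_singleton)

lemma span_single_scale:
  assumes "k \<noteq> 0" shows "vec.span {k *s u} = vec.span {u :: complex ^ 'n}"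
proof -
  have "c *s u \<in> range (\<lambda>c. c *s (k *s u))" for c
    by (rule range_eqI[of _ _ "c / k"]) (use assms in \<open>simp add: vector_smult_assoc\<close>)
  moreover have "c *s (k *s u) \<in> range (\<lambda>c. c *s u)" for c
    by (rule range_eqI[of _ _ "c * k"]) (simp add: vector_smult_assoc)
  ultimately show ?thesis unfolding span_single by (intro equalityI image_subsetI)
qed

lemma proj_eqI:
  assumes "vec.subspace Y" and P: "\<And>v. P *v v \<in> Y" "\<And>v u. u \<in> Y \<Longrightarrow> hinner (v - P *v v) u = 0"
  shows "proj Y = P"
  unfolding proj_def
proof (rule the_equality)
  fix R :: "complex ^ 'a ^ 'a"
  assume R: "\<forall>v. R *v v \<in> Y \<and> (\<forall>u\<in>Y. hinner (v - R *v v) u = 0)"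
  show "R = P"
  proof (rule matrix_eqI_mv)
    fix v
    define d where "d = R *v v - P *v v"
    have "d \<in> Y" unfolding d_def using R P assms(1) vec.subspace_diff by blast
    then have "hinner (v - P *v v) d - hinner (v - R *v v) d = 0" using R P by simp
    then have "hinner ((v - P *v v) - (v - R *v v)) d = 0" by (simp only: hinner_diff_left)
    moreover have "(v - P *v v) - (v - R *v v) = d" by (simp add: d_def)
    ultimately have "hinner d d = 0" by (simp only:)
    then show "R *v v = P *v v" by (simp add: d_def)
  qed
qed (use P in auto)

lemma proj_line:
  assumes "u \<noteq> 0"
  shows "proj (vec.span {u}) = csmult (1 / hinner u u) (outer u u)"
proof (rule proj_eqI)
  show "csmult (1 / hinner u u) (outer u u) *v v \<in> vec.span {u}" for v
    unfolding span_single csmult_mv outer_mv vector_smult_assoc by (rule rangeI)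
  show "hinner (v - csmult (1 / hinner u u) (outer u u) *v v) w = 0" if "w \<in> vec.span {u}" for v w
    using that assms by (auto simp: span_single csmult_mv outer_mv hinner_simps)
qed simp

lemma proj_line_inj:
  assumes "u \<noteq> 0" "v \<noteq> 0" "proj (vec.span {u}) = proj (vec.span {v})"
  shows "vec.span {u} = vec.span {v :: complex ^ 'n}"
proof -
  have "csmult (1 / hinner u u) (outer u u) *v u = csmult (1 / hinner v v) (outer v v) *v u"
    using assms by (simp add: proj_line)
  then have "u = (hinner u v / hinner v v) *s v" using assms(1)
    by (simp add: csmult_mv outer_mv vector_smult_assoc)
  moreover from this have "hinner u v / hinner v v \<noteq> 0" using assms(1) by auto
  ultimately show ?thesis using span_single_scale by metis
qed

lemma dim_span_single:
  assumes "u \<noteq> 0" shows "vec.dim (vec.span {u :: complex ^ 'n}) = 1"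
proof -
  have "vec.independent {u}" using assms by simp
  then have "vec.dim {u} = card {u}" by (rule vec.dim_eq_card_independent)
  then show ?thesis by simp
qed

lemma subspace_dim_1:
  assumes "vec.subspace Y" "vec.dim Y = 1"
  obtains u where "u \<noteq> 0" "Y = vec.span {u :: complex ^ 'n}"
proof -
  obtain B where B: "B \<subseteq> Y" "vec.independent B" "Y \<subseteq> vec.span B" "card B = vec.dim Y"
    using vec.basis_exists[of Y] by blast
  then obtain u where u: "B = {u}" using assms(2) card_1_singletonE by metis
  have "u \<noteq> 0" using B(2) u by auto
  moreover have "Y = vec.span {u}" using B u assms(1) vec.span_minimal by blast
  ultimately show ?thesis using that by blast
qed

lemma subspace_dim_0:
  assumes "vec.subspace Y" "vec.dim Y = 0" shows "Y = {0 :: complex ^ 'n}"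
  using assms vec.subspace_0[OF assms(1)] by (auto simp: vec.dim_eq_0)

subsection \<open>Charts of the sphere\<close>

lemma coords_cases: "c \<in> coords \<Longrightarrow> c = Fin \<or> c = coord_inf" by (simp add: coords_def)
lemma coords_mem [simp]: "Fin \<in> coords" "coord_inf \<in> coords" by (simp_all add: coords_def)
lemma inj_Fin: "inj Fin" by (simp add: inj_def)
lemma inj_coord_inf: "inj coord_inf"
  by (simp add: inj_def coord_inf_def)
lemma inj_coords: "c \<in> coords \<Longrightarrow> inj c"
  by (drule coords_cases, erule disjE) (simp_all add: inj_Fin inj_coord_inf)
lemma coord_inf_simps: "coord_inf 0 = Infty" "w \<noteq> 0 \<Longrightarrow> coord_inf w = Fin (1 / w)"
  by (simp_all add: coord_inf_def)

lemma finite_preimage_coords: "c \<in> coords \<Longrightarrow> finite S \<Longrightarrow> finite {z. c z \<in> S}"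
  by (drule inj_coords, drule (1) finite_vimageI[rotated]) (simp add: vimage_def)

lemma continuous_eq_off_finite:
  fixes f g :: "complex \<Rightarrow> 'a::t2_space"
  assumes "continuous_on UNIV f" "continuous_on UNIV g" "finite S" "\<And>z. z \<notin> S \<Longrightarrow> f z = g z"
  shows "f z = g z"
proof -
  have "open (- (S - {z}))" using assms(3) by (intro open_Compl finite_imp_closed) simp
  then have "\<forall>\<^sub>F w in at z. w \<in> - (S - {z}) - {z}" by (intro eventually_at_in_open) auto
  then have "\<forall>\<^sub>F w in at z. f w = g w" by eventually_elim (use assms(4) in auto)
  moreover have "(f \<longlongrightarrow> f z) (at z)" "(g \<longlongrightarrow> g z) (at z)"
    using assms(1,2) by (auto simp: continuous_on_def)
  ultimately have "(g \<longlongrightarrow> f z) (at z)" by (metis (mono_tags, lifting) Lim_transform_eventually)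
  then show ?thesis using \<open>(g \<longlongrightarrow> g z) (at z)\<close> tendsto_unique[OF at_neq_bot] by blast
qed

lemma smooth_subbundle_proj_continuous:
  "smooth_subbundle k Z \<Longrightarrow> c \<in> coords \<Longrightarrow> continuous_on UNIV (\<lambda>z. proj (Z (c z)))"
proof -
  assume "smooth_subbundle k Z" "c \<in> coords"
  then have "Ck 0 (\<lambda>z. proj (Z (c z)))" unfolding smooth_subbundle_def smooth_map_def smooth_def by blast
  then show ?thesis by simp
qed

lemma sphere_cover: "\<exists>c\<in>coords. \<exists>z. p = c z"
proof (cases p)
  case (Fin z)
  then show ?thesis using coords_mem(1) by blast
next
  case Infty
  then show ?thesis using coords_mem(2) coord_inf_simps(1) by metis
qed

lemma infinite_rsphere_minus: assumes "finite S" shows "\<exists>z. Fin z \<notin> S"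
proof (rule ccontr)
  assume "\<not> ?thesis"
  then have "range Fin \<subseteq> S" by auto
  then have "finite (range Fin)" using assms finite_subset by blast
  then have "finite (UNIV :: complex set)" using inj_Fin finite_imageD by blast
  then show False by (simp add: infinite_UNIV_char_0)
qed

lemma smooth_subbundle_unique:
  assumes Z: "smooth_subbundle k Z" and Z': "smooth_subbundle k' Z'" and k: "k \<le> 1" and S: "finite S"
    and eq: "\<And>c z. c \<in> coords \<Longrightarrow> c z \<notin> S \<Longrightarrow> Z (c z) = Z' (c z)"
  shows "Z = Z'"
proof
  fix p
  obtain z0 where "Fin z0 \<notin> S" using infinite_rsphere_minus[OF S] by blast
  then have "Z (Fin z0) = Z' (Fin z0)" using eq by simp
  then have kk: "k' = k" using Z Z' unfolding smooth_subbundle_def by metis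
  obtain c z where c: "c \<in> coords" "p = c z" using sphere_cover by blast
  have pr: "proj (Z (c z)) = proj (Z' (c z))"
  proof (rule continuous_eq_off_finite)
    show "continuous_on UNIV (\<lambda>z. proj (Z (c z)))" "continuous_on UNIV (\<lambda>z. proj (Z' (c z)))"
      using smooth_subbundle_proj_continuous Z Z' c by blast+
    show "finite {z. c z \<in> S}" by (rule finite_preimage_coords[OF c(1) S])
    show "proj (Z (c z)) = proj (Z' (c z))" if "z \<notin> {z. c z \<in> S}" for z
      using eq[OF c(1)] that by simp
  qed
  have sub: "vec.subspace (Z p)" "vec.dim (Z p) = k" "vec.subspace (Z' p)" "vec.dim (Z' p) = k"
    using Z Z' kk unfolding smooth_subbundle_def by auto
  show "Z p = Z' p"
  proof (cases "k = 0")
    case True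
    then show ?thesis using sub subspace_dim_0 by metis
  next
    case False
    then have "k = 1" using k by simp
    then obtain u v where "u \<noteq> 0" "Z p = vec.span {u}" "v \<noteq> 0" "Z' p = vec.span {v}"
      using subspace_dim_1 sub by metis
    then show ?thesis using proj_line_inj pr c(2) by metis
  qed
qed

lemma next_bundle_eqI:
  assumes Z: "smooth_subbundle k Z" "k \<le> 1" and S: "finite S"
    and eq: "\<And>c z. c \<in> coords \<Longrightarrow> c z \<notin> S \<Longrightarrow> Z (c z) = (*v) (second_ff Y c z) ` Y (c z)"
  shows "next_bundle Y = Z"
  unfolding next_bundle_def
proof (rule the_equality)
  show "(\<exists>k. smooth_subbundle k Z) \<and> (\<exists>S. finite S \<and> (\<forall>c\<in>coords. \<forall>z. c z \<notin> S \<longrightarrow> Z (c z) = (*v) (second_ff Y c z) ` Y (c z)))"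
    using assms by blast
next
  fix Z'
  assume "(\<exists>k. smooth_subbundle k Z') \<and> (\<exists>S. finite S \<and> (\<forall>c\<in>coords. \<forall>z. c z \<notin> S \<longrightarrow> Z' (c z) = (*v) (second_ff Y c z) ` Y (c z)))"
  then obtain k' S' where Z': "smooth_subbundle k' Z'" "finite S'" "\<And>c z. c \<in> coords \<Longrightarrow> c z \<notin> S' \<Longrightarrow> Z' (c z) = (*v) (second_ff Y c z) ` Y (c z)"
    by blast
  have "Z = Z'"
    by (rule smooth_subbundle_unique[OF Z(1) Z'(1) Z(2), of "S \<union> S'"]) (use S Z' eq in auto)
  then show "Z' = Z" by simp
qed

lemma smooth_line_bundle:
  assumes "\<And>c z. c \<in> coords \<Longrightarrow> Y (c z) = vec.span {u c z} \<and> u c z \<noteq> (0 :: complex ^ 'n)"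
    and "\<And>c k. c \<in> coords \<Longrightarrow> Ck k (u c)"
  shows "smooth_subbundle 1 Y"
  unfolding smooth_subbundle_def
proof (intro conjI allI)
  fix p
  obtain c z where "c \<in> coords" "p = c z" using sphere_cover by blast
  then have y: "Y p = vec.span {u c z}" "u c z \<noteq> 0" using assms(1) by auto
  show "vec.subspace (Y p)" unfolding y(1) by (rule vec.subspace_span)
  show "vec.dim (Y p) = 1" unfolding y(1) by (rule dim_span_single[OF y(2)])
next
  have "Ck k (\<lambda>z. proj (Y (c z)))" if "c \<in> coords" for c k
  proof -
    have "proj (Y (c z)) = csmult (1 / hinner (u c z) (u c z)) (outer (u c z) (u c z))" for z
    proof -
      have y: "Y (c z) = vec.span {u c z}" "u c z \<noteq> 0" using assms(1)[OF that] by blast+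
      show ?thesis unfolding y(1) by (rule proj_line[OF y(2)])
    qed
    moreover have "Ck k (\<lambda>z. csmult (1 / hinner (u c z) (u c z)) (outer (u c z) (u c z)))"
      using assms(1)[OF that] by (intro Ck_line_projection assms(2)[OF that]) blast
    ultimately show ?thesis by (simp only:)
  qed
  then show "smooth_map (\<lambda>p. proj (Y p))" by (simp add: smooth_map_def smooth_def)
qed

lemma second_ff_line:
  assumes Y: "\<And>w. Y (c w) = vec.span {u w}" and u0: "\<And>w. u w \<noteq> (0 :: complex ^ 'n)"
    and u: "wdV u a b z"
  defines "e \<equiv> a - (hinner a (u z) / hinner (u z) (u z)) *s u z"
  shows "second_ff Y c z = csmult (1 / hinner (u z) (u z)) (outer e (u z))"
    and "(*v) (second_ff Y c z) ` Y (c z) = vec.span {e}"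
proof -
  let ?h = "hinner (u z) (u z)"
  have h0: "?h \<noteq> 0" using u0 by simp
  have pr: "proj (Y (c w)) = csmult (1 / hinner (u w) (u w)) (outer (u w) (u w))" for w
    using Y u0 by (simp add: proj_line)
  have "\<exists>x y. wd (\<lambda>w. 1 / hinner (u w) (u w)) x y z"
    using wd_divide[OF wd_const wd_hinner[OF u u] h0] by blast
  then obtain x y where xy: "wd (\<lambda>w. 1 / hinner (u w) (u w)) x y z" by blast
  from wdM_dz[OF wdM_csmult[OF xy wdM_outer[OF u u]]]
  have d: "dz (\<lambda>w. proj (Y (c w))) z = csmult x (outer (u z) (u z)) + csmult (1 / ?h) (outer a (u z) + outer (u z) b)"
    unfolding pr by simp
  have k: "proj_perp (Y (c z)) *v u z = 0"
    using h0 by (simp add: proj_perp_def pr matrix_diff_mv csmult_mv outer_mv vector_smult_assoc)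
  have ka: "proj_perp (Y (c z)) *v a = e"
    by (simp add: proj_perp_def pr matrix_diff_mv csmult_mv outer_mv vector_smult_assoc e_def)
  have up: "adj (proj (Y (c z))) *v u z = u z"
    using h0 by (simp add: pr adj_csmult adj_outer csmult_mv outer_mv vector_smult_assoc)
  have ub: "\<exists>t. adj (proj (Y (c z))) *v b = t *s u z"
    by (auto simp: pr adj_csmult adj_outer csmult_mv outer_mv vector_smult_assoc)
  show ff: "second_ff Y c z = csmult (1 / ?h) (outer e (u z))"
    unfolding second_ff_def d
    by (simp add: mm_simps mm_outer outer_mm k ka up)
  show "(*v) (second_ff Y c z) ` Y (c z) = vec.span {e}"
  proof -
    have "(\<lambda>v. second_ff Y c z *v v) ` range (\<lambda>k. k *s u z) = range (\<lambda>k. k *s e)"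
      unfolding ff using h0 by (simp add: csmult_mv outer_mv vector_smult_assoc image_image hinner_scale_left)
    then show ?thesis unfolding Y span_single .
  qed
qed

lemma det_on_zero:
  assumes "u \<noteq> (0 :: complex ^ 'n)" shows "det_on (vec.span {u}) (0 ** T) = 0"
proof -
  have "(mat 1 - proj (vec.span {u})) *v u = 0"
    using assms by (simp add: proj_line matrix_diff_mv csmult_mv outer_mv vector_smult_assoc)
  then have "\<not> invertible (mat 1 - proj (vec.span {u}))"
    using assms by (metis invertible_def matrix_vector_mul_assoc matrix_vector_mul_lid matrix_vector_mult_0_right)
  then show ?thesis by (simp add: det_on_def proj_perp_def invertible_det_nz)
qed

subsection \<open>Polynomial curves in the projective plane\<close>

definition ev :: "(3 \<Rightarrow> complex poly) \<Rightarrow> complex \<Rightarrow> complex ^ 3" where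
  "ev p z = (\<chi> i. poly (p i) z)"

definition pd3 :: "(3 \<Rightarrow> complex poly) \<Rightarrow> 3 \<Rightarrow> complex poly" where
  "pd3 p i = pderiv (p i)"

definition rv :: "nat \<Rightarrow> (3 \<Rightarrow> complex poly) \<Rightarrow> 3 \<Rightarrow> complex poly" where
  "rv n p i = (\<Sum>k\<le>n. monom (coeff (p i) k) (n - k))"

definition curve :: "nat \<Rightarrow> (3 \<Rightarrow> complex poly) \<Rightarrow> bool" where
  "curve n p \<longleftrightarrow> (\<forall>i. degree (p i) \<le> n) \<and> (\<forall>z. ev p z \<noteq> 0) \<and> (\<exists>i. coeff (p i) n \<noteq> 0)"

definition chart :: "nat \<Rightarrow> (3 \<Rightarrow> complex poly) \<Rightarrow> (complex \<Rightarrow> rsphere) \<Rightarrow> 3 \<Rightarrow> complex poly" where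
  "chart n p c = (if c = Fin then p else rv n p)"

definition line :: "nat \<Rightarrow> (3 \<Rightarrow> complex poly) \<Rightarrow> rsphere \<Rightarrow> (complex ^ 3) set" where
  "line n p x = (case x of Fin z \<Rightarrow> vec.span {ev p z} | Infty \<Rightarrow> vec.span {ev (rv n p) 0})"

lemma ev_nth [simp]: "ev p z $ i = poly (p i) z" by (simp add: ev_def)

lemma Fin_neq_coord_inf: "coord_inf \<noteq> Fin"
proof
  assume "coord_inf = Fin"
  then have "coord_inf 0 = Fin 0" by simp
  then show False by (simp add: coord_inf_simps)
qed

lemma chart_simps [simp]: "chart n p Fin = p" "chart n p coord_inf = rv n p"
  using Fin_neq_coord_inf by (simp_all add: chart_def)

lemma ev_rv:
  assumes "\<And>i. degree (p i) \<le> n" "w \<noteq> 0"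
  shows "ev (rv n p) w = w ^ n *s ev p (1 / w)"
proof -
  have "poly (rv n p i) w = w ^ n * poly (p i) (1 / w)" for i
  proof -
    have "poly (p i) (1 / w) = (\<Sum>k\<le>n. coeff (p i) k * (1 / w) ^ k)"
      unfolding poly_altdef using assms(1)[of i] by (intro sum.mono_neutral_left) (auto simp: coeff_eq_0)
    then have "w ^ n * poly (p i) (1 / w) = (\<Sum>k\<le>n. w ^ n * (coeff (p i) k * (1 / w) ^ k))"
      by (simp only: sum_distrib_left)
    also have "\<dots> = (\<Sum>k\<le>n. coeff (p i) k * w ^ (n - k))"
    proof (rule sum.cong)
      fix k assume "k \<in> {..n}"
      then have "w ^ n = w ^ k * w ^ (n - k)" by (simp add: power_add[symmetric])
      then show "w ^ n * (coeff (p i) k * (1 / w) ^ k) = coeff (p i) k * w ^ (n - k)"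
        using assms(2) by (simp add: power_divide)
    qed simp
    finally show ?thesis by (simp add: rv_def poly_sum poly_monom)
  qed
  then show ?thesis by (simp add: vec_eq_iff)
qed

lemma coeff_rv: "coeff (rv n p i) k = (if k \<le> n then coeff (p i) (n - k) else 0)"
proof -
  have "coeff (rv n p i) k = (\<Sum>j\<le>n. if n - j = k then coeff (p i) j else 0)"
    by (simp add: rv_def coeff_sum)
  also have "\<dots> = (\<Sum>j\<le>n. if j = n - k \<and> k \<le> n then coeff (p i) j else 0)"
    by (rule sum.cong) auto
  also have "\<dots> = (if k \<le> n then coeff (p i) (n - k) else 0)" by (simp add: sum.delta)
  finally show ?thesis .
qed

lemma ev_rv_0: "ev (rv n p) 0 $ i = coeff (p i) n"
  by (simp add: poly_0_coeff_0 coeff_rv)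

lemma degree_rv: "degree (rv n p i) \<le> n"
  by (rule degree_le) (simp add: coeff_rv)

lemma curve_rv:
  assumes "curve n p" shows "curve n (rv n p)"
  unfolding curve_def
proof (intro conjI allI)
  show "degree (rv n p i) \<le> n" for i by (rule degree_rv)
  show "ev (rv n p) w \<noteq> 0" for w
  proof (cases "w = 0")
    case True
    obtain i where "coeff (p i) n \<noteq> 0" using assms curve_def by blast
    then have "ev (rv n p) w $ i \<noteq> 0" unfolding True ev_rv_0 .
    then show ?thesis by (metis zero_index)
  next
    case False
    have "ev p (1 / w) \<noteq> 0" "\<And>i. degree (p i) \<le> n" using assms curve_def by blast+
    then show ?thesis using ev_rv[of p n w] False by simp
  qed
  have "ev p 0 \<noteq> 0" using assms curve_def by blast
  then obtain i where "coeff (p i) 0 \<noteq> 0" by (auto simp: vec_eq_iff poly_0_coeff_0)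
  then show "\<exists>i. coeff (rv n p i) n \<noteq> 0" by (auto simp: coeff_rv)
qed

lemma chart_curve: "curve n p \<Longrightarrow> curve n (chart n p c)"
  by (simp add: chart_def curve_rv)

lemma line_chart:
  assumes "curve n p" "c \<in> coords"
  shows "line n p (c z) = vec.span {ev (chart n p c) z}"
proof (cases "c = Fin")
  case True then show ?thesis by (simp add: line_def)
next
  case False
  then have c: "c = coord_inf" using assms coords_cases by blast
  show ?thesis
  proof (cases "z = 0")
    case True then show ?thesis by (simp add: c line_def coord_inf_simps)
  next
    case False
    have d: "\<And>i. degree (p i) \<le> n" using assms curve_def by blast
    show ?thesis using False span_single_scale[of "z ^ n" "ev p (1 / z)"]
      by (simp add: c line_def coord_inf_simps ev_rv[OF d False])
  qed
qed

lemma wdV_ev: "wdV (ev p) (ev (pd3 p) z) 0 z"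
  unfolding wdV_def by (auto simp: pd3_def intro: wd_poly)

lemma Ck_ev: "Ck k (ev p)"
proof (rule Ck_vec)
  show "Ck k (\<lambda>z. ev p z $ i)" for i using Ck_poly[of k "p i"] by simp
qed

definition pair :: "(3 \<Rightarrow> complex poly) \<Rightarrow> (3 \<Rightarrow> complex poly) \<Rightarrow> complex \<Rightarrow> complex" where
  "pair p q z = hinner (ev p z) (vcnj (ev q z))"

lemma pair_sum: "pair p q z = (\<Sum>i\<in>UNIV. poly (p i) z * poly (q i) z)"
  by (simp add: pair_def hinner_def)

lemma pair_derivative:
  assumes "\<And>z. pair p q z = 0"
  shows "pair (pd3 p) q z + pair p (pd3 q) z = 0"
proof -
  have w: "wd (\<lambda>z. hinner (ev p z) (vcnj (ev q z)))
      (hinner (ev (pd3 p) z) (vcnj (ev q z)) + hinner (ev p z) (vcnj (ev (pd3 q) z)))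
      (hinner 0 (vcnj (ev q z)) + hinner (ev p z) (vcnj 0)) z"
    by (intro wd_hinner wdV_ev wdV_vcnj)
  have "(\<lambda>z. hinner (ev p z) (vcnj (ev q z))) = (\<lambda>z. 0)" using assms by (simp add: pair_def fun_eq_iff)
  then have "wd (\<lambda>z. 0) (hinner (ev (pd3 p) z) (vcnj (ev q z)) + hinner (ev p z) (vcnj (ev (pd3 q) z)))
      (hinner 0 (vcnj (ev q z)) + hinner (ev p z) (vcnj 0)) z" using w by (simp only:)
  from wd_unique(1)[OF this wd_const]
  have "hinner (ev (pd3 p) z) (vcnj (ev q z)) + hinner (ev p z) (vcnj (ev (pd3 q) z)) = 0" .
  then show ?thesis by (simp add: pair_def)
qed

lemma crs_crs: "crs (crs a b) (crs a d) = hinner a (vcnj (crs b d)) *s a"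
  unfolding vec_eq_iff forall_3 hinner_3 by (simp add: algebra_simps)

lemma crs_crs_left: "crs a (crs b d) = hinner a (vcnj d) *s b - hinner a (vcnj b) *s d"
  unfolding vec_eq_iff forall_3 hinner_3 by (simp add: algebra_simps)

lemma crs_crs_right: "crs (crs a b) d = hinner a (vcnj d) *s b - hinner b (vcnj d) *s a"
  unfolding vec_eq_iff forall_3 hinner_3 by (simp add: algebra_simps)

lemma crs_swap: "crs a b = - crs b a"
  unfolding vec_eq_iff forall_3 by simp

lemma hinner_vcnj_swap: "hinner u (vcnj v) = hinner v (vcnj u)"
  by (simp add: hinner_def mult.commute)

text \<open>A pair of a curve and its dual; the middle bundle is spanned by \<open>crs (vcnj f) M\<close> and the last
  one by \<open>vcnj M\<close>.\<close>

lemma dual_pair_pointwise: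
  fixes f f' M M' :: "complex ^ 3"
  assumes f0: "f \<noteq> 0" and M0: "M \<noteq> 0" and fM: "hinner f (vcnj M) = 0"
    and f'M: "hinner f' (vcnj M) = 0" and fM': "hinner f (vcnj M') = 0"
  defines "u \<equiv> crs (vcnj f) M"
  shows "u \<noteq> 0"
    and "\<exists>g. crs f f' = g *s M \<and> f' - (hinner f' f / hinner f f) *s f = (- g / hinner f f) *s u"
    and "\<exists>k. crs M M' = k *s f \<and>
      crs (vcnj f) M' - (hinner (crs (vcnj f) M') u / hinner u u) *s u = (- k * hinner f f / hinner M M) *s vcnj M"
proof -
  let ?F = "hinner f f" and ?n = "hinner M M"
  have F: "?F \<noteq> 0" and n: "?n \<noteq> 0" using f0 M0 by auto
  have ff: "hinner (vcnj f) (vcnj f) = ?F" by (simp add: hinner_vcnj)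
  have fM2: "hinner (vcnj f) M = 0"
  proof -
    have "cnj (hinner f (vcnj M)) = 0" by (simp add: fM)
    then show ?thesis by (simp add: hinner_def)
  qed
  have uu: "hinner u u = ?F * ?n" unfolding u_def hinner_crs ff fM2 by simp
  then show u0: "u \<noteq> 0" using F n by auto
  have "crs (crs f f') M = 0" by (simp add: crs_crs_right fM f'M)
  then have "crs M (crs f f') = 0" using crs_swap[of M "crs f f'"] by simp
  then obtain g where g: "crs f f' = g *s M" using crs_eq_0_iff M0 by blast
  have "crs (vcnj f) (crs f f') = hinner f' f *s f - ?F *s f'"
    unfolding crs_crs_left by (simp add: hinner_vcnj_swap[of "vcnj f"])
  then have "g *s u = hinner f' f *s f - ?F *s f'" unfolding g u_def
    by (simp add: vec_eq_iff forall_3 algebra_simps)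
  then have "(- 1 / ?F) *s (g *s u) = (- 1 / ?F) *s (hinner f' f *s f - ?F *s f')" by (simp only:)
  moreover have "(- 1 / ?F) *s (hinner f' f *s f - ?F *s f') = f' - (hinner f' f / ?F) *s f"
    using F by (simp add: vec_eq_iff field_simps)
  ultimately show "\<exists>g. crs f f' = g *s M \<and> f' - (hinner f' f / hinner f f) *s f = (- g / hinner f f) *s u"
    using g by (intro exI[of _ g]) (simp add: vector_smult_assoc)
  have "crs (crs M M') f = 0"
    by (simp add: crs_crs_right hinner_vcnj_swap[of M] hinner_vcnj_swap[of M'] fM fM')
  then have "crs f (crs M M') = 0" using crs_swap[of f "crs M M'"] by simp
  then obtain k where k: "crs M M' = k *s f" using crs_eq_0_iff f0 by blast
  let ?a = "crs (vcnj f) M'"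
  have af: "hinner ?a f = 0" using hinner_crs_left[of "vcnj f" M'] hinner_vcnj_swap[of "vcnj f" ?a] by simp
  have uf: "hinner f u = 0"
  proof -
    have "hinner u f = 0" unfolding u_def using hinner_crs_left[of "vcnj f" M] hinner_vcnj_swap[of "vcnj f" "crs (vcnj f) M"] by simp
    then show ?thesis using hinner_eq_0_commute by blast
  qed
  have cfu: "crs f u = (- ?F) *s M"
    unfolding u_def crs_crs_left by (simp add: fM)
  have "hinner (crs f u) (crs f u) *s ?a = hinner (crs ?a u) (crs f u) *s f + hinner (crs f ?a) (crs f u) *s u
    + hinner ?a (vcnj (crs f u)) *s vcnj (crs f u)"
    by (rule cramer_3)
  moreover have "hinner (crs f u) (crs f u) = ?F * (?F * ?n)" unfolding hinner_crs uf uu by simp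
  moreover have "hinner (crs ?a u) (crs f u) = 0" unfolding hinner_crs af using uf hinner_eq_0_commute[of u f] by simp
  moreover have "hinner (crs f ?a) (crs f u) = ?F * hinner ?a u" unfolding hinner_crs uf by simp
  moreover have "hinner ?a (vcnj (crs f u)) *s vcnj (crs f u) = (?F * ?F * hinner ?a (vcnj M)) *s vcnj M"
    unfolding cfu vcnj_scale hinner_scale_right by (simp add: vector_smult_assoc)
  moreover have "hinner ?a (vcnj M) = - k * ?F"
  proof -
    have "hinner ?a (vcnj M) = - hinner (vcnj f) (vcnj (crs M M'))"
      by (simp add: hinner_3 algebra_simps)
    also have "\<dots> = - k * ?F" unfolding k vcnj_scale hinner_scale_right ff by simp
    finally show ?thesis .
  qed
  ultimately have e: "(?F * (?F * ?n)) *s ?a = (?F * hinner ?a u) *s u + (?F * ?F * (- k * ?F)) *s vcnj M" by simp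
  have "?a - (hinner ?a u / hinner u u) *s u = (- k * ?F / ?n) *s vcnj M"
  proof -
    have "?a $ i - hinner ?a u / (?F * ?n) * u $ i = - k * ?F / ?n * vcnj M $ i" for i
    proof -
      have "?F * (?F * ?n) * ?a $ i = ?F * hinner ?a u * u $ i + ?F * ?F * (- k * ?F) * vcnj M $ i"
        using arg_cong[OF e, of "\<lambda>v. v $ i"] by simp
      then have "?F * (?F * ?n * ?a $ i) = ?F * (hinner ?a u * u $ i - k * ?F * ?F * vcnj M $ i)"
        by (simp add: algebra_simps)
      then have "?F * ?n * ?a $ i = hinner ?a u * u $ i - k * ?F * ?F * vcnj M $ i"
        using F by (simp only: mult_cancel_left simp_thms)
      moreover have "?a $ i = ?F * ?n * ?a $ i / (?F * ?n)" using F n by simp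
      ultimately have "?a $ i = (hinner ?a u * u $ i - k * ?F * ?F * vcnj M $ i) / (?F * ?n)" by simp
      moreover have "(hinner ?a u * u $ i - k * ?F * ?F * vcnj M $ i) / (?F * ?n)
          = hinner ?a u / (?F * ?n) * u $ i - k * ?F / ?n * vcnj M $ i"
        using F by (simp add: diff_divide_distrib)
      ultimately show ?thesis by simp
    qed
    then show ?thesis unfolding uu by (simp add: vec_eq_iff)
  qed
  then show "\<exists>k. crs M M' = k *s f \<and> ?a - (hinner ?a u / hinner u u) *s u = (- k * ?F / ?n) *s vcnj M"
    using k by blast
qed

definition mid :: "nat \<Rightarrow> (3 \<Rightarrow> complex poly) \<Rightarrow> nat \<Rightarrow> (3 \<Rightarrow> complex poly) \<Rightarrow> rsphere \<Rightarrow> (complex ^ 3) set" where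
  "mid n f m M x = (case x of Fin z \<Rightarrow> vec.span {crs (vcnj (ev f z)) (ev M z)}
     | Infty \<Rightarrow> vec.span {crs (vcnj (ev (rv n f) 0)) (ev (rv m M) 0)})"

definition last_bundle :: "nat \<Rightarrow> (3 \<Rightarrow> complex poly) \<Rightarrow> rsphere \<Rightarrow> (complex ^ 3) set" where
  "last_bundle m M x = (case x of Fin z \<Rightarrow> vec.span {vcnj (ev M z)} | Infty \<Rightarrow> vec.span {vcnj (ev (rv m M) 0)})"

lemma mid_chart:
  assumes f: "curve n f" and M: "curve m M" and c: "c \<in> coords"
  shows "mid n f m M (c z) = vec.span {crs (vcnj (ev (chart n f c) z)) (ev (chart m M c) z)}"
proof (cases "c = Fin")
  case True then show ?thesis by (simp add: mid_def)
next
  case False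
  then have c: "c = coord_inf" using c coords_cases by blast
  show ?thesis
  proof (cases "z = 0")
    case True then show ?thesis by (simp add: c mid_def coord_inf_simps)
  next
    case False
    have d: "\<And>i. degree (f i) \<le> n" "\<And>i. degree (M i) \<le> m" using f M curve_def by blast+
    have "crs (vcnj (z ^ n *s ev f (1 / z))) (z ^ m *s ev M (1 / z)) = (cnj (z ^ n) * z ^ m) *s crs (vcnj (ev f (1 / z))) (ev M (1 / z))"
      unfolding vcnj_scale by (rule crs_scale)
    then show ?thesis using False span_single_scale[of "cnj (z ^ n) * z ^ m" "crs (vcnj (ev f (1 / z))) (ev M (1 / z))"]
      by (simp add: c mid_def coord_inf_simps ev_rv[OF d(1) False] ev_rv[OF d(2) False])
  qed
qed

lemma last_bundle_chart:
  assumes M: "curve m M" and c: "c \<in> coords"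
  shows "last_bundle m M (c z) = vec.span {vcnj (ev (chart m M c) z)}"
proof (cases "c = Fin")
  case True then show ?thesis by (simp add: last_bundle_def)
next
  case False
  then have c: "c = coord_inf" using c coords_cases by blast
  show ?thesis
  proof (cases "z = 0")
    case True then show ?thesis by (simp add: c last_bundle_def coord_inf_simps)
  next
    case False
    have d: "\<And>i. degree (M i) \<le> m" using M curve_def by blast
    show ?thesis using False span_single_scale[of "cnj z ^ m" "vcnj (ev M (1 / z))"]
      by (simp add: c last_bundle_def coord_inf_simps ev_rv[OF d False] vcnj_scale)
  qed
qed

lemma poly_pd3_rv:
  assumes d: "\<And>i. degree (f i) \<le> n" and w: "w \<noteq> 0"
  shows "poly (pd3 (rv n f) i) w = of_nat n * w ^ (n - 1) * poly (f i) (1 / w) - w ^ n / w\<^sup>2 * poly (pd3 f i) (1 / w)"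
proof -
  have "((\<lambda>w. poly (rv n f i) w) has_field_derivative poly (pd3 (rv n f) i) w) (at w)"
    unfolding pd3_def by (rule poly_DERIV)
  moreover have "((\<lambda>w. w ^ n * poly (f i) (1 / w)) has_field_derivative
      of_nat n * w ^ (n - 1) * poly (f i) (1 / w) - w ^ n / w\<^sup>2 * poly (pd3 f i) (1 / w)) (at w)"
    unfolding pd3_def using w
    by (auto intro!: derivative_eq_intros DERIV_chain2[OF poly_DERIV] simp: power2_eq_square field_simps)
  moreover have "\<forall>\<^sub>F w in nhds w. w ^ n * poly (f i) (1 / w) = poly (rv n f i) w"
  proof -
    have "\<forall>\<^sub>F w in nhds w. w \<noteq> 0" using w by (rule t1_space_nhds)
    then show ?thesis
    proof eventually_elim
      case (elim w)
      then show ?case using arg_cong[OF ev_rv[OF d elim], of "\<lambda>v. v $ i"] by simp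
    qed
  qed
  ultimately show ?thesis
    by (auto simp: DERIV_cong_ev[OF refl _ refl] intro: DERIV_unique)
qed

lemma ev_pd3_rv:
  assumes "\<And>i. degree (f i) \<le> n" "w \<noteq> 0"
  shows "ev (pd3 (rv n f)) w = (of_nat n * w ^ (n - 1)) *s ev f (1 / w) - (w ^ n / w\<^sup>2) *s ev (pd3 f) (1 / w)"
  by (simp add: vec_eq_iff poly_pd3_rv[OF assms])

lemma continuous_pair: "continuous_on UNIV (pair a b)"
  unfolding pair_sum[abs_def] by (intro continuous_intros)

lemma pair_chart:
  assumes f: "curve n f" and M: "curve m M" and p: "\<And>z. pair f M z = 0" and p': "\<And>z. pair (pd3 f) M z = 0"
    and c: "c \<in> coords"
  shows "pair (chart n f c) (chart m M c) z = 0 \<and> pair (pd3 (chart n f c)) (chart m M c) z = 0"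
proof (cases "c = Fin")
  case True then show ?thesis using p p' by simp
next
  case False
  then have c: "c = coord_inf" using c coords_cases by blast
  have d: "\<And>i. degree (f i) \<le> n" "\<And>i. degree (M i) \<le> m" using f M curve_def by blast+
  have 1: "pair (rv n f) (rv m M) w = 0" for w
  proof (rule continuous_eq_off_finite[where f = "pair (rv n f) (rv m M)" and g = "\<lambda>_. 0" and S = "{0}"])
    show "pair (rv n f) (rv m M) w = 0" if "w \<notin> {0}" for w
      using that p[of "1 / w"] by (simp add: pair_def ev_rv[OF d(1)] ev_rv[OF d(2)] vcnj_scale hinner_scale_left hinner_scale_right)
  qed (use continuous_pair in auto)
  have 2: "pair (pd3 (rv n f)) (rv m M) w = 0" for w
  proof (rule continuous_eq_off_finite[where f = "pair (pd3 (rv n f)) (rv m M)" and g = "\<lambda>_. 0" and S = "{0}"])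
    show "pair (pd3 (rv n f)) (rv m M) w = 0" if "w \<notin> {0}" for w
      using that p[of "1 / w"] p'[of "1 / w"]
      by (simp add: pair_def ev_rv[OF d(2)] ev_pd3_rv[OF d(1)] vcnj_scale hinner_scale_left hinner_scale_right hinner_diff_left)
  qed (use continuous_pair in auto)
  show ?thesis using 1 2 by (simp add: c)
qed

definition pcr :: "(3 \<Rightarrow> complex poly) \<Rightarrow> (3 \<Rightarrow> complex poly) \<Rightarrow> 3 \<Rightarrow> complex poly" where
  "pcr p q i = (if i = 1 then p 2 * q 3 - p 3 * q 2 else if i = 2 then p 3 * q 1 - p 1 * q 3 else p 1 * q 2 - p 2 * q 1)"

lemma ev_pcr: "ev (pcr p q) z = crs (ev p z) (ev q z)"
  unfolding vec_eq_iff forall_3 by (simp add: pcr_def)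

lemma vcnj_zero [simp]: "vcnj 0 = 0"
  by simp

definition wr :: "(3 \<Rightarrow> complex poly) \<Rightarrow> complex \<Rightarrow> complex ^ 3" where
  "wr p z = crs (ev p z) (ev (pd3 p) z)"

lemma wr_ev: "wr p z = ev (pcr p (pd3 p)) z"
  by (simp add: wr_def ev_pcr)

lemma crs_diff_right: "crs u (v - w) = crs u v - crs u w"
  unfolding vec_eq_iff forall_3 by (simp add: algebra_simps)

lemma crs_scale_left: "crs (a *s u) v = a *s crs u v" and crs_scale_right: "crs u (a *s v) = a *s crs u v"
  by (simp_all add: vec_eq_iff forall_3 algebra_simps)

lemma wr_rv:
  assumes "\<And>i. degree (p i) \<le> n" "w \<noteq> 0"
  shows "w\<^sup>2 *s wr (rv n p) w = (- (w ^ n * w ^ n)) *s wr p (1 / w)"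
proof -
  have "wr (rv n p) w = (- (w ^ n * w ^ n / w\<^sup>2)) *s wr p (1 / w)"
    unfolding wr_def ev_rv[OF assms] ev_pd3_rv[OF assms] crs_diff_right crs_scale_left crs_scale_right
    by (simp add: vec_eq_iff)
  then show ?thesis using assms(2) by (simp add: vector_smult_assoc)
qed

lemma finite_zeros_ev:
  assumes "ev p z0 \<noteq> 0" shows "finite {z. ev p z = 0}"
proof -
  obtain i where "poly (p i) z0 \<noteq> 0" using assms by (auto simp: vec_eq_iff)
  then have "finite {z. poly (p i) z = 0}" by (intro poly_roots_finite) auto
  then show ?thesis by (rule finite_subset[rotated]) (auto simp: vec_eq_iff)
qed

lemma continuous_ev: "continuous_on UNIV (ev p)"
  using Ck_ev[of 0 p] by simp

subsection \<open>Curves in duality\<close>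

definition dual_curves :: "nat \<Rightarrow> (3 \<Rightarrow> complex poly) \<Rightarrow> nat \<Rightarrow> (3 \<Rightarrow> complex poly) \<Rightarrow> bool" where
  "dual_curves n f m M \<longleftrightarrow> curve n f \<and> curve m M \<and> (\<forall>z. pair f M z = 0) \<and> (\<forall>z. pair (pd3 f) M z = 0)"

lemma dual_curves_chart:
  assumes "dual_curves n f m M" "c \<in> coords"
  shows "dual_curves n (chart n f c) m (chart m M c)"
  unfolding dual_curves_def
proof (intro conjI allI)
  have a: "curve n f" "curve m M" "\<And>z. pair f M z = 0" "\<And>z. pair (pd3 f) M z = 0"
    using assms(1) unfolding dual_curves_def by auto
  show "curve n (chart n f c)" by (rule chart_curve[OF a(1)])
  show "curve m (chart m M c)" by (rule chart_curve[OF a(2)])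
  show "pair (chart n f c) (chart m M c) z = 0" "pair (pd3 (chart n f c)) (chart m M c) z = 0" for z
    using pair_chart[OF a assms(2)] by blast+
qed

lemma dual_curves_pointwise:
  assumes "dual_curves n f m M"
  shows "ev f z \<noteq> 0" "ev M z \<noteq> 0" "hinner (ev f z) (vcnj (ev M z)) = 0"
    "hinner (ev (pd3 f) z) (vcnj (ev M z)) = 0" "hinner (ev f z) (vcnj (ev (pd3 M) z)) = 0"
proof -
  have a: "curve n f" "curve m M" "\<And>z. pair f M z = 0" "\<And>z. pair (pd3 f) M z = 0"
    using assms unfolding dual_curves_def by auto
  have "pair f (pd3 M) z = 0" using pair_derivative[OF a(3), of z] a(4)[of z] by simp
  with a show "ev f z \<noteq> 0" "ev M z \<noteq> 0" "hinner (ev f z) (vcnj (ev M z)) = 0"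
    "hinner (ev (pd3 f) z) (vcnj (ev M z)) = 0" "hinner (ev f z) (vcnj (ev (pd3 M) z)) = 0"
    by (auto simp: curve_def pair_def)
qed

lemma wdV_crs:
  assumes "wdV u a b z" "wdV v c d z"
  shows "wdV (\<lambda>w. crs (u w) (v w)) (crs a (v z) + crs (u z) c) (crs b (v z) + crs (u z) d) z"
proof -
  have u: "wd (\<lambda>w. u w $ i) (a $ i) (b $ i) z" and v: "wd (\<lambda>w. v w $ i) (c $ i) (d $ i) z" for i
    using assms unfolding wdV_def by blast+
  have m: "wd (\<lambda>w. u w $ i * v w $ j) (a $ i * v z $ j + u z $ i * c $ j) (b $ i * v z $ j + u z $ i * d $ j) z" for i j
    by (rule wd_mult[OF u v])
  have "wd (\<lambda>w. u w $ i * v w $ j - u w $ k * v w $ l)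
     ((a $ i * v z $ j - a $ k * v z $ l) + (u z $ i * c $ j - u z $ k * c $ l))
     ((b $ i * v z $ j - b $ k * v z $ l) + (u z $ i * d $ j - u z $ k * d $ l)) z" for i j k l
    using wd_diff[OF m[of i j] m[of k l]] by (simp add: algebra_simps)
  then show ?thesis unfolding wdV_def forall_3 by simp
qed

lemma line_second_ff:
  assumes d: "dual_curves n f m M" and c: "c \<in> coords"
  defines "F \<equiv> chart n f c"
  shows "(*v) (second_ff (line n f) c z) ` line n f (c z) = (if wr F z = 0 then {0} else mid n f m M (c z))"
    and "wr F z = 0 \<Longrightarrow> second_ff (line n f) c z = 0"
proof -
  have cv: "curve n f" "curve m M" using d unfolding dual_curves_def by auto
  let ?M = "chart m M c"
  note pw = dual_curves_pointwise[OF dual_curves_chart[OF d c], folded F_def]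
  let ?e = "ev (pd3 F) z - (hinner (ev (pd3 F) z) (ev F z) / hinner (ev F z) (ev F z)) *s ev F z"
  have ff: "second_ff (line n f) c z = csmult (1 / hinner (ev F z) (ev F z)) (outer ?e (ev F z))"
    "(*v) (second_ff (line n f) c z) ` line n f (c z) = vec.span {?e}"
    by (rule second_ff_line[OF _ pw(1) wdV_ev]; simp add: line_chart[OF cv(1) c] F_def)+
  obtain g where g: "wr F z = g *s ev ?M z"
    "?e = (- g / hinner (ev F z) (ev F z)) *s crs (vcnj (ev F z)) (ev ?M z)"
    using dual_pair_pointwise(2)[OF pw] unfolding wr_def by blast
  have h: "hinner (ev F z) (ev F z) \<noteq> 0" using pw(1) by simp
  have g0: "g = 0 \<longleftrightarrow> wr F z = 0" using g(1) pw(2)[of z] by auto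
  show "wr F z = 0 \<Longrightarrow> second_ff (line n f) c z = 0"
    using g(2) g0 unfolding ff by (simp add: outer_def csmult_def vec_eq_iff)
  show "(*v) (second_ff (line n f) c z) ` line n f (c z) = (if wr F z = 0 then {0} else mid n f m M (c z))"
  proof (cases "wr F z = 0")
    case True
    then have "?e = 0" using g(2) g0 by simp
    then show ?thesis unfolding ff(2) using True by simp
  next
    case False
    then have "- g / hinner (ev F z) (ev F z) \<noteq> 0" using h g0 by simp
    from span_single_scale[OF this] show ?thesis unfolding ff(2) g(2) mid_chart[OF cv c] F_def[symmetric]
      using False by simp
  qed
qed

lemma mid_second_ff:
  assumes d: "dual_curves n f m M" and c: "c \<in> coords"
  defines "G \<equiv> chart m M c"
  shows "(*v) (second_ff (mid n f m M) c z) ` mid n f m M (c z) = (if wr G z = 0 then {0} else last_bundle m M (c z))"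
    and "wr G z = 0 \<Longrightarrow> second_ff (mid n f m M) c z = 0"
proof -
  have cv: "curve n f" "curve m M" using d unfolding dual_curves_def by auto
  let ?F = "chart n f c"
  note pw = dual_curves_pointwise[OF dual_curves_chart[OF d c], folded G_def]
  let ?u = "\<lambda>z. crs (vcnj (ev ?F z)) (ev G z)"
  let ?a = "crs (vcnj (ev ?F z)) (ev (pd3 G) z)"
  let ?e = "?a - (hinner ?a (?u z) / hinner (?u z) (?u z)) *s ?u z"
  have u0: "?u w \<noteq> 0" for w by (rule dual_pair_pointwise(1)[OF pw])
  have wd: "wdV ?u ?a (crs (vcnj (ev (pd3 ?F) z)) (ev G z)) z"
    using wdV_crs[OF wdV_vcnj[OF wdV_ev[of ?F z]] wdV_ev[of G z]] by simp
  have ff: "second_ff (mid n f m M) c z = csmult (1 / hinner (?u z) (?u z)) (outer ?e (?u z))"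
    "(*v) (second_ff (mid n f m M) c z) ` mid n f m M (c z) = vec.span {?e}"
    by (rule second_ff_line[OF _ u0 wd]; simp add: mid_chart[OF cv c] G_def)+
  obtain k where k: "wr G z = k *s ev ?F z"
    "?e = (- k * hinner (ev ?F z) (ev ?F z) / hinner (ev G z) (ev G z)) *s vcnj (ev G z)"
    using dual_pair_pointwise(3)[OF pw] unfolding wr_def by blast
  have h: "hinner (ev ?F z) (ev ?F z) \<noteq> 0" "hinner (ev G z) (ev G z) \<noteq> 0" using pw(1,2) by simp_all
  have k0: "k = 0 \<longleftrightarrow> wr G z = 0" using k(1) pw(1)[of z] by auto
  show "wr G z = 0 \<Longrightarrow> second_ff (mid n f m M) c z = 0"
    using k(2) k0 unfolding ff by (simp add: outer_def csmult_def vec_eq_iff)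
  show "(*v) (second_ff (mid n f m M) c z) ` mid n f m M (c z) = (if wr G z = 0 then {0} else last_bundle m M (c z))"
  proof (cases "wr G z = 0")
    case True
    then have "?e = 0" using k(2) k0 by simp
    then show ?thesis unfolding ff(2) using True by simp
  next
    case False
    then have "- k * hinner (ev ?F z) (ev ?F z) / hinner (ev G z) (ev G z) \<noteq> 0" using h k0 by simp
    from span_single_scale[OF this] show ?thesis unfolding ff(2) k(2) last_bundle_chart[OF cv(2) c] G_def[symmetric]
      using False by simp
  qed
qed

lemma last_second_ff:
  assumes cv: "curve m M" and c: "c \<in> coords"
  shows "(*v) (second_ff (last_bundle m M) c z) ` last_bundle m M (c z) = {0}"
proof -
  let ?G = "chart m M c" and ?u = "\<lambda>z. vcnj (ev (chart m M c) z)"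
  have u0: "?u w \<noteq> 0" for w using chart_curve[OF cv, of c] by (simp add: curve_def)
  have wd: "wdV ?u 0 (vcnj (ev (pd3 ?G) z)) z"
    using wdV_vcnj[OF wdV_ev[of ?G z]] by simp
  have "(*v) (second_ff (last_bundle m M) c z) ` last_bundle m M (c z)
    = vec.span {0 - (hinner 0 (?u z) / hinner (?u z) (?u z)) *s ?u z}"
    by (rule second_ff_line(2)[OF _ u0 wd]) (simp add: last_bundle_chart[OF cv c])
  then show ?thesis by (simp add: hinner_simps)
qed

lemma smooth_line:
  assumes "curve n f" shows "smooth_subbundle 1 (line n f)"
proof (rule smooth_line_bundle[where u = "\<lambda>c. ev (chart n f c)"])
  show "line n f (c z) = vec.span {ev (chart n f c) z} \<and> ev (chart n f c) z \<noteq> 0" if "c \<in> coords" for c z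
    using line_chart[OF assms that] chart_curve[OF assms, of c] by (simp add: curve_def)
qed (rule Ck_ev)

lemma Ck_vcnj: "Ck k u \<Longrightarrow> Ck k (\<lambda>z. vcnj (u z))"
  by (rule Ck_vec) (simp add: Ck_linear[OF bounded_linear_cnj Ck_component])

lemma Ck_crs:
  assumes u: "Ck k u" and v: "Ck k v" shows "Ck k (\<lambda>z. crs (u z) (v z))"
proof (rule Ck_vec)
  have m: "Ck k (\<lambda>z. u z $ i * v z $ j)" for i j
    by (rule Ck_mult[OF Ck_component[OF u] Ck_component[OF v]])
  have "Ck k (\<lambda>z. u z $ i * v z $ j + - 1 * (u z $ l * v z $ r))" for i j l r
    by (intro Ck_add m Ck_mult[OF Ck_const m])
  then have d: "Ck k (\<lambda>z. u z $ i * v z $ j - u z $ l * v z $ r)" for i j l r by simp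
  show "Ck k (\<lambda>z. crs (u z) (v z) $ i)" for i
    using exhaust_3[of i] by (elim disjE) (simp_all add: d)
qed

lemma smooth_mid:
  assumes d: "dual_curves n f m M" shows "smooth_subbundle 1 (mid n f m M)"
proof (rule smooth_line_bundle[where u = "\<lambda>c z. crs (vcnj (ev (chart n f c) z)) (ev (chart m M c) z)"])
  have cv: "curve n f" "curve m M" using d unfolding dual_curves_def by auto
  show "mid n f m M (c z) = vec.span {crs (vcnj (ev (chart n f c) z)) (ev (chart m M c) z)}
    \<and> crs (vcnj (ev (chart n f c) z)) (ev (chart m M c) z) \<noteq> 0" if c: "c \<in> coords" for c z
    using mid_chart[OF cv c] dual_pair_pointwise(1)[OF dual_curves_pointwise[OF dual_curves_chart[OF d c]]] by blast
qed (intro Ck_crs Ck_vcnj Ck_ev)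

lemma smooth_last:
  assumes cv: "curve m M" shows "smooth_subbundle 1 (last_bundle m M)"
proof (rule smooth_line_bundle[where u = "\<lambda>c z. vcnj (ev (chart m M c) z)"])
  show "last_bundle m M (c z) = vec.span {vcnj (ev (chart m M c) z)} \<and> vcnj (ev (chart m M c) z) \<noteq> 0" if c: "c \<in> coords" for c z
    using last_bundle_chart[OF cv c] chart_curve[OF cv, of c] by (simp add: curve_def)
qed (intro Ck_vcnj Ck_ev)

lemma wr_chart_nonzero:
  assumes cv: "curve n f" and c: "c \<in> coords" and z: "c z \<notin> insert Infty (Fin ` {z. wr f z = 0})"
  shows "wr (chart n f c) z \<noteq> 0"
proof (cases "c = Fin")
  case True then show ?thesis using z by auto
next
  case False
  then have ci: "c = coord_inf" using c coords_cases by blast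
  then have z0: "z \<noteq> 0" using z by (auto simp: coord_inf_simps)
  then have "wr f (1 / z) \<noteq> 0" using z by (auto simp: ci coord_inf_simps)
  moreover have "\<And>i. degree (f i) \<le> n" using cv curve_def by blast
  ultimately show ?thesis using wr_rv[of f n z] z0 by (auto simp: ci)
qed

lemma totally_unramified_nonzero:
  assumes d: "dual_curves n f m M" and f: "wr f z0 \<noteq> 0" and M: "wr M z1 \<noteq> 0"
    and tu: "totally_unramified (line n f)" and c: "c \<in> coords"
  shows "wr (chart n f c) z \<noteq> 0" "wr (chart m M c) z \<noteq> 0"
proof -
  have cv: "curve n f" "curve m M" using d unfolding dual_curves_def by auto
  have "finite {z. wr f z = 0}" "finite {z. wr M z = 0}"
    using finite_zeros_ev f M unfolding wr_ev by blast+
  then have fin: "finite (insert Infty (Fin ` {z. wr f z = 0}))" "finite (insert Infty (Fin ` {z. wr M z = 0}))" by simp_all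
  have 1: "next_bundle (line n f) = mid n f m M"
  proof (rule next_bundle_eqI[OF smooth_mid[OF d] order_refl fin(1)])
    fix c z assume c: "c \<in> coords" and z: "c z \<notin> insert Infty (Fin ` {z. wr f z = 0})"
    show "mid n f m M (c z) = (*v) (second_ff (line n f) c z) ` line n f (c z)"
      unfolding line_second_ff(1)[OF d c] using wr_chart_nonzero[OF cv(1) c z] by simp
  qed
  have 2: "next_bundle (mid n f m M) = last_bundle m M"
  proof (rule next_bundle_eqI[OF smooth_last[OF cv(2)] order_refl fin(2)])
    fix c z assume c: "c \<in> coords" and z: "c z \<notin> insert Infty (Fin ` {z. wr M z = 0})"
    show "last_bundle m M (c z) = (*v) (second_ff (mid n f m M) c z) ` mid n f m M (c z)"
      unfolding mid_second_ff(1)[OF d c] using wr_chart_nonzero[OF cv(2) c z] by simp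
  qed
  have ne: "mid n f m M p \<noteq> {0}" "last_bundle m M p \<noteq> {0}" for p
  proof -
    have "vec.dim (mid n f m M p) = 1" "vec.dim (last_bundle m M p) = 1"
      using smooth_mid[OF d] smooth_last[OF cv(2)] unfolding smooth_subbundle_def by auto
    moreover have "vec.dim ({0} :: (complex ^ 3) set) = 0" by (simp add: vec.dim_eq_0)
    ultimately show "mid n f m M p \<noteq> {0}" "last_bundle m M p \<noteq> {0}" by (metis zero_neq_one)+
  qed
  have g: "gauss_bundle 0 (line n f) = line n f" "gauss_bundle (Suc 0) (line n f) = mid n f m M"
    "gauss_bundle (Suc (Suc 0)) (line n f) = last_bundle m M"
    by (simp_all add: gauss_bundle_def 1 2)
  obtain r where r: "\<forall>p. gauss_bundle (Suc r) (line n f) p = {0}"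
    and det: "\<And>i c z. i < r \<Longrightarrow> c \<in> coords \<Longrightarrow>
        det_on (gauss_bundle (Suc i) (line n f) (c z))
          (second_ff (gauss_bundle i (line n f)) c z ** adj (second_ff (gauss_bundle i (line n f)) c z)) \<noteq> 0"
    using tu unfolding totally_unramified_def by blast
  have "r \<noteq> 0" using r[rule_format, of Infty] ne(1)[of Infty] unfolding g(2)[symmetric] by metis
  moreover have "r \<noteq> Suc 0" using r[rule_format, of Infty] ne(2)[of Infty] unfolding g(3)[symmetric] by metis
  ultimately have r2: "0 < r" "Suc 0 < r" by auto
  have d1: "det_on (mid n f m M (c z)) (second_ff (line n f) c z ** adj (second_ff (line n f) c z)) \<noteq> 0"
    using det[OF r2(1) c, of z] unfolding g .
  have d2: "det_on (last_bundle m M (c z)) (second_ff (mid n f m M) c z ** adj (second_ff (mid n f m M) c z)) \<noteq> 0"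
    using det[OF r2(2) c, of z] unfolding g .
  have u0: "crs (vcnj (ev (chart n f c) z)) (ev (chart m M c) z) \<noteq> 0" "vcnj (ev (chart m M c) z) \<noteq> 0"
    using dual_pair_pointwise(1)[OF dual_curves_pointwise[OF dual_curves_chart[OF d c]]]
      dual_curves_pointwise(2)[OF dual_curves_chart[OF d c]] by auto
  show "wr (chart n f c) z \<noteq> 0"
    using d1 line_second_ff(2)[OF d c, of z] det_on_zero[OF u0(1)] unfolding mid_chart[OF cv c] by metis
  show "wr (chart m M c) z \<noteq> 0"
    using d2 mid_second_ff(2)[OF d c, of z] det_on_zero[OF u0(2)] unfolding last_bundle_chart[OF cv(2) c] by metis
qed

subsection \<open>Reduction of polynomial curves and the dual curve\<close>

lemma reduce_curve:
  fixes p :: "3 \<Rightarrow> complex poly"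
  assumes "p i0 \<noteq> 0"
  obtains g M m where "g \<noteq> 0" "\<And>i. p i = g * M i" "curve m M"
proof -
  define D where "D d \<longleftrightarrow> (\<exists>g. g \<noteq> 0 \<and> degree g = d \<and> (\<forall>i. g dvd p i))" for d
  have "D 0" unfolding D_def by (intro exI[of _ 1]) simp
  moreover have "d \<le> degree (p i0)" if "D d" for d
    using that assms dvd_imp_degree_le unfolding D_def by blast
  ultimately obtain d where d: "D d" "\<And>e. D e \<Longrightarrow> e \<le> d"
    using ex_has_greatest_nat[of D 0 "\<lambda>d. d" "Suc (degree (p i0))"] by (metis le_imp_less_Suc)
  then obtain g where g: "g \<noteq> 0" "degree g = d" "\<And>i. g dvd p i" unfolding D_def by blast
  then obtain M where M: "\<And>i. p i = g * M i" unfolding dvd_def by metis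
  have ex: "\<exists>i. M i \<noteq> 0" using assms M by (metis mult_zero_right)
  define m where "m = Max (range (\<lambda>i. degree (M i)))"
  have deg: "degree (M i) \<le> m" for i unfolding m_def by (rule Max_ge) auto
  have "curve m M"
    unfolding curve_def
  proof (intro conjI allI deg)
    fix z show "ev M z \<noteq> 0"
    proof
      assume "ev M z = 0"
      then have "[:- z, 1:] dvd M i" for i by (auto simp: vec_eq_iff poly_eq_0_iff_dvd)
      then have "(g * [:- z, 1:]) dvd p i" for i unfolding M by (intro mult_dvd_mono) auto
      moreover have "g * [:- z, 1:] \<noteq> 0" using g(1) by (simp only: mult_eq_0_iff) simp
      moreover have "degree (g * [:- z, 1:]) = Suc d" using g by (subst degree_mult_eq) auto
      ultimately have "D (Suc d)" unfolding D_def by metis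
      then show False using d(2) by fastforce
    qed
  next
    have "m \<in> range (\<lambda>i. degree (M i))" unfolding m_def by (rule Max_in) auto
    then obtain i where i: "degree (M i) = m" by auto
    show "\<exists>i. coeff (M i) m \<noteq> 0"
    proof (cases "M i = 0")
      case False
      then show ?thesis using i by (intro exI[of _ i]) auto
    next
      case True
      then have "m = 0" using i by simp
      moreover obtain j where "M j \<noteq> 0" using ex by blast
      ultimately have "coeff (M j) m \<noteq> 0" using deg[of j] by (metis le_0_eq leading_coeff_0_iff)
      then show ?thesis by blast
    qed
  qed
  then show ?thesis using that g(1) M by blast
qed

lemma wronskian_zero:
  fixes p q :: "complex poly"
  assumes w: "pderiv p * q = p * pderiv q" and "poly p z = 0" "poly q z \<noteq> 0"
  shows "p = 0"
proof (rule ccontr)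
  assume p: "p \<noteq> 0"
  have q: "q \<noteq> 0" using assms(3) by auto
  have "degree p \<noteq> 0"
  proof
    assume "degree p = 0"
    then obtain a where "p = [:a:]" by (rule degree_eq_zeroE)
    then show False using assms(2) p by simp
  qed
  then have p': "pderiv p \<noteq> 0" by (simp add: pderiv_eq_0_iff)
  then have ne: "pderiv p * q \<noteq> 0" "p * pderiv q \<noteq> 0" using q w by auto
  have "order z p = Suc (order z (pderiv p))" by (rule order_pderiv[OF p assms(2)])
  moreover have "order z q = 0" using assms(3) by (simp add: order_root)
  ultimately show False using order_mult[OF ne(1), of z] order_mult[OF ne(2), of z] w by simp
qed

lemma constant_curve:
  assumes cv: "curve n p" and "\<And>z. wr p z = 0"
  obtains v where "v \<noteq> 0" "\<And>z. \<exists>c. ev p z = c *s v"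
proof -
  have "ev p 0 \<noteq> 0" using cv curve_def by blast
  then obtain j where j: "poly (p j) 0 \<noteq> 0" by (auto simp: vec_eq_iff)
  have W: "p k * pderiv (p l) = p l * pderiv (p k)" for k l
  proof (rule poly_ext)
    fix z
    have c: "crs (ev p z) (ev (pd3 p) z) = 0" using assms(2)[of z] by (simp add: wr_def)
    obtain t where t: "ev (pd3 p) z = t *s ev p z"
      using crs_eq_0_iff[OF c] cv curve_def by blast
    have "poly (pderiv (p i)) z = t * poly (p i) z" for i
      using arg_cong[OF t, of "\<lambda>v. v $ i"] by (simp add: pd3_def)
    then show "poly (p k * pderiv (p l)) z = poly (p l * pderiv (p k)) z" by simp
  qed
  have eq: "smult (poly (p j) 0) (p i) = smult (poly (p i) 0) (p j)" for i
  proof -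
    have "smult (poly (p j) 0) (p i) - smult (poly (p i) 0) (p j) = 0"
    proof (rule wronskian_zero[where q = "p j" and z = 0])
      show "pderiv (smult (poly (p j) 0) (p i) - smult (poly (p i) 0) (p j)) * p j
        = (smult (poly (p j) 0) (p i) - smult (poly (p i) 0) (p j)) * pderiv (p j)"
        using W[of i j] by (simp add: pderiv_diff pderiv_smult algebra_simps)
    qed (use j in simp_all)
    then show ?thesis by simp
  qed
  have "ev p z = (poly (p j) z / poly (p j) 0) *s ev p 0" for z
  proof -
    have "poly (p j) 0 * poly (p i) z = poly (p i) 0 * poly (p j) z" for i
      using arg_cong[OF eq[of i], of "\<lambda>p. poly p z"] by simp
    then show ?thesis using j by (simp add: vec_eq_iff field_simps)
  qed
  then show ?thesis using that[of "ev p 0"] cv curve_def by blast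
qed

lemma orthogonal_vector: "\<exists>w \<noteq> 0. hinner v w = 0" for v :: "complex ^ 3"
proof (cases "v $ 1 = 0")
  case True
  then show ?thesis by (intro exI[of _ "axis 1 1"]) (simp add: hinner_3 axis_def axis_eq_0_iff vec_eq_iff forall_3)
next
  case False
  then show ?thesis by (intro exI[of _ "vector [cnj (v $ 2), - cnj (v $ 1), 0]"])
    (simp add: hinner_3 vec_eq_iff forall_3)
qed

lemma dual_curve_exists:
  assumes cv: "curve n f" and full: "\<And>v. v \<noteq> 0 \<Longrightarrow> \<exists>z. hinner (ev f z) v \<noteq> 0"
  obtains m M g z0 z1 where "dual_curves n f m M" "g \<noteq> 0" "\<And>z. wr f z = poly g z *s ev M z" "wr f z0 \<noteq> 0" "wr M z1 \<noteq> 0"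
proof -
  have nc: "\<exists>z. wr f z \<noteq> 0"
  proof (rule ccontr)
    assume "\<not> ?thesis"
    then obtain v where v: "v \<noteq> 0" "\<And>z. \<exists>c. ev f z = c *s v" using constant_curve[OF cv] by blast
    obtain w where w: "w \<noteq> 0" "hinner v w = 0" using orthogonal_vector by blast
    obtain z where "hinner (ev f z) w \<noteq> 0" using full w(1) by blast
    then show False using v(2)[of z] w(2) by (auto simp: hinner_scale_left)
  qed
  then obtain z0 where z0: "wr f z0 \<noteq> 0" by blast
  let ?W = "pcr f (pd3 f)"
  have "\<exists>i. ?W i \<noteq> 0" using z0 unfolding wr_ev by (metis ev_nth poly_0 vec_eq_iff zero_index)
  then obtain g M m where g: "g \<noteq> 0" "\<And>i. ?W i = g * M i" and M: "curve m M" using reduce_curve by metis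
  have W: "wr f z = poly g z *s ev M z" for z unfolding wr_ev by (simp add: vec_eq_iff g(2))
  have orth: "pair a M z = 0" if "\<And>z. hinner (ev a z) (vcnj (wr f z)) = 0" for a z
  proof (rule continuous_eq_off_finite[where f = "pair a M" and g = "\<lambda>_. 0" and S = "{z. poly g z = 0}"])
    show "pair a M z = 0" if "z \<notin> {z. poly g z = 0}" for z
      using \<open>\<And>z. hinner (ev a z) (vcnj (wr f z)) = 0\<close>[of z] that
      unfolding W pair_def vcnj_scale hinner_scale_right by simp
  qed (use continuous_pair poly_roots_finite[OF g(1)] in auto)
  have d: "dual_curves n f m M" unfolding dual_curves_def
    using cv M orth[of f] orth[of "pd3 f"] by (simp add: wr_def hinner_crs_left hinner_crs_right)
  have "\<exists>z. wr M z \<noteq> 0"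
  proof (rule ccontr)
    assume "\<not> ?thesis"
    then obtain v where v: "v \<noteq> 0" "\<And>z. \<exists>c. ev M z = c *s v" using constant_curve[OF M] by blast
    have "hinner (ev f z) (vcnj v) = 0" for z
    proof -
      obtain c where c: "ev M z = c *s v" using v(2) by blast
      then have "c \<noteq> 0" using M curve_def by fastforce
      then show ?thesis using dual_curves_pointwise(3)[OF d, of z] unfolding c vcnj_scale hinner_scale_right by simp
    qed
    then show False using full[of "vcnj v"] v(1) by auto
  qed
  then show ?thesis using that d g(1) W z0 by blast
qed

lemma power_match:
  fixes u v :: "complex \<Rightarrow> complex ^ 3"
  assumes "continuous_on UNIV u" "continuous_on UNIV v" "u 0 \<noteq> 0" "v 0 \<noteq> 0"
    and e: "\<And>w. w \<noteq> 0 \<Longrightarrow> w ^ a *s u w = w ^ b *s v w"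
  shows "a = b"
proof -
  have *: "\<not> a < b" if c: "continuous_on UNIV u" "continuous_on UNIV v" and u: "u 0 \<noteq> 0"
    and e: "\<And>w. w \<noteq> 0 \<Longrightarrow> w ^ a *s u w = w ^ b *s v w" for u v :: "complex \<Rightarrow> complex ^ 3" and a b :: nat
  proof
    assume ab: "a < b"
    have "u 0 = 0 ^ (b - a) *s v 0"
    proof (rule continuous_eq_off_finite[where f = u and g = "\<lambda>w. w ^ (b - a) *s v w" and S = "{0}" and z = 0])
      show "continuous_on UNIV (\<lambda>w. w ^ (b - a) *s v w)"
      proof -
        have "continuous_on UNIV (\<lambda>w. \<chi> i. w ^ (b - a) * v w $ i)"
          by (intro continuous_on_vec_lambda continuous_intros c)
        then show ?thesis by (simp add: vector_scalar_mult_def)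
      qed
      show "u w = w ^ (b - a) *s v w" if "w \<notin> {0}" for w
      proof -
        have w: "w \<noteq> 0" using that by simp
        have "w ^ b = w ^ a * w ^ (b - a)" using ab by (simp add: power_add[symmetric])
        then have "w ^ a *s u w = w ^ a *s (w ^ (b - a) *s v w)" using e[OF w] by (simp add: vector_smult_assoc)
        then show ?thesis using w by (simp add: vec_eq_iff mult.assoc)
      qed
    qed (use c in auto)
    then show False using ab u by (simp add: power_0_left)
  qed
  show ?thesis using *[OF assms(1,2,3) e] *[OF assms(2,1,4), of b a] e by (metis linorder_neqE_nat)
qed

lemma unramified_degree:
  assumes f: "curve n f" and M: "curve m M" and W: "\<And>z. wr f z = \<gamma> *s ev M z" and g: "\<gamma> \<noteq> 0"
    and inf: "wr (rv n f) 0 \<noteq> 0"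
  shows "m + 2 = 2 * n"
proof (rule power_match[where u = "wr (rv n f)" and v = "\<lambda>w. (- \<gamma>) *s ev (rv m M) w"])
  have d: "\<And>i. degree (f i) \<le> n" "\<And>i. degree (M i) \<le> m" using f M curve_def by blast+
  show "continuous_on UNIV (wr (rv n f))" using continuous_ev by (simp add: wr_ev[abs_def])
  show "continuous_on UNIV (\<lambda>w. (- \<gamma>) *s ev (rv m M) w)"
  proof -
    have "continuous_on UNIV (\<lambda>w. \<chi> i. (- \<gamma>) * ev (rv m M) w $ i)"
      by (intro continuous_on_vec_lambda continuous_intros continuous_ev)
    then show ?thesis by (simp add: vector_scalar_mult_def)
  qed
  show "wr (rv n f) 0 \<noteq> 0" by (rule inf)
  show "(- \<gamma>) *s ev (rv m M) 0 \<noteq> 0" using g curve_rv[OF M] by (simp add: curve_def)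
  show "w ^ (m + 2) *s wr (rv n f) w = w ^ (2 * n) *s ((- \<gamma>) *s ev (rv m M) w)" if w: "w \<noteq> 0" for w
  proof -
    have "w ^ (m + 2) *s wr (rv n f) w = w ^ m *s (w\<^sup>2 *s wr (rv n f) w)"
      by (simp only: vector_smult_assoc power_add)
    also have "\<dots> = w ^ (2 * n) *s ((- \<gamma>) *s ev (rv m M) w)"
      unfolding wr_rv[OF d(1) w] ev_rv[OF d(2) w] W vector_smult_assoc
      by (simp add: power_mult power2_eq_square power_mult_distrib mult_ac)
    finally show ?thesis .
  qed
qed

lemma nonvanishing_poly_const:
  fixes g :: "complex poly"
  assumes "\<And>z. poly g z \<noteq> 0" obtains c where "c \<noteq> 0" "g = [:c:]"
proof -
  have "degree g = 0" using assms fundamental_theorem_of_algebra[of g] by (metis constant_degree)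
  then obtain c where "g = [:c:]" by (rule degree_eq_zeroE)
  then show ?thesis using that assms[of 0] by auto
qed

theorem unramified_conic:
  assumes cv: "curve n f" and full: "\<And>v. v \<noteq> 0 \<Longrightarrow> \<exists>z. hinner (ev f z) v \<noteq> 0"
    and tu: "totally_unramified (line n f)"
  obtains f0 f1 f2 where "n = 2" "\<And>z. ev f z = f0 + z *s f1 + z\<^sup>2 *s f2" "hinner f0 (vcnj (crs f1 f2)) \<noteq> 0"
    "\<And>z. wr f z \<noteq> 0" "\<And>z. wr (rv n f) z \<noteq> 0"
proof -
  obtain m M g z0 z1 where d: "dual_curves n f m M" and W: "\<And>z. wr f z = poly g z *s ev M z"
    and z: "wr f z0 \<noteq> 0" "wr M z1 \<noteq> 0"
    using dual_curve_exists[OF cv full] by metis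
  have M: "curve m M" using d unfolding dual_curves_def by blast
  note nz = totally_unramified_nonzero[OF d z tu]
  have nzf: "wr f z \<noteq> 0" "wr M z \<noteq> 0" "wr (rv n f) z \<noteq> 0" "wr (rv m M) z \<noteq> 0" for z
    using nz[OF coords_mem(1), of z] nz[OF coords_mem(2), of z] by simp_all
  have "poly g z \<noteq> 0" for z using nzf(1)[of z] W[of z] by auto
  then obtain \<gamma> where \<gamma>: "\<gamma> \<noteq> 0" "g = [:\<gamma>:]" using nonvanishing_poly_const by blast
  have W': "wr f z = \<gamma> *s ev M z" for z using W \<gamma> by simp
  have n1: "m + 2 = 2 * n" by (rule unramified_degree[OF cv M W' \<gamma>(1) nzf(3)])
  define k where "k z = pair f (pcr (pd3 f) (pd3 (pd3 f))) z" for z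
  have kp: "wr M z = (k z / \<gamma>\<^sup>2) *s ev f z" for z
  proof -
    have 1: "wdV (wr f) (crs (ev f z) (ev (pd3 (pd3 f)) z)) 0 z"
      unfolding wr_def[abs_def] using wdV_crs[OF wdV_ev[of f z] wdV_ev[of "pd3 f" z]] by simp
    have 2: "wdV (wr f) (\<gamma> *s ev (pd3 M) z) 0 z"
      using wdV_scale[OF wd_const[of \<gamma> z] wdV_ev[of M z]] unfolding W'[abs_def] by simp
    have "\<gamma> *s ev (pd3 M) z = crs (ev f z) (ev (pd3 (pd3 f)) z)" using wdV_unique[OF 1 2] by simp
    then have "crs (\<gamma> *s ev M z) (\<gamma> *s ev (pd3 M) z) = k z *s ev f z"
      unfolding W'[symmetric] by (simp add: wr_def crs_crs k_def pair_def ev_pcr)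
    then have e: "(\<gamma> * \<gamma>) *s wr M z = k z *s ev f z" unfolding crs_scale wr_def .
    have "wr M z = (1 / (\<gamma> * \<gamma>)) *s ((\<gamma> * \<gamma>) *s wr M z)" using \<gamma>(1) by (simp add: vector_smult_assoc)
    then show ?thesis unfolding e by (simp add: vector_smult_assoc power2_eq_square)
  qed
  define K where "K = (\<Sum>i\<in>UNIV. f i * pcr (pd3 f) (pd3 (pd3 f)) i)"
  have K: "poly K z = k z" for z by (simp add: K_def k_def pair_sum poly_sum)
  have "k z \<noteq> 0" for z using nzf(2)[of z] kp[of z] by auto
  then obtain \<kappa> where \<kappa>: "\<kappa> \<noteq> 0" "K = [:\<kappa>:]" using nonvanishing_poly_const[of K] K by metis
  then have kc: "k z = \<kappa>" for z using K[of z] by simp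
  have n2: "n + 2 = 2 * m"
    by (rule unramified_degree[OF M cv, where \<gamma> = "\<kappa> / \<gamma>\<^sup>2"]) (use kp kc \<gamma> \<kappa> nzf(4) in simp_all)
  have n: "n = 2" using n1 n2 by simp
  define F where "F k = (\<chi> i. coeff (f i) k)" for k
  have "poly (f i) z = coeff (f i) 0 + z * coeff (f i) 1 + z\<^sup>2 * coeff (f i) 2" for i z
  proof -
    have "degree (f i) \<le> 2" using cv n curve_def by blast
    then have "poly (f i) z = (\<Sum>k\<le>2. coeff (f i) k * z ^ k)"
      unfolding poly_altdef by (intro sum.mono_neutral_left) (auto simp: coeff_eq_0)
    also have "\<dots> = coeff (f i) 0 + z * coeff (f i) 1 + z\<^sup>2 * coeff (f i) 2"
      by (simp add: eval_nat_numeral)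
    finally show ?thesis .
  qed
  then have fz: "ev f z = F 0 + z *s F 1 + z\<^sup>2 *s F 2" for z by (simp add: vec_eq_iff F_def)
  have "ev f 0 = F 0" "ev (pd3 f) 0 = F 1" "ev (pd3 (pd3 f)) 0 = 2 *s F 2"
    by (simp_all add: vec_eq_iff F_def pd3_def poly_0_coeff_0 coeff_pderiv eval_nat_numeral)
  then have "k 0 = 2 * hinner (F 0) (vcnj (crs (F 1) (F 2)))"
    by (simp add: k_def pair_def ev_pcr crs_scale_right vcnj_scale hinner_scale_right)
  then have "hinner (F 0) (vcnj (crs (F 1) (F 2))) \<noteq> 0" using kc \<kappa> by auto
  then show ?thesis using that[OF n fz] nzf(1,3) by blast
qed

subsection \<open>Holomorphic line bundles on the sphere are rational\<close>

definition local_frame ::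
    "(rsphere \<Rightarrow> (complex ^ 'n) set) \<Rightarrow> (complex \<Rightarrow> rsphere) \<Rightarrow> complex \<Rightarrow> complex set \<Rightarrow> (complex \<Rightarrow> complex ^ 'n) \<Rightarrow> bool" where
  "local_frame Y c z0 U v \<longleftrightarrow> open U \<and> z0 \<in> U \<and> (\<forall>j. (\<lambda>z. v z $ j) holomorphic_on U) \<and>
     (\<forall>z\<in>U. v z \<noteq> 0 \<and> Y (c z) = vec.span {v z})"

lemma local_frameD:
  assumes "local_frame Y c z0 U v"
  shows "open U" "z0 \<in> U" "(\<lambda>z. v z $ j) holomorphic_on U" "z \<in> U \<Longrightarrow> v z \<noteq> 0 \<and> Y (c z) = vec.span {v z}"
  using assms by (simp_all add: local_frame_def)

lemma holomorphic_line_local: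
  fixes Y :: "rsphere \<Rightarrow> (complex ^ 'n) set"
  assumes "holomorphic_subbundle 1 Y" "c \<in> coords"
  shows "\<exists>U v. local_frame Y c z0 U v"
proof -
  obtain U and s :: "nat \<Rightarrow> complex \<Rightarrow> complex ^ 'n" where U: "open U" "z0 \<in> U"
    and s: "\<And>i j. i < 1 \<Longrightarrow> (\<lambda>z. s i z $ j) holomorphic_on U"
    and Y: "\<And>z. z \<in> U \<Longrightarrow> Y (c z) = vec.span ((\<lambda>i. s i z) ` {..<1}) \<and> vec.dim (Y (c z)) = 1"
    using assms unfolding holomorphic_subbundle_def by metis
  have "{..<1 :: nat} = {0}" by auto
  then have Y': "Y (c z) = vec.span {s 0 z}" "vec.dim (Y (c z)) = 1" if "z \<in> U" for z
    using Y[OF that] by auto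
  have "s 0 z \<noteq> 0" if "z \<in> U" for z
  proof
    assume "s 0 z = 0"
    then have "vec.dim (Y (c z)) = vec.dim {0 :: complex ^ 'n}" using Y'(1)[OF that] by simp
    then show False using Y'(2)[OF that] by (simp add: vec.dim_eq_0)
  qed
  then have "local_frame Y c z0 U (s 0)" unfolding local_frame_def using U s Y'(1) by auto
  then show ?thesis by blast
qed

lemma span_single_eq_iff:
  assumes "vec.span {u} = vec.span {v}" "v \<noteq> (0 :: complex ^ 'n)"
  obtains t where "t \<noteq> 0" "v = t *s u"
proof -
  have "v \<in> vec.span {u}" unfolding assms(1) by (intro vec.span_base) simp
  then obtain t where t: "v = t *s u" unfolding span_single by blast
  then have "t \<noteq> 0" using assms(2) by auto
  then show ?thesis using that t by blast
qed

lemma holomorphic_line_bundle_rational: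
  fixes Y :: "rsphere \<Rightarrow> (complex ^ 3) set"
  assumes Y: "holomorphic_subbundle 1 Y"
  obtains n f where "curve n f" "Y = line n f"
proof -
  define u where "u p = (SOME v. v \<noteq> 0 \<and> Y p = vec.span {v})" for p
  have u: "u p \<noteq> 0" "Y p = vec.span {u p}" for p
  proof -
    obtain c z where c: "c \<in> coords" "p = c z" using sphere_cover by blast
    obtain U v where L: "local_frame Y c z U v" using holomorphic_line_local[OF Y c(1)] by blast
    note U = local_frameD[OF L]
    have "v z \<noteq> 0 \<and> Y p = vec.span {v z}" using U(4)[OF U(2)] c(2) by simp
    then have "\<exists>v. v \<noteq> 0 \<and> Y p = vec.span {v}" by blast
    from someI_ex[OF this] show "u p \<noteq> 0" "Y p = vec.span {u p}" unfolding u_def by blast+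
  qed
  obtain k where k: "u Infty $ k \<noteq> 0" using u(1)[of Infty] by (auto simp: vec_eq_iff)
  define R where "R j z = u (Fin z) $ j / u (Fin z) $ k" for j z
  define Z where "Z = {z. u (Fin z) $ k = 0}"
  have ratio: "(v $ k = 0 \<longleftrightarrow> u p $ k = 0) \<and> v $ j / v $ k = u p $ j / u p $ k"
    if "v \<noteq> 0" "Y p = vec.span {v}" for v p j
  proof -
    have "vec.span {u p} = vec.span {v}" by (rule trans[OF u(2)[of p, symmetric] that(2)])
    from this that(1) obtain t where "t \<noteq> 0" and v: "v = t *s u p" by (rule span_single_eq_iff)
    then show ?thesis unfolding v by simp
  qed
  define L where "L z0 U v \<longleftrightarrow> open U \<and> z0 \<in> U \<and> (\<forall>j. (\<lambda>z. v z $ j) holomorphic_on U) \<and>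
      (\<forall>z\<in>U. (v z $ k = 0 \<longleftrightarrow> z \<in> Z) \<and> (\<forall>j. R j z = v z $ j / v z $ k))" for z0 U and v :: "complex \<Rightarrow> complex ^ 3"
  have loc: "\<exists>U v. L z0 U v" for z0
  proof -
    obtain U v where L: "local_frame Y Fin z0 U v" using holomorphic_line_local[OF Y coords_mem(1)] by blast
    note U = local_frameD[OF L]
    have "(v z $ k = 0 \<longleftrightarrow> z \<in> Z) \<and> (\<forall>j. R j z = v z $ j / v z $ k)" if "z \<in> U" for z
      using ratio[OF conjunct1[OF U(4)[OF that]] conjunct2[OF U(4)[OF that]]] unfolding Z_def R_def mem_Collect_eq by metis
    then have "L z0 U v" unfolding L_def using U(1-3) by blast
    then show ?thesis by blast
  qed
  have LD: "open U" "z0 \<in> U" "(\<lambda>z. v z $ j) holomorphic_on U" "z \<in> U \<Longrightarrow> v z $ k = 0 \<longleftrightarrow> z \<in> Z"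
      "z \<in> U \<Longrightarrow> R j z = v z $ j / v z $ k" if "L z0 U v" for z0 U v j z
    using that unfolding L_def by blast+
  obtain U v where L: "local_frame Y coord_inf 0 U v" using holomorphic_line_local[OF Y coords_mem(2)] by blast
    note U = local_frameD[OF L]
  have vR: "(v w $ k = 0 \<longleftrightarrow> 1 / w \<in> Z) \<and> R j (1 / w) = v w $ j / v w $ k" if "w \<in> U" "w \<noteq> 0" for w j
    using ratio[OF conjunct1[OF U(4)[OF that(1)]] conjunct2[OF U(4)[OF that(1)]]]
    unfolding Z_def R_def mem_Collect_eq coord_inf_simps(2)[OF that(2)] by metis
  have vk0: "v 0 $ k \<noteq> 0" using ratio[OF conjunct1[OF U(4)[OF U(2)]] conjunct2[OF U(4)[OF U(2)]]] k
    unfolding coord_inf_simps(1) by blast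
  have "isCont (\<lambda>w. v w $ k) 0"
    using U(1,2,3) holomorphic_on_imp_continuous_on continuous_on_eq_continuous_at by blast
  then obtain d1 where d1: "d1 > 0" "\<And>w. dist 0 w < d1 \<Longrightarrow> v w $ k \<noteq> 0"
    using continuous_at_avoid[of 0 "\<lambda>w. v w $ k" 0] vk0 by blast
  obtain d2 where d2: "d2 > 0" "ball 0 d2 \<subseteq> U" using U(1,2) open_contains_ball by blast
  define d where "d = min d1 d2"
  have d: "d > 0" "\<And>w. dist 0 w < d \<Longrightarrow> v w $ k \<noteq> 0 \<and> w \<in> U"
    using d1 d2 unfolding d_def by (simp, metis min_less_iff_conj mem_ball subsetD)
  have bd: "norm z \<le> 1 / d" if "z \<in> Z" for z
  proof (rule ccontr)
    assume n: "\<not> norm z \<le> 1 / d"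
    then have z: "z \<noteq> 0" using d(1) by auto
    have "1 < norm z * d" using n d(1) by (simp add: field_simps)
    then have "dist 0 (1 / z) < d" using z by (simp add: norm_divide field_simps)
    then show False using d(2)[of "1 / z"] vR[of "1 / z"] z that by simp
  qed
  have iso: "\<forall>\<^sub>F z in at z0. z \<notin> Z" if z0: "\<not> (\<exists>V. open V \<and> z0 \<in> V \<and> V \<subseteq> Z)" for z0
  proof -
    obtain U v where L: "L z0 U v" using loc by blast
      note U = LD[OF L]
    obtain e where e: "e > 0" "ball z0 e \<subseteq> U" using U(1,2) open_contains_ball by blast
    show ?thesis
    proof (cases "z0 \<in> Z")
      case True
      obtain b where b: "b \<in> ball z0 e" "b \<notin> Z" using z0 e(1) by (metis centre_in_ball open_ball subsetI)
      obtain r where r: "r > 0" "\<And>z. z \<in> ball z0 r - {z0} \<Longrightarrow> v z $ k \<noteq> 0" "ball z0 r \<subseteq> ball z0 e"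
      proof (rule isolated_zeros[of "\<lambda>z. v z $ k" "ball z0 e" z0 b])
        show "(\<lambda>z. v z $ k) holomorphic_on ball z0 e" using U(3) e(2) holomorphic_on_subset by blast
      qed (use b e U True in auto)
      have "\<forall>\<^sub>F z in at z0. z \<in> ball z0 r - {z0}" using r(1) by (intro eventually_at_in_open) auto
      then show ?thesis
      proof eventually_elim
        case (elim z)
        then have "v z $ k \<noteq> 0" "z \<in> U" using r e(2) by blast+
        then show ?case using U(4) by blast
      qed
    next
      case False
      have "isCont (\<lambda>w. v w $ k) z0"
        using U(1,2,3) holomorphic_on_imp_continuous_on continuous_on_eq_continuous_at by blast
      then have "\<forall>\<^sub>F w in at z0. v w $ k \<noteq> 0"
        using False U(2,4) unfolding isCont_def by (intro tendsto_imp_eventually_ne) auto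
      moreover have "\<forall>\<^sub>F w in at z0. w \<in> U - {z0}" using U(1,2) by (intro eventually_at_in_open) auto
      ultimately show ?thesis by eventually_elim (use U(4) in blast)
    qed
  qed
  define A where "A = {z. \<exists>V. open V \<and> z \<in> V \<and> V \<subseteq> Z}"
  have "open A" unfolding A_def by (subst open_subopen) blast
  moreover have "open (- A)"
  proof (subst open_subopen, intro ballI)
    fix z0 assume z0: "z0 \<in> - A"
    then have "\<forall>\<^sub>F z in at z0. z \<notin> Z" using iso unfolding A_def by blast
    then obtain T where T: "open T" "z0 \<in> T" "\<And>z. z \<in> T \<Longrightarrow> z \<noteq> z0 \<Longrightarrow> z \<notin> Z"
      unfolding eventually_at_topological by blast
    have "T \<subseteq> - A" using T(3) z0 unfolding A_def by blast
    then show "\<exists>T. open T \<and> z0 \<in> T \<and> T \<subseteq> - A" using T by blast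
  qed
  ultimately have "A = {} \<or> A = UNIV" using connected_UNIV unfolding connected_clopen
    by (metis closed_def open_openin closed_closedin topspace_euclidean subtopology_UNIV)
  moreover have "A \<noteq> UNIV"
  proof
    assume "A = UNIV"
    then have "Z = UNIV" unfolding A_def by blast
    then have "of_real (1 / d + 1) \<in> Z" by simp
    from bd[OF this] show False using d(1) by (simp only: norm_of_real)
  qed
  ultimately have "A = {}" by blast
  then have iso': "\<forall>\<^sub>F z in at z0. z \<notin> Z" for z0 using iso unfolding A_def by blast
  have finZ: "finite Z"
  proof (rule ccontr)
    assume "infinite Z"
    moreover have "bounded Z" using bd unfolding bounded_iff by blast
    ultimately obtain x where "x islimpt Z" using bounded_infinite_imp_islimpt by blast
    then show False using iso'[of x] unfolding islimpt_iff_eventually by blast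
  qed
  have hol: "R j holomorphic_on (UNIV - Z)" for j
  proof -
    have "\<exists>e>0. R j holomorphic_on ball z0 e" if "z0 \<notin> Z" for z0
    proof -
      obtain U v where L: "L z0 U v" using loc by blast
      note U = LD[OF L]
      have "open (U - Z)" "z0 \<in> U - Z" using U finZ that by (auto simp: finite_imp_closed open_Diff)
      then obtain e where e: "e > 0" "ball z0 e \<subseteq> U - Z" using open_contains_ball by blast
      have "(\<lambda>z. v z $ j / v z $ k) holomorphic_on (U - Z)"
        using U(4) by (intro holomorphic_on_divide holomorphic_on_subset[OF U(3)]) auto
      then have "(\<lambda>z. v z $ j / v z $ k) holomorphic_on ball z0 e" using e(2) holomorphic_on_subset by blast
      then have "R j holomorphic_on ball z0 e"
        by (rule holomorphic_transform) (use U(5) e(2) in force)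
      then show ?thesis using e(1) by blast
    qed
    then have "R j analytic_on (UNIV - Z)" unfolding analytic_on_def by blast
    then show ?thesis by (rule analytic_imp_holomorphic)
  qed
  have ne: "not_essential (\<lambda>w. f w / g w) a" if "open U" "a \<in> U" "f holomorphic_on U" "g holomorphic_on U" for f g a U
    by (intro not_essential_divide not_essential_holomorphic[OF that(3) that(2,1)] not_essential_holomorphic[OF that(4) that(2,1)]
        isolated_singularity_at_holomorphic[OF _ that(1,2)] holomorphic_on_subset[OF that(3)] holomorphic_on_subset[OF that(4)]) auto
  have ne1: "not_essential (R j) a" for j a
  proof -
    obtain U v where L: "L a U v" using loc by blast
      note U = LD[OF L]
    have "\<forall>\<^sub>F z in at a. z \<in> U - {a}" using U(1,2) by (intro eventually_at_in_open) auto
    then have "\<forall>\<^sub>F z in at a. R j z = v z $ j / v z $ k" by eventually_elim (use U(5) in blast)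
    from not_essential_cong[OF this refl] show ?thesis using ne[OF U(1,2) U(3) U(3)] by blast
  qed
  have ne2: "not_essential (\<lambda>w. R j (1 / w)) 0" for j
  proof -
    have "\<forall>\<^sub>F w in at 0. w \<in> U - {0}" using U(1,2) by (intro eventually_at_in_open) auto
    then have "\<forall>\<^sub>F w in at 0. R j (1 / w) = v w $ j / v w $ k" by eventually_elim (use vR in blast)
    from not_essential_cong[OF this refl] show ?thesis using ne[OF U(1,2) U(3) U(3)] by blast
  qed
  have "\<forall>j. \<exists>p q. q \<noteq> 0 \<and> (\<forall>z. z \<notin> Z \<longrightarrow> poly q z \<noteq> 0 \<and> R j z = poly p z / poly q z)"
    using rational_if_not_essential[OF hol finZ ne1 ne2] by blast
  then obtain p q where pq: "\<And>j. q j \<noteq> 0" "\<And>j z. z \<notin> Z \<Longrightarrow> poly (q j) z \<noteq> 0 \<and> R j z = poly (p j) z / poly (q j) z"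
    by metis
  define g where "g j = p j * (\<Prod>i\<in>UNIV - {j}. q i)" for j :: 3
  define Q where "Q = (\<Prod>i\<in>UNIV. q i)"
  have gz: "ev g z = (poly Q z / u (Fin z) $ k) *s u (Fin z) \<and> poly Q z / u (Fin z) $ k \<noteq> 0" if z: "z \<notin> Z" for z
  proof -
    have uk: "u (Fin z) $ k \<noteq> 0" using z by (simp add: Z_def)
    have Q0: "poly Q z \<noteq> 0" using pq(2)[OF z] by (simp add: Q_def poly_prod)
    have "poly (g j) z = poly Q z / u (Fin z) $ k * u (Fin z) $ j" for j
    proof -
      have "poly Q z = poly (q j) z * (\<Prod>i\<in>UNIV - {j}. poly (q i) z)"
        unfolding Q_def poly_prod by (rule prod.remove) auto
      moreover have "poly (p j) z = R j z * poly (q j) z" using pq(2)[OF z, of j] by simp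
      ultimately have "poly (g j) z = R j z * poly Q z" by (simp add: g_def poly_prod)
      then show ?thesis by (simp add: R_def)
    qed
    then show ?thesis using Q0 uk by (simp add: vec_eq_iff)
  qed
  obtain z1 where z1: "z1 \<notin> Z" using finZ infinite_UNIV_char_0 ex_new_if_finite by blast
  have "ev g z1 \<noteq> 0" using gz[OF z1] u(1)[of "Fin z1"] by simp
  then obtain i0 where "g i0 \<noteq> 0" by (auto simp: vec_eq_iff) (metis poly_0)
  then obtain h M m where h: "h \<noteq> 0" "\<And>i. g i = h * M i" and M: "curve m M" using reduce_curve[where p = g] by metis
  have gh: "ev g z = poly h z *s ev M z" for z by (simp add: vec_eq_iff h(2))
  have off: "Y (Fin z) = line m M (Fin z)" if z: "z \<notin> Z" for z
  proof -
    have "poly h z \<noteq> 0" using gz[OF z] gh[of z] u(1)[of "Fin z"] by auto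
    then have "vec.span {ev M z} = vec.span {ev g z}" unfolding gh by (rule span_single_scale[symmetric])
    also have "\<dots> = vec.span {u (Fin z)}" using gz[OF z] span_single_scale by metis
    finally show ?thesis using u(2)[of "Fin z"] by (simp add: line_def)
  qed
  have "Y p = line m M p" for p
  proof -
    obtain c z0 where c: "c \<in> coords" "p = c z0" using sphere_cover by blast
    obtain U v where L: "local_frame Y c z0 U v" using holomorphic_line_local[OF Y c(1)] by blast
    note U = local_frameD[OF L]
    let ?e = "ev (chart m M c)"
    let ?B = "{z. c z \<in> insert Infty (Fin ` Z)}"
    have B: "finite ?B" by (rule finite_preimage_coords[OF c(1)]) (simp add: finZ)
    have e0: "?e z \<noteq> 0" for z using chart_curve[OF M, of c] by (simp add: curve_def)
    have "open (U - (?B - {z0}))" using U(1) B by (intro open_Diff finite_imp_closed) auto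
    then have ev: "\<forall>\<^sub>F z in at z0. z \<in> U - (?B - {z0}) - {z0}" using U(2) by (intro eventually_at_in_open) auto
    have "\<forall>\<^sub>F z in at z0. crs (v z) (?e z) $ i = 0" for i
      using ev
    proof eventually_elim
      case (elim z)
      then have zU: "z \<in> U" and zB: "c z \<notin> insert Infty (Fin ` Z)" by auto
      obtain x where x: "c z = Fin x" using zB by (cases "c z") auto
      then have "Y (c z) = line m M (c z)" using off zB by auto
      then have "vec.span {v z} = vec.span {?e z}" using U(4)[OF zU] line_chart[OF M c(1)] by simp
      from this e0 obtain t where "?e z = t *s v z" by (rule span_single_eq_iff)
      then show ?case by (simp add: crs_scale_right)
    qed
    moreover have "((\<lambda>z. crs (v z) (?e z) $ i) \<longlongrightarrow> crs (v z0) (?e z0) $ i) (at z0)" for i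
    proof -
      have v: "((\<lambda>z. v z $ j) \<longlongrightarrow> v z0 $ j) (at z0)" for j
        using U(1,2,3) holomorphic_on_imp_continuous_on continuous_on_eq_continuous_at isCont_def by blast
      have e: "((\<lambda>z. ?e z $ j) \<longlongrightarrow> ?e z0 $ j) (at z0)" for j
        using continuous_ev[of "chart m M c"] by (intro tendsto_vec_nth) (auto simp: continuous_on_def)
      have d: "((\<lambda>z. v z $ a * ?e z $ b - v z $ a' * ?e z $ b') \<longlongrightarrow> v z0 $ a * ?e z0 $ b - v z0 $ a' * ?e z0 $ b') (at z0)" for a b a' b'
        by (intro tendsto_diff tendsto_mult v e)
      show ?thesis using exhaust_3[of i] by (elim disjE) (simp_all only: crs_nth d)
    qed
    ultimately have "((\<lambda>z. 0) \<longlongrightarrow> crs (v z0) (?e z0) $ i) (at z0)" for i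
      by - (rule Lim_transform_eventually, assumption)
    then have "crs (v z0) (?e z0) $ i = 0" for i
      by (metis tendsto_const tendsto_unique at_neq_bot)
    then have "crs (v z0) (?e z0) = 0" by (simp add: vec_eq_iff)
    then obtain t where t: "?e z0 = t *s v z0" using crs_eq_0_iff U(4)[OF U(2)] by blast
    then have "t \<noteq> 0" using e0[of z0] by auto
    then have "vec.span {?e z0} = vec.span {v z0}" unfolding t by (rule span_single_scale)
    then show ?thesis using U(4)[OF U(2)] line_chart[OF M c(1)] c(2) by simp
  qed
  then show ?thesis using that[OF M] by blast
qed

subsection \<open>Coefficients of a quadratic extended solution\<close>

lemma cis_Arg_S1: "l \<in> S1 \<Longrightarrow> cis (Arg l) = l"
  by (subst cis_Arg) (auto simp: sgn_eq)

lemma cis_Arg_minus_S1: assumes "l \<in> S1" shows "cis (Arg (- l) + pi) = l"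
proof -
  have "cis (Arg (- l) + pi) = cis (Arg (- l)) * cis pi" by (rule cis_mult[symmetric])
  then show ?thesis using cis_Arg_S1[of "- l"] assms by simp
qed

lemma continuous_on_S1I:
  assumes "continuous_on UNIV (\<lambda>t. F (cis t))" shows "continuous_on S1 F"
proof -
  have 1: "continuous_on (S1 - {- 1}) F"
  proof -
    have "continuous_on (S1 - {- 1}) (\<lambda>l. F (cis (Arg l)))"
    proof (rule continuous_on_compose2[OF assms _ subset_UNIV])
      have "isCont Arg l" if "l \<in> S1 - {- 1}" for l
      proof (rule continuous_at_Arg)
        show "l \<notin> \<real>\<^sub>\<le>\<^sub>0"
        proof
          assume "l \<in> \<real>\<^sub>\<le>\<^sub>0"
          then have "l = of_real (Re l)" "Re l \<le> 0" by (auto simp: complex_nonpos_Reals_iff complex_eq_iff)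
          moreover have "\<bar>Re l\<bar> = 1" using that calculation(1) by (metis Diff_iff dist_0_norm mem_sphere norm_of_real)
          ultimately show False using that by (auto simp: complex_eq_iff)
        qed
      qed
      then show "continuous_on (S1 - {- 1}) Arg" by (simp add: continuous_at_imp_continuous_on)
    qed
    then show ?thesis
      by (rule continuous_on_eq) (metis DiffD1 cis_Arg_S1)
  qed
  have 2: "continuous_on (S1 - {1}) F"
  proof -
    have "continuous_on (S1 - {1}) (\<lambda>l. F (cis (Arg (- l) + pi)))"
    proof (rule continuous_on_compose2[OF assms _ subset_UNIV])
      have "isCont Arg (- l)" if "l \<in> S1 - {1}" for l
      proof (rule continuous_at_Arg)
        show "- l \<notin> \<real>\<^sub>\<le>\<^sub>0"
        proof
          assume "- l \<in> \<real>\<^sub>\<le>\<^sub>0"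
          then have "l = of_real (Re l)" "Re l \<ge> 0" by (auto simp: complex_nonpos_Reals_iff complex_eq_iff)
          moreover have "\<bar>Re l\<bar> = 1" using that calculation(1) by (metis Diff_iff dist_0_norm mem_sphere norm_of_real)
          ultimately show False using that by (auto simp: complex_eq_iff)
        qed
      qed
      then have "continuous_on (uminus ` (S1 - {1})) Arg" by (auto simp: continuous_at_imp_continuous_on)
      then have "continuous_on (S1 - {1}) (\<lambda>l. Arg (- l))"
        by (rule continuous_on_compose2) (auto intro: continuous_intros)
      then show "continuous_on (S1 - {1}) (\<lambda>l. Arg (- l) + pi)" by (rule continuous_on_add[OF _ continuous_on_const])
    qed
    then show ?thesis
      by (rule continuous_on_eq) (metis DiffD1 cis_Arg_minus_S1)
  qed
  have "S1 - {- 1} \<union> (S1 - {1}) = S1" by auto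
  moreover have "openin (top_of_set S1) (S1 - {- 1})" "openin (top_of_set S1) (S1 - {1})"
    by (auto simp: openin_open intro!: exI[of _ "- {_}"])
  ultimately show ?thesis
    using continuous_on_Un_local_open[of "S1 - {- 1}" "S1 - {1}" F] 1 2 by simp
qed

lemma Ck_differentiable: "Ck (Suc k) f \<Longrightarrow> f differentiable (at x)"
  by simp

lemma smooth_slice:
  assumes s: "smooth (\<lambda>(z, t::real). G z (cis t))"
  shows "l \<in> S1 \<Longrightarrow> (\<lambda>z. G z l) differentiable (at z)" and "continuous_on S1 (G z)"
proof -
  have d: "Ck (Suc 0) (\<lambda>(z, t). G z (cis t))" using s unfolding smooth_def by blast
  then have df: "(\<lambda>(z, t). G z (cis t)) differentiable (at x)" for x by (rule Ck_differentiable)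
  show "(\<lambda>z. G z l) differentiable (at z)" if l: "l \<in> S1"
  proof -
    obtain t where t: "l = cis t" using cis_Arg_S1[OF l] by metis
    have "((\<lambda>z. (z, t)) has_derivative (\<lambda>h. (h, 0))) (at z)"
      by (intro has_derivative_Pair has_derivative_ident has_derivative_const)
    then have "(\<lambda>z. (z, t)) differentiable (at z)" unfolding differentiable_def by blast
    from differentiable_chain_at[OF this df] show ?thesis by (simp add: o_def t)
  qed
  show "continuous_on S1 (G z)"
  proof (rule continuous_on_S1I)
    have "continuous_on UNIV (\<lambda>(z, t). G z (cis t))"
      using Ck_SucD[OF d] by simp
    then have "continuous_on UNIV (\<lambda>t. (\<lambda>(z, t). G z (cis t)) (z, t))"
      by (rule continuous_on_compose2) (auto intro!: continuous_intros)
    then show "continuous_on UNIV (\<lambda>t. G z (cis t))" by simp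
  qed
qed

definition loop_coefficients ::
    "(complex \<Rightarrow> complex ^ 'n ^ 'n) \<Rightarrow> complex ^ 'n ^ 'n \<Rightarrow> complex ^ 'n ^ 'n \<Rightarrow> complex ^ 'n ^ 'n \<Rightarrow> bool" where
  "loop_coefficients \<gamma> A0 A1 A2 \<longleftrightarrow> (\<forall>l\<in>S1. \<gamma> l = A0 + csmult l A1 + csmult (l\<^sup>2) A2) \<and>
    fst ` {(a, b). (\<lambda>l. a + l *s b) \<in> loop_image \<gamma> H_plus} = range ((*v) A0) \<and>
    snd ` ({(a, b). (\<lambda>l. a + l *s b) \<in> loop_image \<gamma> H_plus} \<inter> ({0} \<times> UNIV)) = {b. adj A2 *v b = 0} \<and>
    (\<forall>g\<in>loop_image \<gamma> H_plus. \<exists>v. (\<chi> i. fcoef (\<lambda>l. g l $ i) 0) = A0 *v v)"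

lemma loop_coefficients_exist:
  assumes "\<And>i j. continuous_on S1 (\<lambda>l. \<gamma> l $ i $ j)" "\<And>l. l \<in> S1 \<Longrightarrow> unitary (\<gamma> l)"
    "loop_image (\<lambda>l. mat (l\<^sup>2)) H_plus \<subseteq> loop_image \<gamma> H_plus" "loop_image \<gamma> H_plus \<subseteq> H_plus"
  shows "\<exists>A0 A1 A2. loop_coefficients \<gamma> A0 A1 A2"
proof (rule normalized_loop[OF assms])
  fix A0 A1 A2
  assume "\<And>l. l \<in> S1 \<Longrightarrow> \<gamma> l = A0 + csmult l A1 + csmult (l\<^sup>2) A2"
    "fst ` {(a, b). (\<lambda>l. a + l *s b) \<in> loop_image \<gamma> H_plus} = range ((*v) A0)"
    "snd ` ({(a, b). (\<lambda>l. a + l *s b) \<in> loop_image \<gamma> H_plus} \<inter> ({0} \<times> UNIV)) = {b. adj A2 *v b = 0}"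
    "\<And>g. g \<in> loop_image \<gamma> H_plus \<Longrightarrow> \<exists>v. (\<chi> i. fcoef (\<lambda>l. g l $ i) 0) = A0 *v v"
  then have "loop_coefficients \<gamma> A0 A1 A2" unfolding loop_coefficients_def by (intro conjI ballI) simp_all
  then show ?thesis by blast
qed

locale uniton_coefficients =
  fixes A0 A1 A2 :: "rsphere \<Rightarrow> complex ^ 'n ^ 'n" and S T :: "(complex \<Rightarrow> rsphere) \<Rightarrow> complex \<Rightarrow> complex ^ 'n ^ 'n"
  assumes sum: "A0 p + A1 p + A2 p = mat 1"
    and rel: "A0 p ** adj (A2 p) = 0" "A0 p ** adj (A1 p) + A1 p ** adj (A2 p) = 0"
      "A0 p ** adj (A0 p) + A1 p ** adj (A1 p) + A2 p ** adj (A2 p) = mat 1"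
      "adj (A2 p) ** A0 p = 0" "adj (A1 p) ** A0 p + adj (A2 p) ** A1 p = 0"
    and AS: "c \<in> coords \<Longrightarrow> A0 (c z) ** S c z = 0" "c \<in> coords \<Longrightarrow> A2 (c z) ** T c z = 0"
    and dA0: "c \<in> coords \<Longrightarrow> wdM (\<lambda>w. A0 (c w)) (- (A1 (c z) ** S c z)) (A0 (c z) ** T c z) z"
    and dA1: "c \<in> coords \<Longrightarrow> wdM (\<lambda>w. A1 (c w)) (A1 (c z) ** S c z - A2 (c z) ** S c z) (A1 (c z) ** T c z - A0 (c z) ** T c z) z"
    and dA2: "c \<in> coords \<Longrightarrow> wdM (\<lambda>w. A2 (c w)) (A2 (c z) ** S c z) (- (A1 (c z) ** T c z)) z"
begin

lemma Q_hermitian: "adj (A2 p - A0 p) = A2 p - A0 p"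
  by (rule hermitian_difference[OF sum rel(1,2)])

lemma dQ:
  assumes c: "c \<in> coords" shows "wdM (\<lambda>w. A2 (c w) - A0 (c w)) (S c z) (- T c z) z"
proof -
  have "A2 (c z) ** S c z - - (A1 (c z) ** S c z) = (A0 (c z) + A1 (c z) + A2 (c z)) ** S c z"
    using AS(1)[OF c] by (simp add: mm_add_left)
  moreover have "- (A1 (c z) ** T c z) - A0 (c z) ** T c z = - ((A0 (c z) + A1 (c z) + A2 (c z)) ** T c z)"
    using AS(2)[OF c] by (simp add: mm_add_left)
  ultimately show ?thesis using wdM_diff[OF dA2[OF c, of z] dA0[OF c, of z]] by (simp add: sum)
qed

lemma T_eq: assumes c: "c \<in> coords" shows "T c z = - adj (S c z)"
proof -
  have "wdM (\<lambda>w. A2 (c w) - A0 (c w)) (adj (- T c z)) (adj (S c z)) z"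
    using wdM_adj[OF dQ[OF c, of z]] unfolding Q_hermitian .
  from wdM_unique[OF this dQ[OF c, of z]] show ?thesis by simp
qed

end

lemma uniton_coefficients_exist:
  assumes "normalized_extended_solution \<psi> 2 \<Psi>"
  obtains A0 A1 A2 where "uniton_coefficients A0 A1 A2 (\<lambda>c. Az (\<lambda>w. \<psi> (c w))) (\<lambda>c. Azbar (\<lambda>w. \<psi> (c w)))"
    "\<And>p. loop_coefficients (\<Psi> p) (A0 p) (A1 p) (A2 p)"
proof -
  have es: "extended_solution \<psi> \<Psi>"
    and W: "\<And>p. loop_image (\<lambda>l. mat (l\<^sup>2)) H_plus \<subseteq> loop_image (\<Psi> p) H_plus"
      "\<And>p. loop_image (\<Psi> p) H_plus \<subseteq> H_plus"
    using assms unfolding normalized_extended_solution_def W_bundle_def by auto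
  have u: "unitary (\<Psi> p l)" if "l \<in> S1" for p l using es that unfolding extended_solution_def by blast
  have one: "\<Psi> p 1 = mat 1" for p using es unfolding extended_solution_def by blast
  have sm: "smooth (\<lambda>(z, t::real). \<Psi> (c z) (cis t))" if "c \<in> coords" for c
    using es that unfolding extended_solution_def by blast
  have eq: "matrix_inv (\<Psi> (c z) l) ** dz (\<lambda>w. \<Psi> (c w) l) z = csmult (1 - inverse l) (Az (\<lambda>w. \<psi> (c w)) z)"
    "matrix_inv (\<Psi> (c z) l) ** dzbar (\<lambda>w. \<Psi> (c w) l) z = csmult (1 - l) (Azbar (\<lambda>w. \<psi> (c w)) z)"
    if "c \<in> coords" "l \<in> S1" for c z l using es that unfolding extended_solution_def by blast+
  have "\<exists>B0 B1 B2. loop_coefficients (\<Psi> p) B0 B1 B2" for p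
  proof (rule loop_coefficients_exist[OF _ u W])
    obtain c z where c: "c \<in> coords" "p = c z" using sphere_cover by blast
    have "continuous_on S1 (\<Psi> p)" using smooth_slice(2)[OF sm[OF c(1)]] c(2) by simp
    then show "continuous_on S1 (\<lambda>l. \<Psi> p l $ i $ j)" for i j by (intro continuous_intros)
  qed
  then obtain A0 A1 A2 where A: "\<And>p. loop_coefficients (\<Psi> p) (A0 p) (A1 p) (A2 p)" by metis
  have P: "\<Psi> p l = A0 p + csmult l (A1 p) + csmult (l\<^sup>2) (A2 p)" if "l \<in> S1" for p l
    using A[of p] that unfolding loop_coefficients_def by blast
  have sum: "A0 p + A1 p + A2 p = mat 1" for p using P[of 1 p] one[of p] by simp
  have deriv: "A0 (c z) ** S = 0 \<and> A2 (c z) ** T = 0 \<and> wdM (\<lambda>w. A0 (c w)) (- (A1 (c z) ** S)) (A0 (c z) ** T) z \<and>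
      wdM (\<lambda>w. A1 (c w)) (A1 (c z) ** S - A2 (c z) ** S) (A1 (c z) ** T - A0 (c z) ** T) z \<and>
      wdM (\<lambda>w. A2 (c w)) (A2 (c z) ** S) (- (A1 (c z) ** T)) z"
    if c: "c \<in> coords" and ST: "S = Az (\<lambda>w. \<psi> (c w)) z" "T = Azbar (\<lambda>w. \<psi> (c w)) z" for c z S T
  proof -
    have G: "wdM (\<lambda>w. \<Psi> (c w) l) (dz (\<lambda>w. \<Psi> (c w) l) z) (dzbar (\<lambda>w. \<Psi> (c w) l) z) z" if "l \<in> S1" for l
      by (rule wdM_differentiable[OF smooth_slice(1)[OF sm[OF c] that]])
    have cm: "\<exists>a b. wdM (\<lambda>w. csmult k (F w)) a b z" if "\<exists>a b. wdM F a b z" for F :: "complex \<Rightarrow> complex ^ 'a ^ 'a" and k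
      using that wdM_csmult[OF wd_const] by blast
    have ad: "\<exists>a b. wdM (\<lambda>w. F w + G w) a b z" "\<exists>a b. wdM (\<lambda>w. F w - G w) a b z"
      if "\<exists>a b. wdM F a b z" "\<exists>a b. wdM G a b z" for F G :: "complex \<Rightarrow> complex ^ 'a ^ 'a"
      using that wdM_add wdM_diff by blast+
    have co: "\<exists>a b. wdM (\<lambda>w. M) a b z" for M :: "complex ^ 'a ^ 'a" using wdM_const by blast
    have S1s: "- 1 \<in> S1" "\<i> \<in> S1" by simp_all
    have ex1: "\<exists>a b. wdM (\<lambda>w. A1 (c w)) a b z"
    proof -
      have "A1 (c w) = csmult (1 / 2) (mat 1 - \<Psi> (c w) (- 1))" for w
        unfolding P[OF S1s(1)] sum[of "c w", symmetric]
        by (simp add: vec_eq_iff csmult_def)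
      moreover have "\<exists>a b. wdM (\<lambda>w. csmult (1 / 2) (mat 1 - \<Psi> (c w) (- 1))) a b z"
        by (intro cm ad co) (use G[OF S1s(1)] in blast)
      ultimately show ?thesis by simp
    qed
    have ex0: "\<exists>a b. wdM (\<lambda>w. A0 (c w)) a b z"
    proof -
      have "A0 (c w) = csmult (1 / 2) (mat 1 - A1 (c w) + \<Psi> (c w) \<i> - csmult \<i> (A1 (c w)))" for w
        unfolding P[OF S1s(2)] sum[of "c w", symmetric]
        by (simp add: vec_eq_iff csmult_def)
      moreover have "\<exists>a b. wdM (\<lambda>w. csmult (1 / 2) (mat 1 - A1 (c w) + \<Psi> (c w) \<i> - csmult \<i> (A1 (c w)))) a b z"
        by (intro cm ad co ex1) (use G[OF S1s(2)] in blast)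
      ultimately show ?thesis by simp
    qed
    have ex2: "\<exists>a b. wdM (\<lambda>w. A2 (c w)) a b z"
    proof -
      have "A2 (c w) = mat 1 - A0 (c w) - A1 (c w)" for w using sum[of "c w"] by (simp add: algebra_simps)
      moreover have "\<exists>a b. wdM (\<lambda>w. mat 1 - A0 (c w) - A1 (c w)) a b z" by (intro ad co ex0 ex1)
      ultimately show ?thesis by simp
    qed
    obtain B0 C0 where w0: "wdM (\<lambda>w. A0 (c w)) B0 C0 z" using ex0 by blast
    obtain B1 C1 where w1: "wdM (\<lambda>w. A1 (c w)) B1 C1 z" using ex1 by blast
    obtain B2 C2 where w2: "wdM (\<lambda>w. A2 (c w)) B2 C2 z" using ex2 by blast
    have dG: "dz (\<lambda>w. \<Psi> (c w) l) z = B0 + csmult l B1 + csmult (l\<^sup>2) B2"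
      "dzbar (\<lambda>w. \<Psi> (c w) l) z = C0 + csmult l C1 + csmult (l\<^sup>2) C2" if l: "l \<in> S1" for l
      using wdM_dz[OF wdM_add[OF wdM_add[OF w0 wdM_csmult[OF wd_const[of l z] w1]] wdM_csmult[OF wd_const[of "l\<^sup>2" z] w2]]]
      unfolding P[OF l] by simp_all
    have inv: "\<Psi> (c z) l ** matrix_inv (\<Psi> (c z) l) = mat 1" if "l \<in> S1" for l
      using u[OF that] unitary_inv[OF u[OF that]] by (simp add: unitary_def)
    have cancel: "D = \<Psi> (c z) l ** X" if "matrix_inv (\<Psi> (c z) l) ** D = X" "l \<in> S1" for D X l
      unfolding that(1)[symmetric] matrix_mul_assoc inv[OF that(2)] by simp
    have e1: "B0 + csmult l B1 + csmult (l\<^sup>2) B2 = (A0 (c z) + csmult l (A1 (c z)) + csmult (l\<^sup>2) (A2 (c z))) ** csmult (1 - inverse l) S"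
      if "l \<in> S1" for l using cancel[OF eq(1)[OF c that] that] unfolding dG(1)[OF that] ST(1)[symmetric] by (simp only: P[OF that])
    have e2: "C0 + csmult l C1 + csmult (l\<^sup>2) C2 = (A0 (c z) + csmult l (A1 (c z)) + csmult (l\<^sup>2) (A2 (c z))) ** csmult (1 - l) T"
      if "l \<in> S1" for l using cancel[OF eq(2)[OF c that] that] unfolding dG(2)[OF that] ST(2)[symmetric] by (simp only: P[OF that])
    have c1: "A0 (c z) ** S = 0" "B0 = - (A1 (c z) ** S)" "B1 = A1 (c z) ** S - A2 (c z) ** S" "B2 = A2 (c z) ** S"
      by (rule extended_solution_coefficients[OF e1]; assumption)+
    have c2: "C0 = A0 (c z) ** T" "C1 = A1 (c z) ** T - A0 (c z) ** T" "C2 = - (A1 (c z) ** T)" "A2 (c z) ** T = 0"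
      by (rule extended_solution_coefficients_bar[OF e2]; assumption)+
    show ?thesis using w0 w1 w2 c1(1) c2(4) unfolding c1(2-4) c2(1-3) by blast
  qed
  have "uniton_coefficients A0 A1 A2 (\<lambda>c. Az (\<lambda>w. \<psi> (c w))) (\<lambda>c. Azbar (\<lambda>w. \<psi> (c w)))"
  proof
    fix p show "A0 p + A1 p + A2 p = mat 1" by (rule sum)
    show "A0 p ** adj (A2 p) = 0" "A0 p ** adj (A1 p) + A1 p ** adj (A2 p) = 0"
      "A0 p ** adj (A0 p) + A1 p ** adj (A1 p) + A2 p ** adj (A2 p) = mat 1"
      "adj (A2 p) ** A0 p = 0" "adj (A1 p) ** A0 p + adj (A2 p) ** A1 p = 0"
      using unitary_loop_relations[of "\<Psi> p", OF u P] by simp_all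
  next
    fix c z assume "c \<in> coords"
    from deriv[OF this refl refl, of z] show
      "A0 (c z) ** Az (\<lambda>w. \<psi> (c w)) z = 0" "A2 (c z) ** Azbar (\<lambda>w. \<psi> (c w)) z = 0"
      "wdM (\<lambda>w. A0 (c w)) (- (A1 (c z) ** Az (\<lambda>w. \<psi> (c w)) z)) (A0 (c z) ** Azbar (\<lambda>w. \<psi> (c w)) z) z"
      "wdM (\<lambda>w. A1 (c w)) (A1 (c z) ** Az (\<lambda>w. \<psi> (c w)) z - A2 (c z) ** Az (\<lambda>w. \<psi> (c w)) z)
        (A1 (c z) ** Azbar (\<lambda>w. \<psi> (c w)) z - A0 (c z) ** Azbar (\<lambda>w. \<psi> (c w)) z) z"
      "wdM (\<lambda>w. A2 (c w)) (A2 (c z) ** Az (\<lambda>w. \<psi> (c w)) z) (- (A1 (c z) ** Azbar (\<lambda>w. \<psi> (c w)) z)) z"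
      by auto
  qed
  then show ?thesis using that A by blast
qed

subsection \<open>The induced metric\<close>

lemma trace_mult_adj: "trace (D ** adj D) = (\<Sum>i\<in>UNIV. \<Sum>j\<in>UNIV. D $ i $ j * cnj (D $ i $ j))"
  by (simp add: trace_def matrix_matrix_mult_def adj_def)

lemma trace_mult_adj_pos:
  assumes "D \<noteq> 0" shows "Re (trace (D ** adj D)) > 0"
proof -
  obtain a b where ab: "D $ a $ b \<noteq> 0" using assms by (auto simp: vec_eq_iff)
  have "Re (trace (D ** adj D)) = (\<Sum>i\<in>UNIV. \<Sum>j\<in>UNIV. (norm (D $ i $ j))\<^sup>2)"
    unfolding trace_mult_adj by (simp add: complex_norm_square[symmetric] flip: of_real_sum)
  moreover have "0 < (\<Sum>i\<in>UNIV. \<Sum>j\<in>UNIV. (norm (D $ i $ j))\<^sup>2)"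
    by (intro sum_pos2[of _ a] sum_pos2[of _ b] sum_nonneg) (use ab in auto)
  ultimately show ?thesis by simp
qed

lemma trace_commute: "trace (A ** B) = trace (B ** (A :: complex ^ 'n ^ 'n))"
  unfolding trace_def matrix_matrix_mult_def by (simp add: mult.commute) (rule sum.swap)

lemma induced_metric_eq:
  assumes u: "unitary (\<phi> z)"
  shows "induced_metric \<phi> z v v = Re (trace (pd v \<phi> z ** adj (pd v \<phi> z))) / 8"
proof -
  let ?D = "pd v \<phi> z"
  have "trace ((adj (\<phi> z) ** ?D) ** adj (adj (\<phi> z) ** ?D)) = trace ((?D ** adj ?D ** \<phi> z) ** adj (\<phi> z))"
    unfolding trace_commute[of _ "adj (\<phi> z)"] by (simp add: adj_mult matrix_mul_assoc)
  also have "\<dots> = trace (?D ** adj ?D)"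
    using u by (simp add: matrix_mul_assoc[symmetric] unitary_def)
  finally show ?thesis by (simp add: induced_metric_def h_metric_def unitary_inv[OF u])
qed

lemma metric_conformal:
  assumes u: "unitary (\<phi> z)"
    and c: "induced_metric \<phi> z 1 1 = induced_metric \<phi> z \<i> \<i>"
    and T: "Azbar \<phi> z = - adj (Az \<phi> z)"
  shows "induced_metric \<phi> z 1 1 = Re (trace (Az \<phi> z ** adj (Az \<phi> z)))"
proof -
  let ?S = "Az \<phi> z" and ?T = "Azbar \<phi> z"
  let ?m = "matrix_inv (\<phi> z)"
  have S: "?S = csmult (1 / 4) (?m ** pd 1 \<phi> z - csmult \<i> (?m ** pd \<i> \<phi> z))"
    and T': "?T = csmult (1 / 4) (?m ** pd 1 \<phi> z + csmult \<i> (?m ** pd \<i> \<phi> z))"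
    by (simp_all add: Az_def Azbar_def dz_def dzbar_def mm_simps)
  define X where "X = ?m ** pd 1 \<phi> z"
  define Y where "Y = ?m ** pd \<i> \<phi> z"
  have s: "?S $ i $ j = (X $ i $ j - \<i> * Y $ i $ j) / 4" for i j unfolding S X_def Y_def by simp
  have t: "adj ?S $ i $ j = - ((X $ i $ j + \<i> * Y $ i $ j) / 4)" for i j
  proof -
    have "- (adj ?S $ i $ j) = (X $ i $ j + \<i> * Y $ i $ j) / 4"
      using arg_cong[OF T, of "\<lambda>M. M $ i $ j"] unfolding T' X_def Y_def by simp
    then show ?thesis by (metis minus_minus)
  qed
  have X: "X = csmult 2 ?S - csmult 2 (adj ?S)"
  proof -
    have "2 * ?S $ i $ j - 2 * adj ?S $ i $ j = X $ i $ j" for i j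
      unfolding s t by (simp add: field_simps)
    then show ?thesis by (simp add: vec_eq_iff)
  qed
  have Y: "Y = csmult (2 * \<i>) ?S + csmult (2 * \<i>) (adj ?S)"
  proof -
    have "\<i> * (2 * \<i> * ?S $ i $ j + 2 * \<i> * adj ?S $ i $ j) = \<i> * Y $ i $ j" for i j
      unfolding s t by (simp add: field_simps)
    then show ?thesis by (simp add: vec_eq_iff)
  qed
  have "trace (X ** adj X) + trace (Y ** adj Y) = 8 * (trace (?S ** adj ?S) + trace (adj ?S ** ?S))"
    unfolding X Y by (simp add: adj_diff adj_add adj_csmult mm_simps trace_add trace_diff trace_csmult algebra_simps)
  also have "\<dots> = 16 * trace (?S ** adj ?S)" using trace_commute[of "adj ?S" ?S] by simp
  finally have "Re (trace (X ** adj X) + trace (Y ** adj Y)) = Re (16 * trace (?S ** adj ?S))" by simp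
  then have "Re (trace (X ** adj X)) + Re (trace (Y ** adj Y)) = 16 * Re (trace (?S ** adj ?S))" by simp
  moreover have "Re (trace (X ** adj X)) = Re (trace (Y ** adj Y))"
    using c by (simp add: induced_metric_def h_metric_def X_def Y_def)
  ultimately show ?thesis by (simp add: induced_metric_def h_metric_def X_def)
qed

lemma metric_continuous_positive:
  assumes im: "immersion \<psi>" and u: "\<And>p. unitary (\<psi> p)" and c: "c \<in> coords"
  shows "continuous_on UNIV (\<lambda>z. induced_metric (\<lambda>w. \<psi> (c w)) z 1 1)"
    and "induced_metric (\<lambda>w. \<psi> (c w)) z 1 1 > 0"
proof -
  let ?\<phi> = "\<lambda>w. \<psi> (c w)"
  have "Ck (Suc 0) ?\<phi>" using im c unfolding immersion_def smooth_map_def smooth_def by blast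
  then have Ck: "continuous_on UNIV (\<lambda>z. pd 1 ?\<phi> z)" and d: "?\<phi> differentiable (at z)" for z
    unfolding pd_def by (simp_all add: Basis_complex_def)
  have e: "induced_metric ?\<phi> z 1 1 = Re (trace (pd 1 ?\<phi> z ** adj (pd 1 ?\<phi> z))) / 8" for z
    using induced_metric_eq[of ?\<phi> z 1] u by simp
  show "continuous_on UNIV (\<lambda>z. induced_metric ?\<phi> z 1 1)"
    unfolding e trace_mult_adj by (intro continuous_intros Ck) auto
  have "pd 1 ?\<phi> z \<noteq> 0"
  proof
    assume "pd 1 ?\<phi> z = 0"
    moreover have "linear (frechet_derivative ?\<phi> (at z))" using d linear_frechet_derivative by blast
    ultimately have "frechet_derivative ?\<phi> (at z) 1 = frechet_derivative ?\<phi> (at z) 0"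
      by (simp add: pd_def linear_0)
    moreover have "inj (frechet_derivative ?\<phi> (at z))" using im c unfolding immersion_def by blast
    ultimately show False by (auto dest: injD)
  qed
  then show "induced_metric ?\<phi> z 1 1 > 0" unfolding e by (simp add: trace_mult_adj_pos)
qed

subsection \<open>Meromorphic functions with controlled modulus\<close>

lemma not_essential_norm_sq:
  fixes H :: "complex \<Rightarrow> complex" and X Y :: "complex \<Rightarrow> real"
  assumes H: "H holomorphic_on U - {a}" "open U" "a \<in> U"
    and X: "isCont X a" and Y: "isCont Y a" and XY: "Y a = 0 \<Longrightarrow> X a \<noteq> 0"
    and eq: "\<forall>\<^sub>F w in at a. (norm (H w))\<^sup>2 * Y w = X w"
  shows "not_essential H a"
proof (cases "Y a = 0")
  case True
  have X0: "\<forall>\<^sub>F w in at a. X w \<noteq> 0"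
    using X XY[OF True] unfolding isCont_def by (rule tendsto_imp_eventually_ne)
  have "((\<lambda>w. Y w / X w) \<longlongrightarrow> Y a / X a) (at a)"
    using X Y XY[OF True] unfolding isCont_def by (intro tendsto_divide)
  then have "((\<lambda>w. Y w / X w) \<longlongrightarrow> 0) (at a)" using True by simp
  moreover have "\<forall>\<^sub>F w in at a. Y w / X w = (norm (inverse (H w)))\<^sup>2"
    using eq X0
  proof eventually_elim
    case (elim w)
    then have "H w \<noteq> 0" "Y w \<noteq> 0" by auto
    then show ?case unfolding elim(1)[symmetric] by (simp add: norm_divide norm_inverse power_divide power_inverse field_simps)
  qed
  ultimately have "((\<lambda>w. (norm (inverse (H w)))\<^sup>2) \<longlongrightarrow> 0) (at a)"
    by - (drule (1) Lim_transform_eventually, simp)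
  then have "((\<lambda>w. sqrt ((norm (inverse (H w)))\<^sup>2)) \<longlongrightarrow> sqrt 0) (at a)" by (rule tendsto_real_sqrt)
  then have "((\<lambda>w. inverse (H w)) \<longlongrightarrow> 0) (at a)" by (simp add: tendsto_norm_zero_iff)
  moreover have "\<forall>\<^sub>F w in at a. inverse (H w) \<noteq> 0"
    using eq X0 by eventually_elim auto
  ultimately have "filterlim (\<lambda>w. inverse (H w)) (at 0) (at a)" by (simp add: filterlim_at)
  then have "is_pole H a" unfolding is_pole_def by (simp add: filterlim_inverse_at_iff)
  then show ?thesis by blast
next
  case False
  have Y0: "\<forall>\<^sub>F w in at a. Y w \<noteq> 0" using Y False unfolding isCont_def by (rule tendsto_imp_eventually_ne)
  have l: "((\<lambda>w. X w / Y w) \<longlongrightarrow> X a / Y a) (at a)"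
    using X Y False unfolding isCont_def by (intro tendsto_divide)
  have "\<forall>\<^sub>F w in at a. X w / Y w = (norm (H w))\<^sup>2"
    using eq Y0 by eventually_elim (simp add: field_simps)
  with l have "((\<lambda>w. (norm (H w))\<^sup>2) \<longlongrightarrow> X a / Y a) (at a)"
    by - (drule (1) Lim_transform_eventually, simp)
  then have "((\<lambda>w. sqrt ((norm (H w))\<^sup>2)) \<longlongrightarrow> sqrt (X a / Y a)) (at a)" by (rule tendsto_real_sqrt)
  then have nH: "((\<lambda>w. norm (H w)) \<longlongrightarrow> sqrt (X a / Y a)) (at a)" by simp
  define G where "G w = (w - a) * H w" for w
  have "((\<lambda>w. norm (w - a) * norm (H w)) \<longlongrightarrow> norm (a - a) * sqrt (X a / Y a)) (at a)"
    by (intro tendsto_mult nH tendsto_norm tendsto_diff tendsto_ident_at tendsto_const)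
  then have G0: "(G \<longlongrightarrow> 0) (at a)" unfolding G_def by (simp add: norm_mult[symmetric] tendsto_norm_zero_iff)
  have "G holomorphic_on U - {a}" unfolding G_def by (intro holomorphic_intros H(1))
  from removable_singularity[OF this H(2) G0]
  have hol: "(\<lambda>y. if y = a then 0 else G y) holomorphic_on U" .
  have ne: "not_essential (\<lambda>w. (if w = a then 0 else G w) / (w - a)) a"
    by (intro not_essential_divide not_essential_holomorphic[OF hol H(3,2)]
        isolated_singularity_at_holomorphic[OF _ H(2,3)] holomorphic_on_subset[OF hol]
        not_essential_holomorphic[OF _ H(3,2)] holomorphic_intros) auto
  have "\<forall>\<^sub>F w in at a. (if w = a then 0 else G w) / (w - a) = H w"
    by (rule eventually_at_filter[THEN iffD2]) (simp add: G_def always_eventually)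
  from not_essential_cong[OF this refl] ne show ?thesis by blast
qed

subsection \<open>The loop along a nondegenerate curve\<close>

lemma wdV_wr: "wdV (wr p) (crs (ev p z) (ev (pd3 (pd3 p)) z)) 0 z"
  unfolding wr_def[abs_def] using wdV_crs[OF wdV_ev[of p z] wdV_ev[of "pd3 p" z]] by simp

lemma hinner_wr: "hinner (ev p z) (vcnj (wr p z)) = 0" "hinner (ev (pd3 p) z) (vcnj (wr p z)) = 0"
  unfolding wr_def by (rule hinner_crs_left hinner_crs_right)+

locale uniton_curve = uniton_coefficients A0 A1 A2 S T
  for A0 A1 A2 :: "rsphere \<Rightarrow> complex ^ 3 ^ 3" and S T +
  fixes f :: "3 \<Rightarrow> complex poly" and X :: "rsphere set"
  assumes cv: "curve 2 f" and nz: "c \<in> coords \<Longrightarrow> wr (chart 2 f c) z \<noteq> 0" and fin: "finite X"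
    and rng: "p \<notin> X \<Longrightarrow> range ((*v) (A0 p)) = line 2 f p" and A2nz: "p \<notin> X \<Longrightarrow> A2 p \<noteq> 0"
begin

definition u where "u c z = ev (chart 2 f c) z"
definition nu where "nu c z = vcnj (wr (chart 2 f c) z)"
definition FF where "FF c z = hinner (u c z) (u c z)"
definition NN where "NN c z = hinner (nu c z) (nu c z)"
definition gg where "gg c z = (1 / FF c z) *s (adj (A0 (c z)) *v u c z)"
definition hh where "hh c z = hinner (A1 (c z) *v gg c z) (nu c z) / hinner (gg c z) (gg c z)"

lemma u_nz: "u c z \<noteq> 0" using chart_curve[OF cv, of c] by (simp add: u_def curve_def)
lemma nu_nz: "c \<in> coords \<Longrightarrow> nu c z \<noteq> 0" using nz by (simp add: nu_def)
lemma FF_nz: "FF c z \<noteq> 0" using u_nz by (simp add: FF_def)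
lemma NN_nz: "c \<in> coords \<Longrightarrow> NN c z \<noteq> 0" using nu_nz by (simp add: NN_def)
lemma cnj_FF [simp]: "cnj (FF c z) = FF c z" by (simp add: FF_def)
lemma cnj_NN [simp]: "cnj (NN c z) = NN c z" by (simp add: NN_def)
lemma u_nu: "hinner (u c z) (nu c z) = 0" "hinner (nu c z) (u c z) = 0"
  using hinner_wr(1) hinner_eq_0_commute unfolding u_def nu_def by blast+

lemma wdV_u: "wdV (u c) (ev (pd3 (chart 2 f c)) z) 0 z"
  unfolding u_def[abs_def] by (rule wdV_ev)

lemma wdV_nu: "wdV (nu c) 0 (vcnj (crs (u c z) (ev (pd3 (pd3 (chart 2 f c))) z))) z"
  using wdV_vcnj[OF wdV_wr[of "chart 2 f c" z]] unfolding nu_def[abs_def] u_def by simp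

lemma A0_outer:
  assumes c: "c \<in> coords" and z: "c z \<notin> X"
  shows "A0 (c z) = outer (u c z) (gg c z)" "gg c z \<noteq> 0"
proof -
  have r: "range ((*v) (A0 (c z))) = range (\<lambda>k. k *s u c z)"
    using rng[OF z] line_chart[OF cv c] unfolding u_def span_single by simp
  have g: "outer (u c z) (gg c z) = csmult (1 / FF c z) (outer (u c z) (u c z) ** A0 (c z))"
    unfolding outer_mm gg_def by (simp add: outer_def vec_eq_iff)
  show e: "A0 (c z) = outer (u c z) (gg c z)"
  proof (rule matrix_eqI_mv)
    fix v
    obtain k where k: "A0 (c z) *v v = k *s u c z" using r by blast
    show "A0 (c z) *v v = outer (u c z) (gg c z) *v v"
      unfolding g csmult_mv matrix_vector_mul_assoc[symmetric] k outer_mv hinner_scale_left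
      using FF_nz[of c z] by (simp add: FF_def vector_smult_assoc)
  qed
  show "gg c z \<noteq> 0"
  proof
    assume "gg c z = 0"
    then have "A0 (c z) = 0" using e by simp
    then have "range ((*v) (A0 (c z))) = {0}" by auto
    moreover have "1 *s u c z \<in> range (\<lambda>k. k *s u c z)" by blast
    ultimately show False using r u_nz[of c z] by simp
  qed
qed

lemma finite_X: "c \<in> coords \<Longrightarrow> finite {z. c z \<in> X}"
  by (rule finite_preimage_coords[OF _ fin])

lemma open_X: "c \<in> coords \<Longrightarrow> open (UNIV - {z. c z \<in> X})"
  using finite_X by (intro open_Diff finite_imp_closed) auto

lemma near_X: assumes c: "c \<in> coords" and z: "c z \<notin> X" shows "\<forall>\<^sub>F w in nhds z. c w \<notin> X"
proof -
  have "\<forall>\<^sub>F w in nhds z. w \<in> UNIV - {z. c z \<in> X}"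
    by (rule eventually_nhds_in_open[OF open_X[OF c]]) (use z in simp)
  then show ?thesis by eventually_elim simp
qed

lemma wdV_gg:
  assumes c: "c \<in> coords" shows "\<exists>a b. wdV (gg c) a b z"
proof -
  have "wdM (\<lambda>w. adj (A0 (c w))) (adj (A0 (c z) ** T c z)) (adj (- (A1 (c z) ** S c z))) z"
    by (rule wdM_adj[OF dA0[OF c]])
  note 1 = wdV_mv[OF this wdV_u[of c z]]
  note 2 = wd_divide[OF wd_const[of 1 z] wd_hinner[OF wdV_u[of c z] wdV_u[of c z]] FF_nz[of c z, unfolded FF_def]]
  show ?thesis using wdV_scale[OF 2 1] unfolding gg_def[abs_def] FF_def by blast
qed

lemma A2_outer:
  assumes c: "c \<in> coords" and z: "c z \<notin> X"
  obtains e where "e \<noteq> 0" "A2 (c z) = outer (nu c z) e"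
proof -
  have 0: "adj (A2 (c z)) *v u c z = 0"
  proof -
    have "outer (adj (A2 (c z)) *v u c z) (gg c z) *v gg c z = 0"
      using rel(4)[of "c z"] unfolding A0_outer(1)[OF c z] mm_outer by simp
    then show ?thesis using A0_outer(2)[OF c z] by (simp add: outer_mv)
  qed
  obtain a b where g: "wdV (gg c) a b z" using wdV_gg[OF c] by blast
  have "wdM (\<lambda>w. outer (u c w) (gg c w)) (outer (ev (pd3 (chart 2 f c)) z) (gg c z) + outer (u c z) b)
      (outer 0 (gg c z) + outer (u c z) a) z"
    by (rule wdM_outer[OF wdV_u g])
  moreover have "\<forall>\<^sub>F w in nhds z. outer (u c w) (gg c w) = A0 (c w)"
    using near_X[OF c z] by eventually_elim (simp add: A0_outer(1)[OF c])
  ultimately have "wdM (\<lambda>w. A0 (c w)) (outer (ev (pd3 (chart 2 f c)) z) (gg c z) + outer (u c z) b)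
      (outer 0 (gg c z) + outer (u c z) a) z" by (rule wdM_cong_ev)
  from wdM_unique[OF this dA0[OF c]]
  have d: "outer (ev (pd3 (chart 2 f c)) z) (gg c z) + outer (u c z) b = - (A1 (c z) ** S c z)" by blast
  have "adj (A2 (c z)) ** (A1 (c z) ** S c z) = - ((adj (A1 (c z)) ** A0 (c z)) ** S c z)"
    using rel(5)[of "c z"] by (simp add: matrix_mul_assoc eq_neg_iff_add_eq_0[symmetric] mm_uminus_left[symmetric] add.commute)
  also have "\<dots> = 0" unfolding matrix_mul_assoc[symmetric] AS(1)[OF c] by simp
  finally have "adj (A2 (c z)) ** (outer (ev (pd3 (chart 2 f c)) z) (gg c z) + outer (u c z) b) = 0"
    unfolding d mm_uminus_right by simp
  then have "outer (adj (A2 (c z)) *v ev (pd3 (chart 2 f c)) z) (gg c z) = 0"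
    by (simp add: mm_add_right mm_outer 0)
  then have "outer (adj (A2 (c z)) *v ev (pd3 (chart 2 f c)) z) (gg c z) *v gg c z = 0" by simp
  then have 1: "adj (A2 (c z)) *v ev (pd3 (chart 2 f c)) z = 0"
    using A0_outer(2)[OF c z] by (simp add: outer_mv)
  obtain e where e: "adj (A2 (c z)) = outer e (vcnj (crs (u c z) (ev (pd3 (chart 2 f c)) z)))"
    using crs_adj_rank_one[OF 0 1] nz[OF c, of z] unfolding u_def wr_def by blast
  have "A2 (c z) = outer (nu c z) e"
    using arg_cong[OF e, of adj] by (simp add: adj_outer nu_def wr_def u_def)
  moreover from this have "e \<noteq> 0" using A2nz[OF z] by auto
  ultimately show ?thesis using that by blast
qed

lemma loop_formulas:
  assumes c: "c \<in> coords" and z: "c z \<notin> X"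
  defines "D \<equiv> FF c z * NN c z + hh c z * cnj (hh c z)"
  shows "D \<noteq> 0"
    "A2 (c z) - A0 (c z) = csmult (1 / D) (csmult (FF c z) (outer (nu c z) (nu c z)) - csmult (NN c z) (outer (u c z) (u c z))
       - csmult (hh c z) (outer (nu c z) (u c z)) - csmult (cnj (hh c z)) (outer (u c z) (nu c z)))"
    "A2 (c z) = csmult (1 / D) (csmult (FF c z) (outer (nu c z) (nu c z)) - csmult (hh c z) (outer (nu c z) (u c z)))"
    "A0 (c z) = csmult (1 / D) (csmult (NN c z) (outer (u c z) (u c z)) + csmult (cnj (hh c z)) (outer (u c z) (nu c z)))"
proof -
  obtain e where e: "e \<noteq> 0" "A2 (c z) = outer (nu c z) e" using A2_outer[OF c z] .
  note r = rank_one_loop[OF sum rel(1,2,5) A0_outer(1)[OF c z] e(2) u_nz A0_outer(2)[OF c z] nu_nz[OF c] e(1) u_nu(1),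
      folded FF_def NN_def hh_def]
  show "D \<noteq> 0" using r(1) unfolding D_def .
  show "A2 (c z) - A0 (c z) = csmult (1 / D) (csmult (FF c z) (outer (nu c z) (nu c z)) - csmult (NN c z) (outer (u c z) (u c z))
       - csmult (hh c z) (outer (nu c z) (u c z)) - csmult (cnj (hh c z)) (outer (u c z) (nu c z)))"
    using r(2) unfolding D_def .
  show "A2 (c z) = csmult (1 / D) (csmult (FF c z) (outer (nu c z) (nu c z)) - csmult (hh c z) (outer (nu c z) (u c z)))"
    using r(3) unfolding D_def .
  show "A0 (c z) = csmult (1 / D) (csmult (NN c z) (outer (u c z) (u c z)) + csmult (cnj (hh c z)) (outer (u c z) (nu c z)))"
    using r(4) unfolding D_def .
qed

lemma hh_holomorphic_at:
  assumes c: "c \<in> coords" and z: "c z \<notin> X"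
  shows "\<exists>k. wd (hh c) k 0 z"
proof -
  obtain e where e: "e \<noteq> 0" "A2 (c z) = outer (nu c z) e" using A2_outer[OF c z] .
  obtain a b where g: "wdV (gg c) a b z" using wdV_gg[OF c] by blast
  have g0: "hinner (gg c z) (gg c z) \<noteq> 0" using A0_outer(2)[OF c z] by simp
  define v where "v w = (1 / hinner (gg c w) (gg c w)) *s gg c w" for w
  obtain a' b' where v: "wdV v a' b' z"
    using wdV_scale[OF wd_divide[OF wd_const[of 1 z] wd_hinner[OF g g] g0] g] unfolding v_def[abs_def] by blast
  have hv: "hh c w = hinner (A1 (c w) *v v w) (nu c w)" for w
    by (simp add: hh_def v_def mv_scale hinner_scale_left)
  have "wdV (\<lambda>w. A0 (c w) *v v w) (- (A1 (c z) ** S c z) *v v z + A0 (c z) *v a')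
      ((A0 (c z) ** T c z) *v v z + A0 (c z) *v b') z" by (rule wdV_mv[OF dA0[OF c] v])
  moreover have "\<forall>\<^sub>F w in nhds z. A0 (c w) *v v w = u c w"
    using near_X[OF c z]
  proof eventually_elim
    case (elim w)
    then show ?case using A0_outer(2)[OF c elim]
      by (simp add: A0_outer(1)[OF c elim] v_def mv_scale outer_mv vector_smult_assoc)
  qed
  ultimately have "wdV (u c) (- (A1 (c z) ** S c z) *v v z + A0 (c z) *v a')
      ((A0 (c z) ** T c z) *v v z + A0 (c z) *v b') z" by (rule wdV_cong_ev)
  from wdV_unique[OF this wdV_u] have k: "A0 (c z) *v (T c z *v v z + b') = 0"
    by (simp add: mv_add matrix_vector_mul_assoc)
  have n1: "hinner (A1 (c z) *v (T c z *v v z + b')) (nu c z) = 0"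
  proof -
    let ?w = "T c z *v v z + b'"
    have "adj (A2 (c z)) *v (A1 (c z) *v ?w) = - (adj (A1 (c z)) *v (A0 (c z) *v ?w))"
      using arg_cong[OF rel(5)[of "c z"], of "\<lambda>M. M *v ?w"]
      by (simp add: matrix_add_mv matrix_vector_mul_assoc[symmetric] eq_neg_iff_add_eq_0 add.commute)
    then have "hinner (A1 (c z) *v ?w) (nu c z) *s e = 0" unfolding k e(2) adj_outer outer_mv by simp
    then show ?thesis using e(1) by simp
  qed
  have n2: "hinner (A0 (c z) *v x) (nu c z) = 0" for x
    unfolding A0_outer(1)[OF c z] outer_mv hinner_scale_left u_nu by simp
  have "wd (\<lambda>w. hinner (A1 (c w) *v v w) (nu c w))
      (hinner ((A1 (c z) ** S c z - A2 (c z) ** S c z) *v v z + A1 (c z) *v a') (nu c z)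
        + hinner (A1 (c z) *v v z) (vcnj (crs (u c z) (ev (pd3 (pd3 (chart 2 f c))) z))))
      (hinner ((A1 (c z) ** T c z - A0 (c z) ** T c z) *v v z + A1 (c z) *v b') (nu c z) + hinner (A1 (c z) *v v z) 0) z"
    by (rule wd_hinner[OF wdV_mv[OF dA1[OF c] v] wdV_nu])
  moreover have "hinner ((A1 (c z) ** T c z - A0 (c z) ** T c z) *v v z + A1 (c z) *v b') (nu c z) = 0"
  proof -
    have "(A1 (c z) ** T c z - A0 (c z) ** T c z) *v v z + A1 (c z) *v b'
        = A1 (c z) *v (T c z *v v z + b') - A0 (c z) *v (T c z *v v z)"
      by (simp add: matrix_diff_mv matrix_vector_mul_assoc[symmetric] mv_add)
    then show ?thesis using n1 n2 by (simp add: hinner_diff_left)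
  qed
  ultimately show ?thesis unfolding hv[abs_def] by auto
qed

lemma hh_holomorphic: assumes c: "c \<in> coords" shows "hh c holomorphic_on UNIV - {z. c z \<in> X}"
  unfolding holomorphic_on_open[OF open_X[OF c]]
  using hh_holomorphic_at[OF c] holo_wd by blast

lemma hh_norm_sq:
  assumes c: "c \<in> coords"
  defines "Y \<equiv> (\<lambda>z. Re (hinner ((A2 (c z) - A0 (c z)) *v u c z) (u c z)))"
  defines "Z \<equiv> (\<lambda>z. - Re (NN c z * (FF c z)\<^sup>2) - Re (FF c z * NN c z) * Y z)"
  shows "c z \<notin> X \<Longrightarrow> (norm (hh c z))\<^sup>2 * Y z = Z z" "isCont Y z" "isCont Z z" "Y z = 0 \<Longrightarrow> Z z \<noteq> 0"
proof -
  have wF: "wd (FF c) (hinner (ev (pd3 (chart 2 f c)) z) (u c z) + hinner (u c z) 0)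
      (hinner 0 (u c z) + hinner (u c z) (ev (pd3 (chart 2 f c)) z)) z"
    unfolding FF_def[abs_def] by (rule wd_hinner[OF wdV_u wdV_u])
  have "\<exists>a b. wd (NN c) a b z" unfolding NN_def[abs_def] using wd_hinner[OF wdV_nu wdV_nu] by blast
  then have cN: "isCont (NN c) z" using wd_isCont by blast
  have cF: "isCont (FF c) z" using wF wd_isCont by blast
  have "\<exists>a b. wd (\<lambda>z. hinner ((A2 (c z) - A0 (c z)) *v u c z) (u c z)) a b z"
    using wd_hinner[OF wdV_mv[OF dQ[OF c] wdV_u] wdV_u] by blast
  then have "isCont (\<lambda>z. hinner ((A2 (c z) - A0 (c z)) *v u c z) (u c z)) z" using wd_isCont by blast
  then show Y: "isCont Y z" unfolding Y_def by (rule isCont_Re)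
  show "isCont Z z" unfolding Z_def by (intro continuous_intros isCont_Re cN cF Y)
  have rl: "FF c z = of_real (Re (FF c z))" "NN c z = of_real (Re (NN c z))" for z
    unfolding FF_def NN_def hinner_self by simp_all
  have "Re (NN c z * (FF c z)\<^sup>2) \<noteq> 0"
  proof
    assume "Re (NN c z * (FF c z)\<^sup>2) = 0"
    moreover have "NN c z * (FF c z)\<^sup>2 = of_real (Re (NN c z) * (Re (FF c z))\<^sup>2)" by (metis rl of_real_mult of_real_power)
    ultimately have "NN c z * (FF c z)\<^sup>2 = 0" by (metis Re_complex_of_real of_real_0)
    then show False using FF_nz[of c z] NN_nz[OF c, of z] by simp
  qed
  then show "Y z = 0 \<Longrightarrow> Z z \<noteq> 0" unfolding Z_def by simp
  show "(norm (hh c z))\<^sup>2 * Y z = Z z" if z: "c z \<notin> X"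
  proof -
    define D where "D = FF c z * NN c z + hh c z * cnj (hh c z)"
    have D0: "D \<noteq> 0" using loop_formulas(1)[OF c z] unfolding D_def .
    have "hinner ((A2 (c z) - A0 (c z)) *v u c z) (u c z) = - (NN c z * (FF c z)\<^sup>2) / D"
      unfolding loop_formulas(2)[OF c z, folded D_def]
      by (simp add: mv_simps outer_mv hinner_simps u_nu power2_eq_square flip: FF_def)
    then have "D * hinner ((A2 (c z) - A0 (c z)) *v u c z) (u c z) = - (NN c z * (FF c z)\<^sup>2)" using D0 by simp
    moreover have "D = of_real (Re (FF c z * NN c z) + (norm (hh c z))\<^sup>2)"
    proof -
      have "FF c z * NN c z = of_real (Re (FF c z) * Re (NN c z))" by (metis rl of_real_mult)
      then show ?thesis unfolding D_def complex_norm_square[symmetric] by (metis Re_complex_of_real of_real_add)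
    qed
    moreover have "Re (of_real d * H) = d * Re H" for d H by simp
    ultimately have "(Re (FF c z * NN c z) + (norm (hh c z))\<^sup>2) * Y z = - Re (NN c z * (FF c z)\<^sup>2)"
      unfolding Y_def by (metis uminus_complex.simps(1))
    then show ?thesis unfolding Z_def by (simp add: algebra_simps)
  qed
qed

lemma hh_not_essential:
  assumes c: "c \<in> coords" shows "not_essential (hh c) a"
proof -
  let ?U = "UNIV - ({z. c z \<in> X} - {a})"
  have o: "open ?U" using finite_X[OF c] by (intro open_Diff finite_imp_closed) auto
  show ?thesis
  proof (rule not_essential_norm_sq[where U = ?U])
    show "hh c holomorphic_on ?U - {a}" by (rule holomorphic_on_subset[OF hh_holomorphic[OF c]]) auto
    have "\<forall>\<^sub>F w in at a. w \<in> ?U - {a}" using o by (intro eventually_at_in_open) auto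
    then show "\<forall>\<^sub>F w in at a. (norm (hh c w))\<^sup>2 * Re (hinner ((A2 (c w) - A0 (c w)) *v u c w) (u c w))
        = - Re (NN c w * (FF c w)\<^sup>2) - Re (FF c w * NN c w) * Re (hinner ((A2 (c w) - A0 (c w)) *v u c w) (u c w))"
      by eventually_elim (rule hh_norm_sq(1)[OF c], auto)
  qed (use o hh_norm_sq(2-4)[OF c] in auto)
qed

lemma hh_infinity:
  assumes w: "w \<noteq> 0" shows "hh Fin (1 / w) = - hh coord_inf w / w ^ 4"
proof -
  have d: "\<And>i. degree (f i) \<le> 2" using cv curve_def by blast
  have ci: "coord_inf w = Fin (1 / w)" using w by (rule coord_inf_simps(2))
  have u: "u coord_inf w = w\<^sup>2 *s u Fin (1 / w)" by (simp add: u_def ev_rv[OF d w])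
  have "w\<^sup>2 *s wr (rv 2 f) w = w\<^sup>2 *s ((- w\<^sup>2) *s wr f (1 / w))"
    unfolding wr_rv[OF d w] vector_smult_assoc by (simp add: power2_eq_square mult.assoc)
  then have "wr (rv 2 f) w = (- w\<^sup>2) *s wr f (1 / w)"
    by (rule vec.scale_left_imp_eq[rotated]) (use w in simp)
  then have n: "nu coord_inf w = (- (cnj w)\<^sup>2) *s nu Fin (1 / w)"
    by (simp only: nu_def chart_simps vcnj_scale complex_cnj_minus complex_cnj_power)
  have F: "FF coord_inf w = w\<^sup>2 * (cnj w)\<^sup>2 * FF Fin (1 / w)"
    unfolding FF_def u by (simp add: hinner_scale_left hinner_scale_right)
  have g: "gg coord_inf w = (1 / (cnj w)\<^sup>2) *s gg Fin (1 / w)"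
    unfolding gg_def F ci u mv_scale vector_smult_assoc using w by (simp add: field_simps)
  have "hh coord_inf w = - (w ^ 4) * hh Fin (1 / w)"
  proof -
    have w4: "w ^ 4 = w\<^sup>2 * w\<^sup>2" by (simp add: power2_eq_square power4_eq_xxxx mult.assoc)
    have G: "hinner (gg coord_inf w) (gg coord_inf w) = 1 / ((cnj w)\<^sup>2 * w\<^sup>2) * hinner (gg Fin (1 / w)) (gg Fin (1 / w))"
      unfolding g hinner_scale_left hinner_scale_right by simp
    have B: "hinner (A1 (coord_inf w) *v gg coord_inf w) (nu coord_inf w)
        = - (w\<^sup>2 / (cnj w)\<^sup>2) * hinner (A1 (Fin (1 / w)) *v gg Fin (1 / w)) (nu Fin (1 / w))"
      unfolding ci g n mv_scale hinner_scale_left hinner_scale_right by simp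
    have "- (x / y) * b / (1 / (y * x) * k) = - (x * x) * (b / k)" if "x \<noteq> 0" "y \<noteq> 0" for x y b k :: complex
      using that by (cases "k = 0") (auto simp: field_simps)
    from this[of "w\<^sup>2" "(cnj w)\<^sup>2"] show ?thesis using w unfolding hh_def w4 G B by simp
  qed
  then show ?thesis using w by simp
qed

lemma hh_rational:
  obtains p q :: "complex poly" where "q \<noteq> 0" "\<And>z. poly q z \<noteq> 0 \<or> poly p z \<noteq> 0"
    "\<And>z. Fin z \<notin> X \<Longrightarrow> poly q z \<noteq> 0 \<and> hh Fin z = poly p z / poly q z"
proof -
  have i: "isolated_singularity_at (hh c) a" if "c \<in> coords" for c a
    by (rule isolated_singularity_finite[OF hh_holomorphic[OF that] finite_X[OF that]])
  have ne: "not_essential (\<lambda>w. - hh coord_inf w / w ^ 4) 0"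
    by (intro not_essential_divide not_essential_uminus hh_not_essential isolated_singularity_at_uminus i
        coords_mem not_essential_holomorphic[of _ UNIV] isolated_singularity_at_holomorphic[of _ UNIV] holomorphic_intros) auto
  have "\<forall>\<^sub>F w in at 0. - hh coord_inf w / w ^ 4 = hh Fin (1 / w)"
    by (rule eventually_at_filter[THEN iffD2]) (simp add: hh_infinity always_eventually)
  from not_essential_cong[OF this refl] ne have "not_essential (\<lambda>w. hh Fin (1 / w)) 0" by blast
  then have "\<exists>p q :: complex poly. q \<noteq> 0 \<and> (\<forall>z. z \<notin> {z. Fin z \<in> X} \<longrightarrow> poly q z \<noteq> 0 \<and> hh Fin z = poly p z / poly q z)"
    using rational_if_not_essential[OF hh_holomorphic[OF coords_mem(1)] finite_X[OF coords_mem(1)] hh_not_essential[OF coords_mem(1)]]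
    by blast
  then obtain p q :: "complex poly" where q: "q \<noteq> 0"
    and pq: "\<And>z. Fin z \<notin> X \<Longrightarrow> poly q z \<noteq> 0 \<and> hh Fin z = poly p z / poly q z" by auto
  define R where "R i = (if i = 1 then p else if i = 2 then q else 0)" for i :: 3
  have R: "R 1 = p" "R 2 = q" "R 3 = 0" by (simp_all add: R_def)
  have "R 2 \<noteq> 0" using q by (simp add: R)
  then obtain g M m where g: "g \<noteq> 0" and gM: "\<And>i. R i = g * M i" and M: "curve m M"
    using reduce_curve[where p = R] by metis
  have p: "p = g * M 1" and q': "q = g * M 2" using gM[of 1] gM[of 2] R by simp_all
  have M3: "M 3 = 0" using gM[of 3] g by (simp add: R)
  show ?thesis
  proof (rule that[of "M 2" "M 1"])
    show "M 2 \<noteq> 0" using q q' by auto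
    show "poly (M 2) z \<noteq> 0 \<or> poly (M 1) z \<noteq> 0" for z
    proof -
      have "ev M z \<noteq> 0" using M curve_def by blast
      then show ?thesis using M3 by (auto simp: vec_eq_iff forall_3)
    qed
    show "poly (M 2) z \<noteq> 0 \<and> hh Fin z = poly (M 1) z / poly (M 2) z" if "Fin z \<notin> X" for z
      using pq[OF that] unfolding p q' by simp
  qed
qed

end

subsection \<open>The induced metric of the loop as a Hermitian square\<close>

context uniton_curve
begin

definition PP :: "complex poly \<Rightarrow> complex poly \<Rightarrow> (3 \<times> 3) option \<Rightarrow> complex poly" where
  "PP p q = (\<lambda>x. case x of None \<Rightarrow> p | Some (i, j) \<Rightarrow> q * f i * pcr f (pd3 f) j)"

end

lemma hs_option:
  fixes P R :: "(3 \<times> 3) option \<Rightarrow> complex poly"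
  shows "hs P R z = poly (P None) z * cnj (poly (R None) z)
    + (\<Sum>i\<in>UNIV. \<Sum>j\<in>UNIV. poly (P (Some (i, j))) z * cnj (poly (R (Some (i, j))) z))"
proof -
  have "hs P R z = poly (P None) z * cnj (poly (R None) z)
      + (\<Sum>x\<in>range Some. poly (P x) z * cnj (poly (R x) z))"
    unfolding hs_def UNIV_option_conv by (subst sum.insert) auto
  also have "(\<Sum>x\<in>range Some. poly (P x) z * cnj (poly (R x) z))
      = (\<Sum>x\<in>UNIV \<times> UNIV. poly (P (Some x)) z * cnj (poly (R (Some x)) z))"
    unfolding UNIV_Times_UNIV by (subst sum.reindex) (auto simp: inj_on_def)
  also have "\<dots> = (\<Sum>i\<in>UNIV. \<Sum>j\<in>UNIV. poly (P (Some (i, j))) z * cnj (poly (R (Some (i, j))) z))"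
    unfolding sum.cartesian_product by simp
  finally show ?thesis .
qed

lemma hinner_mult: "hinner a b * hinner c d = (\<Sum>i\<in>UNIV. \<Sum>j\<in>UNIV. (a $ i * cnj (b $ i)) * (c $ j * cnj (d $ j)))"
  unfolding hinner_def by (rule sum_product)

lemma wd_unique2: "wd F a b z \<Longrightarrow> wd F c d z \<Longrightarrow> a = c \<and> b = d"
  using wd_unique by blast

context uniton_curve
begin

context
  fixes p q :: "complex poly"
  assumes q0: "q \<noteq> 0" and pq: "\<And>z. poly q z \<noteq> 0 \<or> poly p z \<noteq> 0"
    and hpq: "\<And>z. Fin z \<notin> X \<Longrightarrow> poly q z \<noteq> 0 \<and> hh Fin z = poly p z / poly q z"
begin

definition uh where "uh z = poly q z *s ev f z"
definition uh' where "uh' z = poly (pderiv q) z *s ev f z + poly q z *s ev (pd3 f) z"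
definition n0 where "n0 z = vcnj (wr f z)"
definition n0' where "n0' z = vcnj (crs (ev f z) (ev (pd3 (pd3 f)) z))"
definition Dh where "Dh z = hinner (uh z) (uh z) * hinner (n0 z) (n0 z) + poly p z * cnj (poly p z)"
definition Rh where "Rh z = csmult (hinner (uh z) (uh z)) (outer (n0 z) (n0 z)) - csmult (hinner (n0 z) (n0 z)) (outer (uh z) (uh z))
    - csmult (poly p z) (outer (n0 z) (uh z)) - csmult (cnj (poly p z)) (outer (uh z) (n0 z))"

lemma wdV_uh: "wdV uh (uh' z) 0 z"
  using wdV_scale[OF wd_poly[of q z] wdV_ev[of f z]] unfolding uh_def[abs_def] uh'_def by simp

lemma wdV_n0: "wdV n0 0 (n0' z) z"
  using wdV_vcnj[OF wdV_wr[of f z]] unfolding n0_def[abs_def] n0'_def by simp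

lemma n0_nz: "n0 z \<noteq> 0" using nu_nz[OF coords_mem(1), of z] by (simp add: n0_def nu_def)

lemma uh_n0: "hinner (uh z) (n0 z) = 0" "hinner (uh' z) (n0 z) = 0" "hinner (uh z) (n0' z) = 0"
  unfolding uh_def uh'_def n0_def n0'_def hinner_scale_left hinner_add_left hinner_wr hinner_crs_left by simp_all

lemma Dh_real: "Dh z = of_real ((norm (uh z))\<^sup>2 * (norm (n0 z))\<^sup>2 + (norm (poly p z))\<^sup>2)"
  unfolding Dh_def hinner_self complex_norm_square[symmetric] by simp

lemma Dh_nz: "Dh z \<noteq> 0"
proof -
  have f: "ev f z \<noteq> 0" using cv curve_def by blast
  have "(norm (uh z))\<^sup>2 * (norm (n0 z))\<^sup>2 + (norm (poly p z))\<^sup>2 \<noteq> 0"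
  proof (cases "poly q z = 0")
    case True
    then have "poly p z \<noteq> 0" using pq by blast
    then show ?thesis by (simp add: add_nonneg_eq_0_iff)
  next
    case False
    then have "uh z \<noteq> 0" using f by (simp add: uh_def)
    then show ?thesis using n0_nz[of z] by (simp add: add_nonneg_eq_0_iff)
  qed
  then show ?thesis unfolding Dh_real by (simp only: of_real_eq_0_iff not_False_eq_True)
qed

lemma wd_Dh: "wd Dh (hinner (uh' z) (uh z) * hinner (n0 z) (n0 z) + hinner (uh z) (uh z) * hinner (n0 z) (n0' z)
      + poly (pderiv p) z * cnj (poly p z))
    (hinner (uh z) (uh' z) * hinner (n0 z) (n0 z) + hinner (uh z) (uh z) * hinner (n0' z) (n0 z)
      + poly p z * cnj (poly (pderiv p) z)) z"
proof -
  note 1 = wd_hinner[OF wdV_uh[of z] wdV_uh[of z]] and 2 = wd_hinner[OF wdV_n0[of z] wdV_n0[of z]]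
  note 3 = wd_mult[OF wd_poly[of p z] wd_cnj[OF wd_poly[of p z]]]
  show ?thesis unfolding Dh_def[abs_def]
    by (rule wd_eqI[OF wd_add[OF wd_mult[OF 1 2] 3]]) (simp_all add: algebra_simps)
qed

lemma Q_formula: "A2 (Fin z) - A0 (Fin z) = csmult (1 / Dh z) (Rh z)" if "Fin z \<notin> X"
proof -
  have q: "poly q z \<noteq> 0" and h: "hh Fin z = poly p z / poly q z" using hpq[OF that] by blast+
  define F where "F = FF Fin z"
  define N where "N = NN Fin z"
  let ?k = "poly q z * cnj (poly q z)"
  have k0: "?k \<noteq> 0" using q by simp
  have un: "u Fin z = ev f z" "nu Fin z = n0 z" by (simp_all add: u_def nu_def n0_def)
  have F: "hinner (uh z) (uh z) = ?k * F" unfolding uh_def F_def FF_def un hinner_scale_left hinner_scale_right by simp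
  have N: "hinner (n0 z) (n0 z) = N" unfolding N_def NN_def un ..
  have D: "Dh z = ?k * (F * N + hh Fin z * cnj (hh Fin z))" unfolding Dh_def F N h using q by (simp add: field_simps)
  have R: "Rh z = csmult ?k (csmult F (outer (n0 z) (n0 z)) - csmult N (outer (ev f z) (ev f z))
       - csmult (hh Fin z) (outer (n0 z) (ev f z)) - csmult (cnj (hh Fin z)) (outer (ev f z) (n0 z)))"
    unfolding Rh_def F N h unfolding uh_def using q by (simp add: vec_eq_iff outer_def field_simps)
  have Ds: "1 / Dh z * ?k = 1 / (F * N + hh Fin z * cnj (hh Fin z))" unfolding D using k0 by simp
  show ?thesis
    unfolding loop_formulas(2)[OF coords_mem(1) that, folded F_def N_def] R csmult_csmult Ds un ..
qed

lemma wdM_Rh: "wdM Rh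
    (csmult (hinner (uh' z) (uh z)) (outer (n0 z) (n0 z)) + csmult (hinner (uh z) (uh z)) (outer (n0 z) (n0' z))
      - csmult (hinner (n0 z) (n0' z)) (outer (uh z) (uh z)) - csmult (hinner (n0 z) (n0 z)) (outer (uh' z) (uh z))
      - csmult (poly (pderiv p) z) (outer (n0 z) (uh z))
      - csmult (cnj (poly p z)) (outer (uh' z) (n0 z) + outer (uh z) (n0' z)))
    (csmult (hinner (uh z) (uh' z)) (outer (n0 z) (n0 z)) + csmult (hinner (uh z) (uh z)) (outer (n0' z) (n0 z))
      - (csmult (hinner (n0' z) (n0 z)) (outer (uh z) (uh z)) + csmult (hinner (n0 z) (n0 z)) (outer (uh z) (uh' z)))
      - csmult (poly p z) (outer (n0' z) (uh z) + outer (n0 z) (uh' z))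
      - csmult (cnj (poly (pderiv p) z)) (outer (uh z) (n0 z))) z"
proof -
  note U = wdV_uh[of z] and V = wdV_n0[of z] and p = wd_poly[of p z]
  note 1 = wdM_csmult[OF wd_hinner[OF U U] wdM_outer[OF V V]]
  note 2 = wdM_csmult[OF wd_hinner[OF V V] wdM_outer[OF U U]]
  note 3 = wdM_csmult[OF p wdM_outer[OF V U]]
  note 4 = wdM_csmult[OF wd_cnj[OF p] wdM_outer[OF U V]]
  note w = wdM_diff[OF wdM_diff[OF wdM_diff[OF 1 2] 3] 4]
  have eq: "wdM F a b z \<Longrightarrow> a = c \<Longrightarrow> b = d \<Longrightarrow> wdM F c d z" for F :: "complex \<Rightarrow> complex ^ 3 ^ 3" and a b c d by simp
  show ?thesis unfolding Rh_def[abs_def]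
    by (rule eq[OF w]) (simp_all add: algebra_simps csmult_add_right)
qed

lemma isCont_entry: "wdM F a b z \<Longrightarrow> isCont (\<lambda>w. F w $ i $ j) z"
  unfolding wdM_def using wd_isCont by blast

lemma wdM_Q_formula: "wdM (\<lambda>z. csmult (1 / Dh z) (Rh z)) (csmult a (Rh z) + csmult (1 / Dh z) R1)
    (csmult b (Rh z) + csmult (1 / Dh z) R2) z"
  if "wd (\<lambda>z. 1 / Dh z) a b z" "wdM Rh R1 R2 z" for a b R1 R2
  by (rule wdM_csmult[OF that])

lemma Q_global: "A2 (Fin z) - A0 (Fin z) = csmult (1 / Dh z) (Rh z)"
proof -
  have "(A2 (Fin z) - A0 (Fin z)) $ i $ j = csmult (1 / Dh z) (Rh z) $ i $ j" for i j
  proof (rule continuous_eq_off_finite[where z = z])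
    show "continuous_on UNIV (\<lambda>z. (A2 (Fin z) - A0 (Fin z)) $ i $ j)"
      by (intro continuous_at_imp_continuous_on ballI isCont_entry[OF dQ[OF coords_mem(1)]])
    show "continuous_on UNIV (\<lambda>z. csmult (1 / Dh z) (Rh z) $ i $ j)"
      by (intro continuous_at_imp_continuous_on ballI
          isCont_entry[OF wdM_Q_formula[OF wd_divide[OF wd_const wd_Dh Dh_nz] wdM_Rh]])
    show "finite {z. Fin z \<in> X}" by (rule finite_X) simp
    show "(A2 (Fin z) - A0 (Fin z)) $ i $ j = csmult (1 / Dh z) (Rh z) $ i $ j" if "z \<notin> {z. Fin z \<in> X}" for z
      using Q_formula[of z] that by simp
  qed
  then show ?thesis by (simp only: vec_eq_iff) simp
qed

lemma hs_PP: "hs (PP p q) (PP p q) z = Dh z"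
  unfolding hs_option Dh_def uh_def n0_def hinner_mult wr_ev by (simp add: PP_def mult_ac)

lemma energy_hs:
  "trace (S Fin z ** adj (S Fin z)) = hs (wedge (PP p q)) (wedge (PP p q)) z / (2 * (hs (PP p q) (PP p q) z)\<^sup>2)"
proof -
  let ?P = "PP p q"
  define N' where "N' = hinner (uh' z) (uh z) * hinner (n0 z) (n0 z) + hinner (uh z) (uh z) * hinner (n0 z) (n0' z)
      + poly (pderiv p) z * cnj (poly p z)"
  define N2 where "N2 = hinner (uh' z) (uh' z) * hinner (n0 z) (n0 z) + hinner (uh' z) (uh z) * cnj (hinner (n0 z) (n0' z))
      + cnj (hinner (uh' z) (uh z)) * hinner (n0 z) (n0' z) + hinner (uh z) (uh z) * hinner (n0' z) (n0' z)
      + poly (pderiv p) z * cnj (poly (pderiv p) z)"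
  have "wdM (\<lambda>z. A2 (Fin z) - A0 (Fin z)) (S Fin z) (- T Fin z) z" by (rule dQ) simp
  then have "wdM (\<lambda>z. csmult (1 / Dh z) (Rh z)) (S Fin z) (- T Fin z) z" unfolding Q_global .
  from wdM_unique[OF this wdM_Q_formula[OF wd_divide[OF wd_const wd_Dh Dh_nz] wdM_Rh]]
  have S: "S Fin z = csmult (1 / Dh z)
     (csmult (hinner (uh' z) (uh z)) (outer (n0 z) (n0 z)) + csmult (hinner (uh z) (uh z)) (outer (n0 z) (n0' z))
      - csmult (hinner (n0 z) (n0' z)) (outer (uh z) (uh z)) - csmult (hinner (n0 z) (n0 z)) (outer (uh' z) (uh z))
      - csmult (poly (pderiv p) z) (outer (n0 z) (uh z))
      - csmult (cnj (poly p z)) (outer (uh' z) (n0 z) + outer (uh z) (n0' z)))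
     - csmult (N' / (Dh z)\<^sup>2) (Rh z)"
    unfolding N'_def by (simp add: vec_eq_iff)
  have e: "trace (S Fin z ** adj (S Fin z)) = (Dh z * N2 - N' * cnj N') / (Dh z)\<^sup>2"
    using energy_identity[OF uh_n0[of z], where h = "poly p z" and k = "poly (pderiv p) z", folded Rh_def Dh_def N'_def N2_def, OF Dh_nz]
    unfolding S .
  have wP: "wd (hs ?P ?P) (hs (dv ?P) ?P z) (hs ?P (dv ?P) z) z" by (rule wd_hs)
  then have "wd Dh (hs (dv ?P) ?P z) (hs ?P (dv ?P) z) z" unfolding hs_PP[abs_def] .
  from wd_unique2[OF this wd_Dh[of z]] have 1: "hs (dv ?P) ?P z = N'" unfolding N'_def by blast
  have 2: "hs ?P (dv ?P) z = cnj N'" unfolding 1[symmetric] hs_def by (simp add: mult.commute)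
  have 3: "hs (dv ?P) (dv ?P) z = N2"
  proof -
    have d: "poly (dv ?P (Some (i, j))) z = uh' z $ i * cnj (n0 z $ j) + uh z $ i * cnj (n0' z $ j)" for i j
    proof -
      have "poly (dv ?P (Some (i, j))) z = uh' z $ i * poly (pcr f (pd3 f) j) z + uh z $ i * poly (pderiv (pcr f (pd3 f) j)) z"
        by (simp add: dv_def PP_def pderiv_mult uh'_def uh_def pd3_def algebra_simps)
      moreover have "poly (pcr f (pd3 f) j) z = cnj (n0 z $ j)" by (simp add: n0_def wr_ev)
      moreover have "poly (pderiv (pcr f (pd3 f) j)) z = cnj (n0' z $ j)"
      proof -
        have "wdV (wr f) (ev (pd3 (pcr f (pd3 f))) z) 0 z" unfolding wr_ev[abs_def] by (rule wdV_ev)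
        from wdV_unique[OF this wdV_wr] have "ev (pd3 (pcr f (pd3 f))) z = crs (ev f z) (ev (pd3 (pd3 f)) z)" by blast
        from arg_cong[OF this, of "\<lambda>v. v $ j"] show ?thesis by (simp add: n0'_def pd3_def)
      qed
      ultimately show ?thesis by simp
    qed
    have "hs (dv ?P) (dv ?P) z = poly (pderiv p) z * cnj (poly (pderiv p) z)
        + (\<Sum>i\<in>UNIV. \<Sum>j\<in>UNIV. (uh' z $ i * cnj (n0 z $ j) + uh z $ i * cnj (n0' z $ j))
           * cnj (uh' z $ i * cnj (n0 z $ j) + uh z $ i * cnj (n0' z $ j)))"
      unfolding hs_option d by (simp add: dv_def PP_def)
    also have "(\<Sum>i\<in>UNIV. \<Sum>j\<in>UNIV. (uh' z $ i * cnj (n0 z $ j) + uh z $ i * cnj (n0' z $ j))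
           * cnj (uh' z $ i * cnj (n0 z $ j) + uh z $ i * cnj (n0' z $ j)))
        = hinner (uh' z) (uh' z) * hinner (n0 z) (n0 z) + hinner (uh' z) (uh z) * hinner (n0' z) (n0 z)
          + hinner (uh z) (uh' z) * hinner (n0 z) (n0' z) + hinner (uh z) (uh z) * hinner (n0' z) (n0' z)"
      unfolding hinner_mult sum.distrib[symmetric] by (intro sum.cong refl) (simp add: algebra_simps)
    finally show ?thesis unfolding N2_def by simp
  qed
  show ?thesis unfolding e hs_wedge 1 2 3 hs_PP by (rule nonzero_mult_divide_mult_cancel_left[symmetric]) simp
qed

end

end

subsection \<open>Constant curvature forces the loop to be homogeneous\<close>

lemma wdM_comp:
  assumes F: "wdM F a b (g z)" and g: "(g has_field_derivative d) (at z)"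
  shows "wdM (\<lambda>w. F (g w)) (csmult d a) (csmult (cnj d) b) z"
  unfolding wdM_def
proof (intro allI)
  fix i j
  have "((\<lambda>w. F w $ i $ j) has_derivative (\<lambda>h. a $ i $ j * h + b $ i $ j * cnj h)) (at (g z))"
    using F unfolding wdM_def wd_def by blast
  moreover have "(g has_derivative (\<lambda>h. d * h)) (at z)" using g by (simp add: has_field_derivative_def)
  ultimately have "((\<lambda>w. F (g w) $ i $ j) has_derivative (\<lambda>h. a $ i $ j * (d * h) + b $ i $ j * cnj (d * h))) (at z)"
    by (rule has_derivative_compose[rotated])
  then show "wd (\<lambda>w. F (g w) $ i $ j) (csmult d a $ i $ j) (csmult (cnj d) b $ i $ j) z"
    unfolding wd_def by (simp add: algebra_simps)
qed

context uniton_coefficients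
begin

lemma S_infinity:
  assumes w: "w \<noteq> 0"
  shows "trace (S Fin (1 / w) ** adj (S Fin (1 / w))) = (w\<^sup>2 * (cnj w)\<^sup>2) * trace (S coord_inf w ** adj (S coord_inf w))"
proof -
  have "((\<lambda>w. 1 / w) has_field_derivative - (1 / w\<^sup>2)) (at w)"
    using w by (auto intro!: derivative_eq_intros simp: power2_eq_square)
  from wdM_comp[OF _ this, OF dQ[OF coords_mem(1)]]
  have "wdM (\<lambda>w. A2 (Fin (1 / w)) - A0 (Fin (1 / w))) (csmult (- (1 / w\<^sup>2)) (S Fin (1 / w)))
     (csmult (cnj (- (1 / w\<^sup>2))) (- T Fin (1 / w))) w" .
  moreover have "\<forall>\<^sub>F w in nhds w. A2 (Fin (1 / w)) - A0 (Fin (1 / w)) = A2 (coord_inf w) - A0 (coord_inf w)"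
  proof -
    have "\<forall>\<^sub>F w in nhds w. w \<noteq> 0" using w by (rule t1_space_nhds)
    then show ?thesis by eventually_elim (simp add: coord_inf_simps)
  qed
  ultimately have "wdM (\<lambda>w. A2 (coord_inf w) - A0 (coord_inf w)) (csmult (- (1 / w\<^sup>2)) (S Fin (1 / w)))
     (csmult (cnj (- (1 / w\<^sup>2))) (- T Fin (1 / w))) w" by (rule wdM_cong_ev)
  from wdM_unique[OF this dQ[OF coords_mem(2)]]
  have "S coord_inf w = csmult (- (1 / w\<^sup>2)) (S Fin (1 / w))" by simp
  then show ?thesis using w by (simp add: adj_csmult mm_simps trace_csmult)
qed

end

context uniton_curve
begin

theorem constant_curvature_normal_form:
  fixes f0 f1 f2 :: "complex ^ 3" and K :: real
  assumes fz: "\<And>z. ev f z = f0 + z *s f1 + z\<^sup>2 *s f2" and det: "hinner f0 (vcnj (crs f1 f2)) \<noteq> 0"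
    and pos: "\<And>c z. c \<in> coords \<Longrightarrow> Re (trace (S c z ** adj (S c z))) > 0"
    and cont: "continuous_on UNIV (\<lambda>z. Re (trace (S coord_inf z ** adj (S coord_inf z))))"
    and curv: "\<And>z. laplacian (\<lambda>w. ln (Re (trace (S Fin w ** adj (S Fin w))))) z
        = - 2 * K * Re (trace (S Fin z ** adj (S Fin z)))"
  shows "(\<forall>z. Fin z \<notin> X \<longrightarrow> hh Fin z = 0) \<and> (\<exists>a b a' d U s. a * d - b * a' \<noteq> 0 \<and> unitary U \<and> s \<noteq> 0 \<and>
    (\<forall>x y. (a' * x + d * y)\<^sup>2 *s f0 + ((a * x + b * y) * (a' * x + d * y)) *s f1 + (a * x + b * y)\<^sup>2 *s f2
       = s *s (U *v vero x y)))"
proof -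
  obtain p q :: "complex poly" where q0: "q \<noteq> 0" and pq: "\<And>z. poly q z \<noteq> 0 \<or> poly p z \<noteq> 0"
    and hpq: "\<And>z. Fin z \<notin> X \<Longrightarrow> poly q z \<noteq> 0 \<and> hh Fin z = poly p z / poly q z"
    using hh_rational by metis
  note H = q0 pq hpq
  let ?P = "PP p q"
  define N where "N z = Re (hs ?P ?P z)" for z
  define M where "M z = Re (hs (wedge ?P) (wedge ?P) z)" for z
  have N0: "hs ?P ?P z \<noteq> 0" for z using Dh_nz[OF H] hs_PP[OF H] by metis
  have Npos: "N z > 0" for z unfolding N_def by (rule hs_self_pos[OF N0])
  have \<rho>: "Re (trace (S Fin z ** adj (S Fin z))) = M z / (2 * (N z)\<^sup>2)" for z
  proof -
    have t: "trace (S Fin z ** adj (S Fin z)) = hs (wedge ?P) (wedge ?P) z / (2 * (hs ?P ?P z)\<^sup>2)"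
      by (rule energy_hs[OF H])
    have "hs (wedge ?P) (wedge ?P) z = of_real (M z)" "hs ?P ?P z = of_real (N z)"
      unfolding M_def N_def by (rule hs_self_Re)+
    then have "trace (S Fin z ** adj (S Fin z)) = of_real (M z / (2 * (N z)\<^sup>2))" unfolding t by simp
    then show ?thesis by (simp only: Re_complex_of_real)
  qed
  have Mpos: "M z > 0" for z
    using pos[OF coords_mem(1), of z] Npos[of z] unfolding \<rho> by (simp add: zero_less_divide_iff)
  have M0: "hs (wedge ?P) (wedge ?P) z \<noteq> 0" for z using Mpos[of z] unfolding M_def by auto
  define n where "n = max (degree q + 4) (degree p)"
  let ?mu = "crs f0 f1"
  have mu: "wr f z = crs f0 f1 + (2 * z) *s crs f0 f2 + z\<^sup>2 *s crs f1 f2" for z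
  proof -
    have "wdV (\<lambda>z. f0 + z *s f1 + z\<^sup>2 *s f2) (f1 + (2 * z) *s f2) 0 z"
    proof -
      have z: "wd (\<lambda>z. z) 1 0 z" "wd (\<lambda>z. z\<^sup>2) (2 * z) 0 z"
        by (auto intro!: wd_holo derivative_eq_intros)
      show ?thesis
        using wdV_add[OF wdV_add[OF wdV_const[of f0 z] wdV_scale[OF z(1) wdV_const[of f1 z]]] wdV_scale[OF z(2) wdV_const[of f2 z]]]
        by simp
    qed
    then have "wdV (ev f) (f1 + (2 * z) *s f2) 0 z" unfolding fz[abs_def] .
    from wdV_unique[OF this wdV_ev] have "ev (pd3 f) z = f1 + (2 * z) *s f2" by simp
    then show ?thesis unfolding wr_def fz unfolding vec_eq_iff forall_3
      by (simp add: algebra_simps power2_eq_square)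
  qed
  have degf: "degree (f i) \<le> 2" for i using cv curve_def by blast
  have ci: "coeff (f i) 2 = f2 $ i" for i
  proof -
    have "poly (f i) = poly [:f0 $ i, f1 $ i, f2 $ i:]"
      using arg_cong[OF fz, of "\<lambda>v. v $ i"] by (auto simp: fun_eq_iff algebra_simps power2_eq_square)
    then have "f i = [:f0 $ i, f1 $ i, f2 $ i:]" by (simp only: poly_eq_poly_eq_iff)
    then show ?thesis by (simp add: eval_nat_numeral)
  qed
  have mj: "pcr f (pd3 f) j = [:crs f0 f1 $ j, 2 * crs f0 f2 $ j, crs f1 f2 $ j:]" for j
  proof -
    have "poly (pcr f (pd3 f) j) = poly [:crs f0 f1 $ j, 2 * crs f0 f2 $ j, crs f1 f2 $ j:]"
      using arg_cong[OF mu, of "\<lambda>v. v $ j"] unfolding wr_ev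
      by (auto simp: fun_eq_iff algebra_simps power2_eq_square)
    then show ?thesis by (simp only: poly_eq_poly_eq_iff)
  qed
  have degm: "degree (pcr f (pd3 f) j) \<le> 2" for j unfolding mj by simp
  have deg: "degree (?P x) \<le> n" for x
  proof (cases x)
    case None then show ?thesis by (simp add: PP_def n_def)
  next
    case (Some ij)
    obtain i j where ij: "ij = (i, j)" by (cases ij)
    have "degree (q * f i * pcr f (pd3 f) j) \<le> degree (q * f i) + degree (pcr f (pd3 f) j)" by (rule degree_mult_le)
    moreover have "degree (q * f i) \<le> degree q + degree (f i)" by (rule degree_mult_le)
    ultimately show ?thesis using degf[of i] degm[of j] by (simp add: Some ij PP_def n_def)
  qed
  have "f2 \<noteq> 0" "crs f1 f2 \<noteq> 0" using det by auto
  then obtain i j where ij: "f2 $ i \<noteq> 0" "crs f1 f2 $ j \<noteq> 0" by (auto simp: vec_eq_iff)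
  have "\<exists>x. coeff (?P x) n \<noteq> 0"
  proof (cases "degree q + 4 \<ge> degree p")
    case True
    have di: "degree (f i) = 2" using degf[of i] ci[of i] ij(1) le_degree[of "f i" 2] by simp
    have dj: "degree (pcr f (pd3 f) j) = 2" unfolding mj using ij(2) by simp
    have nz: "q \<noteq> 0" "f i \<noteq> 0" "pcr f (pd3 f) j \<noteq> 0" using q0 di dj by auto
    then have "degree (?P (Some (i, j))) = n" "?P (Some (i, j)) \<noteq> 0" using di dj True
      by (auto simp: PP_def n_def degree_mult_eq)
    then show ?thesis using leading_coeff_0_iff by metis
  next
    case False
    then have "degree (?P None) = n" "?P None \<noteq> 0" by (auto simp: PP_def n_def)
    then show ?thesis using leading_coeff_0_iff by metis
  qed
  then obtain x0 where lead: "coeff (?P x0) n \<noteq> 0" by blast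
  define r0 where "r0 = Re (trace (S coord_inf 0 ** adj (S coord_inf 0)))"
  have r0: "r0 > 0" unfolding r0_def by (rule pos) simp
  have "isCont (\<lambda>z. Re (trace (S coord_inf z ** adj (S coord_inf z)))) 0"
    using cont by (simp add: continuous_on_eq_continuous_at)
  then obtain \<delta> where \<delta>: "\<delta> > 0"
    "\<And>w. dist w 0 < \<delta> \<Longrightarrow> dist (Re (trace (S coord_inf w ** adj (S coord_inf w)))) r0 < r0 / 2"
    unfolding continuous_at_eps_delta r0_def[symmetric] using half_gt_zero[OF r0] by blast
  have growth: "r0 * (Re (hs ?P ?P z))\<^sup>2 \<le> Re (hs (wedge ?P) (wedge ?P) z) * norm z ^ 4"
    if z: "norm z \<ge> 2 / \<delta>" for z
  proof -
    define w where "w = 1 / z"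
    have z0: "z \<noteq> 0" using z \<delta>(1) by (auto simp: divide_le_0_iff)
    then have w0: "w \<noteq> 0" and zw: "1 / w = z" by (simp_all add: w_def)
    have "2 \<le> norm z * \<delta>" using z \<delta>(1) by (simp add: pos_divide_le_eq)
    then have "dist w 0 < \<delta>" using z0 \<delta>(1) by (simp add: w_def norm_divide pos_divide_less_eq mult.commute)
    then have g: "Re (trace (S coord_inf w ** adj (S coord_inf w))) \<ge> r0 / 2"
      using \<delta>(2)[of w] by (auto simp: dist_real_def abs_if split: if_splits)
    have wc: "w\<^sup>2 * (cnj w)\<^sup>2 = of_real (1 / norm z ^ 4)"
    proof -
      have "w\<^sup>2 * (cnj w)\<^sup>2 = (w * cnj w)\<^sup>2" by (simp add: power_mult_distrib)
      also have "\<dots> = of_real (((norm w)\<^sup>2)\<^sup>2)" by (simp only: complex_norm_square[symmetric] of_real_power)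
      also have "((norm w)\<^sup>2)\<^sup>2 = 1 / norm z ^ 4" by (simp add: w_def norm_divide power_divide power_mult[symmetric])
      finally show ?thesis .
    qed
    have "M z / (2 * (N z)\<^sup>2) = 1 / norm z ^ 4 * Re (trace (S coord_inf w ** adj (S coord_inf w)))"
      using \<rho>[of z] arg_cong[OF S_infinity[OF w0], of Re] unfolding zw wc by simp
    then have "M z / (2 * (N z)\<^sup>2) * norm z ^ 4 = Re (trace (S coord_inf w ** adj (S coord_inf w)))"
      using z0 by simp
    with g have "r0 / 2 \<le> M z / (2 * (N z)\<^sup>2) * norm z ^ 4" by simp
    also have "\<dots> = M z * norm z ^ 4 / (2 * (N z)\<^sup>2)" by simp
    finally have "r0 / 2 * (2 * (N z)\<^sup>2) \<le> M z * norm z ^ 4"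
      using Npos[of z] by (subst (asm) pos_le_divide_eq) auto
    then show ?thesis unfolding M_def N_def by simp
  qed
  have curv': "laplacian (\<lambda>w. ln (Re (hs (wedge ?P) (wedge ?P) w) / (2 * (Re (hs ?P ?P w))\<^sup>2))) z
      = - 2 * K * (Re (hs (wedge ?P) (wedge ?P) z) / (2 * (Re (hs ?P ?P z))\<^sup>2))" for z
    using curv[of z] unfolding \<rho> M_def N_def .
  from constant_curvature_hermitian_square[OF N0 M0 deg lead r0 growth curv']
  obtain v0 \<beta> c where v: "c > 0" "(norm \<beta>)\<^sup>2 < v0 * c"
    and Nv: "\<And>z. Re (hs ?P ?P z) = (v0 + 2 * Re (\<beta> * z) + c * (norm z)\<^sup>2) ^ n" by metis
  define m where "m = n - 4"
  have nm: "n = m + 4" unfolding m_def n_def by simp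
  have id: "poly q z * cnj (poly q z) * hinner (f0 + z *s f1 + z\<^sup>2 *s f2) (f0 + z *s f1 + z\<^sup>2 *s f2)
        * hinner (crs f0 f1 + (2 * z) *s crs f0 f2 + z\<^sup>2 *s crs f1 f2) (crs f0 f1 + (2 * z) *s crs f0 f2 + z\<^sup>2 *s crs f1 f2)
        + poly p z * cnj (poly p z) = of_real ((v0 + 2 * Re (\<beta> * z) + c * (norm z)\<^sup>2) ^ (m + 4))" for z
  proof -
    have "hs ?P ?P z = of_real ((v0 + 2 * Re (\<beta> * z) + c * (norm z)\<^sup>2) ^ (m + 4))"
      using hs_self_Re[of ?P z] unfolding Nv nm .
    moreover have "hinner (vcnj (wr f z)) (vcnj (wr f z)) = hinner (wr f z) (wr f z)"
      unfolding hinner_vcnj by simp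
    moreover have "hs ?P ?P z = poly q z * cnj (poly q z) * hinner (ev f z) (ev f z) * hinner (vcnj (wr f z)) (vcnj (wr f z))
        + poly p z * cnj (poly p z)"
      by (simp add: hs_PP[OF H] Dh_def[OF H] uh_def[OF H] n0_def[OF H] hinner_scale_left hinner_scale_right mult_ac)
    ultimately show ?thesis by (simp only: fz mu)
  qed
  have "degree q \<le> m" "degree p \<le> m + 4" unfolding m_def n_def by auto
  from curve_normal_form[OF det id q0 this v]
  have "p = 0" and U: "\<exists>a b a' d U s. a * d - b * a' \<noteq> 0 \<and> unitary U \<and> s \<noteq> 0 \<and>
    (\<forall>x y. (a' * x + d * y)\<^sup>2 *s f0 + ((a * x + b * y) * (a' * x + d * y)) *s f1 + (a * x + b * y)\<^sup>2 *s f2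
       = s *s (U *v vero x y))" by blast+
  then have "hh Fin z = 0" if "Fin z \<notin> X" for z using hpq[OF that] by simp
  then show ?thesis using U by blast
qed

end

subsection \<open>Moebius transformations of the sphere\<close>

definition pt :: "complex \<Rightarrow> complex \<Rightarrow> rsphere" where
  "pt x y = (if y = 0 then Infty else Fin (x / y))"

lemma pt_scale: "k \<noteq> 0 \<Longrightarrow> pt (k * x) (k * y) = pt x y"
  by (simp add: pt_def)

lemma Fin_pt: "Fin z = pt z 1" and coord_inf_pt: "coord_inf w = pt 1 w"
  by (simp_all add: pt_def coord_inf_def)

definition moebius :: "complex \<Rightarrow> complex \<Rightarrow> complex \<Rightarrow> complex \<Rightarrow> rsphere \<Rightarrow> rsphere" where
  "moebius a b a' d p = (case p of Fin z \<Rightarrow> pt (a * z + b) (a' * z + d) | Infty \<Rightarrow> pt a a')"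

lemma moebius_pt:
  assumes "x \<noteq> 0 \<or> y \<noteq> 0"
  shows "moebius a b a' d (pt x y) = pt (a * x + b * y) (a' * x + d * y)"
proof (cases "y = 0")
  case True
  then show ?thesis using assms pt_scale[of x a a'] by (simp add: moebius_def pt_def mult.commute)
next
  case False
  have e: "y * (a * (x / y) + b) = a * x + b * y" "y * (a' * (x / y) + d) = a' * x + d * y"
    using False by (simp_all add: field_simps)
  have "pt (a * (x / y) + b) (a' * (x / y) + d) = pt (y * (a * (x / y) + b)) (y * (a' * (x / y) + d))"
    using pt_scale[OF False] by simp
  then show ?thesis unfolding e using False by (simp add: moebius_def pt_def)
qed

lemma pt_surj: "\<exists>x y. (x \<noteq> 0 \<or> y \<noteq> 0) \<and> p = pt x y"
proof (cases p)
  case (Fin z)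
  then have "p = pt z 1" by (simp add: Fin_pt)
  then show ?thesis using zero_neq_one by metis
next
  case Infty
  then have "p = pt 1 0" by (simp add: pt_def)
  then show ?thesis using zero_neq_one by metis
qed

lemma moebius_inverse:
  assumes det: "a * d - b * a' \<noteq> 0"
  shows "moebius d (- b) (- a') a (moebius a b a' d p) = p"
proof -
  obtain x y where xy: "x \<noteq> 0 \<or> y \<noteq> 0" "p = pt x y" using pt_surj by blast
  have ne: "a * x + b * y \<noteq> 0 \<or> a' * x + d * y \<noteq> 0"
  proof (rule ccontr)
    assume "\<not> ?thesis"
    then have e: "a * x + b * y = 0" "a' * x + d * y = 0" by auto
    have "(a * d - b * a') * x = d * (a * x + b * y) - b * (a' * x + d * y)"
      "(a * d - b * a') * y = a * (a' * x + d * y) - a' * (a * x + b * y)" by (simp_all add: algebra_simps)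
    then show False using e det xy(1) by simp
  qed
  have "d * (a * x + b * y) + - b * (a' * x + d * y) = (a * d - b * a') * x"
    "- a' * (a * x + b * y) + a * (a' * x + d * y) = (a * d - b * a') * y" by (simp_all add: algebra_simps)
  then show ?thesis unfolding xy(2) moebius_pt[OF xy(1)] moebius_pt[OF ne] by (simp only: pt_scale[OF det])
qed

lemma range_pt: "pt x y \<in> range Fin \<longleftrightarrow> y \<noteq> 0" "x \<noteq> 0 \<or> y \<noteq> 0 \<Longrightarrow> pt x y \<in> range coord_inf \<longleftrightarrow> x \<noteq> 0"
proof -
  show "pt x y \<in> range Fin \<longleftrightarrow> y \<noteq> 0" by (auto simp: pt_def)
  show "pt x y \<in> range coord_inf \<longleftrightarrow> x \<noteq> 0" if "x \<noteq> 0 \<or> y \<noteq> 0"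
  proof
    assume "pt x y \<in> range coord_inf"
    then show "x \<noteq> 0" using that by (auto simp: pt_def coord_inf_def split: if_splits)
  next
    assume x: "x \<noteq> 0"
    have "pt x y = coord_inf (y / x)" using x by (simp add: pt_def coord_inf_def)
    then show "pt x y \<in> range coord_inf" by blast
  qed
qed

lemma inv_pt: "y \<noteq> 0 \<Longrightarrow> inv Fin (pt x y) = x / y" "x \<noteq> 0 \<Longrightarrow> inv coord_inf (pt x y) = y / x"
proof -
  show "inv Fin (pt x y) = x / y" if "y \<noteq> 0" using inv_f_f[OF inj_Fin, of "x / y"] that by (simp add: pt_def)
  show "inv coord_inf (pt x y) = y / x" if "x \<noteq> 0"
  proof -
    have "pt x y = coord_inf (y / x)" using that by (simp add: pt_def coord_inf_def)
    then show ?thesis using inv_f_f[OF inj_coord_inf, of "y / x"] by simp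
  qed
qed

lemma holomorphic_self_map_moebius:
  assumes det: "a * d - b * a' \<noteq> 0"
  shows "holomorphic_self_map (moebius a b a' d)"
  unfolding holomorphic_self_map_def
proof (intro ballI)
  fix c e assume c: "c \<in> coords" and e: "e \<in> coords"
  obtain X Y where XY: "\<And>z. moebius a b a' d (c z) = pt (X z) (Y z)" "X holomorphic_on UNIV" "Y holomorphic_on UNIV"
    "\<And>z. X z \<noteq> 0 \<or> Y z \<noteq> 0"
  proof -
    have ne: "a * x + b * y \<noteq> 0 \<or> a' * x + d * y \<noteq> 0" if "x \<noteq> 0 \<or> y \<noteq> 0" for x y
    proof (rule ccontr)
      assume "\<not> ?thesis"
      then have e: "a * x + b * y = 0" "a' * x + d * y = 0" by auto
      have "(a * d - b * a') * x = d * (a * x + b * y) - b * (a' * x + d * y)"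
        "(a * d - b * a') * y = a * (a' * x + d * y) - a' * (a * x + b * y)" by (simp_all add: algebra_simps)
      then show False using e det that by simp
    qed
    consider "c = Fin" | "c = coord_inf" using c coords_cases by blast
    then show ?thesis
    proof cases
      case 1
      show ?thesis
        by (rule that[of "\<lambda>z. a * z + b * 1" "\<lambda>z. a' * z + d * 1"])
          (use ne[of _ 1] in \<open>auto simp: 1 Fin_pt moebius_pt intro!: holomorphic_intros\<close>)
    next
      case 2
      show ?thesis
        by (rule that[of "\<lambda>z. a * 1 + b * z" "\<lambda>z. a' * 1 + d * z"])
          (use ne[of 1] in \<open>auto simp: 2 coord_inf_pt moebius_pt intro!: holomorphic_intros\<close>)
    qed
  qed
  have cont: "continuous_on UNIV X" "continuous_on UNIV Y"
    using XY(2,3) holomorphic_on_imp_continuous_on by blast+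
  consider "e = Fin" | "e = coord_inf" using e coords_cases by blast
  then show "open {z. moebius a b a' d (c z) \<in> range e} \<and>
      (\<lambda>z. inv e (moebius a b a' d (c z))) holomorphic_on {z. moebius a b a' d (c z) \<in> range e}"
  proof cases
    case 1
    have s: "{z. moebius a b a' d (c z) \<in> range e} = {z. Y z \<noteq> 0}" unfolding 1 XY(1) range_pt(1) ..
    have "(\<lambda>z. X z / Y z) holomorphic_on {z. Y z \<noteq> 0}"
      by (intro holomorphic_on_divide holomorphic_on_subset[OF XY(2)] holomorphic_on_subset[OF XY(3)]) auto
    then have "(\<lambda>z. inv e (moebius a b a' d (c z))) holomorphic_on {z. Y z \<noteq> 0}"
      by (rule holomorphic_transform) (simp add: 1 XY(1) inv_pt)
    then show ?thesis unfolding s by (simp add: open_Collect_neq[OF cont(2) continuous_on_const])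
  next
    case 2
    have s: "{z. moebius a b a' d (c z) \<in> range e} = {z. X z \<noteq> 0}" unfolding 2 XY(1) range_pt(2)[OF XY(4)] ..
    have "(\<lambda>z. Y z / X z) holomorphic_on {z. X z \<noteq> 0}"
      by (intro holomorphic_on_divide holomorphic_on_subset[OF XY(2)] holomorphic_on_subset[OF XY(3)]) auto
    then have "(\<lambda>z. inv e (moebius a b a' d (c z))) holomorphic_on {z. X z \<noteq> 0}"
      by (rule holomorphic_transform) (simp add: 2 XY(1) inv_pt)
    then show ?thesis unfolding s by (simp add: open_Collect_neq[OF cont(1) continuous_on_const])
  qed
qed

lemma biholomorphism_moebius:
  assumes det: "a * d - b * a' \<noteq> 0"
  shows "biholomorphism (moebius a b a' d)"
proof -
  have det': "d * a - - b * - a' \<noteq> 0" using det by (simp add: mult.commute)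
  have 1: "moebius d (- b) (- a') a (moebius a b a' d p) = p" for p by (rule moebius_inverse[OF det])
  have 2: "moebius a b a' d (moebius d (- b) (- a') a p) = p" for p using moebius_inverse[OF det'] by simp
  have bij: "bij (moebius a b a' d)" by (rule o_bij[where g = "moebius d (- b) (- a') a"]) (auto simp: fun_eq_iff 1 2)
  moreover have "inv (moebius a b a' d) = moebius d (- b) (- a') a" by (rule inv_equality) (rule 1, rule 2)
  ultimately show ?thesis
    unfolding biholomorphism_def using holomorphic_self_map_moebius[OF det] holomorphic_self_map_moebius[OF det'] by simp
qed

subsection \<open>The Veronese sequence in the projective plane\<close>

definition vp :: "3 \<Rightarrow> complex poly" where
  "vp i = (if i = 1 then [:1:] else if i = 2 then [:0, of_real (sqrt 2):] else [:0, 0, 1:])"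

definition vd :: "3 \<Rightarrow> complex poly" where
  "vd i = (if i = 1 then [:0, 0, 1:] else if i = 2 then [:0, - of_real (sqrt 2):] else [:1:])"

lemma vp_simps: "vp 1 = [:1:]" "vp 2 = [:0, of_real (sqrt 2):]" "vp 3 = [:0, 0, 1:]"
  "vd 1 = [:0, 0, 1:]" "vd 2 = [:0, - of_real (sqrt 2):]" "vd 3 = [:1:]"
  by (simp_all add: vp_def vd_def)

lemma sqrt2_sq: "complex_of_real (sqrt 2) * complex_of_real (sqrt 2) = 2"
  by (simp flip: of_real_mult)

lemma dual_vp: "dual_curves 2 vp 2 vd"
proof -
  have e: "(\<exists>i :: 3. P i) \<longleftrightarrow> P 1 \<or> P 2 \<or> P 3" for P using forall_3[of "\<lambda>i. \<not> P i"] by blast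
  have c: "curve 2 vp" "curve 2 vd"
    unfolding curve_def vec_eq_iff forall_3 e by (simp_all add: vp_simps eval_nat_numeral)
  moreover have "pair vp vd z = 0" "pair (pd3 vp) vd z = 0" for z
    using sqrt2_sq by (simp_all add: pair_sum sum_3 vp_simps pd3_def pderiv_pCons algebra_simps)
  ultimately show ?thesis unfolding dual_curves_def by blast
qed

lemma veronese_curve_vp: "(veronese_curve 2 z :: complex ^ 3) = ev vp z"
  unfolding veronese_curve_def vec_eq_iff forall_3
  by (simp add: vp_simps upt_rec numeral_2_eq_2 eval_nat_numeral choose_two power2_eq_square)

lemma wr_vp: "wr vp z = of_real (sqrt 2) *s ev vd z"
  unfolding wr_def vec_eq_iff forall_3 using sqrt2_sq
  by (simp add: vp_simps pd3_def pderiv_pCons algebra_simps power2_eq_square)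

lemma osculating_vp:
  "osculating 2 1 z = vec.span {ev vp z}" "osculating 2 2 z = vec.span {ev vp z, ev (pd3 vp) z}"
proof -
  have d: "(\<chi> m. deriv (\<lambda>w. (veronese_curve 2 w :: complex ^ 3) $ m) z) = ev (pd3 vp) z"
    unfolding veronese_curve_vp by (simp add: vec_eq_iff pd3_def DERIV_imp_deriv poly_DERIV)
  have "{..<1 :: nat} = {0}" "{..<2 :: nat} = {0, 1}" by auto
  then show "osculating 2 1 z = vec.span {ev vp z}" "osculating 2 2 z = vec.span {ev vp z, ev (pd3 vp) z}"
    using d unfolding osculating_def by (simp_all add: veronese_curve_vp vec_lambda_eta ev_def)
qed

lemma veronese_2_1: "veronese 2 1 = mid 2 vp 2 vd"
proof -
  have cv: "curve 2 vp" "curve 2 vd" using dual_vp unfolding dual_curves_def by auto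
  have fib: "{v \<in> osculating 2 (Suc 1) z. \<forall>u\<in>osculating 2 1 z. hinner v u = 0} = mid 2 vp 2 vd (Fin z)" for z
  proof -
    let ?f = "ev vp z" and ?f' = "ev (pd3 vp) z"
    note pw = dual_curves_pointwise[OF dual_vp, of z]
    obtain g where g: "crs ?f ?f' = g *s ev vd z" "?f' - (hinner ?f' ?f / hinner ?f ?f) *s ?f = (- g / hinner ?f ?f) *s crs (vcnj ?f) (ev vd z)"
      using dual_pair_pointwise(2)[OF pw] by blast
    define m where "m = crs (vcnj ?f) (ev vd z)"
    define k where "k = - g / hinner ?f ?f"
    have F: "hinner ?f ?f \<noteq> 0" using pw(1) by simp
    have g0: "g \<noteq> 0"
    proof
      assume "g = 0"
      then have "wr vp z = 0" using g(1) by (simp add: wr_def)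
      then show False using pw(2) unfolding wr_vp by simp
    qed
    then have k0: "k \<noteq> 0" using F by (simp add: k_def)
    have f': "?f' = (hinner ?f' ?f / hinner ?f ?f) *s ?f + k *s m" using g(2) unfolding m_def k_def by (simp add: algebra_simps)
    have mf: "hinner m ?f = 0"
      unfolding m_def using hinner_crs_left[of "vcnj ?f" "ev vd z"] by (simp add: hinner_vcnj_swap[of "vcnj ?f"])
    have S2: "Suc 1 = 2" by simp
    have "{v \<in> vec.span {?f, ?f'}. \<forall>u\<in>vec.span {?f}. hinner v u = 0} = vec.span {m}"
    proof (intro equalityI subsetI)
      fix v assume "v \<in> {v \<in> vec.span {?f, ?f'}. \<forall>u\<in>vec.span {?f}. hinner v u = 0}"
      then have v: "v \<in> vec.span {?f, ?f'}" and o: "hinner v ?f = 0" using vec.span_base[of ?f "{?f}"] by auto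
      obtain x where x: "v - x *s ?f \<in> vec.span {?f'}" using v vec.span_breakdown_eq[of v ?f "{?f'}"] by blast
      then obtain y where y: "v - x *s ?f = y *s ?f'" unfolding span_single by blast
      define t where "t = x + y * (hinner ?f' ?f / hinner ?f ?f)"
      have "v = x *s ?f + y *s ?f'" using y by (simp add: algebra_simps)
      then have "v = x *s ?f + y *s ((hinner ?f' ?f / hinner ?f ?f) *s ?f + k *s m)" using f' by simp
      then have v2: "v = t *s ?f + (y * k) *s m" unfolding t_def by (simp add: vec_eq_iff algebra_simps)
      have "t * hinner ?f ?f = 0" using o unfolding v2 by (simp add: hinner_add_left hinner_scale_left mf)
      then have "v = (y * k) *s m" using F v2 by simp
      then show "v \<in> vec.span {m}" unfolding span_single by blast
    next
      fix v assume "v \<in> vec.span {m}"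
      then obtain y where v: "v = y *s m" unfolding span_single by blast
      have "m = (1 / k) *s ?f' - (1 / k * (hinner ?f' ?f / hinner ?f ?f)) *s ?f"
      proof -
        have "k *s m = ?f' - (hinner ?f' ?f / hinner ?f ?f) *s ?f" using g(2) unfolding m_def k_def by simp
        then have "(1 / k) *s (k *s m) = (1 / k) *s (?f' - (hinner ?f' ?f / hinner ?f ?f) *s ?f)" by simp
        then show ?thesis using k0 by (simp add: vector_smult_assoc vec.scale_right_diff_distrib)
      qed
      moreover have "(1 / k) *s ?f' - (1 / k * (hinner ?f' ?f / hinner ?f ?f)) *s ?f \<in> vec.span {?f, ?f'}"
        by (intro vec.span_diff vec.span_scale vec.span_base) auto
      ultimately have "v \<in> vec.span {?f, ?f'}" unfolding v by (metis vec.span_scale)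
      moreover have "hinner v u = 0" if "u \<in> vec.span {?f}" for u
        using that mf unfolding span_single v by (auto simp: hinner_scale_left hinner_scale_right)
      ultimately show "v \<in> {v \<in> vec.span {?f, ?f'}. \<forall>u\<in>vec.span {?f}. hinner v u = 0}" by blast
    qed
    then show ?thesis unfolding S2 osculating_vp m_def by (simp add: mid_def)
  qed
  show ?thesis unfolding veronese_def fib
  proof (rule the_equality)
    show "smooth_subbundle 1 (mid 2 vp 2 vd) \<and> (\<forall>z. mid 2 vp 2 vd (Fin z) = mid 2 vp 2 vd (Fin z))"
      using smooth_mid[OF dual_vp] by simp
    fix Y :: "rsphere \<Rightarrow> (complex ^ 3) set"
    assume Y: "smooth_subbundle 1 Y \<and> (\<forall>z. Y (Fin z) = mid 2 vp 2 vd (Fin z))"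
    show "Y = mid 2 vp 2 vd"
    proof (rule smooth_subbundle_unique[where S = "{Infty}"])
      fix c z assume "c \<in> coords" and z: "c z \<notin> {Infty}"
      then show "Y (c z) = mid 2 vp 2 vd (c z)" using Y by (cases "c z") auto
    qed (use Y smooth_mid[OF dual_vp] in auto)
  qed
qed

subsection \<open>Orthogonal frames\<close>

definition dg :: "complex \<Rightarrow> complex \<Rightarrow> complex \<Rightarrow> complex ^ 3 ^ 3" where
  "dg x y z = (\<chi> i j. if i = j then (if i = 1 then x else if i = 2 then y else z) else 0)"

lemma orthonormal_frame:
  fixes e1 e2 e3 :: "complex ^ 3"
  assumes n: "hinner e1 e1 = 1" "hinner e2 e2 = 1" "hinner e3 e3 = 1"
    and o: "hinner e1 e2 = 0" "hinner e1 e3 = 0" "hinner e2 e3 = 0"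
  defines "V \<equiv> (\<chi> i j. if j = 1 then e1 $ i else if j = 2 then e2 $ i else e3 $ i)"
  shows "unitary V"
    and "V ** dg x y z ** adj V = csmult x (outer e1 e1) + csmult y (outer e2 e2) + csmult z (outer e3 e3)"
proof -
  have o': "hinner e2 e1 = 0" "hinner e3 e1 = 0" "hinner e3 e2 = 0" using o hinner_eq_0_commute by blast+
  have "(adj V ** V) $ i $ j = (mat 1 :: complex ^ 3 ^ 3) $ i $ j" for i j
    using exhaust_3[of i] exhaust_3[of j] n o o'
    by (elim disjE) (simp_all add: V_def adj_def matrix_matrix_mult_def mat_def hinner_def mult.commute)
  then have "adj V ** V = mat 1" by (simp add: vec_eq_iff)
  moreover from this have "V ** adj V = mat 1" by (simp add: matrix_left_right_inverse)
  ultimately show "unitary V" by (simp add: unitary_def)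
  show "V ** dg x y z ** adj V = csmult x (outer e1 e1) + csmult y (outer e2 e2) + csmult z (outer e3 e3)"
    unfolding vec_eq_iff forall_3
    by (simp add: V_def dg_def adj_def matrix_matrix_mult_def outer_def sum_3)
qed

lemma orthogonal_frame:
  fixes a b c :: "complex ^ 3"
  assumes nz: "a \<noteq> 0" "b \<noteq> 0" "c \<noteq> 0" and o: "hinner a b = 0" "hinner a c = 0" "hinner b c = 0"
  obtains V where "unitary V"
    "\<And>x y z. V ** dg x y z ** adj V = csmult x (proj (vec.span {a})) + csmult y (proj (vec.span {b})) + csmult z (proj (vec.span {c}))"
proof -
  define nm where "nm v = (1 / complex_of_real (norm v)) *s v" for v :: "complex ^ 3"
  have n: "hinner (nm v) (nm v) = 1" if "v \<noteq> 0" for v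
    unfolding nm_def hinner_scale_left hinner_scale_right unfolding hinner_self
    using that by (simp add: power2_eq_square)
  have oo: "hinner (nm v) (nm w) = 0" if "hinner v w = 0" for v w
    using that by (simp add: nm_def hinner_scale_left hinner_scale_right)
  have p: "outer (nm v) (nm v) = proj (vec.span {v})" if "v \<noteq> 0" for v
    unfolding proj_line[OF that]
    by (simp add: nm_def hinner_self outer_def vec_eq_iff power2_eq_square)
  note f = orthonormal_frame[OF n[OF nz(1)] n[OF nz(2)] n[OF nz(3)] oo[OF o(1)] oo[OF o(2)] oo[OF o(3)]]
  show ?thesis using that[OF f(1)] f(2) unfolding p[OF nz(1)] p[OF nz(2)] p[OF nz(3)] by blast
qed

lemma dg_one: "dg 1 1 1 = mat 1"
  by (simp add: dg_def mat_def vec_eq_iff)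

lemma dg_mult: "dg x y z ** dg x' y' z' = dg (x * x') (y * y') (z * z')"
  unfolding vec_eq_iff forall_3 by (simp add: dg_def matrix_matrix_mult_def sum_3)

lemma adj_dg: "adj (dg x y z) = dg (cnj x) (cnj y) (cnj z)"
  unfolding vec_eq_iff forall_3 by (simp add: dg_def adj_def)

lemma S1_homomorphism_dg: "S1_homomorphism (\<lambda>l. dg 1 l (l\<^sup>2))"
  unfolding S1_homomorphism_def
proof (intro conjI ballI)
  have "continuous_on S1 (\<lambda>l :: complex. if i = j then (if i = 1 then 1 else if i = 2 then l else l\<^sup>2) else 0)" for i j :: 3
    by (cases "i = j"; cases "i = 1"; cases "i = 2") (auto intro!: continuous_intros)
  then have "continuous_on S1 (\<lambda>l. \<chi> i j. if i = j then (if i = 1 then 1 else if i = 2 then l else l\<^sup>2) else 0 :: complex ^ 3 ^ 3)"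
    by (intro continuous_on_vec_lambda)
  then show "continuous_on S1 (\<lambda>l. dg 1 l (l\<^sup>2))" by (simp add: dg_def)
next
  fix l :: complex assume "l \<in> S1"
  then have l: "l * cnj l = 1" "cnj l * l = 1" by (simp_all flip: complex_norm_square add: mult.commute)
  then have "l\<^sup>2 * (cnj l)\<^sup>2 = 1" "(cnj l)\<^sup>2 * l\<^sup>2 = 1" by (simp_all add: power_mult_distrib[symmetric])
  then show "unitary (dg 1 l (l\<^sup>2))" using l by (simp add: unitary_def adj_dg dg_mult dg_one)
next
  fix l m :: complex
  show "dg 1 (l * m) ((l * m)\<^sup>2) = dg 1 l (l\<^sup>2) ** dg 1 m (m\<^sup>2)" by (simp add: dg_mult power_mult_distrib)
qed

lemma dual_frame:
  assumes d: "dual_curves n f m M"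
  obtains V where "unitary V"
    "\<And>x y z. V ** dg x y z ** adj V = csmult x (proj (line n f p)) + csmult y (proj (mid n f m M p)) + csmult z (proj (last_bundle m M p))"
proof -
  have cv: "curve n f" "curve m M" using d unfolding dual_curves_def by auto
  obtain c z where c: "c \<in> coords" "p = c z" using sphere_cover by blast
  note pw = dual_curves_pointwise[OF dual_curves_chart[OF d c(1)], of z]
  let ?a = "ev (chart n f c) z" and ?c = "vcnj (ev (chart m M c) z)"
  let ?b = "crs (vcnj ?a) (ev (chart m M c) z)"
  have "hinner ?b ?a = 0"
    using hinner_crs_left[of "vcnj ?a" "ev (chart m M c) z"] by (simp add: hinner_vcnj_swap[of "vcnj ?a"])
  then have ab: "hinner ?a ?b = 0" using hinner_eq_0_commute by blast
  have bc: "hinner ?b ?c = 0"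
    using hinner_crs_right[of "ev (chart m M c) z" "vcnj ?a"] by (simp add: hinner_vcnj_swap[of ?b])
  show ?thesis
    by (rule orthogonal_frame[OF pw(1) dual_pair_pointwise(1)[OF pw] _ ab pw(3) bc])
      (use pw(2) that in \<open>simp_all add: c(2) line_chart[OF cv(1) c(1)] mid_chart[OF cv c(1)] last_bundle_chart[OF cv(2) c(1)]\<close>)
qed

lemma dual_projections_sum:
  assumes "dual_curves n f m M"
  shows "proj (line n f p) + proj (mid n f m M p) + proj (last_bundle m M p) = mat 1"
proof -
  obtain V where V: "unitary V"
    "\<And>x y z. V ** dg x y z ** adj V = csmult x (proj (line n f p)) + csmult y (proj (mid n f m M p)) + csmult z (proj (last_bundle m M p))"
    by (rule dual_frame[OF assms, where p = p]) blast
  show ?thesis using V(2)[of 1 1 1] V(1) unfolding dg_one by (simp add: unitary_def)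
qed

subsection \<open>Conics in homogeneous coordinates\<close>

definition fh :: "complex ^ 3 \<Rightarrow> complex ^ 3 \<Rightarrow> complex ^ 3 \<Rightarrow> complex \<Rightarrow> complex \<Rightarrow> complex ^ 3" where
  "fh f0 f1 f2 x y = y\<^sup>2 *s f0 + (x * y) *s f1 + x\<^sup>2 *s f2"

definition muh :: "complex ^ 3 \<Rightarrow> complex ^ 3 \<Rightarrow> complex ^ 3 \<Rightarrow> complex \<Rightarrow> complex \<Rightarrow> complex ^ 3" where
  "muh f0 f1 f2 x y = crs (2 * y *s f0 + x *s f1) (y *s f1 + (2 * x) *s f2)"

lemma conic_bundles:
  assumes d: "dual_curves 2 f m M" and fz: "\<And>z. ev f z = f0 + z *s f1 + z\<^sup>2 *s f2"
    and nz: "\<And>z. wr f z \<noteq> 0" "wr (rv 2 f) 0 \<noteq> 0" and xy: "x \<noteq> 0 \<or> y \<noteq> 0"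
  shows "line 2 f (pt x y) = vec.span {fh f0 f1 f2 x y}"
    "last_bundle m M (pt x y) = vec.span {vcnj (muh f0 f1 f2 x y)}" "muh f0 f1 f2 x y \<noteq> 0"
proof -
  have cv: "curve 2 f" "curve m M" using d unfolding dual_curves_def by auto
  have fi: "f i = [:f0 $ i, f1 $ i, f2 $ i:]" for i
  proof -
    have "poly (f i) = poly [:f0 $ i, f1 $ i, f2 $ i:]"
      using arg_cong[OF fz, of "\<lambda>v. v $ i"] by (auto simp: fun_eq_iff algebra_simps power2_eq_square)
    then show ?thesis by (simp only: poly_eq_poly_eq_iff)
  qed
  have sp: "vec.span {vcnj (wr (chart 2 f c) z)} = vec.span {vcnj (ev (chart m M c) z)}"
    if c: "c \<in> coords" and w: "wr (chart 2 f c) z \<noteq> 0" for c z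
  proof -
    obtain g where "crs (ev (chart 2 f c) z) (ev (pd3 (chart 2 f c)) z) = g *s ev (chart m M c) z"
      using dual_pair_pointwise(2)[OF dual_curves_pointwise[OF dual_curves_chart[OF d c], of z]] by blast
    then have g: "wr (chart 2 f c) z = g *s ev (chart m M c) z" by (simp add: wr_def)
    then have "cnj g \<noteq> 0" using w by auto
    then show ?thesis unfolding g vcnj_scale by (rule span_single_scale)
  qed
  have "line 2 f (pt x y) = vec.span {fh f0 f1 f2 x y} \<and>
    last_bundle m M (pt x y) = vec.span {vcnj (muh f0 f1 f2 x y)} \<and> muh f0 f1 f2 x y \<noteq> 0"
  proof (cases "y = 0")
    case True
    then have x: "x \<noteq> 0" using xy by simp
    have l: "fh f0 f1 f2 x y = x\<^sup>2 *s ev (rv 2 f) 0"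
      by (simp add: fh_def True vec_eq_iff ev_rv_0 fi eval_nat_numeral poly_0_coeff_0 coeff_rv)
    have "ev (pd3 (rv 2 f)) 0 = f1" "ev (rv 2 f) 0 = f2"
      by (simp_all add: vec_eq_iff pd3_def poly_0_coeff_0 coeff_pderiv coeff_rv fi eval_nat_numeral)
    then have mu: "muh f0 f1 f2 x y = (- 2 * x\<^sup>2) *s wr (rv 2 f) 0"
      unfolding wr_def muh_def True unfolding vec_eq_iff forall_3 by (simp add: algebra_simps power2_eq_square)
    have "line 2 f (pt x y) = vec.span {fh f0 f1 f2 x y}"
      unfolding l using x span_single_scale[of "x\<^sup>2" "ev (rv 2 f) 0"] by (simp add: True pt_def line_def)
    moreover have "last_bundle m M (pt x y) = vec.span {vcnj (muh f0 f1 f2 x y)}"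
      using sp[OF coords_mem(2), of 0] nz(2) x span_single_scale[of "cnj (- 2 * x\<^sup>2)" "vcnj (wr (rv 2 f) 0)"]
      unfolding mu vcnj_scale by (simp add: True pt_def last_bundle_def)
    moreover have "muh f0 f1 f2 x y \<noteq> 0" unfolding mu using nz(2) x by simp
    ultimately show ?thesis by blast
  next
    case y: False
    define z where "z = x / y"
    have x: "x = z * y" using y by (simp add: z_def)
    have pd: "ev (pd3 f) z = f1 + (2 * z) *s f2"
      by (simp add: vec_eq_iff pd3_def fi pderiv_pCons)
    have l: "fh f0 f1 f2 x y = y\<^sup>2 *s ev f z"
      unfolding fz fh_def x by (simp add: vec_eq_iff algebra_simps power2_eq_square)
    have mu: "muh f0 f1 f2 x y = (2 * y\<^sup>2) *s wr f z"
      unfolding wr_def muh_def pd fz x unfolding vec_eq_iff forall_3 by (simp add: algebra_simps power2_eq_square)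
    have p: "pt x y = Fin z" using y by (simp add: pt_def z_def)
    have "line 2 f (pt x y) = vec.span {fh f0 f1 f2 x y}"
      unfolding l p using y span_single_scale[of "y\<^sup>2" "ev f z"] by (simp add: line_def)
    moreover have "last_bundle m M (pt x y) = vec.span {vcnj (muh f0 f1 f2 x y)}"
      using sp[OF coords_mem(1), of z] nz(1)[of z] y span_single_scale[of "cnj (2 * y\<^sup>2)" "vcnj (wr f z)"]
      unfolding mu vcnj_scale p by (simp add: last_bundle_def)
    moreover have "muh f0 f1 f2 x y \<noteq> 0" unfolding mu using nz(1)[of z] y by simp
    ultimately show ?thesis by blast
  qed
  then show "line 2 f (pt x y) = vec.span {fh f0 f1 f2 x y}"
    "last_bundle m M (pt x y) = vec.span {vcnj (muh f0 f1 f2 x y)}" "muh f0 f1 f2 x y \<noteq> 0" by blast+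
qed

lemma unitary_mv_nz: "unitary U \<Longrightarrow> v \<noteq> 0 \<Longrightarrow> U *v v \<noteq> (0 :: complex ^ 'n)"
proof
  assume u: "unitary U" and v: "v \<noteq> 0" and z: "U *v v = 0"
  have "v = (adj U ** U) *v v" using u by (simp add: unitary_def)
  also have "\<dots> = 0" unfolding matrix_vector_mul_assoc[symmetric] z by simp
  finally show False using v by simp
qed

lemma unitary_crs:
  assumes U: "unitary U" and ne: "crs a b \<noteq> 0" "crs (U *v a) (U *v b) \<noteq> 0"
  shows "\<exists>k. k \<noteq> 0 \<and> vcnj (crs (U *v a) (U *v b)) = k *s (U *v vcnj (crs a b))"
proof -
  let ?w = "vcnj (crs (U *v a) (U *v b))"
  have "hinner a (adj U *v ?w) = 0" "hinner b (adj U *v ?w) = 0"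
    unfolding hinner_adj[symmetric] by (rule hinner_crs_left hinner_crs_right)+
  then have "crs (crs a b) (vcnj (adj U *v ?w)) = 0" by (simp add: crs_crs_right)
  then obtain k where k: "vcnj (adj U *v ?w) = k *s crs a b" using crs_eq_0_iff ne(1) by blast
  have "adj U *v ?w = cnj k *s vcnj (crs a b)" using arg_cong[OF k, of vcnj] by (simp add: vcnj_scale)
  then have "U *v (adj U *v ?w) = cnj k *s (U *v vcnj (crs a b))" by (simp add: mv_scale)
  then have w: "?w = cnj k *s (U *v vcnj (crs a b))"
    using U by (simp add: matrix_vector_mul_assoc unitary_def)
  then have "cnj k \<noteq> 0" using ne(2) by auto
  then show ?thesis using w by blast
qed

lemma proj_unitary:
  assumes U: "unitary U" and v: "v \<noteq> 0" and k: "k \<noteq> 0"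
  shows "proj (vec.span {k *s (U *v v)}) = U ** proj (vec.span {v}) ** adj U"
proof -
  have h: "hinner (U *v v) (U *v v) = hinner v v"
    unfolding hinner_adj using U by (simp add: matrix_vector_mul_assoc unitary_def)
  show ?thesis
    unfolding span_single_scale[OF k] proj_line[OF unitary_mv_nz[OF U v]] proj_line[OF v] h
    by (simp add: csmult_mult_left csmult_mult_right mm_outer outer_mm)
qed

lemma vp_quadratic: "ev vp z = axis 1 1 + z *s (of_real (sqrt 2) *s axis 2 1) + z\<^sup>2 *s axis 3 1"
  unfolding vec_eq_iff forall_3 by (simp add: vp_simps axis_def power2_eq_square)

lemma conic_congruence:
  assumes d: "dual_curves 2 f m M" and fz: "\<And>z. ev f z = f0 + z *s f1 + z\<^sup>2 *s f2"
    and nz: "\<And>z. wr f z \<noteq> 0" "wr (rv 2 f) 0 \<noteq> 0"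
    and det: "a * e - b * a' \<noteq> 0" and U: "unitary U" and s: "s \<noteq> 0"
    and eq: "\<And>x y. (a' * x + e * y)\<^sup>2 *s f0 + ((a * x + b * y) * (a' * x + e * y)) *s f1 + (a * x + b * y)\<^sup>2 *s f2
       = s *s (U *v vero x y)"
  shows "proj (mid 2 f m M (moebius a b a' e p)) = U ** proj (mid 2 vp 2 vd p) ** adj U"
proof -
  define v0 v1 v2 :: "complex ^ 3" where "v0 = axis 1 1" and "v1 = of_real (sqrt 2) *s axis 2 1" and "v2 = axis 3 1"
  obtain x y where xy: "x \<noteq> 0 \<or> y \<noteq> 0" "p = pt x y" using pt_surj by blast
  define X where "X = a * x + b * y"
  define Y where "Y = a' * x + e * y"
  have XY: "X \<noteq> 0 \<or> Y \<noteq> 0"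
  proof (rule ccontr)
    assume "\<not> ?thesis"
    then have z: "X = 0" "Y = 0" by auto
    have "(a * e - b * a') * x = e * X - b * Y" "(a * e - b * a') * y = a * Y - a' * X"
      unfolding X_def Y_def by (simp_all add: algebra_simps)
    then show False using z det xy(1) by simp
  qed
  have g: "moebius a b a' e p = pt X Y" unfolding xy(2) moebius_pt[OF xy(1)] X_def Y_def ..
  have nzv: "wr vp z \<noteq> 0" "wr (rv 2 vp) 0 \<noteq> 0" for z
  proof -
    show "wr vp z \<noteq> 0" using dual_curves_pointwise(2)[OF dual_vp, of z] unfolding wr_vp by simp
    have "ev (rv 2 vp) 0 $ 3 = 1" "ev (pd3 (rv 2 vp)) 0 $ 2 = of_real (sqrt 2)" "ev (rv 2 vp) 0 $ 2 = 0"
      by (simp_all add: ev_rv_0 pd3_def poly_0_coeff_0 coeff_pderiv coeff_rv vp_simps eval_nat_numeral)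
    then have "wr (rv 2 vp) 0 $ 1 \<noteq> 0" by (simp add: wr_def)
    then show "wr (rv 2 vp) 0 \<noteq> 0" by (metis zero_index)
  qed
  note cf = conic_bundles[OF d fz nz XY] and cvp = conic_bundles[OF dual_vp vp_quadratic nzv xy(1), folded v0_def v1_def v2_def]
  have vero: "vero x y = y\<^sup>2 *s v0 + (x * y) *s v1 + x\<^sup>2 *s v2" for x y
    unfolding vec_eq_iff forall_3 by (simp add: vero_def v0_def v1_def v2_def axis_def)
  have G: "fh f0 f1 f2 X Y = s *s (U *v fh v0 v1 v2 x y)"
    using eq[of x y] unfolding fh_def X_def Y_def vero .
  have g0: "e\<^sup>2 *s f0 + (b * e) *s f1 + b\<^sup>2 *s f2 = s *s (U *v v0)" using eq[of 0 1] by (simp add: vero)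
  have g2: "a'\<^sup>2 *s f0 + (a * a') *s f1 + a\<^sup>2 *s f2 = s *s (U *v v2)" using eq[of 1 0] by (simp add: vero)
  have g1: "(2 * a' * e) *s f0 + (a * e + b * a') *s f1 + (2 * a * b) *s f2 = s *s (U *v v1)"
  proof -
    have "s *s (U *v v1) = s *s (U *v vero 1 1) - s *s (U *v v0) - s *s (U *v v2)"
      by (simp add: vero mv_add vec.scale_right_distrib)
    then show ?thesis unfolding eq[of 1 1, symmetric] g0[symmetric] g2[symmetric]
      by (simp add: vec_eq_iff algebra_simps power2_eq_square)
  qed
  let ?P = "Y *s f1 + (2 * X) *s f2" and ?Q = "2 * Y *s f0 + X *s f1"
  have Gx: "a *s ?P + a' *s ?Q = s *s (U *v (y *s v1 + (2 * x) *s v2))"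
  proof -
    have "s *s (U *v (y *s v1 + (2 * x) *s v2)) = y *s (s *s (U *v v1)) + (2 * x) *s (s *s (U *v v2))"
      by (simp add: mv_add mv_scale vec.scale_right_distrib vector_smult_assoc mult.commute)
    then show ?thesis unfolding g1[symmetric] g2[symmetric] X_def Y_def
      by (simp add: vec_eq_iff algebra_simps power2_eq_square)
  qed
  have Gy: "b *s ?P + e *s ?Q = s *s (U *v (2 * y *s v0 + x *s v1))"
  proof -
    have "s *s (U *v (2 * y *s v0 + x *s v1)) = (2 * y) *s (s *s (U *v v0)) + x *s (s *s (U *v v1))"
      by (simp add: mv_add mv_scale vec.scale_right_distrib vector_smult_assoc mult.commute)
    then show ?thesis unfolding g1[symmetric] g0[symmetric] X_def Y_def
      by (simp add: vec_eq_iff algebra_simps power2_eq_square)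
  qed
  have cr: "(a * e - b * a') *s muh f0 f1 f2 X Y = (s * s) *s crs (U *v (2 * y *s v0 + x *s v1)) (U *v (y *s v1 + (2 * x) *s v2))"
  proof -
    have "crs (b *s P + e *s Q) (a *s P + a' *s Q) = (a * e - b * a') *s crs Q P" for P Q
      unfolding vec_eq_iff forall_3 by (simp add: algebra_simps)
    from this[of ?P ?Q] show ?thesis unfolding Gx Gy crs_scale muh_def by simp
  qed
  have mu: "muh f0 f1 f2 X Y = (s * s / (a * e - b * a')) *s crs (U *v (2 * y *s v0 + x *s v1)) (U *v (y *s v1 + (2 * x) *s v2))"
  proof -
    have "v = (1 / k) *s (k *s v)" if "k \<noteq> 0" for k and v :: "complex ^ 3"
      using that by (simp add: vector_smult_assoc)
    from this[OF det, of "muh f0 f1 f2 X Y"] show ?thesis unfolding cr by (simp add: vector_smult_assoc)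
  qed
  obtain k where k: "k \<noteq> 0" "vcnj (crs (U *v (2 * y *s v0 + x *s v1)) (U *v (y *s v1 + (2 * x) *s v2))) = k *s (U *v vcnj (muh v0 v1 v2 x y))"
    using unitary_crs[OF U, of "2 * y *s v0 + x *s v1" "y *s v1 + (2 * x) *s v2"] cvp(3) cf(3)[unfolded mu]
    unfolding muh_def by auto
  have V: "vcnj (muh f0 f1 f2 X Y) = (cnj (s * s / (a * e - b * a')) * k) *s (U *v vcnj (muh v0 v1 v2 x y))"
    unfolding mu vcnj_scale k(2) vector_smult_assoc ..
  have nzk: "cnj (s * s / (a * e - b * a')) * k \<noteq> 0"
  proof -
    have "s * s / (a * e - b * a') \<noteq> 0" using s det by simp
    then show ?thesis using k(1) by (metis mult_eq_0_iff complex_cnj_zero_iff)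
  qed
  have fv: "fh v0 v1 v2 x y \<noteq> 0"
  proof
    assume "fh v0 v1 v2 x y = 0"
    then have "vec.dim (line 2 vp p) = vec.dim {0 :: complex ^ 3}" unfolding xy(2) cvp(1) by simp
    moreover have "vec.dim (line 2 vp p) = 1"
      using smooth_line[of 2 vp] dual_vp unfolding dual_curves_def smooth_subbundle_def by blast
    ultimately show False by (simp add: vec.dim_eq_0)
  qed
  have 0: "proj (line 2 f (moebius a b a' e p)) = U ** proj (line 2 vp p) ** adj U"
    unfolding g cf(1) G unfolding xy(2) cvp(1) by (rule proj_unitary[OF U fv s])
  have 2: "proj (last_bundle m M (moebius a b a' e p)) = U ** proj (last_bundle 2 vd p) ** adj U"
    unfolding g cf(2) V unfolding xy(2) cvp(2) by (rule proj_unitary[OF U _ nzk]) (use cvp(3) in simp)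
  have "proj (mid 2 f m M (moebius a b a' e p))
      = mat 1 - proj (line 2 f (moebius a b a' e p)) - proj (last_bundle m M (moebius a b a' e p))"
    using dual_projections_sum[OF d, of "moebius a b a' e p"] by (simp add: algebra_simps)
  also have "\<dots> = U ** (mat 1 - proj (line 2 vp p) - proj (last_bundle 2 vd p)) ** adj U"
    unfolding 0 2 using U by (simp add: mm_diff_left mm_diff_right unitary_def)
  also have "mat 1 - proj (line 2 vp p) - proj (last_bundle 2 vd p) = proj (mid 2 vp 2 vd p)"
    using dual_projections_sum[OF dual_vp, of p] by (simp add: algebra_simps)
  finally show ?thesis .
qed

subsection \<open>Consequences of the normalisation\<close>

text \<open>If all fibres at parameter zero were orthogonal to \<open>v\<close>, then so would be the zeroth Fourier
  coefficient of every element of the span of the fibres.\<close>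

lemma normalized_full:
  assumes nes: "normalized_extended_solution \<psi> 2 \<Psi>"
    and co: "\<And>p. loop_coefficients (\<Psi> p) (A0 p) (A1 p) (A2 p)"
    and z: "\<And>p. adj (A0 p) *v v = 0"
  shows "v = 0"
proof -
  have "(\<lambda>l. v) \<in> H_plus" using H_plus_quadratic[of v 0 0] by simp
  from bspec[OF nes[unfolded normalized_extended_solution_def, THEN conjunct2, THEN conjunct2] this]
  obtain N :: nat and q g where Ng: "(\<forall>i<N. g i \<in> W_bundle \<Psi> (q i)) \<and> (\<forall>l\<in>S1. v = (\<Sum>i<N. g i l))"
    by (elim exE)
  have g: "g i \<in> W_bundle \<Psi> (q i)" if "i < N" for i using Ng that by blast
  have s: "v = (\<Sum>i<N. g i l)" if "l \<in> S1" for l using conjunct2[OF Ng] that by (rule bspec)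
  define F where "F i = (\<chi> k. fcoef (\<lambda>l. g i l $ k) 0)" for i
  have F: "hinner (F i) v = 0" if i: "i < N" for i
  proof -
    obtain w where "F i = A0 (q i) *v w"
      using co[of "q i"] g[OF i] unfolding loop_coefficients_def W_bundle_def F_def by blast
    then show ?thesis unfolding hinner_adj using z by (simp add: hinner_adj)
  qed
  have "v $ k = (\<Sum>i<N. F i $ k)" for k
  proof -
    have "fcoef (\<lambda>l. v $ k * 1) 0 = v $ k" unfolding fcoef_cmult fcoef_one by simp
    moreover have "fcoef (\<lambda>l. v $ k * 1) 0 = fcoef (\<lambda>l. \<Sum>i\<in>{..<N}. g i l $ k) 0"
    proof (rule fcoef_cong)
      fix l assume "l \<in> S1"
      from arg_cong[OF s[OF this], of "\<lambda>v. v $ k"] show "v $ k * 1 = (\<Sum>i\<in>{..<N}. g i l $ k)" by simp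
    qed
    moreover have "fcoef (\<lambda>l. \<Sum>i\<in>{..<N}. g i l $ k) 0 = (\<Sum>i\<in>{..<N}. fcoef (\<lambda>l. g i l $ k) 0)"
    proof (rule fcoef_sum)
      fix i assume "i \<in> {..<N}"
      then have "g i \<in> W_bundle \<Psi> (q i)" using g by simp
      then have "g i \<in> L2_circle"
        using nes unfolding normalized_extended_solution_def H_plus_def by blast
      from integrable_bounded_linear[OF bounded_linear_vec_nth L2_circle_integrable[OF this]]
      show "integrable circ (\<lambda>t. g i (cis t) $ k)" .
    qed
    ultimately show ?thesis by (simp add: F_def)
  qed
  then have v: "v = (\<Sum>i<N. F i)" by (simp add: vec_eq_iff)
  have "hinner (\<Sum>i<N. F i) v = (\<Sum>i<N. hinner (F i) v)"
    unfolding hinner_def by (simp add: sum_distrib_right) (rule sum.swap)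
  then have "hinner v v = 0" using F v by simp
  then show ?thesis by simp
qed

lemma continuous_on_entry:
  assumes "\<And>z. \<exists>a b. wdM F a b z" shows "continuous_on UNIV (\<lambda>z. F z $ i $ j)"
  using assms wd_isCont unfolding wdM_def by (metis continuous_at_imp_continuous_on)

lemma wdM_zero_const:
  assumes "\<And>z. wdM F 0 0 z" shows "F z = F w"
proof -
  have "F z $ i $ j = F w $ i $ j" for i j
  proof -
    have "((\<lambda>z. F z $ i $ j) has_field_derivative 0) (at z within UNIV)" for z
      using assms[of z] holo_wd unfolding wdM_def by fastforce
    then obtain c where "\<And>x. F x $ i $ j = c"
      using has_field_derivative_zero_constant[OF convex_UNIV, of "\<lambda>z. F z $ i $ j"] by blast
    then show ?thesis by simp
  qed
  then show ?thesis by (simp add: vec_eq_iff)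
qed

lemma proj_entry_continuous:
  "smooth_subbundle k Z \<Longrightarrow> c \<in> coords \<Longrightarrow> continuous_on UNIV (\<lambda>z. proj (Z (c z)) $ i $ j)"
  by (intro continuous_intros smooth_subbundle_proj_continuous)

theorem theorem5p5:
  fixes \<psi> :: "rsphere \<Rightarrow> complex ^ 3 ^ 3"
    and \<Psi> :: "rsphere \<Rightarrow> complex \<Rightarrow> complex ^ 3 ^ 3"
    and X0 X1 :: "rsphere \<Rightarrow> (complex ^ 3) set"
    and S :: "rsphere set"
  assumes "minimal_immersion \<psi>" and "constant_curvature \<psi>"
    and "has_uniton_number \<psi> 2"
    and "normalized_extended_solution \<psi> 2 \<Psi>"
    and "holomorphic_subbundle 1 X0" and "holomorphic_subbundle 2 X1"
    and "\<And>p. X0 p \<subseteq> X1 p"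
    and "finite S"
    and "\<And>p. p \<notin> S \<Longrightarrow> X0 p = fst ` X_bundle \<Psi> p"
    and "\<And>p. p \<notin> S \<Longrightarrow> X1 p = snd ` (X_bundle \<Psi> p \<inter> ({0} \<times> UNIV))"
    and "totally_unramified X0"
  shows "S1_invariant \<psi> \<and>
    unitarily_congruent \<psi> (\<lambda>p. proj (veronese 2 1 p) - proj_perp (veronese 2 1 p))"
proof -
  have im: "immersion \<psi>" and conf: "conformal \<psi>" and harm: "harmonic \<psi>"
    using assms(1) unfolding minimal_immersion_def by blast+
  have u\<psi>: "unitary (\<psi> p)" for p using harm unfolding harmonic_def by blast
  let ?S = "\<lambda>c. Az (\<lambda>w. \<psi> (c w))" and ?T = "\<lambda>c. Azbar (\<lambda>w. \<psi> (c w))"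
  obtain A0 A1 A2 where uc: "uniton_coefficients A0 A1 A2 ?S ?T"
    and co: "\<And>p. loop_coefficients (\<Psi> p) (A0 p) (A1 p) (A2 p)"
    using uniton_coefficients_exist[OF assms(4)] by metis
  interpret uniton_coefficients A0 A1 A2 ?S ?T by (rule uc)
  have P: "\<Psi> p l = A0 p + csmult l (A1 p) + csmult (l\<^sup>2) (A2 p)" if "l \<in> S1" for p l
    using co[of p] that unfolding loop_coefficients_def by blast
  have X0: "X0 p = range ((*v) (A0 p))" if "p \<notin> S" for p
    using assms(9)[OF that] co[of p] unfolding X_bundle_def W_bundle_def loop_coefficients_def by simp
  have X1: "X1 p = {b. adj (A2 p) *v b = 0}" if "p \<notin> S" for p
    using assms(10)[OF that] co[of p] unfolding X_bundle_def W_bundle_def loop_coefficients_def by simp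
  obtain n f where cv: "curve n f" and X0f: "X0 = line n f"
    using holomorphic_line_bundle_rational[OF assms(5)] by metis
  have eA: "\<exists>a b. wdM (\<lambda>w. A0 (c w)) a b z" "\<exists>a b. wdM (\<lambda>w. A2 (c w)) a b z" if "c \<in> coords" for c z
    using dA0[OF that] dA2[OF that] by blast+
  have full: "\<exists>z. hinner (ev f z) v \<noteq> 0" if v0: "v \<noteq> 0" for v
  proof (rule ccontr)
    assume "\<not> ?thesis"
    then have fv: "hinner (ev f z) v = 0" for z by blast
    have "adj (A0 p) *v v = 0" for p
    proof -
      obtain c z where c: "c \<in> coords" "p = c z" using sphere_cover by blast
      have "(adj (A0 (c z)) *v v) $ k = 0" for k
      proof (rule continuous_eq_off_finite[where f = "\<lambda>z. (adj (A0 (c z)) *v v) $ k" and g = "\<lambda>_. 0" and S = "{z. c z \<in> insert Infty S}"])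
        have "continuous_on UNIV (\<lambda>z. \<Sum>i\<in>UNIV. cnj (A0 (c z) $ i $ k) * v $ i)"
          by (intro continuous_intros continuous_on_entry eA(1) c(1))
        then show "continuous_on UNIV (\<lambda>z. (adj (A0 (c z)) *v v) $ k)"
          by (simp add: matrix_vector_mult_def adj_def)
        show "finite {z. c z \<in> insert Infty S}" by (rule finite_preimage_coords[OF c(1)]) (simp add: assms(8))
        show "(adj (A0 (c z)) *v v) $ k = 0" if z: "z \<notin> {z. c z \<in> insert Infty S}" for z
        proof -
          obtain x where x: "c z = Fin x" using z by (cases "c z") auto
          have "hinner w (adj (A0 (c z)) *v v) = 0" for w
          proof -
            have "Fin x \<notin> S" using z x by simp
            then have "range ((*v) (A0 (Fin x))) = vec.span {ev f x}"
              using X0[of "Fin x"] unfolding X0f by (simp add: line_def)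
            then have "A0 (c z) *v w \<in> vec.span {ev f x}" unfolding x by blast
            then show ?thesis unfolding hinner_adj[symmetric] span_single using fv by (auto simp: hinner_scale_left)
          qed
          from this[of "adj (A0 (c z)) *v v"] show ?thesis by simp
        qed
      qed simp
      then show ?thesis using c(2) by (simp add: vec_eq_iff)
    qed
    from normalized_full[OF assms(4) co this] v0 show False by simp
  qed
  obtain f0 f1 f2 where n: "n = 2" and fz: "\<And>z. ev f z = f0 + z *s f1 + z\<^sup>2 *s f2"
    and det: "hinner f0 (vcnj (crs f1 f2)) \<noteq> 0" and wnz: "\<And>z. wr f z \<noteq> 0" "\<And>z. wr (rv n f) z \<noteq> 0"
    using unramified_conic[OF cv full assms(11)[unfolded X0f]] by metis
  note cv2 = cv[unfolded n]
  obtain m M g where d: "dual_curves 2 f m M" and W: "\<And>z. wr f z = poly g z *s ev M z"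
    using dual_curve_exists[OF cv2 full] by metis
  have A2nz: "A2 p \<noteq> 0" if p: "p \<notin> S" for p
  proof
    assume "A2 p = 0"
    then have "X1 p = UNIV" using X1[OF p] by simp
    obtain c z where c: "c \<in> coords" "p = c z" using sphere_cover by blast
    then have "vec.dim (X1 p) = 2" using assms(6) unfolding holomorphic_subbundle_def by metis
    then show False using \<open>X1 p = UNIV\<close> vec_dim_card[where 'a = complex and 'n = 3] by simp
  qed
  interpret uniton_curve A0 A1 A2 ?S ?T f S
  proof
    show "curve 2 f" by (rule cv2)
    show "finite S" by (rule assms(8))
    show "wr (chart 2 f c) z \<noteq> 0" if "c \<in> coords" for c z
      using coords_cases[OF that] wnz unfolding n by auto
    show "range ((*v) (A0 p)) = line 2 f p" if "p \<notin> S" for p using X0[OF that] unfolding X0f n by simp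
    show "A2 p \<noteq> 0" if "p \<notin> S" for p by (rule A2nz[OF that])
  qed
  have met: "induced_metric (\<lambda>w. \<psi> (c w)) z 1 1 = Re (trace (?S c z ** adj (?S c z)))" if c: "c \<in> coords" for c z
    using metric_conformal[of "\<lambda>w. \<psi> (c w)" z] u\<psi> conf c T_eq[OF c, of z] unfolding conformal_def by blast
  obtain K where K: "\<And>z. gauss_curvature (\<lambda>w. \<psi> (Fin w)) z = K"
    using assms(2) unfolding constant_curvature_def using coords_mem(1) by blast
  have pos: "Re (trace (?S c z ** adj (?S c z))) > 0" if c: "c \<in> coords" for c z
    using metric_continuous_positive(2)[OF im u\<psi> c, of z] unfolding met[OF c] .
  have cont: "continuous_on UNIV (\<lambda>z. Re (trace (?S coord_inf z ** adj (?S coord_inf z))))"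
    using metric_continuous_positive(1)[OF im u\<psi> coords_mem(2)] unfolding met[OF coords_mem(2)] .
  have curv: "laplacian (\<lambda>w. ln (Re (trace (?S Fin w ** adj (?S Fin w))))) z
      = - 2 * K * Re (trace (?S Fin z ** adj (?S Fin z)))" for z
    using K[of z] pos[OF coords_mem(1), of z] unfolding gauss_curvature_def Let_def met[OF coords_mem(1)]
    by (simp add: field_simps)
  from constant_curvature_normal_form[OF fz det pos cont curv]
  obtain a b a' e U s where h0: "\<And>z. Fin z \<notin> S \<Longrightarrow> hh Fin z = 0" and de: "a * e - b * a' \<noteq> 0"
    and U: "unitary U" and s: "s \<noteq> 0"
    and eq: "\<And>x y. (a' * x + e * y)\<^sup>2 *s f0 + ((a * x + b * y) * (a' * x + e * y)) *s f1 + (a * x + b * y)\<^sup>2 *s f2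
       = s *s (U *v vero x y)" by metis
  have M: "curve m M" using d unfolding dual_curves_def by blast
  have off: "A0 (Fin x) = proj (line 2 f (Fin x)) \<and> A2 (Fin x) = proj (last_bundle m M (Fin x))" if x: "Fin x \<notin> S" for x
  proof -
    note lf = loop_formulas[OF coords_mem(1) x, unfolded h0[OF x]]
    have F: "FF Fin x \<noteq> 0" and N: "NN Fin x \<noteq> 0" using FF_nz NN_nz by simp_all
    have "A0 (Fin x) = csmult (1 / FF Fin x) (outer (u Fin x) (u Fin x))"
      using lf(4) F N by (simp add: csmult_csmult)
    moreover have "A2 (Fin x) = csmult (1 / NN Fin x) (outer (nu Fin x) (nu Fin x))"
      using lf(3) F N by (simp add: csmult_csmult)
    moreover have "poly g x \<noteq> 0" using W[of x] wnz(1)[of x] by auto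
    then have "vec.span {nu Fin x} = vec.span {vcnj (ev M x)}"
      using span_single_scale[of "cnj (poly g x)" "vcnj (ev M x)"] by (simp add: nu_def W vcnj_scale)
    ultimately show ?thesis
      using proj_line[OF u_nz[where c = Fin and z = x]] proj_line[OF nu_nz[OF coords_mem(1), of x]]
      by (simp add: FF_def NN_def line_def last_bundle_def u_def)
  qed
  have glob: "A0 p = proj (line 2 f p) \<and> A2 p = proj (last_bundle m M p)" for p
  proof -
    obtain c z where c: "c \<in> coords" "p = c z" using sphere_cover by blast
    have fin': "finite {z. c z \<in> insert Infty S}" by (rule finite_preimage_coords[OF c(1)]) (simp add: assms(8))
    have o: "A0 (c z) = proj (line 2 f (c z)) \<and> A2 (c z) = proj (last_bundle m M (c z))"
      if "z \<notin> {z. c z \<in> insert Infty S}" for z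
      using off that by (cases "c z") auto
    have "A0 (c z) $ i $ j = proj (line 2 f (c z)) $ i $ j" for i j
      by (rule continuous_eq_off_finite[OF continuous_on_entry proj_entry_continuous[OF smooth_line[OF cv2] c(1)] fin'])
        (use eA(1)[OF c(1)] o in auto)
    moreover have "A2 (c z) $ i $ j = proj (last_bundle m M (c z)) $ i $ j" for i j
      by (rule continuous_eq_off_finite[OF continuous_on_entry proj_entry_continuous[OF smooth_last[OF M] c(1)] fin'])
        (use eA(2)[OF c(1)] o in auto)
    ultimately show ?thesis unfolding c(2) by (simp add: vec_eq_iff)
  qed
  have A1m: "A1 p = proj (mid 2 f m M p)" for p
  proof -
    have "A1 p = mat 1 - A0 p - A2 p" using sum[of p] by (simp add: algebra_simps)
    also have "\<dots> = mat 1 - proj (line 2 f p) - proj (last_bundle m M p)" using glob[of p] by simp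
    also have "\<dots> = proj (mid 2 f m M p)" using dual_projections_sum[OF d, of p] by (simp add: algebra_simps)
    finally show ?thesis .
  qed
  have es: "extended_solution \<psi> \<Psi>" using assms(4) unfolding normalized_extended_solution_def by blast
  have "S1_invariant_solution \<Psi>"
    unfolding S1_invariant_solution_def
  proof (rule exI[of _ "\<lambda>l. dg 1 l (l\<^sup>2)"], intro conjI allI)
    show "S1_homomorphism (\<lambda>l. dg 1 l (l\<^sup>2))" by (rule S1_homomorphism_dg)
    fix p
    obtain V where V: "unitary V"
      "\<And>x y z. V ** dg x y z ** adj V = csmult x (proj (line 2 f p)) + csmult y (proj (mid 2 f m M p)) + csmult z (proj (last_bundle m M p))"
      by (rule dual_frame[OF d, where p = p]) blast
    show "\<exists>A. unitary A \<and> (\<forall>l\<in>S1. \<Psi> p l = A ** dg 1 l (l\<^sup>2) ** matrix_inv A)"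
      using V(1) by (intro exI[of _ V]) (simp add: unitary_inv V(2) P A1m glob)
  qed
  then have inv: "S1_invariant \<psi>" unfolding S1_invariant_def using es by blast
  define \<Phi> where "\<Phi> p = A0 p - A1 p + A2 p" for p
  have \<Phi>: "\<Phi> p = mat 1 - csmult 2 (A1 p)" for p
  proof -
    have "\<Phi> p = A0 p + A1 p + A2 p - csmult 2 (A1 p)" by (simp add: \<Phi>_def vec_eq_iff)
    then show ?thesis by (simp add: sum)
  qed
  have u\<Phi>: "unitary (\<Phi> p)" for p
  proof -
    have "unitary (\<Psi> p (- 1))" using es unfolding extended_solution_def by simp
    moreover have "\<Psi> p (- 1) = \<Phi> p" using P[of "- 1" p] by (simp add: \<Phi>_def vec_eq_iff)
    ultimately show ?thesis by simp
  qed
  have d0: "wdM (\<lambda>w. \<psi> (c w) ** adj (\<Phi> (c w))) 0 0 z" if c: "c \<in> coords" for c z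
  proof -
    have "Ck (Suc 0) (\<lambda>w. \<psi> (c w))" using im c unfolding immersion_def smooth_map_def smooth_def by blast
    then have dp: "wdM (\<lambda>w. \<psi> (c w)) (dz (\<lambda>w. \<psi> (c w)) z) (dzbar (\<lambda>w. \<psi> (c w)) z) z"
      by (intro wdM_differentiable Ck_differentiable)
    have i1: "\<psi> (c z) ** matrix_inv (\<psi> (c z)) = mat 1" using u\<psi>[of "c z"] by (simp add: unitary_inv unitary_def)
    have e1: "dz (\<lambda>w. \<psi> (c w)) z = csmult 2 (\<psi> (c z) ** ?S c z)" "dzbar (\<lambda>w. \<psi> (c w)) z = csmult 2 (\<psi> (c z) ** ?T c z)"
      unfolding Az_def Azbar_def by (simp_all add: csmult_mult_right csmult_csmult matrix_mul_assoc i1)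
    have "wdM (\<lambda>w. \<Phi> (c w)) (csmult 2 (\<Phi> (c z) ** ?S c z)) (csmult 2 (\<Phi> (c z) ** ?T c z)) z"
    proof -
      have w: "wdM (\<lambda>w. \<Phi> (c w))
        (- (A1 (c z) ** ?S c z) - (A1 (c z) ** ?S c z - A2 (c z) ** ?S c z) + A2 (c z) ** ?S c z)
        (A0 (c z) ** ?T c z - (A1 (c z) ** ?T c z - A0 (c z) ** ?T c z) + - (A1 (c z) ** ?T c z)) z"
        unfolding \<Phi>_def by (rule wdM_add[OF wdM_diff[OF dA0[OF c] dA1[OF c]] dA2[OF c]])
      have "csmult 2 (\<Phi> (c z) ** ?S c z) = - (A1 (c z) ** ?S c z) - (A1 (c z) ** ?S c z - A2 (c z) ** ?S c z) + A2 (c z) ** ?S c z"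
        using AS(1)[OF c, of z] unfolding \<Phi>_def mm_add_left mm_diff_left by (simp add: vec_eq_iff)
      moreover have "csmult 2 (\<Phi> (c z) ** ?T c z) = A0 (c z) ** ?T c z - (A1 (c z) ** ?T c z - A0 (c z) ** ?T c z) + - (A1 (c z) ** ?T c z)"
        using AS(2)[OF c, of z] unfolding \<Phi>_def mm_add_left mm_diff_left by (simp add: vec_eq_iff)
      ultimately show ?thesis using w by simp
    qed
    from wdM_mm[OF dp wdM_adj[OF this]]
    show ?thesis unfolding e1 T_eq[OF c]
      by (simp add: adj_csmult adj_mult adj_uminus mm_simps matrix_mul_assoc)
  qed
  define C where "C = \<psi> (Fin 0) ** adj (\<Phi> (Fin 0))"
  have C: "\<psi> p ** adj (\<Phi> p) = C" for p
  proof (cases p)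
    case (Fin z)
    then show ?thesis using wdM_zero_const[OF d0[OF coords_mem(1)], of z 0] by (simp add: C_def)
  next
    case Infty
    have "\<psi> (coord_inf 0) ** adj (\<Phi> (coord_inf 0)) = \<psi> (coord_inf 1) ** adj (\<Phi> (coord_inf 1))"
      by (rule wdM_zero_const[OF d0[OF coords_mem(2)]])
    moreover have "coord_inf 0 = Infty" "coord_inf 1 = Fin 1" by (simp_all add: coord_inf_def)
    ultimately show ?thesis
      using Infty wdM_zero_const[OF d0[OF coords_mem(1)], of 1 0] by (simp add: C_def)
  qed
  have uC: "unitary C"
    using u\<psi>[of "Fin 0"] u\<Phi>[of "Fin 0"] unfolding C_def unitary_def adj_mult adj_adj
    by (simp add: matrix_mul_assoc[symmetric]) (simp add: matrix_mul_assoc)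
  have \<psi>: "\<psi> p = C ** \<Phi> p" for p
    using C[of p] u\<Phi>[of p] unfolding unitary_def by (metis matrix_mul_assoc matrix_mul_rid)
  define G where "G = moebius a b a' e"
  have "unitarily_congruent \<psi> (\<lambda>p. proj (veronese 2 1 p) - proj_perp (veronese 2 1 p))"
    unfolding unitarily_congruent_def
  proof (rule exI[of _ "- (adj U ** adj C)"], rule exI[of _ U], rule exI[of _ G], intro conjI allI)
    show "biholomorphism G" unfolding G_def by (rule biholomorphism_moebius[OF de])
    show "unitary U" by (rule U)
    have U': "adj U ** U = mat 1" "U ** adj U = mat 1" "adj C ** C = mat 1" "C ** adj C = mat 1"
      using U uC unfolding unitary_def by auto
    show "unitary (- (adj U ** adj C))"
      unfolding unitary_def adj_uminus adj_mult adj_adj mm_uminus_left mm_uminus_right minus_minus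
      using U' by (metis matrix_mul_assoc matrix_mul_lid)
    fix p
    have nz0: "wr (rv 2 f) 0 \<noteq> 0" using wnz(2)[of 0] unfolding n .
    have A: "A1 (G p) = U ** proj (mid 2 vp 2 vd p) ** adj U"
      unfolding A1m G_def by (rule conic_congruence[OF d fz wnz(1) nz0 de U s eq])
    have "- (adj U ** adj C) ** \<psi> (G p) ** U = - (adj U ** ((adj C ** C) ** \<Phi> (G p)) ** U)"
      unfolding \<psi> by (simp add: mm_uminus_left matrix_mul_assoc)
    also have "\<dots> = - ((adj U ** U) - csmult 2 ((adj U ** U) ** proj (mid 2 vp 2 vd p) ** (adj U ** U)))"
      unfolding U'(3) \<Phi> A by (simp add: mm_simps matrix_mul_assoc)
    also have "\<dots> = proj (veronese 2 1 p) - proj_perp (veronese 2 1 p)"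
      unfolding U'(1) proj_perp_def veronese_2_1 by (simp add: vec_eq_iff)
    finally show "proj (veronese 2 1 p) - proj_perp (veronese 2 1 p) = - (adj U ** adj C) ** \<psi> (G p) ** U" ..
  qed
  with inv show ?thesis by blast
qed

end
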